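(* Let $(u,w)\in\mathcal{U}$ be the solution of $B((u,w),(y,z))=F(y)$ for all $(y,z)\in\mathcal{U}$, having the solution decomposition described in the context, and let $(u_h,w_h)\in\mathcal{U}_h$ be the solution of $B((u_h,w_h),(y,z))=F(y)$ for all $(y,z)\in\mathcal{U}_h$, with piecewise polynomials of degree $q\ge1$ on the mesh described in the context (S-type with parameter $\sigma$ at the boundary layers, weak equidistant around $x=1$). If $\sigma\ge q+1$ and $e^{-\varepsilon^{-1/q}}\le(h+N^{-1})^{q-2}$, then the supercloseness estimate $$|||(I_1u-u_h,\,I_2w-w_h)|||\lesssim(h+N^{-1}\max|\psi'|)^{q+1/2}$$ and the convergence estimate $$|||(u-u_h,\,w-w_h)|||\lesssim(h+N^{-1}\max|\psi'|)^{q}$$ hold.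
   Context: Problem: $m\in\{1,2\}$, $\Omega=(0,2)$, $\varepsilon>0$ small; $u$ solves $\varepsilon^2u^{(4)}-bu''+cu+d\,u(\cdot-1)=f$ in $\Omega$, $u=\Phi$ on $(-1,0)$, $u(0)=u(2)=0$, $u^{(m)}(0)=u^{(m)}(2)=0$, where $b,c,d$ are smooth, $b\ge\beta^2>0$ ($\beta>0$), $c-\frac12\|d\|_{L^\infty(1,2)}-\frac{1}{2\beta^2}\|b'\|_{L^\infty}^2\ge\delta>0$, $\Phi(0)=\Phi^{(m)}(0)=0$. Put $w=\varepsilon u''$. Variational formulation: $\mathcal{U}=H_0^1(\Omega)\times H^1(\Omega)$ if $m=1$, $\mathcal{U}=H_0^1(\Omega)\times H_0^1(\Omega)$ if $m=2$. With $\langle\cdot,\cdot\rangle_D$ the $L^2(D)$ inner product ($D=\Omega$ if omitted; likewise for norms), $$B((u,w),(y,z))=-\varepsilon\langle w',y'\rangle+\langle bu',y'\rangle+\langle b'u',y\rangle+\langle cu,y\rangle+\langle d\,u(\cdot-1),y\rangle_{(1,2)}+\varepsilon\langle u',z'\rangle+\langle w,z\rangle,$$ $F(y)=\langle f,y\rangle-\langle d\,\Phi(\cdot-1),y\rangle_{(0,1)}$, and $|||(y,z)|||^2=\|z\|_{L^2}^2+\frac{\beta^2}{2}\|y'\|_{L^2}^2+\delta\|y\|_{L^2}^2$. Solution decomposition (standing assumption): $u=S+E_1+E_2+W_1\chi_{(0,1)}+W_2\chi_{(1,2)}$ and $w=\tilde S+\tilde E_1+\tilde E_2+\tilde W_1\chi_{(0,1)}+\tilde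 W_2\chi_{(1,2)}$, where for $0\le k\le q+1$: $\|S^{(k)}\|_{L^2(0,1)}+\|S^{(k)}\|_{L^2(1,2)}\lesssim1$; $|E_1^{(k)}(x)|\lesssim\varepsilon^{m-k}e^{-\beta x/\varepsilon}$, $|E_2^{(k)}(x)|\lesssim\varepsilon^{m-k}e^{-\beta(2-x)/\varepsilon}$; $|W_1^{(k)}(x)|\lesssim\varepsilon^{3-k}e^{-\beta(1-x)/\varepsilon}$ on $(0,1)$, $|W_2^{(k)}(x)|\lesssim\varepsilon^{3-k}e^{-\beta(x-1)/\varepsilon}$ on $(1,2)$; $|\tilde S^{(k)}(x)|\lesssim\varepsilon$ on $\Omega\setminus\{1\}$; $|\tilde E_1^{(k)}(x)|\lesssim\varepsilon^{m-1-k}e^{-\beta x/\varepsilon}$, $|\tilde E_2^{(k)}(x)|\lesssim\varepsilon^{m-1-k}e^{-\beta(2-x)/\varepsilon}$; $|\tilde W_1^{(k)}(x)|\lesssim\varepsilon^{2-k}e^{-\beta(1-x)/\varepsilon}$ on $(0,1)$, $|\tilde W_2^{(k)}(x)|\lesssim\varepsilon^{2-k}e^{-\beta(x-1)/\varepsilon}$ on $(1,2)$. Mesh (S-type at the boundary, weak equidistant inside): $N\in\mathbb{N}$ divisible by 8, $\sigma>0$, $\lambda=\frac{\sigma}{\beta}\varepsilon\ln N$ with $\varepsilon$ small enough that $\lambda<\frac14$; $\mu=\frac14$ if $q\le2$, and $\mu=\frac1\beta\varepsilon^{1-\frac{5}{2(q+1)}}$ if $q>2$, with $\varepsilon$ small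 enough that then $\mu<\frac14$. The mesh-defining function $\phi:[0,\frac12]\to\mathbb{R}$ (which may depend on $N$) is continuous, piecewise continuously differentiable, monotonically increasing, $\phi(0)=0$, $\phi(\frac12)=\ln N$, $\max\phi'\lesssim N$. The mesh has $N/8$ cells in $[0,\lambda]$ with nodes $x_i=\frac{\sigma\varepsilon}{\beta}\phi(\frac{4i}{N})$, $0\le i\le\frac N8$, their mirror images $2-\frac{\sigma\varepsilon}{\beta}\phi(\frac{4i}{N})$ in $[2-\lambda,2]$, and is equidistant with $N/4$ cells in each of $[\lambda,1-\mu]$, $[1-\mu,1+\mu]$, $[1+\mu,2-\lambda]$. The mesh characterising function is $\psi=e^{-\phi}$, $\max|\psi'|=\max_{t\in[0,1/2]}|\psi'(t)|$. $h$ denotes the maximum mesh width in the boundary layer regions $(0,\lambda)\cup(2-\lambda,2)$; one has $h\lesssim\varepsilon$, and all other cells have width $\lesssim N^{-1}$. Discrete space: $\mathcal{U}_h=\{(y,z)\in\mathcal{U}: y|_T,z|_T\in\mathbb{P}_q(T)\text{ for each mesh cell }T=[x_{i-1},x_i]\}$, $\mathbb{P}_q$ the polynomials of degree at most $q$. Interpolation: for $j\in\{1,2\}$ and continuous $v$, $I_jv$ is the continuous piecewise polynomial of degree $\le q$ with, on each cell, $(I_jv-v)(x_{i-1})=(I_jv-v)(x_i)=0$ and $\int_{x_{i-1}}^{x_i}(I_jv-v)\xi\,dx=0$ for all polynomials $\xi$ of degree $\le q-2$ (no condition if $q=1$). $A\lesssim B$ means $A\le CB$ with $C$ independent of $\varepsilon$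 and $N$. *)

theory Defs
  imports
    "HOL-Analysis.Analysis"
    "HOL-Computational_Algebra.Polynomial"
    "HOL-Probability.Essential_Supremum"
begin

text \<open>Functions on an interval are total functions \<open>real \<Rightarrow> real\<close> of which only the values on that
  interval matter. Domains are given by their endpoints: \<open>a b\<close> stands for the open interval.\<close>

definition dern :: "real set \<Rightarrow> nat \<Rightarrow> (real \<Rightarrow> real) \<Rightarrow> real \<Rightarrow> real" where
  "dern A k v = ((\<lambda>g x. vector_derivative g (at x within A)) ^^ k) v"
  \<comment> \<open>\<open>k\<close>-th derivative on an interval \<open>A\<close>, one-sided at endpoints belonging to \<open>A\<close>\<close>

definition times_differentiable_on :: "nat \<Rightarrow> (real \<Rightarrow> real) \<Rightarrow> real set \<Rightarrow> bool" where
  "times_differentiable_on n v A \<longleftrightarrow> (\<forall>k<n. dern A k v differentiable_on A)"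

definition smooth_fun_on :: "(real \<Rightarrow> real) \<Rightarrow> real set \<Rightarrow> bool" where
  "smooth_fun_on v A \<longleftrightarrow> (\<forall>n. times_differentiable_on n v A)"

definition square_integrable :: "real \<Rightarrow> real \<Rightarrow> (real \<Rightarrow> real) \<Rightarrow> bool" where
  "square_integrable a b v \<longleftrightarrow>
     set_borel_measurable lebesgue {a<..<b} v \<and> set_integrable lebesgue {a<..<b} (\<lambda>x. (v x)\<^sup>2)"

definition L2_inner :: "real \<Rightarrow> real \<Rightarrow> (real \<Rightarrow> real) \<Rightarrow> (real \<Rightarrow> real) \<Rightarrow> real" where
  "L2_inner a b v y = (LINT x:{a<..<b}|lebesgue. v x * y x)"

definition L2_nrm :: "real \<Rightarrow> real \<Rightarrow> (real \<Rightarrow> real) \<Rightarrow> real" where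
  "L2_nrm a b v = sqrt (L2_inner a b v v)"

definition Linf_nrm :: "real \<Rightarrow> real \<Rightarrow> (real \<Rightarrow> real) \<Rightarrow> real" where
  "Linf_nrm a b v = real_of_ereal (esssup (restrict_space lebesgue {a<..<b}) (\<lambda>x. ereal \<bar>v x\<bar>))"

text \<open>Weak derivatives are taken with respect to test functions in $C^1_c(a,b)$, as is usual in
  dimension one.\<close>

definition test_function :: "real \<Rightarrow> real \<Rightarrow> (real \<Rightarrow> real) \<Rightarrow> bool" where
  "test_function a b \<eta> \<longleftrightarrow> \<eta> C1_differentiable_on UNIV \<and>
     (\<exists>r s. a < r \<and> s < b \<and> (\<forall>x. x \<notin> {r..s} \<longrightarrow> \<eta> x = 0))"

definition weak_derivative :: "real \<Rightarrow> real \<Rightarrow> (real \<Rightarrow> real) \<Rightarrow> (real \<Rightarrow> real) \<Rightarrow> bool" where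
  "weak_derivative a b v g \<longleftrightarrow> square_integrable a b g \<and>
     (\<forall>\<eta>. test_function a b \<eta> \<longrightarrow> L2_inner a b v (deriv \<eta>) = - L2_inner a b g \<eta>)"

definition wderiv :: "real \<Rightarrow> real \<Rightarrow> (real \<Rightarrow> real) \<Rightarrow> real \<Rightarrow> real" where
  "wderiv a b v = (SOME g. weak_derivative a b v g)"
  \<comment> \<open>unique up to null sets\<close>

definition sobolev :: "nat \<Rightarrow> real \<Rightarrow> real \<Rightarrow> (real \<Rightarrow> real) set" where
  "sobolev n a b = {v. square_integrable a b v \<and>
     (\<forall>k<n. \<exists>g. weak_derivative a b ((wderiv a b ^^ k) v) g)}"

text \<open>Elements of $H^1(a,b)$ are represented by their continuous representative on \<open>[a,b]\<close>, so
  that point values make sense; $H^1_0(a,b)$ is given by vanishing boundary values.\<close>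

definition H1 :: "real \<Rightarrow> real \<Rightarrow> (real \<Rightarrow> real) set" where
  "H1 a b = {v. continuous_on {a..b} v \<and> v \<in> sobolev 1 a b}"

definition H10 :: "real \<Rightarrow> real \<Rightarrow> (real \<Rightarrow> real) set" where
  "H10 a b = {v \<in> H1 a b. v a = 0 \<and> v b = 0}"

definition U_space :: "nat \<Rightarrow> ((real \<Rightarrow> real) \<times> (real \<Rightarrow> real)) set" where
  "U_space m = H10 0 2 \<times> (if m = 1 then H1 0 2 else H10 0 2)"

definition B_form :: "real \<Rightarrow> (real \<Rightarrow> real) \<Rightarrow> (real \<Rightarrow> real) \<Rightarrow> (real \<Rightarrow> real) \<Rightarrow>
    (real \<Rightarrow> real) \<times> (real \<Rightarrow> real) \<Rightarrow> (real \<Rightarrow> real) \<times> (real \<Rightarrow> real) \<Rightarrow> real" where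
  "B_form \<epsilon> b c d = (\<lambda>(u, w) (y, z).
     - \<epsilon> * L2_inner 0 2 (wderiv 0 2 w) (wderiv 0 2 y)
     + L2_inner 0 2 (\<lambda>x. b x * wderiv 0 2 u x) (wderiv 0 2 y)
     + L2_inner 0 2 (\<lambda>x. dern {0..2} 1 b x * wderiv 0 2 u x) y
     + L2_inner 0 2 (\<lambda>x. c x * u x) y
     + L2_inner 1 2 (\<lambda>x. d x * u (x - 1)) y
     + \<epsilon> * L2_inner 0 2 (wderiv 0 2 u) (wderiv 0 2 z)
     + L2_inner 0 2 w z)"

definition F_form :: "(real \<Rightarrow> real) \<Rightarrow> (real \<Rightarrow> real) \<Rightarrow> (real \<Rightarrow> real) \<Rightarrow> (real \<Rightarrow> real) \<Rightarrow> real" where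
  "F_form f d \<Phi> y = L2_inner 0 2 f y - L2_inner 0 1 (\<lambda>x. d x * \<Phi> (x - 1)) y"

definition energy_nrm :: "real \<Rightarrow> real \<Rightarrow> (real \<Rightarrow> real) \<times> (real \<Rightarrow> real) \<Rightarrow> real" where
  "energy_nrm \<beta> \<delta> = (\<lambda>(y, z).
     sqrt ((L2_nrm 0 2 z)\<^sup>2 + \<beta>\<^sup>2 / 2 * (L2_nrm 0 2 (wderiv 0 2 y))\<^sup>2 + \<delta> * (L2_nrm 0 2 y)\<^sup>2))"

text \<open>The constant hidden in the bounds is the explicit parameter \<open>K\<close>.\<close>

definition deriv_bounds :: "nat \<Rightarrow> real set \<Rightarrow> (real \<Rightarrow> real) \<Rightarrow> (nat \<Rightarrow> real \<Rightarrow> real) \<Rightarrow> bool" where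
  "deriv_bounds n A v g \<longleftrightarrow> times_differentiable_on n v A \<and> (\<forall>k\<le>n. \<forall>x\<in>A. \<bar>dern A k v x\<bar> \<le> g k x)"

definition u_decomposition ::
    "nat \<Rightarrow> nat \<Rightarrow> real \<Rightarrow> real \<Rightarrow> real \<Rightarrow> (real \<Rightarrow> real) \<Rightarrow> bool" where
  "u_decomposition q m \<beta> K \<epsilon> u \<longleftrightarrow> (\<exists>S E1 E2 W1 W2.
     (AE x in lebesgue. x \<in> {0<..<2} \<longrightarrow>
        u x = S x + E1 x + E2 x + W1 x * indicator {0<..<1} x + W2 x * indicator {1<..<2} x) \<and>
     S \<in> sobolev (q + 1) 0 1 \<and> S \<in> sobolev (q + 1) 1 2 \<and>
     (\<forall>k\<le>q + 1. L2_nrm 0 1 ((wderiv 0 1 ^^ k) S) + L2_nrm 1 2 ((wderiv 1 2 ^^ k) S) \<le> K) \<and>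
     deriv_bounds (q + 1) {0<..<2} E1
       (\<lambda>k x. K * \<epsilon> powi (int m - int k) * exp (- \<beta> * x / \<epsilon>)) \<and>
     deriv_bounds (q + 1) {0<..<2} E2
       (\<lambda>k x. K * \<epsilon> powi (int m - int k) * exp (- \<beta> * (2 - x) / \<epsilon>)) \<and>
     deriv_bounds (q + 1) {0<..<1} W1
       (\<lambda>k x. K * \<epsilon> powi (3 - int k) * exp (- \<beta> * (1 - x) / \<epsilon>)) \<and>
     deriv_bounds (q + 1) {1<..<2} W2
       (\<lambda>k x. K * \<epsilon> powi (3 - int k) * exp (- \<beta> * (x - 1) / \<epsilon>)))"

definition w_decomposition ::
    "nat \<Rightarrow> nat \<Rightarrow> real \<Rightarrow> real \<Rightarrow> real \<Rightarrow> (real \<Rightarrow> real) \<Rightarrow> bool" where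
  "w_decomposition q m \<beta> K \<epsilon> w \<longleftrightarrow> (\<exists>S E1 E2 W1 W2.
     (\<forall>x\<in>{0<..<2} - {1}.
        w x = S x + E1 x + E2 x + W1 x * indicator {0<..<1} x + W2 x * indicator {1<..<2} x) \<and>
     deriv_bounds (q + 1) ({0<..<2} - {1}) S (\<lambda>k x. K * \<epsilon>) \<and>
     deriv_bounds (q + 1) {0<..<2} E1
       (\<lambda>k x. K * \<epsilon> powi (int m - 1 - int k) * exp (- \<beta> * x / \<epsilon>)) \<and>
     deriv_bounds (q + 1) {0<..<2} E2
       (\<lambda>k x. K * \<epsilon> powi (int m - 1 - int k) * exp (- \<beta> * (2 - x) / \<epsilon>)) \<and>
     deriv_bounds (q + 1) {0<..<1} W1
       (\<lambda>k x. K * \<epsilon> powi (2 - int k) * exp (- \<beta> * (1 - x) / \<epsilon>)) \<and>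
     deriv_bounds (q + 1) {1<..<2} W2
       (\<lambda>k x. K * \<epsilon> powi (2 - int k) * exp (- \<beta> * (x - 1) / \<epsilon>)))"

text \<open>Derivatives of the piecewise $C^1$ functions \<open>\<phi>\<close> and \<open>\<psi>\<close> are evaluated away from their
  finitely many break points.\<close>

definition mesh_defining :: "real \<Rightarrow> nat \<Rightarrow> (real \<Rightarrow> real) \<Rightarrow> bool" where
  "mesh_defining K N \<phi> \<longleftrightarrow>
     \<phi> piecewise_C1_differentiable_on {0..1/2} \<and> mono_on {0..1/2} \<phi> \<and>
     \<phi> 0 = 0 \<and> \<phi> (1/2) = ln (real N) \<and>
     (\<forall>t\<in>{0<..<1/2}. \<phi> differentiable (at t) \<longrightarrow> deriv \<phi> t \<le> K * real N)"

definition max_abs_psi' :: "(real \<Rightarrow> real) \<Rightarrow> real" where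
  "max_abs_psi' \<phi> = (let \<psi> = (\<lambda>t. exp (- \<phi> t)) in
     SUP t\<in>{t \<in> {0<..<1/2}. \<psi> differentiable (at t)}. \<bar>deriv \<psi> t\<bar>)"

definition mesh_lambda :: "real \<Rightarrow> real \<Rightarrow> real \<Rightarrow> nat \<Rightarrow> real" where
  "mesh_lambda \<sigma> \<beta> \<epsilon> N = \<sigma> / \<beta> * \<epsilon> * ln (real N)"

definition mesh_mu :: "nat \<Rightarrow> real \<Rightarrow> real \<Rightarrow> real" where
  "mesh_mu q \<beta> \<epsilon> = (if q \<le> 2 then 1/4 else 1 / \<beta> * \<epsilon> powr (1 - 5 / (2 * (real q + 1))))"

definition mesh_node ::
    "nat \<Rightarrow> real \<Rightarrow> real \<Rightarrow> real \<Rightarrow> nat \<Rightarrow> (real \<Rightarrow> real) \<Rightarrow> nat \<Rightarrow> real" where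
  "mesh_node q \<sigma> \<beta> \<epsilon> N \<phi> i =
    (let n = real N; j = real i; l = mesh_lambda \<sigma> \<beta> \<epsilon> N; \<mu> = mesh_mu q \<beta> \<epsilon> in
     if j \<le> n / 8 then \<sigma> * \<epsilon> / \<beta> * \<phi> (4 * j / n)
     else if j \<le> 3 * n / 8 then l + (j - n / 8) * ((1 - \<mu> - l) / (n / 4))
     else if j \<le> 5 * n / 8 then (1 - \<mu>) + (j - 3 * n / 8) * (2 * \<mu> / (n / 4))
     else if j \<le> 7 * n / 8 then (1 + \<mu>) + (j - 5 * n / 8) * ((1 - \<mu> - l) / (n / 4))
     else 2 - \<sigma> * \<epsilon> / \<beta> * \<phi> (4 * (n - j) / n))"

definition layer_width :: "nat \<Rightarrow> (nat \<Rightarrow> real) \<Rightarrow> real" where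
  "layer_width N X = Max ((\<lambda>i. X i - X (i - 1)) ` ({1..N div 8} \<union> {7 * N div 8 + 1..N}))"

text \<open>A mesh is given by the number \<open>N\<close> of cells and the nodes \<open>X 0, \<dots>, X N\<close>.\<close>

definition piecewise_poly :: "nat \<Rightarrow> nat \<Rightarrow> (nat \<Rightarrow> real) \<Rightarrow> (real \<Rightarrow> real) \<Rightarrow> bool" where
  "piecewise_poly q N X v \<longleftrightarrow>
     (\<forall>i\<in>{1..N}. \<exists>p :: real poly. degree p \<le> q \<and> (\<forall>x\<in>{X (i - 1)..X i}. v x = poly p x))"

definition Uh_space ::
    "nat \<Rightarrow> nat \<Rightarrow> nat \<Rightarrow> (nat \<Rightarrow> real) \<Rightarrow> ((real \<Rightarrow> real) \<times> (real \<Rightarrow> real)) set" where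
  "Uh_space m q N X = {(y, z) \<in> U_space m. piecewise_poly q N X y \<and> piecewise_poly q N X z}"

definition is_interpolant ::
    "nat \<Rightarrow> nat \<Rightarrow> (nat \<Rightarrow> real) \<Rightarrow> (real \<Rightarrow> real) \<Rightarrow> (real \<Rightarrow> real) \<Rightarrow> bool" where
  "is_interpolant q N X v g \<longleftrightarrow>
     continuous_on {X 0..X N} g \<and> piecewise_poly q N X g \<and>
     (\<forall>i\<in>{1..N}. g (X (i - 1)) = v (X (i - 1)) \<and> g (X i) = v (X i) \<and>
        (\<forall>\<xi> :: real poly. degree \<xi> + 2 \<le> q \<longrightarrow>
           (LINT x:{X (i - 1)..X i}|lebesgue. (g x - v x) * poly \<xi> x) = 0))"
  \<comment> \<open>\<open>degree \<xi> + 2 \<le> q\<close> is void for \<open>q = 1\<close>, unlike truncated \<open>degree \<xi> \<le> q - 2\<close>\<close>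

definition interp :: "nat \<Rightarrow> nat \<Rightarrow> (nat \<Rightarrow> real) \<Rightarrow> (real \<Rightarrow> real) \<Rightarrow> real \<Rightarrow> real" where
  "interp q N X v = (SOME g. is_interpolant q N X v g)"
  \<comment> \<open>unique on \<open>[X 0, X N]\<close>; the same operator serves as $I_1$ and $I_2$\<close>

end

theory Submission imports Defs begin

text \<open>On every cell, $(I v)'$ is the $L^2$-projection of $v'$ onto the polynomials of degree less than
  $q$, because $Iv - v$ vanishes at both end points and is orthogonal to polynomials of degree
  at most $q - 2$. Hence, when the Galerkin orthogonality is tested with $(I_1u - u_h, I_2w - w_h)$, both
  terms carrying the factor $\varepsilon$ vanish, and of the diffusion term only the oscillation of
  $b$ on a cell survives. Coercivity and Young's inequality bound the discrete error by
  $H\,\|(u - I_1u)'\| + \|w - I_2w\|$, with $H$ the largest mesh width. It remains to estimate these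
  projection errors, of order $q$ and $q + \frac12$ in $r = h + N^{-1}\max|\psi'|$.

  For the smooth part one uses $q$ more derivatives. In the boundary layers,
  $(x_i - x_{i-1})\,\psi \lesssim \varepsilon r$ and $\sigma \ge q + 1$ compensate $\varepsilon^{-q}$ inside
  $(0,\lambda)$, while outside the layer is as small as $N^{-(q+1)}$ and stability of the projection
  suffices, in $L^2$ for $u$ and from $L^1$ to the primitive for $w$. The weak layers at $x = 1$ are
  resolved by the cells of width $8\mu/N$; beyond the distance $\mu$ two derivatives are enough,
  since the decay $e^{-\beta\mu/\varepsilon}$ is controlled by the assumption on
  $e^{-\varepsilon^{-1/q}}$. Only the weak
  layers for $q = 2$ contribute less than order $q + 1$ to the error of $w$; there the short support
  of the layers yields half an order beyond $q$.\<close>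

section \<open>Square integrable and absolutely continuous functions\<close>

text \<open>Instead the weak derivative is split, and every summand is compared with its own
  projection, which needs only moments. The interpolation error of w then appears as the primitive
  of a projection error on each cell.

  The exponent in \<mu> balances two demands for q > 2. On cells of width 8\<mu>/N the squared error
  of w due to the weak layers is of size (\<beta>\<mu>/\<epsilon>)^(2q+2) \<epsilon>^5 N^(-2q-2),
  and \<mu> makes the factor in front of N^(-2q-2) equal to 1. Farther from x = 1 the factor
  e^(-\<beta>\<mu>/\<epsilon>) has to supply the missing orders. For q \<le> 2 the value \<mu> = 1/4
  gives no refinement, and q = 2 becomes the critical case.

  Cells may have width zero, since \<phi> is only monotone; hence projections are a relation without
  uniqueness. Gauge integrals are used because they recover a function from its derivative without
  continuity of the latter, and \<open>AC\<close> keeps that derivative as an explicit argument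
  because it is determined only up to null sets.\<close>

definition Ltwo :: "real \<Rightarrow> real \<Rightarrow> (real \<Rightarrow> real) \<Rightarrow> bool" where
  "Ltwo a b f \<longleftrightarrow> f integrable_on {a..b} \<and> (\<lambda>x. (f x)\<^sup>2) integrable_on {a..b}"

abbreviation sqint :: "real \<Rightarrow> real \<Rightarrow> (real \<Rightarrow> real) \<Rightarrow> real" where
  "sqint a b f \<equiv> integral {a..b} (\<lambda>x. (f x)\<^sup>2)"

lemma Ltwo_measurable: "Ltwo a b f \<Longrightarrow> f \<in> borel_measurable (lebesgue_on {a..b})"
  by (simp add: Ltwo_def integrable_imp_measurable)

lemma abs_le_1_sq: "\<bar>x::real\<bar> \<le> 1 + x\<^sup>2"
proof -
  have "0 \<le> (\<bar>x\<bar> - 1)\<^sup>2" by simp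
  also have "\<dots> = x\<^sup>2 - 2 * \<bar>x\<bar> + 1" by (simp add: power2_eq_square algebra_simps abs_mult_self_eq)
  finally show ?thesis by (simp add: abs_le_iff) (smt (verit))
qed

lemma abs_mult_le_sq: "\<bar>x * y\<bar> \<le> x\<^sup>2 + (y::real)\<^sup>2"
proof -
  have "2 * \<bar>x\<bar> * \<bar>y\<bar> \<le> \<bar>x\<bar>\<^sup>2 + \<bar>y\<bar>\<^sup>2" by (rule sum_squares_bound)
  moreover have "0 \<le> \<bar>x\<bar> * \<bar>y\<bar>" by simp
  ultimately have "\<bar>x\<bar> * \<bar>y\<bar> \<le> \<bar>x\<bar>\<^sup>2 + \<bar>y\<bar>\<^sup>2" by linarith
  then show ?thesis by (simp add: abs_mult)
qed

lemma Ltwo_I: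
  assumes "f \<in> borel_measurable (lebesgue_on {a..b})" "(\<lambda>x. (f x)\<^sup>2) integrable_on {a..b}"
  shows "Ltwo a b f"
  unfolding Ltwo_def
proof
  show "f integrable_on {a..b}"
    by (rule measurable_bounded_by_integrable_imp_integrable[OF assms(1),
          of "\<lambda>x. 1 + (f x)\<^sup>2"])
      (use assms in \<open>auto intro!: integrable_add abs_le_1_sq\<close>)
qed (use assms in auto)

text \<open>Gauge integrability of \<open>f\<close> supplies measurability, and 1 + f^2 is an
  integrable majorant. Conditionally convergent integrals are thereby excluded, and
  \<open>Ltwo\<close> is the usual L2 space on a bounded interval.\<close>

lemma Ltwo_absint: "Ltwo a b f \<Longrightarrow> f absolutely_integrable_on {a..b}"
  by (rule measurable_bounded_by_integrable_imp_absolutely_integrable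
      [OF Ltwo_measurable, of _ _ _ "\<lambda>x. 1 + (f x)\<^sup>2"])
    (auto simp: Ltwo_def intro!: integrable_add abs_le_1_sq)

lemma Ltwo_mult:
  assumes "Ltwo a b f" "Ltwo a b g"
  shows "(\<lambda>x. f x * g x) absolutely_integrable_on {a..b}"
proof (rule measurable_bounded_by_integrable_imp_absolutely_integrable)
  show "(\<lambda>x. f x * g x) \<in> borel_measurable (lebesgue_on {a..b})"
    using assms by (intro borel_measurable_times Ltwo_measurable)
  show "(\<lambda>x. (f x)\<^sup>2 + (g x)\<^sup>2) integrable_on {a..b}"
    using assms by (intro integrable_add) (auto simp: Ltwo_def)
qed (auto simp: abs_mult_le_sq)

lemma Ltwo_mult_int:
  assumes "Ltwo a b f" "Ltwo a b g"
  shows "(\<lambda>x. f x * g x) integrable_on {a..b}"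
  using Ltwo_mult[OF assms] by (simp add: absolutely_integrable_on_def)

lemma Ltwo_sq_int: "Ltwo a b f \<Longrightarrow> (\<lambda>x. (f x)\<^sup>2) integrable_on {a..b}"
  by (simp add: Ltwo_def)

lemma Ltwo_cmult: "Ltwo a b f \<Longrightarrow> Ltwo a b (\<lambda>x. c * f x)"
  by (simp add: Ltwo_def power_mult_distrib integrable_on_mult_right)

lemma Ltwo_add:
  assumes "Ltwo a b f" "Ltwo a b g" shows "Ltwo a b (\<lambda>x. f x + g x)"
proof -
  have "(\<lambda>x. (f x)\<^sup>2 + (g x)\<^sup>2 + 2 * (f x * g x)) integrable_on {a..b}"
    using assms Ltwo_mult_int[OF assms]
    by (intro integrable_add integrable_on_mult_right) (auto simp: Ltwo_def)
  then show ?thesis using assms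
    by (auto simp: Ltwo_def power2_sum mult.assoc intro: integrable_add)
qed

lemma Ltwo_minus: "Ltwo a b f \<Longrightarrow> Ltwo a b (\<lambda>x. - f x)"
  using Ltwo_cmult[of a b f "-1"] by simp

lemma Ltwo_diff: "Ltwo a b f \<Longrightarrow> Ltwo a b g \<Longrightarrow> Ltwo a b (\<lambda>x. f x - g x)"
  using Ltwo_add[of a b f "\<lambda>x. - g x"] Ltwo_minus[of a b g] by simp

lemma Ltwo_cont:
  assumes "continuous_on {a..b} f" shows "Ltwo a b f"
  unfolding Ltwo_def using assms
  by (intro conjI integrable_continuous_real continuous_on_power)

lemma Ltwo_subinterval: "Ltwo a b f \<Longrightarrow> {c..d} \<subseteq> {a..b} \<Longrightarrow> Ltwo c d f"
  unfolding Ltwo_def by (auto intro: integrable_subinterval_real)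

lemma Ltwo_spike:
  assumes "Ltwo a b f" "negligible S" "\<And>x. x \<in> {a..b} - S \<Longrightarrow> g x = f x"
  shows "Ltwo a b g"
  using assms(1) unfolding Ltwo_def
  by (auto intro: integrable_spike[OF _ assms(2)] simp: assms(3))

lemma Ltwo_bounded:
  assumes "f \<in> borel_measurable (lebesgue_on {a..b})" "\<And>x. x \<in> {a..b} \<Longrightarrow> \<bar>f x\<bar> \<le> M"
  shows "Ltwo a b f"
proof (rule Ltwo_I[OF assms(1)])
  show "(\<lambda>x. (f x)\<^sup>2) integrable_on {a..b}"
  proof (rule measurable_bounded_by_integrable_imp_integrable)
    show "norm ((f x)\<^sup>2) \<le> M\<^sup>2" if "x \<in> {a..b}" for x
      using assms(2)[OF that] by (simp add: abs_le_square_iff[symmetric])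
  qed (use assms in auto)
qed

lemma absint_cont_mult:
  fixes f g :: "real \<Rightarrow> real"
  assumes "continuous_on {a..b} g" "f absolutely_integrable_on {a..b}"
  shows "(\<lambda>x. g x * f x) absolutely_integrable_on {a..b}"
  by (rule absolutely_integrable_bounded_measurable_product_real)
    (use assms in \<open>auto intro: continuous_imp_measurable_on_sets_lebesgue
      compact_imp_bounded compact_continuous_image\<close>)

lemma Ltwo_cont_mult:
  assumes "continuous_on {a..b} g" "Ltwo a b f"
  shows "Ltwo a b (\<lambda>x. g x * f x)"
proof (rule Ltwo_I)
  show "(\<lambda>x. g x * f x) \<in> borel_measurable (lebesgue_on {a..b})"
    using assms by (intro borel_measurable_times continuous_imp_measurable_on_sets_lebesgue
        Ltwo_measurable) auto
  have "(\<lambda>x. (g x)\<^sup>2 * (f x)\<^sup>2) absolutely_integrable_on {a..b}"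
    by (intro absint_cont_mult continuous_intros assms nonnegative_absolutely_integrable_1)
      (use assms in \<open>auto simp: Ltwo_def\<close>)
  then show "(\<lambda>x. (g x * f x)\<^sup>2) integrable_on {a..b}"
    by (simp add: absolutely_integrable_on_def power_mult_distrib)
qed

text \<open>Passage from the Lebesgue integral over the open interval, as in the statement, to the
  gauge integral over the closed one: the end points form a null set, and for the nonnegative
  function f^2 the two notions of integrability agree.\<close>

lemma square_integrable_iff_Ltwo: "square_integrable a b f \<longleftrightarrow> Ltwo a b f"
proof
  assume "square_integrable a b f"
  then have m: "f \<in> borel_measurable (lebesgue_on {a<..<b})"
    and i: "(\<lambda>x. (f x)\<^sup>2) absolutely_integrable_on {a<..<b}"
    by (auto simp: square_integrable_def set_borel_measurable_def borel_measurable_restrict_space_iff)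
  have "f absolutely_integrable_on {a<..<b}"
    by (rule measurable_bounded_by_integrable_imp_absolutely_integrable[OF m,
          of "\<lambda>x. 1 + (f x)\<^sup>2"])
      (use i abs_le_1_sq in \<open>auto intro!: integrable_add
         simp: absolutely_integrable_on_def integrable_on_open_interval_real\<close>)
  with i show "Ltwo a b f"
    by (simp add: Ltwo_def absolutely_integrable_on_def integrable_on_open_interval_real)
next
  assume L: "Ltwo a b f"
  have "f absolutely_integrable_on {a<..<b}"
    using Ltwo_absint[OF L] by (simp add: absolutely_integrable_on_Icc_iff_Ioo)
  then have "set_borel_measurable lebesgue {a<..<b} f"
    by (simp add: set_integrable_def set_borel_measurable_def)
  moreover have "(\<lambda>x. (f x)\<^sup>2) absolutely_integrable_on {a..b}"
    using Ltwo_mult[OF L L] by (simp add: power2_eq_square)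
  ultimately show "square_integrable a b f"
    by (simp add: square_integrable_def absolutely_integrable_on_Icc_iff_Ioo)
qed

lemma L2_inner_eq_integral':
  assumes "(\<lambda>x. f x * g x) absolutely_integrable_on {a..b}"
  shows "L2_inner a b f g = integral {a..b} (\<lambda>x. f x * g x)"
  using assms unfolding L2_inner_def
  by (simp add: absolutely_integrable_on_Icc_iff_Ioo set_lebesgue_integral_eq_integral(2)
      integral_open_interval_real)

lemma L2_inner_eq_integral:
  assumes "Ltwo a b f" "Ltwo a b g"
  shows "L2_inner a b f g = integral {a..b} (\<lambda>x. f x * g x)"
  using L2_inner_eq_integral' Ltwo_mult assms by blast

lemma L2_nrm_sq:
  assumes "Ltwo a b f"
  shows "(L2_nrm a b f)\<^sup>2 = sqint a b f"
proof -
  have "integral {a..b} (\<lambda>x. f x * f x) \<ge> 0"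
    using Ltwo_mult_int[OF assms assms] by (intro integral_nonneg) auto
  then show ?thesis
    by (simp add: L2_nrm_def L2_inner_eq_integral[OF assms assms] power2_eq_square)
qed

lemma Ltwo_Cauchy_Schwarz:
  assumes "Ltwo a b f" "Ltwo a b g"
  shows "(integral {a..b} (\<lambda>x. f x * g x))\<^sup>2
    \<le> sqint a b f * sqint a b g"
proof -
  let ?A = "sqint a b f" and ?B = "integral {a..b} (\<lambda>x. f x * g x)"
    and ?C = "sqint a b g"
  have key: "0 \<le> s\<^sup>2 * ?A + 2 * s * t * ?B + t\<^sup>2 * ?C" for s t
  proof -
    have "0 \<le> sqint a b (\<lambda>x. s * f x + t * g x)"
      by (intro integral_nonneg Ltwo_sq_int Ltwo_add Ltwo_cmult assms) auto
    also have "(\<lambda>x. (s * f x + t * g x)\<^sup>2)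
      = (\<lambda>x. s\<^sup>2 * (f x)\<^sup>2 + (2 * s * t) * (f x * g x) + t\<^sup>2 * (g x)\<^sup>2)"
      by (auto simp: power2_eq_square algebra_simps)
    also have "integral {a..b} \<dots> = s\<^sup>2 * ?A + 2 * s * t * ?B + t\<^sup>2 * ?C"
      using Ltwo_sq_int[OF assms(1)] Ltwo_sq_int[OF assms(2)] Ltwo_mult_int[OF assms]
      by (simp add: integral_add integrable_add integrable_on_mult_right)
    finally show ?thesis .
  qed
  have A: "?A \<ge> 0" and C: "?C \<ge> 0" using key[of 1 0] key[of 0 1] by auto
  show ?thesis
  proof (cases "?C = 0")
    case True
    have "?B = 0"
    proof (rule ccontr)
      assume "?B \<noteq> 0"
      \<comment> \<open>With \<open>?C = 0\<close> the form in \<open>key\<close> is affine in its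
        second argument; the chosen one gives it the value -1.\<close>
      then show False using key[of 1 "- (?A + 1) / (2 * ?B)"] True A by (simp add: field_simps)
    qed
    then show ?thesis using True by simp
  next
    case False
    then have "?C > 0" using C by simp
    \<comment> \<open>The form is evaluated at s = \<open>?C\<close>, t = -\<open>?B\<close>, which
      is the minimiser in t for this s.\<close>
    have "0 \<le> ?C * (?A * ?C - ?B\<^sup>2)"
      using key[of ?C "- ?B"] by (simp add: power2_eq_square algebra_simps)
    then show ?thesis using \<open>?C > 0\<close> by (simp add: zero_le_mult_iff)
  qed
qed

section \<open>Absolutely continuous functions and integration by parts\<close>

definition AC :: "real \<Rightarrow> real \<Rightarrow> (real \<Rightarrow> real) \<Rightarrow> (real \<Rightarrow> real) \<Rightarrow> bool" where
  "AC a b F f \<longleftrightarrow> f absolutely_integrable_on {a..b} \<and> (\<forall>x\<in>{a..b}. F x = F a + integral {a..x} f)"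

lemma absint_int:
  fixes f :: "real \<Rightarrow> real"
  shows "f absolutely_integrable_on S \<Longrightarrow> f integrable_on S"
  by (simp add: absolutely_integrable_on_def)

lemma absint_sub:
  fixes f :: "real \<Rightarrow> real"
  shows "f absolutely_integrable_on {a..b} \<Longrightarrow> {c..d} \<subseteq> {a..b} \<Longrightarrow> f absolutely_integrable_on {c..d}"
  unfolding absolutely_integrable_on_def by (auto intro: integrable_subinterval_real)

lemma AC_eq: "AC a b F f \<Longrightarrow> a \<le> x \<Longrightarrow> x \<le> b \<Longrightarrow> F x = F a + integral {a..x} f"
  unfolding AC_def by (meson atLeastAtMost_iff)

lemma AC_absint: "AC a b F f \<Longrightarrow> f absolutely_integrable_on {a..b}"
  unfolding AC_def by blast

lemma AC_int: "AC a b F f \<Longrightarrow> f integrable_on {a..b}"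
  by (rule absint_int[OF AC_absint])

lemma AC_diff_eq:
  assumes "AC a b F f" "a \<le> x" "x \<le> y" "y \<le> b"
  shows "F y - F x = integral {x..y} f"
proof -
  have "f integrable_on {a..y}"
    using assms by (intro integrable_subinterval_real[OF AC_int[OF assms(1)]]) auto
  then have "integral {a..x} f + integral {x..y} f = integral {a..y} f"
    using assms by (intro Henstock_Kurzweil_Integration.integral_combine) auto
  moreover have "F y = F a + integral {a..y} f" "F x = F a + integral {a..x} f"
    using assms by (auto intro: AC_eq)
  ultimately show ?thesis by simp
qed

lemma AC_I:
  assumes "f absolutely_integrable_on {a..b}"
    and "\<And>x. a \<le> x \<Longrightarrow> x \<le> b \<Longrightarrow> F x = F a + integral {a..x} f"
  shows "AC a b F f"
  using assms unfolding AC_def by (meson atLeastAtMost_iff)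

lemma AC_sub:
  assumes "AC a b F f" "a \<le> c" "d \<le> b" shows "AC c d F f"
proof (rule AC_I)
  show "f absolutely_integrable_on {c..d}"
    by (rule absint_sub[where a = a and b = b]) (use assms AC_absint[OF assms(1)] in auto)
  show "F x = F c + integral {c..x} f" if "c \<le> x" "x \<le> d" for x
    using AC_diff_eq[OF assms(1), of c x] that assms by auto
qed

lemma AC_cont:
  assumes "AC a b F f" shows "continuous_on {a..b} F"
proof -
  have "continuous_on {a..b} (\<lambda>x. F a + integral {a..x} f)"
    using AC_int[OF assms] by (intro continuous_intros indefinite_integral_continuous_1)
  then show ?thesis
    by (rule continuous_on_eq) (metis AC_eq[OF assms] atLeastAtMost_iff)
qed

lemma AC_spike:
  assumes "AC a b F f" "negligible S" "\<And>x. x \<in> {a..b} - S \<Longrightarrow> g x = f x"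
  shows "AC a b F g"
proof (rule AC_I)
  show "g absolutely_integrable_on {a..b}"
    using absolutely_integrable_spike[OF AC_absint[OF assms(1)]] assms(2,3) by blast
  fix x assume x: "a \<le> x" "x \<le> b"
  have "integral {a..x} g = integral {a..x} f"
    by (rule integral_spike[OF assms(2)]) (use assms x in auto)
  then show "F x = F a + integral {a..x} g" using AC_eq[OF assms(1) x] by simp
qed

lemma AC_fun_cong:
  assumes "AC a b F f" "\<And>x. x \<in> {a..b} \<Longrightarrow> F x = G x"
  shows "AC a b G f"
proof (rule AC_I)
  show "f absolutely_integrable_on {a..b}" using AC_absint[OF assms(1)] .
  fix x assume "a \<le> x" "x \<le> b"
  then show "G x = G a + integral {a..x} f"
    using AC_eq[OF assms(1), of x] assms(2)[of x] assms(2)[of a] by simp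
qed

lemma AC_indef:
  assumes "f absolutely_integrable_on {a..b}"
  shows "AC a b (\<lambda>x. c + integral {a..x} f) f"
  by (rule AC_I[OF assms]) simp

lemma AC_lincomb:
  assumes "AC a b F f" "AC a b G g"
  shows "AC a b (\<lambda>x. s * F x + t * G x) (\<lambda>x. s * f x + t * g x)"
proof (rule AC_I)
  show "(\<lambda>x. s * f x + t * g x) absolutely_integrable_on {a..b}"
    using assms by (intro set_integral_add set_integrable_mult_right) (auto dest: AC_absint)
  fix x assume x: "a \<le> x" "x \<le> b"
  have "AC a x F f" "AC a x G g" using assms x by (auto intro: AC_sub)
  then have "integral {a..x} (\<lambda>y. s * f y + t * g y) = s * integral {a..x} f + t * integral {a..x} g"
    by (subst integral_add) (auto intro!: integrable_on_mult_right dest: AC_int)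
  then show "s * F x + t * G x = s * F a + t * G a + integral {a..x} (\<lambda>x. s * f x + t * g x)"
    using AC_eq[OF assms(1) x] AC_eq[OF assms(2) x] by (simp add: algebra_simps)
qed

lemma AC_diff: "AC a b F f \<Longrightarrow> AC a b G g \<Longrightarrow> AC a b (\<lambda>x. F x - G x) (\<lambda>x. f x - g x)"
  using AC_lincomb[of a b F f G g 1 "-1"] by simp

text \<open>Absolutely continuous functions need not be differentiable everywhere; the product rule is
  obtained from their increments, where a local estimate adds up over a fine partition.\<close>

lemma increment_bound_from_local:
  fixes D \<Psi> :: "real \<Rightarrow> real"
  assumes ab: "a \<le> b" "\<delta> > 0"
    and loc: "\<And>x y. a \<le> x \<Longrightarrow> x \<le> y \<Longrightarrow> y \<le> b \<Longrightarrow> y - x < \<delta> \<Longrightarrow> \<bar>D y - D x\<bar> \<le> \<Psi> y - \<Psi> x"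
  shows "\<bar>D b - D a\<bar> \<le> \<Psi> b - \<Psi> a"
proof -
  obtain n :: nat where n: "real n > (b - a) / \<delta>" using reals_Archimedean2 by blast
  have "(b - a) / \<delta> \<ge> 0" using ab by simp
  then have n0: "real n > 0" using n by linarith
  define s where "s = (b - a) / real n"
  have s: "0 \<le> s" "s < \<delta>" "real n * s = b - a"
    using n n0 ab by (auto simp: s_def field_simps)
  have "\<bar>D (a + real k * s) - D a\<bar> \<le> \<Psi> (a + real k * s) - \<Psi> a" if "k \<le> n" for k
    using that
  proof (induction k)
    case (Suc k)
    have "real (Suc k) * s \<le> real n * s" using Suc.prems s by (intro mult_right_mono) auto
    then have "\<bar>D (a + real (Suc k) * s) - D (a + real k * s)\<bar> \<le> \<Psi> (a + real (Suc k) * s) - \<Psi> (a + real k * s)"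
      using s by (intro loc) (auto simp: algebra_simps)
    then show ?case using Suc by simp
  qed simp
  from this[of n] show ?thesis using s by simp
qed

lemma AC_mult:
  assumes F: "AC a b F f" and G: "AC a b G g"
  shows "AC a b (\<lambda>x. F x * G x) (\<lambda>x. f x * G x + F x * g x)"
proof -
  let ?k = "\<lambda>x. f x * G x + F x * g x"
  have contF: "continuous_on {a..b} F" and contG: "continuous_on {a..b} G"
    using AC_cont assms by auto
  have i1: "(\<lambda>x. f x * G x) absolutely_integrable_on {a..b}"
    using absint_cont_mult[OF contG AC_absint[OF F]] by (simp add: mult.commute)
  have i2: "(\<lambda>x. F x * g x) absolutely_integrable_on {a..b}"
    using absint_cont_mult[OF contF AC_absint[OF G]] .
  have k: "?k absolutely_integrable_on {a..b}" using i1 i2 by (rule set_integral_add)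
  have n: "(\<lambda>x. \<bar>f x\<bar> + \<bar>g x\<bar>) absolutely_integrable_on {a..b}"
    using AC_absint[OF F] AC_absint[OF G] by (intro set_integral_add set_integrable_abs)
  show ?thesis
  proof (rule AC_I[OF k])
    fix x assume x: "a \<le> x" "x \<le> b"
    define D where "D t = F t * G t - integral {a..t} ?k" for t
    define V where "V t = integral {a..t} (\<lambda>x. \<bar>f x\<bar> + \<bar>g x\<bar>)" for t
    \<comment> \<open>\<open>D\<close> measures the failure of the product rule, and
      \<open>V\<close> bounds the variation of both functions. If \<open>D\<close> moves by at most
      \<open>e * V\<close> for every e > 0, it is constant.\<close>
    have loc: "\<bar>D x - D a\<bar> \<le> e * V x" if "e > 0" for e
    proof -
      have "uniformly_continuous_on {a..b} F" "uniformly_continuous_on {a..b} G"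
        using contF contG by (auto intro: compact_uniformly_continuous)
      then obtain d1 d2 where d: "d1 > 0" "d2 > 0"
        "\<And>s t. s \<in> {a..b} \<Longrightarrow> t \<in> {a..b} \<Longrightarrow> dist t s < d1 \<Longrightarrow> dist (F t) (F s) < e"
        "\<And>s t. s \<in> {a..b} \<Longrightarrow> t \<in> {a..b} \<Longrightarrow> dist t s < d2 \<Longrightarrow> dist (G t) (G s) < e"
        unfolding uniformly_continuous_on_def using \<open>e > 0\<close> by metis
      have "\<bar>D x - D a\<bar> \<le> e * V x - e * V a"
      proof (rule increment_bound_from_local[of a x "min d1 d2" D "\<lambda>t. e * V t"])
        fix s t assume st: "a \<le> s" "s \<le> t" "t \<le> x" "t - s < min d1 d2"
        have sub: "{s..t} \<subseteq> {a..b}" "{a..t} \<subseteq> {a..b}" using st x by auto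
        have DD: "AC a b (\<lambda>t. 0 + integral {a..t} ?k) ?k" "AC a b (\<lambda>t. 0 + V t) (\<lambda>x. \<bar>f x\<bar> + \<bar>g x\<bar>)"
          unfolding V_def by (rule AC_indef[OF k], rule AC_indef[OF n])
        have eK: "integral {a..t} ?k - integral {a..s} ?k = integral {s..t} ?k"
          and eV: "V t - V s = integral {s..t} (\<lambda>x. \<bar>f x\<bar> + \<bar>g x\<bar>)"
          using AC_diff_eq[OF DD(1), of s t] AC_diff_eq[OF DD(2), of s t] st x by auto
        have eF: "F t - F s = integral {s..t} f" and eG: "G t - G s = integral {s..t} g"
          using AC_diff_eq[OF F, of s t] AC_diff_eq[OF G, of s t] st x by auto
        have ii: "f integrable_on {s..t}" "g integrable_on {s..t}" "?k integrable_on {s..t}"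
          "(\<lambda>x. \<bar>f x\<bar> + \<bar>g x\<bar>) integrable_on {s..t}"
          using sub AC_int[OF F] AC_int[OF G] absint_int[OF k] absint_int[OF n]
          by (auto intro: integrable_subinterval_real)
        \<comment> \<open>Discrete product rule with \<open>G\<close> frozen at the right and
          \<open>F\<close> at the left end. Compared with the integrand \<open>?k\<close>, each
          frozen factor is off by at most \<open>e\<close> on a short interval, by uniform
          continuity.\<close>
        have "D t - D s = (F t - F s) * G t + F s * (G t - G s) - integral {s..t} ?k"
          unfolding D_def using eK by (simp add: algebra_simps)
        also have "\<dots> = integral {s..t} (\<lambda>r. (f r * G t + F s * g r) - ?k r)"
          unfolding eF eG using ii
          by (simp add: integral_diff integral_add integrable_add integrable_on_mult_left
              integrable_on_mult_right)
        finally have "D t - D s = integral {s..t} (\<lambda>r. (f r * G t + F s * g r) - ?k r)" .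
        also have "\<bar>\<dots>\<bar> \<le> integral {s..t} (\<lambda>r. e * (\<bar>f r\<bar> + \<bar>g r\<bar>))"
          unfolding real_norm_def[symmetric]
        proof (rule Henstock_Kurzweil_Integration.integral_norm_bound_integral)
          fix r assume r: "r \<in> {s..t}"
          have "\<bar>G t - G r\<bar> \<le> e" "\<bar>F s - F r\<bar> \<le> e"
            using d(3)[of r s] d(4)[of r t] r st x by (auto simp: dist_real_def)
          then have "\<bar>f r * (G t - G r)\<bar> \<le> \<bar>f r\<bar> * e" "\<bar>(F s - F r) * g r\<bar> \<le> e * \<bar>g r\<bar>"
            unfolding abs_mult by (auto intro: mult_left_mono mult_right_mono)
          moreover have "f r * G t + F s * g r - ?k r = f r * (G t - G r) + (F s - F r) * g r"
            by (simp add: algebra_simps)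
          ultimately show "norm (f r * G t + F s * g r - ?k r) \<le> e * (norm (f r) + norm (g r))"
            by (simp add: algebra_simps)
        qed (use ii in \<open>auto intro!: integrable_diff integrable_add integrable_on_mult_left
              integrable_on_mult_right\<close>)
        also have "\<dots> = e * (V t - V s)" by (simp only: integral_mult_right eV)
        finally show "\<bar>D t - D s\<bar> \<le> e * V t - e * V s" by (simp add: algebra_simps)
      qed (use d x in auto)
      then show ?thesis by (simp add: V_def)
    qed
    have "D x = D a"
    proof (rule ccontr)
      assume ne: "D x \<noteq> D a"
      have "\<bar>D x - D a\<bar> \<le> V x * e" if "e > 0" for e using loc[OF that] by (simp add: mult.commute)
      note B = this
      have "V x > 0" using B[of 1] ne by simp
      then show False using B[of "\<bar>D x - D a\<bar> / (2 * V x)"] ne by (simp add: field_simps)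
    qed
    then show "F x * G x = F a * G a + integral {a..x} ?k" by (simp add: D_def)
  qed
qed

lemma AC_by_parts:
  assumes "AC a b F f" "AC a b G g" "a \<le> b"
  shows "integral {a..b} (\<lambda>x. f x * G x) = F b * G b - F a * G a - integral {a..b} (\<lambda>x. F x * g x)"
proof -
  have i1: "(\<lambda>x. f x * G x) absolutely_integrable_on {a..b}"
    using absint_cont_mult[OF AC_cont[OF assms(2)] AC_absint[OF assms(1)]] by (simp add: mult.commute)
  have i2: "(\<lambda>x. F x * g x) absolutely_integrable_on {a..b}"
    using absint_cont_mult[OF AC_cont[OF assms(1)] AC_absint[OF assms(2)]] .
  show ?thesis
    using AC_diff_eq[OF AC_mult[OF assms(1,2)], of a b] assms(3)
      integral_add[OF absint_int[OF i1] absint_int[OF i2]] by simp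
qed

section \<open>Integrable functions determined by their primitives\<close>

lemma integral_zero_imp_negligible:
  fixes f :: "real \<Rightarrow> real"
  assumes f: "f absolutely_integrable_on {a..b}"
    and z: "\<And>x. a \<le> x \<Longrightarrow> x \<le> b \<Longrightarrow> integral {a..x} f = 0"
  shows "negligible {x\<in>{a..b}. f x \<noteq> 0}"
proof -
  define F where "F = (\<lambda>x. indicator {a..b} x * f x)"
  have F: "integrable lebesgue F"
    using f by (simp add: set_integrable_def F_def)
  \<comment> \<open>The densities below are formed over \<open>lborel\<close> and need a Borel
    function; this one differs from \<open>F\<close> only on a null set.\<close>
  then obtain f' where f'[measurable]: "f' \<in> borel_measurable borel" and ae: "AE x in lborel. F x = f' x"
    using completion_ex_borel_measurable_real[of F lborel] by (auto simp: borel_measurable_integrable)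
  have ae': "AE x in lebesgue. F x = f' x" using ae by (rule AE_completion)
  have "integrable lebesgue f'"
    using F ae' by (subst integrable_cong_AE[symmetric, where f = F])
      (auto simp: borel_measurable_integrable intro: measurable_completion)
  then have f'i: "integrable lborel f'" by (simp add: integrable_completion)
  have tail: "(\<integral>t. indicator {x<..} t * f' t \<partial>lborel) = 0" for x
  proof -
    have "(\<integral>t. indicator {x<..} t * f' t \<partial>lborel) = (\<integral>t. indicator {x<..} t * f' t \<partial>lebesgue)"
      by (simp add: integral_completion)
    also have "\<dots> = (\<integral>t. indicator {x<..} t * F t \<partial>lebesgue)"
      by (rule integral_cong_AE) (use F ae' in \<open>auto intro!: borel_measurable_times
            simp: borel_measurable_integrable measurable_completion\<close>)
    also have "\<dots> = (LINT t:{x<..}\<inter>{a..b}|lebesgue. f t)"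
      unfolding set_lebesgue_integral_def F_def by (simp add: indicator_inter_arith mult.assoc)
    also have "\<dots> = integral ({x<..}\<inter>{a..b}) f"
      by (rule set_lebesgue_integral_eq_integral) (rule set_integrable_subset[OF f]; auto)
    also have "\<dots> = 0"
    proof (cases "x \<le> b \<and> a \<le> b")
      case True
      define m where "m = max a x"
      have m: "a \<le> m" "m \<le> b" using True by (auto simp: m_def)
      have "integral ({x<..}\<inter>{a..b}) f = integral {m..b} f"
        by (rule integral_spike_set; rule negligible_subset[of "{x}"]) (auto simp: m_def)
      also have "integral {a..m} f + integral {m..b} f = integral {a..b} f"
        using m f by (intro Henstock_Kurzweil_Integration.integral_combine absint_int) auto
      then have "integral {m..b} f = 0" using z[of m] z[of b] m by simp
      finally show ?thesis .
    next
      case False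
      then have "{x<..}\<inter>{a..b} = {}" by auto
      then show ?thesis by simp
    qed
    finally show ?thesis .
  qed
  \<comment> \<open>the positive and the negative part of \<open>f\<close> are densities of finite measures that agree on half-lines\<close>
  let ?P = "density lborel (\<lambda>t. ennreal (max 0 (f' t)))"
  let ?M = "density lborel (\<lambda>t. ennreal (max 0 (- f' t)))"
  have ip: "integrable lborel (\<lambda>t. max 0 (f' t))" "integrable lborel (\<lambda>t. max 0 (- f' t))"
    using f'i by (auto intro: integrable_max)
  have em: "emeasure (density lborel (\<lambda>t. ennreal (g t))) {x<..} = ennreal (\<integral>t. indicator {x<..} t * g t \<partial>lborel)"
    if "integrable lborel g" "\<And>t. g t \<ge> 0" for g :: "real \<Rightarrow> real" and x
  proof -
    have "emeasure (density lborel (\<lambda>t. ennreal (g t))) {x<..}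
       = (\<integral>\<^sup>+t. ennreal (g t) * indicator {x<..} t \<partial>lborel)"
      using that by (subst emeasure_density) auto
    also have "\<dots> = (\<integral>\<^sup>+t. ennreal (indicator {x<..} t * g t) \<partial>lborel)"
      by (intro nn_integral_cong) (auto split: split_indicator)
    also have "\<dots> = ennreal (\<integral>t. indicator {x<..} t * g t \<partial>lborel)"
      by (intro nn_integral_eq_integral integrable_real_mult_indicator) 
         (use that in \<open>auto simp: integrable_real_mult_indicator mult.commute\<close>)
    finally show ?thesis .
  qed
  have "?P = ?M"
  proof (rule measure_eqI_lessThan)
    fix x
    have ii: "integrable lborel (\<lambda>t. indicator {x<..} t * max 0 (f' t))"
      "integrable lborel (\<lambda>t. indicator {x<..} t * max 0 (- f' t))"
      using integrable_real_mult_indicator[OF _ ip(1), of "{x<..}"]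
        integrable_real_mult_indicator[OF _ ip(2), of "{x<..}"] by (auto simp: mult.commute)
    have "(\<integral>t. indicator {x<..} t * max 0 (f' t) \<partial>lborel) - (\<integral>t. indicator {x<..} t * max 0 (- f' t) \<partial>lborel)
      = (\<integral>t. indicator {x<..} t * max 0 (f' t) - indicator {x<..} t * max 0 (- f' t) \<partial>lborel)"
      using ii by simp
    also have "\<dots> = (\<integral>t. indicator {x<..} t * f' t \<partial>lborel)"
      by (intro Bochner_Integration.integral_cong) (auto split: split_indicator)
    also have "\<dots> = 0" by (rule tail)
    finally show "emeasure ?P {x<..} = emeasure ?M {x<..}"
      by (simp add: em ip)
    show "emeasure ?P {x<..} < \<infinity>" by (simp add: em ip)
  qed auto
  then have "AE x in lborel. ennreal (max 0 (f' x)) = ennreal (max 0 (- f' x))"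
    by (intro sigma_finite_measure.density_unique[OF sigma_finite_lborel]) auto
  then have "AE x in lborel. F x = 0"
    using ae
  proof eventually_elim
    case (elim x)
    then have "max 0 (f' x) = max 0 (- f' x)" by (simp add: ennreal_inj)
    then show ?case using elim by (auto simp: max_def split: if_splits)
  qed
  then have "AE x in lebesgue. F x = 0" by (rule AE_completion)
  then have "negligible {x. F x \<noteq> 0}"
    by (simp add: negligible_iff_null_sets AE_iff_null_sets[symmetric] eventually_ae_filter)
       (metis (mono_tags, lifting) completion.complete2 Collect_mono mem_Collect_eq)
  then show ?thesis
    by (rule negligible_subset) (auto simp: F_def)
qed

lemma integrals_eq_imp_ae_eq:
  fixes f g :: "real \<Rightarrow> real"
  assumes "f absolutely_integrable_on {a..b}" "g absolutely_integrable_on {a..b}"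
    and "\<And>x. a \<le> x \<Longrightarrow> x \<le> b \<Longrightarrow> integral {a..x} f = integral {a..x} g"
  shows "negligible {x\<in>{a..b}. f x \<noteq> g x}"
proof -
  have "negligible {x\<in>{a..b}. f x - g x \<noteq> 0}"
  proof (rule integral_zero_imp_negligible)
    show "(\<lambda>x. f x - g x) absolutely_integrable_on {a..b}"
      using assms by (intro set_integral_diff)
    fix x assume x: "a \<le> x" "x \<le> b"
    then have "f integrable_on {a..x}" "g integrable_on {a..x}"
      using assms by (auto intro: integrable_subinterval_real[OF absint_int])
    then show "integral {a..x} (\<lambda>x. f x - g x) = 0"
      using assms(3)[OF x] by (simp add: integral_diff)
  qed
  then show ?thesis by simp
qed

lemma AC_unique_deriv:
  assumes "AC a b F f" "AC a b G g" "\<And>x. x \<in> {a..b} \<Longrightarrow> F x = G x"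
  shows "negligible {x\<in>{a..b}. f x \<noteq> g x}"
proof (rule integrals_eq_imp_ae_eq)
  fix x assume x: "a \<le> x" "x \<le> b"
  show "integral {a..x} f = integral {a..x} g"
    using AC_diff_eq[OF assms(1) order_refl x] AC_diff_eq[OF assms(2) order_refl x] assms(3) x by auto
qed (use assms in \<open>auto dest: AC_absint\<close>)

lemma continuous_ae_eq:
  fixes f g :: "real \<Rightarrow> real"
  assumes "continuous_on {a..b} f" "continuous_on {a..b} g" "a < b"
    and N: "negligible N" "\<And>x. x \<in> {a..b} - N \<Longrightarrow> f x = g x"
    and x: "x \<in> {a..b}"
  shows "f x = g x"
proof -
  have "((\<lambda>x. \<bar>f x - g x\<bar>) has_integral 0) {a..b}"
    by (rule has_integral_spike[OF N(1), of _ _ "\<lambda>x. 0"]) (use N(2) in auto)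
  moreover have "continuous_on {a..b} (\<lambda>x. \<bar>f x - g x\<bar>)"
    by (intro continuous_intros assms)
  ultimately have "\<bar>f x - g x\<bar> = 0"
    using has_integral_0_cbox_imp_0[of a b "\<lambda>x. \<bar>f x - g x\<bar>" x] \<open>a < b\<close> x by simp
  then show ?thesis by simp
qed

text \<open>The fundamental theorem for the gauge integral makes \<open>f\<close> integrable without
  any continuity, and the bound \<open>M\<close> turns this into square integrability. At the points
  of \<open>S\<close> and at the end points \<open>f\<close> is an arbitrary value within the
  bound.\<close>

lemma AC_of_deriv:
  assumes "a \<le> b" "continuous_on {a..b} F" "finite S"
    and d: "\<And>x. x \<in> {a<..<b} - S \<Longrightarrow> (F has_real_derivative f x) (at x)"
    and bd: "\<And>x. x \<in> {a..b} \<Longrightarrow> \<bar>f x\<bar> \<le> M"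
  shows "AC a b F f" "Ltwo a b f"
proof -
  have I: "(f has_integral F x - F a) {a..x}" if "a \<le> x" "x \<le> b" for x
    by (rule fundamental_theorem_of_calculus_interior_strong[OF \<open>finite S\<close>])
      (use that assms in \<open>auto intro!: continuous_on_subset[OF assms(2)] d
         simp: has_real_derivative_iff_has_vector_derivative[symmetric]\<close>)
  have fi: "f integrable_on {a..b}" using I[of b] assms(1) by auto
  show L: "Ltwo a b f"
    by (rule Ltwo_bounded[OF integrable_imp_measurable[OF fi] bd])
  show "AC a b F f"
    by (rule AC_I[OF Ltwo_absint[OF L]]) (use I in \<open>auto simp: integral_unique[OF I]\<close>)
qed

lemma AC_C1:
  assumes "a \<le> b" "\<And>x. x \<in> {a..b} \<Longrightarrow> (F has_real_derivative f x) (at x within {a..b})"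
    "continuous_on {a..b} f"
  shows "AC a b F f" "Ltwo a b f"
proof -
  obtain M where M: "\<And>x. x \<in> {a..b} \<Longrightarrow> \<bar>f x\<bar> \<le> M"
    using compact_imp_bounded[OF compact_continuous_image[OF assms(3)]]
    unfolding bounded_iff by (metis compact_Icc image_eqI real_norm_def)
  have c: "continuous_on {a..b} F"
    by (rule DERIV_continuous_on[OF assms(2)])
  have d: "(F has_real_derivative f x) (at x)" if "x \<in> {a<..<b} - {}" for x
    using assms(2)[of x] that by (simp add: at_within_Icc_at)
  show "AC a b F f" "Ltwo a b f"
    using AC_of_deriv[OF assms(1) c finite.emptyI d M] by auto
qed

section \<open>Weak derivatives\<close>

text \<open>Only the values of \<open>v\<close> almost everywhere matter, as for \<open>weak_derivative\<close>, but without test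
  functions and localizable to subintervals.\<close>

definition wderiv_on :: "real \<Rightarrow> real \<Rightarrow> (real \<Rightarrow> real) \<Rightarrow> (real \<Rightarrow> real) \<Rightarrow> bool" where
  "wderiv_on a b v g \<longleftrightarrow> Ltwo a b g \<and> (\<exists>c. negligible {x\<in>{a..b}. v x \<noteq> c + integral {a..x} g})"

lemma wderiv_on_Ltwo: "wderiv_on a b v g \<Longrightarrow> Ltwo a b g"
  by (simp add: wderiv_on_def)

lemma AC_imp_wderiv_on:
  assumes "AC a b v g" "Ltwo a b g" shows "wderiv_on a b v g"
proof -
  define R where "R x = v a + integral {a..x} g" for x
  have "v x = R x" if "x \<in> {a..b}" for x
    unfolding R_def by (rule AC_eq[OF assms(1)]) (use that in auto)
  then have "{x\<in>{a..b}. v x \<noteq> R x} = {}" by auto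
  then show ?thesis unfolding wderiv_on_def R_def using assms(2) by (metis negligible_empty)
qed

lemma wderiv_on_sub:
  assumes "wderiv_on a b v g" "a \<le> c" "d \<le> b" shows "wderiv_on c d v g"
proof -
  obtain k where k: "negligible {x\<in>{a..b}. v x \<noteq> k + integral {a..x} g}" and L: "Ltwo a b g"
    using assms by (auto simp: wderiv_on_def)
  have A: "AC a b (\<lambda>x. k + integral {a..x} g) g" by (rule AC_indef[OF Ltwo_absint[OF L]])
  have "negligible {x\<in>{c..d}. v x \<noteq> (k + integral {a..c} g) + integral {c..x} g}"
  proof (rule negligible_subset[OF k], safe)
    fix x assume x: "x \<in> {c..d}" "v x \<noteq> (k + integral {a..c} g) + integral {c..x} g"
    then show "x \<in> {a..b}" using assms by auto
    assume "v x = k + integral {a..x} g"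
    then show False using AC_diff_eq[OF A, of c x] x assms by auto
  qed
  moreover have "Ltwo c d g" by (rule Ltwo_subinterval[OF L]) (use assms in auto)
  ultimately show ?thesis by (auto simp: wderiv_on_def)
qed

lemma wderiv_on_spike_fun:
  assumes "wderiv_on a b v g" "negligible N" "\<And>x. x \<in> {a..b} - N \<Longrightarrow> v x = v' x"
  shows "wderiv_on a b v' g"
proof -
  obtain k where k: "negligible {x\<in>{a..b}. v x \<noteq> k + integral {a..x} g}" and L: "Ltwo a b g"
    using assms by (auto simp: wderiv_on_def)
  have "negligible {x\<in>{a..b}. v' x \<noteq> k + integral {a..x} g}"
    by (rule negligible_subset[OF negligible_Un[OF k assms(2)]]) (use assms(3) in force)
  with L show ?thesis by (auto simp: wderiv_on_def)
qed

lemma wderiv_on_add: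
  assumes "wderiv_on a b v g" "wderiv_on a b v' g'" shows "wderiv_on a b (\<lambda>x. v x + v' x) (\<lambda>x. g x + g' x)"
proof -
  obtain k k' where k: "negligible {x\<in>{a..b}. v x \<noteq> k + integral {a..x} g}"
    "negligible {x\<in>{a..b}. v' x \<noteq> k' + integral {a..x} g'}" and L: "Ltwo a b g" "Ltwo a b g'"
    using assms by (auto simp: wderiv_on_def)
  have "negligible {x\<in>{a..b}. v x + v' x \<noteq> (k + k') + integral {a..x} (\<lambda>x. g x + g' x)}"
  proof (rule negligible_subset[OF negligible_Un[OF k]], rule subsetI, rule ccontr)
    fix x assume x: "x \<in> {x\<in>{a..b}. v x + v' x \<noteq> (k + k') + integral {a..x} (\<lambda>x. g x + g' x)}"
      "x \<notin> {x\<in>{a..b}. v x \<noteq> k + integral {a..x} g} \<union> {x\<in>{a..b}. v' x \<noteq> k' + integral {a..x} g'}"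
    have "{a..x} \<subseteq> {a..b}" using x by auto
    then have "integral {a..x} (\<lambda>x. g x + g' x) = integral {a..x} g + integral {a..x} g'"
      using L by (intro integral_add) (auto simp: Ltwo_def intro: integrable_subinterval_real)
    then show False using x by simp
  qed
  with L show ?thesis unfolding wderiv_on_def by (blast intro: Ltwo_add)
qed

lemma wderiv_on_imp_AC:
  assumes "wderiv_on a b v g" "continuous_on {a..b} v" "a < b"
  shows "AC a b v g"
proof -
  obtain k where k: "negligible {x\<in>{a..b}. v x \<noteq> k + integral {a..x} g}" and L: "Ltwo a b g"
    using assms by (auto simp: wderiv_on_def)
  have A: "AC a b (\<lambda>x. k + integral {a..x} g) g" by (rule AC_indef[OF Ltwo_absint[OF L]])
  show ?thesis
    by (rule AC_fun_cong[OF A], rule continuous_ae_eq[OF AC_cont[OF A] assms(2,3) k]) auto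
qed

lemma wderiv_on_unique:
  assumes "wderiv_on a b v g" "wderiv_on a b v g'" "a < b"
  shows "negligible {x\<in>{a..b}. g x \<noteq> g' x}"
proof -
  obtain k where k: "negligible {x\<in>{a..b}. v x \<noteq> k + integral {a..x} g}" and L: "Ltwo a b g" "Ltwo a b g'"
    using assms by (auto simp: wderiv_on_def)
  have A: "AC a b (\<lambda>x. k + integral {a..x} g) g" by (rule AC_indef[OF Ltwo_absint[OF L(1)]])
  have "wderiv_on a b (\<lambda>x. k + integral {a..x} g) g'"
    by (rule wderiv_on_spike_fun[OF assms(2) k]) auto
  then have "AC a b (\<lambda>x. k + integral {a..x} g) g'"
    by (rule wderiv_on_imp_AC[OF _ AC_cont[OF A] assms(3)])
  from AC_unique_deriv[OF A this] show ?thesis by simp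
qed

section \<open>Weak derivatives by test functions are almost everywhere primitives\<close>

lemma test_function_props:
  assumes "test_function a b \<eta>" "a < b"
  shows "AC a b \<eta> (deriv \<eta>)" "continuous_on {a..b} (deriv \<eta>)" "\<eta> a = 0" "\<eta> b = 0"
proof -
  obtain D where D: "\<And>x. (\<eta> has_vector_derivative D x) (at x)" "continuous_on UNIV D"
    using assms(1) unfolding test_function_def C1_differentiable_on_def by auto
  have DD: "(\<eta> has_real_derivative D x) (at x)" for x
    using D(1) by (simp add: has_real_derivative_iff_has_vector_derivative)
  then have e: "deriv \<eta> = D" by (auto intro: DERIV_imp_deriv)
  show c: "continuous_on {a..b} (deriv \<eta>)" unfolding e using D(2) continuous_on_subset by blast
  show "AC a b \<eta> (deriv \<eta>)"
    by (rule AC_C1) (use assms c in \<open>auto simp: e intro: DD has_field_derivative_at_within\<close>)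
  show "\<eta> a = 0" "\<eta> b = 0" using assms unfolding test_function_def by fastforce+
qed

lemma AC_imp_weak_derivative:
  assumes "AC a b v g" "Ltwo a b g" "a < b"
  shows "weak_derivative a b v g"
  unfolding weak_derivative_def
proof (intro conjI allI impI)
  show "square_integrable a b g" using assms by (simp add: square_integrable_iff_Ltwo)
  fix \<eta> assume t: "test_function a b \<eta>"
  note T = test_function_props[OF t \<open>a < b\<close>]
  have "integral {a..b} (\<lambda>x. deriv \<eta> x * v x) = - integral {a..b} (\<lambda>x. \<eta> x * g x)"
    using AC_by_parts[OF T(1) assms(1)] T assms(3) by simp
  moreover have "Ltwo a b v" "Ltwo a b (deriv \<eta>)" "Ltwo a b \<eta>"
    using AC_cont[OF assms(1)] AC_cont[OF T(1)] T by (auto intro: Ltwo_cont)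
  ultimately show "L2_inner a b v (deriv \<eta>) = - L2_inner a b g \<eta>"
    using assms by (simp add: L2_inner_eq_integral mult.commute)
qed

lemma integral_eq_zero: "(\<And>x. x \<in> S \<Longrightarrow> f x = 0) \<Longrightarrow> integral S f = 0"
  by (metis has_integral_is_0 integral_unique)

text \<open>Mean value zero makes the primitive vanish again to the right of the support. A
  condition on the derivatives of all test functions thus becomes a condition on all continuous
  functions of mean zero with support inside the interval.\<close>

lemma indefinite_integral_test_function:
  assumes "continuous_on UNIV \<theta>" "a < r" "s < b" "a < b" "\<And>x. x \<notin> {r..s} \<Longrightarrow> \<theta> x = 0"
    and "integral {a..b} \<theta> = (0::real)"
  shows "test_function a b (\<lambda>x. integral {a..x} \<theta>)" "deriv (\<lambda>x. integral {a..x} \<theta>) = \<theta>"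
proof -
  have ii: "\<theta> integrable_on {x..y}" for x y
    using assms(1) by (intro integrable_continuous_real) (auto intro: continuous_on_subset)
  have zl: "integral {a..x} \<theta> = 0" if "x < r" for x
    by (rule integral_eq_zero) (use that assms in auto)
  have zr: "integral {a..x} \<theta> = 0" if "x > s" for x
  proof -
    have 1: "integral {x..b} \<theta> = 0" "integral {b..x} \<theta> = 0"
      by (rule integral_eq_zero, use that assms in auto)+
    show ?thesis
    proof (cases "x < r")
      case False
      show ?thesis
      proof (cases "x \<le> b")
        case True
        then show ?thesis
          using Henstock_Kurzweil_Integration.integral_combine[of a x b \<theta>] ii 1 assms False by simp
      next
        case False
        then show ?thesis
          using Henstock_Kurzweil_Integration.integral_combine[of a b x \<theta>] ii 1 assms by simp
      qed
    qed (use zl in auto)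
  qed
  have D: "((\<lambda>x. integral {a..x} \<theta>) has_real_derivative \<theta> x) (at x)" for x
  proof (cases "x < r")
    case True
    have "((\<lambda>x. 0) has_real_derivative \<theta> x) (at x)" using True assms(5)[of x] by simp
    then show ?thesis
      by (rule has_field_derivative_transform_within_open[of _ _ _ "{..<r}"]) (use True zl in auto)
  next
    case False
    have "((\<lambda>x. integral {a..x} \<theta>) has_real_derivative \<theta> x) (at x within {a..x+1})"
      by (rule integral_has_real_derivative) (use False assms in \<open>auto intro: continuous_on_subset\<close>)
    then show ?thesis using False assms by (simp add: at_within_Icc_at)
  qed
  show "deriv (\<lambda>x. integral {a..x} \<theta>) = \<theta>" using D by (auto intro: DERIV_imp_deriv)
  show "test_function a b (\<lambda>x. integral {a..x} \<theta>)"
    unfolding test_function_def C1_differentiable_on_def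
  proof (rule conjI)
    show "\<exists>D. (\<forall>x\<in>UNIV. ((\<lambda>x. integral {a..x} \<theta>) has_vector_derivative D x) (at x)) \<and> continuous_on UNIV D"
      using D assms(1) by (auto simp: has_real_derivative_iff_has_vector_derivative)
    have "integral {a..x} \<theta> = 0" if "x \<notin> {r..s}" for x
      using zl[of x] zr[of x] that by force
    then show "\<exists>r s. a < r \<and> s < b \<and> (\<forall>x. x \<notin> {r..s} \<longrightarrow> integral {a..x} \<theta> = 0)"
      using assms by blast
  qed
qed

lemma weak_derivative_imp_wderiv_on:
  assumes v: "Ltwo a b v" and w: "weak_derivative a b v g" and ab: "a < b"
  shows "wderiv_on a b v g"
proof -
  have g: "Ltwo a b g" using w by (simp add: weak_derivative_def square_integrable_iff_Ltwo)
  define G where "G x = 0 + integral {a..x} g" for x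
  have AG: "AC a b G g" unfolding G_def by (rule AC_indef[OF Ltwo_absint[OF g]])
  have wG: "weak_derivative a b G g" by (rule AC_imp_weak_derivative[OF AG g ab])
  define k where "k x = v x - G x" for x
  have LG: "Ltwo a b G" by (intro Ltwo_cont AC_cont[OF AG])
  have k: "Ltwo a b k" unfolding k_def by (intro Ltwo_diff v LG)
  \<comment> \<open>du Bois-Reymond: \<open>k\<close> annihilates the derivatives of all test functions, hence is constant\<close>
  have kt: "integral {a..b} (\<lambda>x. k x * \<theta> x) = 0"
    if "continuous_on UNIV \<theta>" "a < r" "s < b" "\<And>x. x \<notin> {r..s} \<Longrightarrow> \<theta> x = 0"
      "integral {a..b} \<theta> = 0" for \<theta> r s
  proof -
    note t = indefinite_integral_test_function[OF that(1,2,3) ab that(4,5)]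
    have L: "Ltwo a b \<theta>" using that(1) by (intro Ltwo_cont) (auto intro: continuous_on_subset)
    have "L2_inner a b v \<theta> = L2_inner a b G \<theta>"
      using w wG t unfolding weak_derivative_def by metis
    then have "integral {a..b} (\<lambda>x. v x * \<theta> x) = integral {a..b} (\<lambda>x. G x * \<theta> x)"
      by (simp add: L2_inner_eq_integral v LG L)
    then show ?thesis unfolding k_def left_diff_distrib
      by (subst integral_diff) (auto intro: Ltwo_mult_int v LG L)
  qed
  define p q where "p = (2*a+b)/3" and "q = (a+2*b)/3"
  have pq: "a < p" "p < q" "q < b" using ab by (auto simp: p_def q_def)
  \<comment> \<open>A fixed bump with nonzero integral: subtracting a multiple of it makes any
    admissible function have mean value zero. The constant \<open>c\<close> below is the mean of
    \<open>k\<close> weighted by this bump.\<close>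
  define \<theta>0 where "\<theta>0 t = max 0 ((t - p) * (q - t))" for t
  have c0: "continuous_on A \<theta>0" for A unfolding \<theta>0_def by (intro continuous_intros)
  have s0: "\<theta>0 x = 0" if "x \<notin> {p..q}" for x
  proof -
    have "(x - p) * (q - x) \<le> 0" using that pq by (auto simp: mult_le_0_iff)
    then show ?thesis by (simp add: \<theta>0_def)
  qed
  define I0 where "I0 = integral {a..b} \<theta>0"
  have I0: "I0 \<noteq> 0"
  proof
    assume "I0 = 0"
    moreover have "\<theta>0 x \<ge> 0" for x by (simp add: \<theta>0_def)
    ultimately have "\<theta>0 ((p+q)/2) = 0"
      using integral_eq_0_iff[OF c0 ab] pq unfolding I0_def by fastforce
    moreover have "((p+q)/2 - p) * (q - (p+q)/2) > 0" using pq by (intro mult_pos_pos) auto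
    ultimately show False by (simp add: \<theta>0_def)
  qed
  define c where "c = integral {a..b} (\<lambda>x. k x * \<theta>0 x) / I0"
  have kc: "integral {a..b} (\<lambda>x. (k x - c) * \<theta> x) = 0"
    if "continuous_on UNIV \<theta>" "a < r" "s < b" "\<And>x. x \<notin> {r..s} \<Longrightarrow> \<theta> x = 0" for \<theta> r s
  proof -
    define J where "J = integral {a..b} \<theta>"
    define R where "R = J / I0"
    have c1: "continuous_on {a..b} \<theta>" using that(1) continuous_on_subset by blast
    have L: "Ltwo a b \<theta>" "Ltwo a b \<theta>0" by (auto intro: Ltwo_cont c1 c0)
    note ii = integrable_continuous_real[OF c1] integrable_continuous_real[OF c0[of "{a..b}"]]
      Ltwo_mult_int[OF k L(1)] Ltwo_mult_int[OF k L(2)]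
    have "integral {a..b} (\<lambda>x. k x * (\<theta> x - R * \<theta>0 x)) = 0"
    proof (rule kt[of _ "min r p" "max s q"])
      show "continuous_on UNIV (\<lambda>x. \<theta> x - R * \<theta>0 x)" by (intro continuous_intros that c0)
      show "\<theta> x - R * \<theta>0 x = 0" if "x \<notin> {min r p..max s q}" for x
      proof -
        have "x \<notin> {r..s}" "x \<notin> {p..q}" using that by auto
        then show ?thesis using \<open>\<And>x. x \<notin> {r..s} \<Longrightarrow> \<theta> x = 0\<close>[of x] s0[of x] by simp
      qed
      show "integral {a..b} (\<lambda>x. \<theta> x - R * \<theta>0 x) = 0"
        using ii I0 by (subst integral_diff) (auto simp: R_def J_def[symmetric] I0_def[symmetric] intro: integrable_on_mult_right)
    qed (use that pq in auto)
    moreover have "(\<lambda>x. k x * (\<theta> x - R * \<theta>0 x)) = (\<lambda>x. k x * \<theta> x - R * (k x * \<theta>0 x))"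
      by (auto simp: algebra_simps)
    ultimately have "integral {a..b} (\<lambda>x. k x * \<theta> x) = R * integral {a..b} (\<lambda>x. k x * \<theta>0 x)"
      using ii by (simp add: integral_diff integrable_on_mult_right)
    then have "integral {a..b} (\<lambda>x. k x * \<theta> x) - c * J = 0"
      using I0 by (simp add: c_def R_def)
    then show ?thesis unfolding left_diff_distrib using ii
      by (simp add: integral_diff integrable_on_mult_right J_def)
  qed
  have Lk: "Ltwo a b (\<lambda>x. k x - c)" by (intro Ltwo_diff k Ltwo_cont continuous_intros)
  have zero: "integral {a..x} (\<lambda>x. k x - c) = 0" if x: "a \<le> x" "x \<le> b" for x
  proof -
    \<comment> \<open>Continuous trapezoids converging to the indicator of the open interval from
      \<open>a\<close> to \<open>x\<close>. They vanish within distance 1/(n+1) of both ends, so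
      that \<open>kc\<close> applies to each of them and dominated convergence gives the
      limit.\<close>
    define \<theta> where "\<theta> n t = max 0 (min 1 (min (real (Suc n) * (t - a) - 1) (real (Suc n) * (x - t) - 1)))" for n t
    have z: "integral {a..b} (\<lambda>t. (k t - c) * \<theta> n t) = 0" for n
    proof (rule kc[of _ "a + 1 / real (Suc n)" "x - 1 / real (Suc n)"])
      show "continuous_on UNIV (\<theta> n)" unfolding \<theta>_def by (intro continuous_intros)
      show "\<theta> n t = 0" if "t \<notin> {a + 1 / real (Suc n)..x - 1 / real (Suc n)}" for t
      proof -
        have "real (Suc n) * (t - a) - 1 \<le> 0 \<or> real (Suc n) * (x - t) - 1 \<le> 0"
          using that by (auto simp: field_simps)
        then show ?thesis by (auto simp: \<theta>_def)
      qed
      show "x - 1 / real (Suc n) < b" using x by (smt (verit) of_nat_0_less_iff zero_less_Suc zero_less_divide_1_iff)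
    qed simp
    have lim: "(\<lambda>n. integral {a..b} (\<lambda>t. (k t - c) * \<theta> n t)) \<longlonglongrightarrow>
       integral {a..b} (\<lambda>t. (k t - c) * indicator {a<..<x} t)"
    proof (rule dominated_convergence(2))
      show "(\<lambda>t. (k t - c) * \<theta> n t) integrable_on {a..b}" for n
        by (intro Ltwo_mult_int Lk Ltwo_cont) (auto simp: \<theta>_def intro!: continuous_intros)
      show "(\<lambda>t. \<bar>k t - c\<bar>) integrable_on {a..b}"
        using Ltwo_absint[OF Lk] by (simp add: absolutely_integrable_on_def)
      show "norm ((k t - c) * \<theta> n t) \<le> \<bar>k t - c\<bar>" for n t
        by (auto simp: \<theta>_def abs_mult intro!: mult_left_le)
      fix t assume "t \<in> {a..b}"
      have "(\<lambda>n. \<theta> n t) \<longlonglongrightarrow> indicator {a<..<x} t"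
      proof (cases "a < t \<and> t < x")
        case True
        obtain N :: nat where N: "real N > 2 / (t - a)" "real N > 2 / (x - t)"
          using reals_Archimedean2[of "max (2 / (t - a)) (2 / (x - t))"] by auto
        have "\<theta> n t = 1" if "n \<ge> N" for n
        proof -
          have "2 / (t - a) < real (Suc n)" "2 / (x - t) < real (Suc n)" using N that by auto
          then have "2 < real (Suc n) * (t - a)" "2 < real (Suc n) * (x - t)"
            using True by (simp_all only: pos_divide_less_eq diff_gt_0_iff_gt)
          then show ?thesis by (simp add: \<theta>_def)
        qed
        then show ?thesis using True
          by (intro tendsto_eventually eventually_sequentiallyI[of N]) auto
      next
        case False
        have "\<theta> n t = 0" for n
        proof -
          have "real (Suc n) * (t - a) \<le> 0 \<or> real (Suc n) * (x - t) \<le> 0"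
            using False by (auto simp: mult_le_0_iff)
          then show ?thesis unfolding \<theta>_def by linarith
        qed
        then show ?thesis using False by simp
      qed
      then show "(\<lambda>n. (k t - c) * \<theta> n t) \<longlonglongrightarrow> (k t - c) * indicator {a<..<x} t"
        by (intro tendsto_intros)
    qed
    have "integral {a..b} (\<lambda>t. (k t - c) * indicator {a<..<x} t) = 0"
      using LIMSEQ_unique[OF lim] by (simp add: z)
    moreover have "integral {a..b} (\<lambda>t. (k t - c) * indicator {a<..<x} t)
        = integral {a..b} (\<lambda>t. if t \<in> {a<..<x} then k t - c else 0)"
      by (rule Henstock_Kurzweil_Integration.integral_cong) auto
    moreover have "\<dots> = integral ({a..b} \<inter> {a<..<x}) (\<lambda>t. k t - c)"
      by (subst Int_commute) (rule integral_restrict_Int)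
    moreover have "{a..b} \<inter> {a<..<x} = {a<..<x}" using x by auto
    ultimately show ?thesis by (simp add: integral_open_interval_real)
  qed
  have "negligible {x\<in>{a..b}. k x - c \<noteq> 0}"
    by (rule integral_zero_imp_negligible[OF Ltwo_absint[OF Lk] zero])
  then have "negligible {x\<in>{a..b}. v x \<noteq> c + integral {a..x} g}"
    by (rule negligible_subset) (auto simp: k_def G_def)
  with g show ?thesis by (auto simp: wderiv_on_def)
qed

lemma H1_AC:
  assumes "v \<in> H1 a b" "a < b"
  shows "AC a b v (wderiv a b v)" "Ltwo a b (wderiv a b v)"
proof -
  have c: "continuous_on {a..b} v" and "\<exists>g. weak_derivative a b v g"
    using assms by (auto simp: H1_def sobolev_def)
  then have w: "weak_derivative a b v (wderiv a b v)" unfolding wderiv_def by (metis someI_ex)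
  have "wderiv_on a b v (wderiv a b v)" by (rule weak_derivative_imp_wderiv_on[OF Ltwo_cont[OF c] w assms(2)])
  then show "AC a b v (wderiv a b v)" "Ltwo a b (wderiv a b v)"
    by (auto intro: wderiv_on_imp_AC[OF _ c assms(2)] wderiv_on_Ltwo)
qed

lemma AC_H1:
  assumes "AC a b v g" "Ltwo a b g" "a < b"
  shows "v \<in> H1 a b" "negligible {x\<in>{a..b}. wderiv a b v x \<noteq> g x}"
proof -
  show h: "v \<in> H1 a b"
    using AC_cont[OF assms(1)] AC_imp_weak_derivative[OF assms]
    by (auto simp: H1_def sobolev_def square_integrable_iff_Ltwo Ltwo_cont)
  show "negligible {x\<in>{a..b}. wderiv a b v x \<noteq> g x}"
    by (rule AC_unique_deriv[OF H1_AC(1)[OF h assms(3)] assms(1)]) simp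
qed

text \<open>Every iterate of \<open>wderiv\<close> is a choice. Existence of a weak derivative at
  each order below \<open>n\<close> makes these choices genuine, so that they link up to a chain of
  primitives.\<close>

lemma sobolev_wderiv_on:
  assumes "v \<in> sobolev n a b" "k < n" "a < b"
  shows "wderiv_on a b ((wderiv a b ^^ k) v) ((wderiv a b ^^ Suc k) v)"
proof -
  have w: "weak_derivative a b ((wderiv a b ^^ j) v) ((wderiv a b ^^ Suc j) v)" if "j < n" for j
    using assms that by (simp add: sobolev_def) (metis someI_ex wderiv_def)
  have "Ltwo a b ((wderiv a b ^^ k) v)"
  proof (cases k)
    case 0
    then show ?thesis using assms by (simp add: sobolev_def square_integrable_iff_Ltwo)
  next
    case (Suc j)
    then show ?thesis using w[of j] assms by (simp add: weak_derivative_def square_integrable_iff_Ltwo)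
  qed
  then show ?thesis by (rule weak_derivative_imp_wderiv_on) (use w assms in auto)
qed

text \<open>The layer components are differentiable on open intervals only and have arbitrary values
  at the ends. A bounded derivative makes \<open>v\<close> Lipschitz, hence it extends continuously
  to the closed interval, and changing it at two points does not affect
  \<open>wderiv_on\<close>.\<close>

lemma wderiv_on_of_deriv:
  assumes ab: "a < b" and d: "\<And>x. x \<in> {a<..<b} \<Longrightarrow> (v has_real_derivative g x) (at x)"
    and M: "\<And>x. x \<in> {a<..<b} \<Longrightarrow> \<bar>g x\<bar> \<le> M"
  shows "wderiv_on a b v g"
proof -
  have "M \<ge> 0" using M[of "(a+b)/2"] ab by (simp add: field_simps)
  have "M-lipschitz_on {a<..<b} v"
  proof (rule lipschitz_onI)
    fix x y assume "x \<in> {a<..<b}" "y \<in> {a<..<b}"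
    then have "norm (v x - v y) \<le> M * norm (x - y)"
      by (intro field_differentiable_bound[of "{a<..<b}" v g])
        (auto intro!: has_field_derivative_at_within d M)
    then show "dist (v x) (v y) \<le> M * dist x y" by (simp add: dist_norm)
  qed fact
  then have "uniformly_continuous_on {a<..<b} v" by (rule lipschitz_on_uniformly_continuous)
  then obtain w where w: "uniformly_continuous_on (closure {a<..<b}) w" "\<And>x. x \<in> {a<..<b} \<Longrightarrow> v x = w x"
    using uniformly_continuous_on_extension_on_closure by metis
  have c: "continuous_on {a..b} w"
    using uniformly_continuous_imp_continuous[OF w(1)] ab by simp
  have dw: "(w has_real_derivative g x) (at x)" if "x \<in> {a<..<b} - {}" for x
    by (rule has_field_derivative_transform_within_open[OF d[of x], of "{a<..<b}"]) (use that w in auto)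
  \<comment> \<open>At the two end points nothing is known about \<open>g\<close>; its values there
    enter the bound explicitly.\<close>
  have bd: "\<bar>g x\<bar> \<le> max M (max \<bar>g a\<bar> \<bar>g b\<bar>)" if "x \<in> {a..b}" for x
    using M[of x] that by (cases "x = a \<or> x = b") (auto simp: le_max_iff_disj)
  note AC = AC_of_deriv[OF less_imp_le[OF ab] c finite.emptyI dw bd]
  show ?thesis
    by (rule wderiv_on_spike_fun[OF AC_imp_wderiv_on[OF AC], of "{a,b}"]) (use w in auto)
qed

lemma cont_poly: "continuous_on S (poly (p::real poly))"
  by (intro continuous_intros)

lemma Ltwo_poly: "Ltwo a b (poly p)"
  by (rule Ltwo_cont[OF cont_poly])

lemma AC_poly: "a \<le> b \<Longrightarrow> AC a b (poly p) (poly (pderiv p))"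
  by (rule AC_C1) (auto intro: cont_poly has_field_derivative_at_within poly_DERIV)

section \<open>Projection onto polynomials and interpolation\<close>

text \<open>For \<open>n = 0\<close> this is \<open>p = 0\<close>, which \<open>degree p < n\<close> and \<open>degree p \<le> n - 1\<close> both miss.\<close>

abbreviation degree_less :: "nat \<Rightarrow> real poly \<Rightarrow> bool" where
  "degree_less n p \<equiv> \<forall>i\<ge>n. coeff p i = 0"

lemma degree_less_iff: "n > 0 \<Longrightarrow> degree_less n p \<longleftrightarrow> degree p < n"
  by (metis coeff_eq_0 degree_0 leading_coeff_0_iff linorder_not_le order_less_le_trans)

lemma degree_less_0: "degree_less 0 p \<longleftrightarrow> p = 0"
  by (auto simp: poly_eq_iff)

text \<open>Moment problems \<open>I (s * \<xi>) = L \<xi>\<close> are solved degree by degree: the weight \<open>1\<close> gives the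
  $L^2$-projection, the weight $(x-a)(b-x)$ the interpolant on a cell.\<close>

locale positive_functional =
  fixes I :: "real poly \<Rightarrow> real"
  assumes add: "I (p + q) = I p + I q"
    and smult: "I (smult c p) = c * I p"
    and pos: "p \<noteq> 0 \<Longrightarrow> I (p * p) > 0"
begin

lemma zero: "I 0 = 0" using smult[of 0 0] by simp

lemma diff: "I (p - q) = I p - I q"
proof -
  have "p - q = p + smult (-1) q" by simp
  then have "I (p - q) = I p + -1 * I q" by (simp only: add smult)
  then show ?thesis by simp
qed

text \<open>Gram-Schmidt: the monic orthogonal polynomial is the monomial minus its projection onto
  lower degrees. Solvability of the moment problem of order \<open>n\<close> is a premise because
  the lemma is called within the induction that proves it.\<close>

lemma orthogonal_of_solution:
  assumes "\<And>L. (\<And>p q. L (p + q) = L p + L q) \<Longrightarrow> (\<And>c p. L (smult c p) = c * L p) \<Longrightarrow>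
     \<exists>s. degree_less n s \<and> (\<forall>\<xi>. degree_less n \<xi> \<longrightarrow> I (s * \<xi>) = L \<xi>)"
  shows "\<exists>\<pi>. degree_less (Suc n) \<pi> \<and> coeff \<pi> n = 1 \<and> (\<forall>\<xi>. degree_less n \<xi> \<longrightarrow> I (\<pi> * \<xi>) = 0)"
proof -
  obtain t where t: "degree_less n t" "\<And>\<xi>. degree_less n \<xi> \<Longrightarrow> I (t * \<xi>) = I (monom 1 n * \<xi>)"
    using assms[of "\<lambda>\<xi>. I (monom 1 n * \<xi>)"] by (auto simp: add smult distrib_left)
  show ?thesis
  proof (intro exI[of _ "monom 1 n - t"] conjI allI impI)
    fix \<xi> assume "degree_less n \<xi>"
    then show "I ((monom 1 n - t) * \<xi>) = 0" using t(2) by (simp add: left_diff_distrib diff)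
  qed (use t in \<open>auto simp: coeff_monom\<close>)
qed

lemma solution:
  assumes "\<And>p q. L (p + q) = L p + L q" "\<And>c p. L (smult c p) = c * L p"
  shows "\<exists>s. degree_less n s \<and> (\<forall>\<xi>. degree_less n \<xi> \<longrightarrow> I (s * \<xi>) = L \<xi>)"
  using assms
proof (induction n arbitrary: L)
  case 0
  have "L 0 = 0" using 0(2)[of 0 0] by simp
  then have "I (0 * \<xi>) = L \<xi>" if "degree_less 0 \<xi>" for \<xi>
    using that zero unfolding degree_less_0 by simp
  then show ?case by (intro exI[of _ 0]) simp
next
  case (Suc n)
  obtain \<pi> where \<pi>: "degree_less (Suc n) \<pi>" "coeff \<pi> n = 1"
    "\<And>\<xi>. degree_less n \<xi> \<Longrightarrow> I (\<pi> * \<xi>) = 0"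
    using orthogonal_of_solution[OF Suc.IH] by blast
  have k: "I (\<pi> * \<pi>) > 0" using pos[of \<pi>] \<pi>(2) by force
  obtain s where s: "degree_less n s" "\<And>\<xi>. degree_less n \<xi> \<Longrightarrow> I (s * \<xi>) = L \<xi>"
    using Suc.IH[OF Suc.prems] by blast
  \<comment> \<open>The coefficient of \<open>\<pi>\<close> is fixed by the one remaining moment;
    the moments against lower degrees are not disturbed, as \<open>\<pi>\<close> is orthogonal to
    them.\<close>
  define \<alpha> where "\<alpha> = L \<pi> / I (\<pi> * \<pi>)"
  show ?case
  proof (intro exI[of _ "s + smult \<alpha> \<pi>"] conjI allI impI)
    fix i assume "Suc n \<le> i" then show "coeff (s + smult \<alpha> \<pi>) i = 0" using s(1) \<pi>(1) by simp
  next
    fix \<xi> :: "real poly" assume \<xi>: "degree_less (Suc n) \<xi>"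
    define c where "c = coeff \<xi> n"
    define \<xi>' where "\<xi>' = \<xi> - smult c \<pi>"
    have d: "degree_less n \<xi>'"
    proof (intro allI impI)
      fix i assume "n \<le> i"
      then consider "i = n" | "Suc n \<le> i" by linarith
      then show "coeff \<xi>' i = 0" using \<xi> \<pi>(1,2) by cases (auto simp: \<xi>'_def c_def)
    qed
    have e: "\<xi> = \<xi>' + smult c \<pi>" by (simp add: \<xi>'_def)
    have "I (s * \<pi>) = 0" using \<pi>(3)[OF s(1)] by (simp add: mult.commute)
    then have "I ((s + smult \<alpha> \<pi>) * \<xi>) = L \<xi>' + \<alpha> * c * I (\<pi> * \<pi>)"
      unfolding e using \<pi>(3)[OF d] s(2)[OF d]
      by (simp add: distrib_left distrib_right add smult)
    also have "\<dots> = L \<xi>' + c * L \<pi>" using k by (simp add: \<alpha>_def)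
    also have "\<dots> = L \<xi>" by (simp add: e Suc.prems)
    finally show "I ((s + smult \<alpha> \<pi>) * \<xi>) = L \<xi>" .
  qed
qed

lemma orthogonal: "\<exists>\<pi>. degree_less (Suc n) \<pi> \<and> coeff \<pi> n = 1 \<and> (\<forall>\<xi>. degree_less n \<xi> \<longrightarrow> I (\<pi> * \<xi>) = 0)"
  by (rule orthogonal_of_solution) (rule solution)

text \<open>Equivalence of norms on a finite-dimensional space, by induction on the degree instead
  of compactness: after splitting off the orthogonal polynomial \<open>\<pi>\<close>,
  \<open>I (p * p)\<close> is a Pythagorean sum, and the coefficient of \<open>\<pi>\<close> is
  controlled by its second term.\<close>

lemma point_bound:
  "\<exists>C. \<forall>p x. degree_less n p \<longrightarrow> x \<in> {0..1} \<longrightarrow> (poly p x)\<^sup>2 \<le> C * I (p * p)"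
proof (induction n)
  case 0
  have "(poly p x)\<^sup>2 \<le> 0 * I (p * p)" if "degree_less 0 p" for p x
    using that unfolding degree_less_0 by simp
  then show ?case by blast
next
  case (Suc n)
  obtain C where C: "\<And>p x. degree_less n p \<Longrightarrow> x \<in> {0..1} \<Longrightarrow> (poly p x)\<^sup>2 \<le> C * I (p * p)"
    using Suc by blast
  obtain \<pi> where \<pi>: "degree_less (Suc n) \<pi>" "coeff \<pi> n = 1"
    "\<And>\<xi>. degree_less n \<xi> \<Longrightarrow> I (\<pi> * \<xi>) = 0"
    using orthogonal by blast
  have k: "I (\<pi> * \<pi>) > 0" using pos[of \<pi>] \<pi>(2) by force
  have "bounded (poly \<pi> ` {0..1})"
    by (intro compact_imp_bounded compact_continuous_image cont_poly) auto
  then obtain M where M: "\<And>x. x \<in> {0..1} \<Longrightarrow> \<bar>poly \<pi> x\<bar> \<le> M"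
    unfolding bounded_iff by (metis image_eqI real_norm_def)
  define D where "D = max (2 * C) (2 * M\<^sup>2 / I (\<pi> * \<pi>))"
  show ?case
  proof (intro exI[of _ D] allI impI)
    fix p :: "real poly" and x :: real assume p: "degree_less (Suc n) p" and x: "x \<in> {0..1}"
    define c where "c = coeff p n"
    define r where "r = p - smult c \<pi>"
    have d: "degree_less n r"
    proof (intro allI impI)
      fix i assume "n \<le> i"
      then consider "i = n" | "Suc n \<le> i" by linarith
      then show "coeff r i = 0" using p \<pi>(1,2) by cases (auto simp: r_def c_def)
    qed
    have e: "p = r + smult c \<pi>" by (simp add: r_def)
    have "I (r * \<pi>) = 0" using \<pi>(3)[OF d] by (simp add: mult.commute)
    then have Ip: "I (p * p) = I (r * r) + c\<^sup>2 * I (\<pi> * \<pi>)"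
      unfolding e using \<pi>(3)[OF d] by (simp add: distrib_left distrib_right add smult power2_eq_square)
    have r0: "I (r * r) \<ge> 0" using pos[of r] zero by (cases "r = 0") auto
    have "(poly \<pi> x)\<^sup>2 \<le> M\<^sup>2" using M[OF x] by (simp add: abs_le_square_iff[symmetric])
    then have "c\<^sup>2 * (poly \<pi> x)\<^sup>2 \<le> c\<^sup>2 * M\<^sup>2" by (intro mult_left_mono) auto
    moreover have "(poly p x)\<^sup>2 \<le> 2 * (poly r x)\<^sup>2 + 2 * (c * poly \<pi> x)\<^sup>2"
    proof -
      have "0 \<le> (poly r x - c * poly \<pi> x)\<^sup>2" by simp
      then show ?thesis unfolding e by (simp add: power2_eq_square algebra_simps)
    qed
    ultimately have "(poly p x)\<^sup>2 \<le> 2 * (C * I (r * r)) + 2 * (c\<^sup>2 * M\<^sup>2)"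
      using C[OF d x] unfolding power_mult_distrib by linarith
    also have "\<dots> = 2 * C * I (r * r) + (2 * M\<^sup>2 / I (\<pi> * \<pi>)) * (c\<^sup>2 * I (\<pi> * \<pi>))"
      using k by simp
    also have "\<dots> \<le> D * I (r * r) + D * (c\<^sup>2 * I (\<pi> * \<pi>))"
      using r0 k by (intro add_mono mult_right_mono) (auto simp: D_def)
    finally show "(poly p x)\<^sup>2 \<le> D * I (p * p)" unfolding Ip by (simp add: algebra_simps)
  qed
qed

end

section \<open>Polynomial approximation and projection on one cell\<close>

lemma poly_eq_0_of_interval:
  assumes "a < (b::real)" "\<And>x. a < x \<Longrightarrow> x < b \<Longrightarrow> poly p x = 0" shows "p = (0::real poly)"
proof (rule ccontr)
  assume "p \<noteq> 0"
  then have "finite {x. poly p x = 0}" by (rule poly_roots_finite)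
  moreover have "{a<..<b} \<subseteq> {x. poly p x = 0}" using assms by auto
  ultimately show False using infinite_Ioo[OF \<open>a < b\<close>] finite_subset by blast
qed

text \<open>Positivity is asked for in the interior only, because the weight (x-a)(b-x) of the
  interpolation problem vanishes at the ends. A polynomial that is zero on an open interval is the
  zero polynomial.\<close>

lemma weighted_positive_functional:
  assumes ab: "a < b" and c: "continuous_on {a..b} \<omega>" and p: "\<And>x. a < x \<Longrightarrow> x < b \<Longrightarrow> \<omega> x > 0"
    and nn: "\<And>x. x \<in> {a..b} \<Longrightarrow> \<omega> x \<ge> 0"
  shows "positive_functional (\<lambda>p. integral {a..b} (\<lambda>x. \<omega> x * poly p x))"
proof
  have ii: "(\<lambda>x. \<omega> x * poly p x) integrable_on {a..b}" for p
    by (intro integrable_continuous_real continuous_intros c cont_poly)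
  show "integral {a..b} (\<lambda>x. \<omega> x * poly (p + q) x) = integral {a..b} (\<lambda>x. \<omega> x * poly p x) +
      integral {a..b} (\<lambda>x. \<omega> x * poly q x)" for p q
    by (simp add: distrib_left integral_add ii)
  show "integral {a..b} (\<lambda>x. \<omega> x * poly (smult c p) x) = c * integral {a..b} (\<lambda>x. \<omega> x * poly p x)" for c p
    by (simp add: mult.left_commute flip: integral_mult_right)
  fix p :: "real poly" assume "p \<noteq> 0"
  have "integral {a..b} (\<lambda>x. \<omega> x * poly (p * p) x) \<ge> 0"
    by (intro integral_nonneg ii) (simp add: nn)
  moreover have "integral {a..b} (\<lambda>x. \<omega> x * poly (p * p) x) \<noteq> 0"
  proof
    assume "integral {a..b} (\<lambda>x. \<omega> x * poly (p * p) x) = 0"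
    moreover have "continuous_on {a..b} (\<lambda>x. \<omega> x * poly (p * p) x)"
      by (intro continuous_intros c cont_poly)
    ultimately have z: "\<omega> x * poly (p * p) x = 0" if "x \<in> {a..b}" for x
      using integral_eq_0_iff[of a b "\<lambda>x. \<omega> x * poly (p * p) x"] ab nn that by auto
    have "poly p x = 0" if "a < x" "x < b" for x
      using z[of x] p[OF that] that by auto
    then show False using poly_eq_0_of_interval[OF ab] \<open>p \<noteq> 0\<close> by blast
  qed
  ultimately show "0 < integral {a..b} (\<lambda>x. \<omega> x * poly (p * p) x)" by simp
qed

text \<open>An inverse estimate by scaling: an affine map carries the cell to the unit interval, and
  the change of variables produces the factor 1/(b-a). One constant therefore serves all
  cells.\<close>

lemma poly_point_bound:
  "\<exists>C. \<forall>p a b x. degree_less n p \<longrightarrow> a < b \<longrightarrow> x \<in> {a..b} \<longrightarrow>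
     (poly p x)\<^sup>2 \<le> C / (b - a) * sqint a b (poly p)"
proof -
  interpret positive_functional "\<lambda>p. integral {0..1} (\<lambda>x. 1 * poly p x)"
    by (rule weighted_positive_functional) auto
  obtain C where C: "\<And>p x. degree_less n p \<Longrightarrow> x \<in> {0..1} \<Longrightarrow> (poly p x)\<^sup>2 \<le> C * sqint 0 1 (poly p)"
    using point_bound[of n] by (auto simp: power2_eq_square)
  show ?thesis
  proof (intro exI[of _ C] allI impI)
    fix p :: "real poly" and a b x :: real assume p: "degree_less n p" and ab: "a < b" and x: "x \<in> {a..b}"
    define P where "P = pcompose p [:a, b - a:]"
    have P: "poly P t = poly p ((b - a) * t + a)" for t by (simp add: P_def poly_pcompose algebra_simps)
    have dP: "degree_less n P"
    proof (cases "n = 0")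
      case True
      then have "p = 0" using p degree_less_0 by blast
      then show ?thesis by (simp add: P_def)
    next
      case False
      then have "degree p < n" using p by (simp add: degree_less_iff del: coeff_eq_0)
      moreover have "degree P = degree p" using ab by (simp add: P_def degree_pcompose)
      ultimately have "degree P < n" by simp
      then show ?thesis using False by (simp add: degree_less_iff del: coeff_eq_0)
    qed
    define t where "t = (x - a) / (b - a)"
    have t: "t \<in> {0..1}" using x ab by (auto simp: t_def field_simps)
    have "(poly p x)\<^sup>2 = (poly P t)\<^sup>2" using ab by (simp add: P t_def)
    also have "\<dots> \<le> C * sqint 0 1 (poly P)" by (rule C[OF dP t])
    also have "sqint 0 1 (poly P) = sqint a b (poly p) / (b - a)"
    proof -
      have "((\<lambda>x. (poly p x)\<^sup>2) has_integral sqint a b (poly p)) (cbox a b)"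
        using Ltwo_sq_int[OF Ltwo_poly[of a b p]] by (auto intro: integrable_integral)
      from has_integral_affinity'[OF this, of "b - a" a] ab
      have "((\<lambda>x. (poly p ((b - a) * x + a))\<^sup>2) has_integral sqint a b (poly p) / (b - a)) {0..1}"
        by (simp add: divide_inverse mult.commute)
      then show ?thesis by (simp add: P integral_unique)
    qed
    finally show "(poly p x)\<^sup>2 \<le> C / (b - a) * sqint a b (poly p)" by simp
  qed
qed

text \<open>Cauchy-Schwarz against the constant 1 bounds \<open>F\<close> pointwise, and integration
  yields the second power of the width. The constant is not the optimal one; only the power of the
  width matters.\<close>

lemma AC_Poincare:
  assumes A: "AC a b F f" and L: "Ltwo a b f" and "F a = 0" and "a \<le> b"
  shows "sqint a b F \<le> (b - a)\<^sup>2 * sqint a b f"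
proof -
  let ?Q = "sqint a b f"
  have Q: "?Q \<ge> 0" by (intro integral_nonneg Ltwo_sq_int L) auto
  have "(F x)\<^sup>2 \<le> (b - a) * ?Q" if x: "x \<in> {a..b}" for x
  proof -
    have L': "Ltwo a x f" using x by (intro Ltwo_subinterval[OF L]) auto
    have "F x = integral {a..x} (\<lambda>x. 1 * f x)" using AC_diff_eq[OF A, of a x] x assms by simp
    then have "(F x)\<^sup>2 \<le> integral {a..x} (\<lambda>x. 1\<^sup>2) * sqint a x f"
      using Ltwo_Cauchy_Schwarz[OF _ L', of "\<lambda>x. 1"] by (simp add: Ltwo_cont)
    also have "\<dots> \<le> (b - a) * ?Q"
    proof (rule mult_mono)
      show "sqint a x f \<le> ?Q"
        using x by (intro integral_subset_le Ltwo_sq_int L L') auto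
      show "0 \<le> sqint a x f" by (intro integral_nonneg Ltwo_sq_int L') auto
    qed (use x in auto)
    finally show ?thesis .
  qed
  then have "sqint a b F \<le> integral {a..b} (\<lambda>x. (b - a) * ?Q)"
    by (intro integral_le Ltwo_sq_int Ltwo_cont AC_cont[OF A]) auto
  then show ?thesis using assms by (simp add: power2_eq_square algebra_simps)
qed

lemma poly_antiderivative:
  assumes "degree_less n p"
  shows "\<exists>P. degree_less (Suc n) P \<and> pderiv P = p \<and> poly P a = c"
proof -
  define P where "P = (\<Sum>i<n. monom (coeff p i / real (Suc i)) (Suc i))"
  have cP: "coeff P j = (if j = 0 \<or> j > n then 0 else coeff p (j - 1) / real j)" for j
  proof -
    have "coeff P j = (\<Sum>i<n. if Suc i = j then coeff p i / real (Suc i) else 0)"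
      by (simp add: P_def coeff_sum coeff_monom del: of_nat_Suc)
    also have "\<dots> = (\<Sum>i<n. if i = j - 1 \<and> j \<noteq> 0 then coeff p i / real (Suc i) else 0)"
      by (intro sum.cong) auto
    also have "\<dots> = (if j = 0 \<or> j > n then 0 else coeff p (j - 1) / real j)"
      by (cases j) (auto simp: sum.delta)
    finally show ?thesis .
  qed
  have "pderiv P = p"
  proof (rule poly_eqI)
    fix i show "coeff (pderiv P) i = coeff p i"
      using assms by (cases "i < n") (auto simp: coeff_pderiv cP)
  qed
  then show ?thesis
    by (intro exI[of _ "P + [:c - poly P a:]"])
      (auto simp: cP pderiv_add coeff_pCons split: nat.splits)
qed

text \<open>A Bramble-Hilbert estimate without compactness: a polynomial approximating the
  derivative is integrated, with the constant of integration of \<open>g 0\<close>, and each such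
  step gains a squared width by the Poincare inequality. The derivatives form an indexed family
  because each is determined only almost everywhere.\<close>

lemma deriv_chain_approx:
  assumes "a \<le> b" "Ltwo a b (g 0)" "\<And>k. k < n \<Longrightarrow> wderiv_on a b (g k) (g (Suc k))"
  shows "\<exists>\<pi>. degree_less n \<pi> \<and>
    sqint a b (\<lambda>x. g 0 x - poly \<pi> x) \<le> (b - a) ^ (2 * n) * sqint a b (g n)"
  using assms
proof (induction n arbitrary: g)
  case 0
  then show ?case by (intro exI[of _ 0]) auto
next
  case (Suc n)
  have w: "wderiv_on a b (g 0) (g 1)" using Suc.prems(3)[of 0] by simp
  have L1: "Ltwo a b (g 1)" using wderiv_on_Ltwo[OF w] .
  obtain \<pi> where \<pi>: "degree_less n \<pi>"
    "sqint a b (\<lambda>x. g 1 x - poly \<pi> x) \<le> (b - a) ^ (2 * n) * sqint a b (g (Suc n))"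
    using Suc.IH[of "\<lambda>k. g (Suc k)"] Suc.prems(1,3) L1 by auto
  obtain c where c: "negligible {x\<in>{a..b}. g 0 x \<noteq> c + integral {a..x} (g 1)}"
    using w by (auto simp: wderiv_on_def)
  obtain P where P: "degree_less (Suc n) P" "pderiv P = \<pi>" "poly P a = c"
    using poly_antiderivative[OF \<pi>(1)] by blast
  have A: "AC a b (\<lambda>x. (c + integral {a..x} (g 1)) - poly P x) (\<lambda>x. g 1 x - poly \<pi> x)"
    using AC_diff[OF AC_indef[OF Ltwo_absint[OF L1]] AC_poly[OF \<open>a \<le> b\<close>, of P]] P(2) by simp
  have "sqint a b (\<lambda>x. g 0 x - poly P x)
      = sqint a b (\<lambda>x. (c + integral {a..x} (g 1)) - poly P x)"
    by (rule integral_spike[OF c]) auto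
  also have "\<dots> \<le> (b - a)\<^sup>2 * sqint a b (\<lambda>x. g 1 x - poly \<pi> x)"
    by (rule AC_Poincare[OF A]) (use P(3) Suc.prems(1) L1 in \<open>auto intro!: Ltwo_diff Ltwo_poly\<close>)
  also have "\<dots> \<le> (b - a)\<^sup>2 * ((b - a) ^ (2 * n) * sqint a b (g (Suc n)))"
    using \<pi>(2) by (intro mult_left_mono) auto
  finally show ?case using P(1) by (intro exI[of _ P]) (auto simp: power2_eq_square mult.assoc)
qed

text \<open>A relation instead of an operator: on a cell of width zero every polynomial of degree
  less than \<open>q\<close> qualifies. Estimates are therefore made for every polynomial in the
  relation.\<close>

definition is_proj :: "nat \<Rightarrow> real \<Rightarrow> real \<Rightarrow> (real \<Rightarrow> real) \<Rightarrow> real poly \<Rightarrow> bool" where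
  "is_proj q a b g p \<longleftrightarrow> degree_less q p \<and>
     (\<forall>\<xi>. degree_less q \<xi> \<longrightarrow> integral {a..b} (\<lambda>x. (g x - poly p x) * poly \<xi> x) = 0)"

lemma is_proj_exists:
  assumes "a < b" "Ltwo a b g" shows "\<exists>p. is_proj q a b g p"
proof -
  interpret positive_functional "\<lambda>p. integral {a..b} (\<lambda>x. 1 * poly p x)"
    by (rule weighted_positive_functional) (use assms in auto)
  have gi: "(\<lambda>x. g x * poly p x) integrable_on {a..b}" for p
    by (intro Ltwo_mult_int assms Ltwo_poly)
  have "\<exists>s. degree_less q s \<and> (\<forall>\<xi>. degree_less q \<xi> \<longrightarrow>
      integral {a..b} (\<lambda>x. 1 * poly (s * \<xi>) x) = integral {a..b} (\<lambda>x. g x * poly \<xi> x))"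
    by (rule solution) (simp_all add: distrib_left integral_add gi mult.left_commute flip: integral_mult_right)
  then show ?thesis
    using gi Ltwo_mult_int[OF Ltwo_poly[of a b] Ltwo_poly[of a b]]
    by (auto simp: is_proj_def left_diff_distrib integral_diff)
qed

lemma is_proj_best:
  assumes p: "is_proj q a b g p" and g: "Ltwo a b g" and \<pi>: "degree_less q \<pi>"
  shows "sqint a b (\<lambda>x. g x - poly p x) \<le> sqint a b (\<lambda>x. g x - poly \<pi> x)"
proof -
  have d: "degree_less q (p - \<pi>)" using p \<pi> by (auto simp: is_proj_def)
  have L: "Ltwo a b (\<lambda>x. g x - poly p x)" by (intro Ltwo_diff g Ltwo_poly)
  have o: "integral {a..b} (\<lambda>x. (g x - poly p x) * poly (p - \<pi>) x) = 0"
    using p d unfolding is_proj_def by blast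
  note i1 = Ltwo_sq_int[OF L] Ltwo_mult_int[OF L Ltwo_poly[of a b "p - \<pi>"]] Ltwo_sq_int[OF Ltwo_poly[of a b "p - \<pi>"]]
  have "(\<lambda>x. (g x - poly \<pi> x)\<^sup>2) = (\<lambda>x. (g x - poly p x)\<^sup>2 + (2 * ((g x - poly p x) * poly (p - \<pi>) x) + (poly (p - \<pi>) x)\<^sup>2))"
    by (auto simp: power2_eq_square algebra_simps)
  then have "sqint a b (\<lambda>x. g x - poly \<pi> x) = sqint a b (\<lambda>x. g x - poly p x) +
     (2 * integral {a..b} (\<lambda>x. (g x - poly p x) * poly (p - \<pi>) x) + sqint a b (poly (p - \<pi>)))"
    using i1 by (simp only: integral_add integrable_add integrable_on_mult_right integral_mult_right)
  moreover have "sqint a b (poly (p - \<pi>)) \<ge> 0"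
    by (intro integral_nonneg i1) auto
  ultimately show ?thesis using o by simp
qed

text \<open>Best approximation over degree less than \<open>q\<close> is at least as good as over
  degree less than \<open>n\<close>. The freedom to take \<open>n\<close> below \<open>q\<close> is
  used for layers, where each derivative costs a power of 1/\<epsilon>.\<close>

lemma is_proj_chain:
  assumes p: "is_proj q a b (g 0) p" and "a \<le> b" "Ltwo a b (g 0)" "n \<le> q"
    and w: "\<And>k. k < n \<Longrightarrow> wderiv_on a b (g k) (g (Suc k))"
  shows "sqint a b (\<lambda>x. g 0 x - poly p x) \<le> (b - a) ^ (2 * n) * sqint a b (g n)"
proof -
  obtain \<pi> where \<pi>: "degree_less n \<pi>"
    "sqint a b (\<lambda>x. g 0 x - poly \<pi> x) \<le> (b - a) ^ (2 * n) * sqint a b (g n)"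
    using deriv_chain_approx[OF assms(2,3) w] by blast
  show ?thesis
    using is_proj_best[OF p assms(3), of \<pi>] \<pi> \<open>n \<le> q\<close> by force
qed

text \<open>Applied to layers on cells that do not resolve them: there \<open>g\<close> is as large as $1/\varepsilon$, but
  its integral is not.\<close>

lemma is_proj_L1:
  "\<exists>C>0. \<forall>a b g p x. a < b \<longrightarrow> Ltwo a b g \<longrightarrow> is_proj q a b g p \<longrightarrow> x \<in> {a..b} \<longrightarrow>
     (integral {a..x} (\<lambda>x. g x - poly p x))\<^sup>2 \<le> C * (integral {a..b} (\<lambda>x. \<bar>g x\<bar>))\<^sup>2"
proof -
  obtain C0 where C0: "\<And>p a b x. degree_less q p \<Longrightarrow> a < b \<Longrightarrow> x \<in> {a..b} \<Longrightarrow>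
     (poly p x)\<^sup>2 \<le> C0 / (b - a) * sqint a b (poly p)"
    using poly_point_bound[of q] by blast
  define C where "C = max C0 0"
  show ?thesis
  proof (intro exI[of _ "2 + 2 * C"] conjI allI impI)
    fix a b x :: real and g :: "real \<Rightarrow> real" and p
    assume ab: "a < b" and g: "Ltwo a b g" and p: "is_proj q a b g p" and x: "x \<in> {a..b}"
    have dp: "degree_less q p" using p by (simp add: is_proj_def)
    define Q where "Q = sqint a b (poly p)"
    define G where "G = integral {a..b} (\<lambda>x. \<bar>g x\<bar>)"
    have ag: "(\<lambda>x. \<bar>g x\<bar>) integrable_on {a..b}"
      using Ltwo_absint[OF g] by (simp add: absolutely_integrable_on_def)
    have G0: "G \<ge> 0" unfolding G_def by (intro integral_nonneg ag) auto
    have Q0: "Q \<ge> 0" unfolding Q_def by (intro integral_nonneg Ltwo_sq_int Ltwo_poly) auto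
    have pt: "(poly p t)\<^sup>2 \<le> C / (b - a) * Q" if "t \<in> {a..b}" for t
    proof -
      have "C0 / (b - a) * Q \<le> C / (b - a) * Q"
        using ab Q0 by (intro mult_right_mono divide_right_mono) (auto simp: C_def)
      then show ?thesis using C0[OF dp ab that] unfolding Q_def by linarith
    qed
    have ptb: "\<bar>poly p t\<bar> \<le> sqrt (C / (b - a) * Q)" if "t \<in> {a..b}" for t
      using pt[OF that] by (simp add: real_le_rsqrt)
    \<comment> \<open>The projection error is orthogonal to \<open>p\<close> itself.\<close>
    have "Q = integral {a..b} (\<lambda>x. g x * poly p x)"
    proof -
      have "integral {a..b} (\<lambda>x. (g x - poly p x) * poly p x) = 0" using p dp by (auto simp: is_proj_def)
      then show ?thesis
        unfolding Q_def left_diff_distrib power2_eq_square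
        by (subst (asm) integral_diff) (auto intro: Ltwo_mult_int g Ltwo_poly)
    qed
    also have "\<dots> \<le> \<bar>\<dots>\<bar>" by simp
    \<comment> \<open>The inverse estimate replaces \<open>p\<close> by its own norm, which leaves
      an inequality for \<open>Q\<close> involving only the integral of \<bar>g\<bar>.\<close>
    also have "\<dots> \<le> integral {a..b} (\<lambda>x. \<bar>g x\<bar> * sqrt (C / (b - a) * Q))"
      unfolding real_norm_def[symmetric]
    proof (rule Henstock_Kurzweil_Integration.integral_norm_bound_integral)
      show "(\<lambda>x. g x * poly p x) integrable_on {a..b}" by (intro Ltwo_mult_int g Ltwo_poly)
      show "(\<lambda>x. norm (g x) * sqrt (C / (b - a) * Q)) integrable_on {a..b}"
        using ag by (intro integrable_on_mult_left) simp
      show "norm (g t * poly p t) \<le> norm (g t) * sqrt (C / (b - a) * Q)" if "t \<in> {a..b}" for t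
        using ptb[OF that] by (simp add: abs_mult mult_left_mono)
    qed
    also have "\<dots> = G * sqrt (C / (b - a) * Q)" by (simp add: G_def)
    finally have "Q \<le> G * sqrt (C / (b - a) * Q)" .
    then have "Q\<^sup>2 \<le> (G * sqrt (C / (b - a) * Q))\<^sup>2" using Q0 by (intro power_mono) auto
    also have "\<dots> = G\<^sup>2 * (C / (b - a)) * Q"
      using Q0 ab by (simp add: power_mult_distrib C_def)
    finally have Q1: "Q * Q \<le> G\<^sup>2 * (C / (b - a)) * Q" by (simp add: power2_eq_square)
    have Q2: "Q \<le> G\<^sup>2 * (C / (b - a))"
    proof (cases "Q = 0")
      case True then show ?thesis using ab by (simp add: C_def)
    next
      case False
      then have "Q > 0" using Q0 by simp
      then show ?thesis using Q1 by (rule mult_right_le_imp_le[rotated])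
    qed
    have sub: "{a..x} \<subseteq> {a..b}" using x by auto
    have gx: "Ltwo a x g" by (rule Ltwo_subinterval[OF g sub])
    \<comment> \<open>Cauchy-Schwarz on the cell returns the factor b - a lost by the inverse
      estimate; the final constant is independent of the width.\<close>
    have "(integral {a..x} (\<lambda>x. 1 * poly p x))\<^sup>2 \<le> integral {a..x} (\<lambda>x. 1\<^sup>2) * sqint a x (poly p)"
      by (rule Ltwo_Cauchy_Schwarz) (auto intro: Ltwo_poly Ltwo_cont)
    also have "\<dots> \<le> (b - a) * Q"
      unfolding Q_def
    proof (rule mult_mono)
      show "sqint a x (poly p) \<le> sqint a b (poly p)"
        using sub by (intro integral_subset_le Ltwo_sq_int Ltwo_poly) auto
      show "0 \<le> sqint a x (poly p)" by (intro integral_nonneg Ltwo_sq_int Ltwo_poly) auto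
    qed (use x in auto)
    also have "\<dots> \<le> (b - a) * (G\<^sup>2 * (C / (b - a)))" using Q2 ab by (intro mult_left_mono) auto
    also have "\<dots> = C * G\<^sup>2" using ab by simp
    finally have P: "(integral {a..x} (poly p))\<^sup>2 \<le> C * G\<^sup>2" by simp
    have "\<bar>integral {a..x} g\<bar> \<le> integral {a..x} (\<lambda>x. \<bar>g x\<bar>)"
      using Ltwo_absint[OF gx] unfolding real_norm_def[symmetric]
      by (intro Henstock_Kurzweil_Integration.integral_norm_bound_integral) (auto simp: absolutely_integrable_on_def)
    also have "\<dots> \<le> G" unfolding G_def
      using sub Ltwo_absint[OF gx] ag by (intro integral_subset_le) (auto simp: absolutely_integrable_on_def)
    finally have "\<bar>integral {a..x} g\<bar> \<le> \<bar>G\<bar>" by simp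
    then have g2: "(integral {a..x} g)\<^sup>2 \<le> G\<^sup>2" by (simp add: abs_le_square_iff)
    have "integral {a..x} (\<lambda>x. g x - poly p x) = integral {a..x} g - integral {a..x} (poly p)"
      using gx Ltwo_poly[of a x p] by (intro integral_diff) (auto simp: Ltwo_def)
    moreover have "(s - t)\<^sup>2 \<le> 2 * s\<^sup>2 + 2 * t\<^sup>2" for s t :: real
      using zero_le_power2[of "s + t"] by (simp add: power2_eq_square algebra_simps)
    ultimately have "(integral {a..x} (\<lambda>x. g x - poly p x))\<^sup>2 \<le> 2 * (integral {a..x} g)\<^sup>2 + 2 * (integral {a..x} (poly p))\<^sup>2"
      by simp
    also have "\<dots> \<le> (2 + 2 * C) * G\<^sup>2" using P g2 by (simp add: algebra_simps)
    finally show "(integral {a..x} (\<lambda>x. g x - poly p x))\<^sup>2 \<le> (2 + 2 * C) * (integral {a..b} (\<lambda>x. \<bar>g x\<bar>))\<^sup>2"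
      by (simp add: G_def)
  qed (simp add: C_def)
qed

text \<open>The linear interpolant \<open>l\<close> is corrected by a bubble:
  \<open>\<omega>\<close> vanishes at both ends, so end values are kept, and its positivity inside
  makes the moment problem for the factor \<open>s\<close> solvable. For q = 1 the condition on
  \<open>s\<close> forces s = 0. A cell of width zero is served by a constant.\<close>

lemma cell_interpolant:
  fixes a b :: real
  assumes "a \<le> b" "continuous_on {a..b} v" "q \<ge> 1"
  shows "\<exists>p. degree p \<le> q \<and> poly p a = v a \<and> poly p b = v b \<and>
     (\<forall>\<xi>. degree \<xi> + 2 \<le> q \<longrightarrow> integral {a..b} (\<lambda>x. (poly p x - v x) * poly \<xi> x) = 0)"
proof (cases "a = b")
  case True
  have "integral {a..b} f = 0" for f :: "real \<Rightarrow> real" unfolding True by simp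
  with True show ?thesis by (intro exI[of _ "[:v a:]"]) simp
next
  case False
  then have ab: "a < b" using assms by simp
  define k where "k = (v b - v a) / (b - a)"
  define l where "l = [:v a - k * a, k:]"
  have "k * (b - a) = v b - v a" using ab by (simp add: k_def)
  then have l: "poly l a = v a" "poly l b = v b" "degree l \<le> 1"
    by (auto simp: l_def algebra_simps)
  define \<omega> where "\<omega> = [:-a, 1:] * [:b, -1:]"
  have \<omega>: "poly \<omega> x = (x - a) * (b - x)" for x by (simp add: \<omega>_def algebra_simps)
  interpret positive_functional "\<lambda>p. integral {a..b} (\<lambda>x. poly \<omega> x * poly p x)"
    by (rule weighted_positive_functional[OF ab cont_poly]; unfold \<omega>; rule mult_pos_pos mult_nonneg_nonneg) auto
  have vi: "(\<lambda>x. (v x - poly l x) * poly \<xi> x) integrable_on {a..b}" for \<xi>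
    by (intro Ltwo_mult_int Ltwo_diff Ltwo_poly Ltwo_cont assms)
  obtain s where s: "degree_less (q - 1) s" "\<And>\<xi>. degree_less (q - 1) \<xi> \<Longrightarrow>
      integral {a..b} (\<lambda>x. poly \<omega> x * poly (s * \<xi>) x) = integral {a..b} (\<lambda>x. (v x - poly l x) * poly \<xi> x)"
    using solution[of "\<lambda>\<xi>. integral {a..b} (\<lambda>x. (v x - poly l x) * poly \<xi> x)" "q - 1"]
    by (auto simp add: distrib_left integral_add vi mult.left_commute simp flip: integral_mult_right)
  define p where "p = l + \<omega> * s"
  show ?thesis
  proof (intro exI[of _ p] conjI allI impI)
    have "degree (\<omega> * s) \<le> q"
    proof (cases "s = 0")
      case s0: False
      then have "q - 1 > 0" using s(1) degree_less_0 by (cases "q - 1") auto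
      then have "degree s < q - 1" using s(1) by (simp add: degree_less_iff del: coeff_eq_0)
      moreover have "degree \<omega> \<le> 2" unfolding \<omega>_def by (rule order_trans[OF degree_mult_le]) auto
      ultimately show ?thesis using degree_mult_le[of \<omega> s] by linarith
    qed simp
    then show "degree p \<le> q" unfolding p_def using l assms by (intro degree_add_le) auto
    show "poly p a = v a" "poly p b = v b" using l by (auto simp: p_def \<omega>)
    fix \<xi> :: "real poly" assume x: "degree \<xi> + 2 \<le> q"
    then have "degree_less (q - 1) \<xi>" by (subst degree_less_iff) auto
    from s(2)[OF this] have "integral {a..b} (\<lambda>x. poly \<omega> x * poly (s * \<xi>) x - (v x - poly l x) * poly \<xi> x) = 0"
      using vi by (subst integral_diff) (auto intro!: integrable_continuous_real continuous_intros cont_poly)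
    then show "integral {a..b} (\<lambda>x. (poly p x - v x) * poly \<xi> x) = 0"
      by (simp add: p_def algebra_simps)
  qed
qed

section \<open>Gluing cells and existence of the interpolant\<close>

lemma AC_glue:
  assumes "AC a b F f" "AC b c F f" "a \<le> b" "b \<le> c"
  shows "AC a c F f"
proof (rule AC_I)
  have "f absolutely_integrable_on {a..b} \<union> {b..c}"
    using assms by (intro absolutely_integrable_Un AC_absint) auto
  moreover have "{a..b} \<union> {b..c} = {a..c}" using assms by auto
  ultimately show ai: "f absolutely_integrable_on {a..c}" by simp
  fix x assume x: "a \<le> x" "x \<le> c"
  show "F x = F a + integral {a..x} f"
  proof (cases "x \<le> b")
    case True then show ?thesis using AC_eq[OF assms(1) x(1)] by simp
  next
    case False
    have "f integrable_on {a..x}" using x by (intro integrable_subinterval_real[OF absint_int[OF ai]]) auto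
    then have "integral {a..b} f + integral {b..x} f = integral {a..x} f"
      using False assms by (intro Henstock_Kurzweil_Integration.integral_combine) auto
    then show ?thesis
      using AC_diff_eq[OF assms(1), of a b] AC_diff_eq[OF assms(2), of b x] False assms x by auto
  qed
qed

lemma Ltwo_glue:
  assumes "Ltwo a b f" "Ltwo b c f" "a \<le> b" "b \<le> c" shows "Ltwo a c f"
  using assms unfolding Ltwo_def
  by (auto intro: Henstock_Kurzweil_Integration.integrable_combine[of a b c])

lemma is_interpolant_alt:
  assumes "continuous_on {X 0..X N} v" "\<forall>i\<in>{1..N}. {X (i - 1)..X i} \<subseteq> {X 0..X N}"
  shows "is_interpolant q N X v g \<longleftrightarrow>
     continuous_on {X 0..X N} g \<and> piecewise_poly q N X g \<and>
     (\<forall>i\<in>{1..N}. g (X (i - 1)) = v (X (i - 1)) \<and> g (X i) = v (X i) \<and>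
        (\<forall>\<xi> :: real poly. degree \<xi> + 2 \<le> q \<longrightarrow>
           integral {X (i - 1)..X i} (\<lambda>x. (g x - v x) * poly \<xi> x) = 0))"
proof -
  have "(LINT x:{X (i - 1)..X i}|lebesgue. (g x - v x) * poly \<xi> x)
     = integral {X (i - 1)..X i} (\<lambda>x. (g x - v x) * poly \<xi> x)"
    if "continuous_on {X 0..X N} g" "i \<in> {1..N}" for \<xi> i
  proof (rule set_lebesgue_integral_eq_integral)
    have "continuous_on {X (i - 1)..X i} g" "continuous_on {X (i - 1)..X i} v"
      using that assms continuous_on_subset by blast+
    then show "(\<lambda>x. (g x - v x) * poly \<xi> x) absolutely_integrable_on {X (i - 1)..X i}"
      by (intro absolutely_integrable_continuous_real continuous_intros cont_poly)
  qed
  then show ?thesis unfolding is_interpolant_def by auto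
qed

text \<open>Nodes are ordered weakly: the mesh-defining function is only monotone, so cells in the
  boundary layers may degenerate to points.\<close>

locale mesh =
  fixes N :: nat and X :: "nat \<Rightarrow> real"
  assumes N: "N > 0" and step: "\<And>i. i \<in> {1..N} \<Longrightarrow> X (i - 1) \<le> X i"
begin

lemma node_mono: "i \<le> j \<Longrightarrow> j \<le> N \<Longrightarrow> X i \<le> X j"
proof (induction j)
  case (Suc j)
  then show ?case using step[of "Suc j"] by (cases "i = Suc j") auto
qed simp

lemma cell_sub: "i \<in> {1..N} \<Longrightarrow> {X (i - 1)..X i} \<subseteq> {X 0..X N}"
  using node_mono[of 0 "i - 1"] node_mono[of i N] by auto

lemma cell_sub_all: "\<forall>i\<in>{1..N}. {X (i - 1)..X i} \<subseteq> {X 0..X N}"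
  using cell_sub by blast

lemma cell_bounds: "i \<in> {1..N} \<Longrightarrow> X 0 \<le> X (i - 1) \<and> X i \<le> X N"
  using node_mono[of 0 "i - 1"] node_mono[of i N] by auto

lemma integral_cells:
  fixes f :: "real \<Rightarrow> real"
  assumes "f integrable_on {X 0..X N}"
  shows "integral {X 0..X N} f = (\<Sum>i\<in>{1..N}. integral {X (i - 1)..X i} f)"
proof -
  have "integral {X 0..X n} f = (\<Sum>i\<in>{1..n}. integral {X (i - 1)..X i} f)" if "n \<le> N" for n
    using that
  proof (induction n)
    case (Suc n)
    have "f integrable_on {X 0..X (Suc n)}"
      by (rule integrable_subinterval_real[OF assms]) (use node_mono Suc in auto)
    then have "integral {X 0..X (Suc n)} f = integral {X 0..X n} f + integral {X n..X (Suc n)} f"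
      using node_mono Suc by (intro Henstock_Kurzweil_Integration.integral_combine[symmetric]) auto
    then show ?case using Suc by simp
  qed simp
  then show ?thesis by simp
qed

lemma glue_cells:
  assumes "\<And>i. i \<in> {1..N} \<Longrightarrow> AC (X (i - 1)) (X i) F f" "\<And>i. i \<in> {1..N} \<Longrightarrow> Ltwo (X (i - 1)) (X i) f"
  shows "AC (X 0) (X N) F f" "Ltwo (X 0) (X N) f"
proof -
  have "AC (X 0) (X n) F f \<and> Ltwo (X 0) (X n) f" if "n \<le> N" for n
    using that
  proof (induction n)
    case 0
    have "f integrable_on {X 0..X 0}" "(\<lambda>x. (f x)\<^sup>2) integrable_on {X 0..X 0}"
      using integrable_on_refl[of f "X 0"] integrable_on_refl[of "\<lambda>x. (f x)\<^sup>2" "X 0"] by auto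
    then have L: "Ltwo (X 0) (X 0) f" by (simp add: Ltwo_def)
    have "AC (X 0) (X 0) F f" by (rule AC_I[OF Ltwo_absint[OF L]]) auto
    with L show ?case by simp
  next
    case (Suc n)
    have "X 0 \<le> X n" "X n \<le> X (Suc n)" using node_mono Suc by auto
    then show ?case using Suc assms[of "Suc n"] by (auto intro: AC_glue Ltwo_glue)
  qed
  then show "AC (X 0) (X N) F f" "Ltwo (X 0) (X N) f" by auto
qed

lemma cell_poly_AC:
  assumes i: "i \<in> {1..N}" and p: "\<And>x. x \<in> {X (i - 1)..X i} \<Longrightarrow> v x = poly p x"
  shows "AC (X (i - 1)) (X i) v (poly (pderiv p))"
  by (rule AC_fun_cong[OF AC_poly[OF step[OF i]]]) (use p in simp)

text \<open>Neighbouring polynomials agree at the common node because each represents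
  \<open>v\<close> on its closed cell; this is what permits gluing. At the nodes
  \<open>deriv v\<close> may be meaningless, but they form a null set.\<close>

lemma piecewise_poly_AC:
  assumes "piecewise_poly q N X v"
  shows "AC (X 0) (X N) v (deriv v)" "Ltwo (X 0) (X N) (deriv v)"
proof -
  have *: "AC (X (i - 1)) (X i) v (deriv v) \<and> Ltwo (X (i - 1)) (X i) (deriv v)" if i: "i \<in> {1..N}" for i
  proof -
    obtain p where p: "\<And>x. x \<in> {X (i - 1)..X i} \<Longrightarrow> v x = poly p x"
      using assms i unfolding piecewise_poly_def by blast
    have d: "deriv v x = poly (pderiv p) x" if x: "x \<in> {X (i - 1)..X i} - {X (i - 1), X i}" for x
    proof (rule DERIV_imp_deriv)
      show "(v has_real_derivative poly (pderiv p) x) (at x)"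
        by (rule has_field_derivative_transform_within_open[OF poly_DERIV, of "{X (i - 1)<..<X i}"])
          (use x p in auto)
    qed
    have n: "negligible {X (i - 1), X i}" by simp
    show ?thesis
      using AC_spike[OF cell_poly_AC[OF i p] n d] Ltwo_spike[OF Ltwo_poly n d] by blast
  qed
  show "AC (X 0) (X N) v (deriv v)" "Ltwo (X 0) (X N) (deriv v)"
    using glue_cells[of v "deriv v"] * by auto
qed

lemma is_interpolant_exists:
  assumes v: "continuous_on {X 0..X N} v" and q: "q \<ge> 1"
  shows "\<exists>g. is_interpolant q N X v g"
proof -
  have "\<forall>i\<in>{1..N}. \<exists>p. degree p \<le> q \<and> poly p (X (i - 1)) = v (X (i - 1)) \<and> poly p (X i) = v (X i) \<and>
     (\<forall>\<xi>. degree \<xi> + 2 \<le> q \<longrightarrow> integral {X (i - 1)..X i} (\<lambda>x. (poly p x - v x) * poly \<xi> x) = 0)"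
    using cell_interpolant step continuous_on_subset[OF v cell_sub] q by blast
  then obtain P where P: "\<And>i. i \<in> {1..N} \<Longrightarrow> degree (P i) \<le> q \<and> poly (P i) (X (i - 1)) = v (X (i - 1)) \<and>
     poly (P i) (X i) = v (X i) \<and>
     (\<forall>\<xi>. degree \<xi> + 2 \<le> q \<longrightarrow> integral {X (i - 1)..X i} (\<lambda>x. (poly (P i) x - v x) * poly \<xi> x) = 0)"
    by metis
  \<comment> \<open>The first closed cell containing x is selected. At a shared node the polynomials
    of both cells take the value of \<open>v\<close>, so the selection does not matter, even if
    cells of width zero lie in between.\<close>
  define g where "g x = poly (P (LEAST i. i \<ge> 1 \<and> x \<le> X i)) x" for x
  have g: "g x = poly (P i) x" if i: "i \<in> {1..N}" and x: "x \<in> {X (i - 1)..X i}" for i x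
  proof -
    define j where "j = (LEAST i. i \<ge> 1 \<and> x \<le> X i)"
    have "i \<ge> 1 \<and> x \<le> X i" using i x by auto
    then have j: "j \<ge> 1 \<and> x \<le> X j" "j \<le> i" unfolding j_def by (rule LeastI, rule Least_le)
    show ?thesis
    proof (cases "j = i")
      case True then show ?thesis by (simp add: g_def j_def)
    next
      case False
      then have "X j \<le> X (i - 1)" using j i by (intro node_mono) auto
      then have e: "x = X j" "x = X (i - 1)" using j x by auto
      have "poly (P j) x = v x" using P[of j] j i e(1) by auto
      moreover have "poly (P i) x = v x" using P[OF i] e(2) by auto
      ultimately show ?thesis by (simp add: g_def j_def)
    qed
  qed
  have pp: "piecewise_poly q N X g"
    unfolding piecewise_poly_def using P g by blast
  have c: "continuous_on {X 0..X N} g" using AC_cont[OF piecewise_poly_AC(1)[OF pp]] .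
  have "is_interpolant q N X v g"
  proof (subst is_interpolant_alt[OF v cell_sub_all], intro conjI ballI allI impI c pp)
    fix i assume i: "i \<in> {1..N}"
    then show "g (X (i - 1)) = v (X (i - 1))" "g (X i) = v (X i)"
      using g[OF i] P[OF i] step[OF i] by auto
    fix \<xi> :: "real poly" assume \<xi>: "degree \<xi> + 2 \<le> q"
    have "integral {X (i - 1)..X i} (\<lambda>x. (g x - v x) * poly \<xi> x) = integral {X (i - 1)..X i} (\<lambda>x. (poly (P i) x - v x) * poly \<xi> x)"
      by (rule Henstock_Kurzweil_Integration.integral_cong) (simp add: g[OF i])
    then show "integral {X (i - 1)..X i} (\<lambda>x. (g x - v x) * poly \<xi> x) = 0" using P[OF i] \<xi> by simp
  qed
  then show ?thesis by blast
qed

lemma interp_props: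
  assumes v: "AC (X 0) (X N) v v1" "Ltwo (X 0) (X N) v1" and q: "q \<ge> 1"
  defines "g \<equiv> interp q N X v"
  shows "AC (X 0) (X N) g (deriv g)" "Ltwo (X 0) (X N) (deriv g)" "piecewise_poly q N X g"
    "g (X 0) = v (X 0)" "g (X N) = v (X N)"
    "\<And>i. i \<in> {1..N} \<Longrightarrow> \<exists>p. degree p \<le> q \<and> (\<forall>x\<in>{X (i - 1)..X i}. g x = poly p x) \<and>
       is_proj q (X (i - 1)) (X i) v1 (pderiv p) \<and> v (X (i - 1)) = g (X (i - 1))"
proof -
  have c: "continuous_on {X 0..X N} v" by (rule AC_cont[OF v(1)])
  have "is_interpolant q N X v g"
    unfolding g_def interp_def using is_interpolant_exists[OF c q] by (rule someI_ex)
  note I = this[unfolded is_interpolant_alt[OF c cell_sub_all]]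
  show pp: "piecewise_poly q N X g" using I by blast
  show "AC (X 0) (X N) g (deriv g)" "Ltwo (X 0) (X N) (deriv g)" using piecewise_poly_AC[OF pp] by auto
  show "g (X 0) = v (X 0)" using I N by (metis One_nat_def Suc_leI atLeastAtMost_iff diff_Suc_1 order_refl)
  show "g (X N) = v (X N)" using I N by (metis One_nat_def Suc_leI atLeastAtMost_iff order_refl)
  fix i assume i: "i \<in> {1..N}"
  obtain p where p: "degree p \<le> q" "\<And>x. x \<in> {X (i - 1)..X i} \<Longrightarrow> g x = poly p x"
    using pp i unfolding piecewise_poly_def by blast
  let ?a = "X (i - 1)" and ?b = "X i"
  have e: "poly p ?a = v ?a" "poly p ?b = v ?b" using I i p(2)[of ?a] p(2)[of ?b] step[OF i] by auto
  have dp: "degree_less q (pderiv p)"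
    using p(1) q by (subst degree_less_iff) (auto simp: degree_pderiv)
  have vi: "AC ?a ?b v v1" using cell_bounds[OF i] by (intro AC_sub[OF v(1)]) auto
  have A: "AC ?a ?b (\<lambda>x. v x - poly p x) (\<lambda>x. v1 x - poly (pderiv p) x)"
    by (rule AC_diff[OF vi AC_poly[OF step[OF i]]])
  have "integral {?a..?b} (\<lambda>x. (v1 x - poly (pderiv p) x) * poly \<xi> x) = 0" if \<xi>: "degree_less q \<xi>" for \<xi>
  proof -
    have "integral {?a..?b} (\<lambda>x. (v1 x - poly (pderiv p) x) * poly \<xi> x)
        = - integral {?a..?b} (\<lambda>x. (v x - poly p x) * poly (pderiv \<xi>) x)"
      using AC_by_parts[OF A AC_poly[OF step[OF i]] step[OF i], of \<xi>] e by simp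
    also have "integral {?a..?b} (\<lambda>x. (v x - poly p x) * poly (pderiv \<xi>) x)
       = - integral {?a..?b} (\<lambda>x. (g x - v x) * poly (pderiv \<xi>) x)"
      unfolding integral_neg[symmetric]
      by (rule Henstock_Kurzweil_Integration.integral_cong) (simp add: p(2) algebra_simps)
    also have "integral {?a..?b} (\<lambda>x. (g x - v x) * poly (pderiv \<xi>) x) = 0"
    \<comment> \<open>Differentiation brings the degree from below \<open>q\<close> down to at most
      q - 2, which are exactly the admissible moments. Constants are separate: their derivative is
      0, and for q = 1 no moment condition is available.\<close>
    proof (cases "degree \<xi> = 0")
      case True
      then have "pderiv \<xi> = 0" by (simp add: pderiv_eq_0_iff)
      then show ?thesis by simp
    next
      case False
      have "degree \<xi> < q" using \<xi> q by (subst degree_less_iff[symmetric]) auto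
      then have "degree (pderiv \<xi>) + 2 \<le> q" using False by (simp add: degree_pderiv)
      then show ?thesis using I i by blast
    qed
    finally show ?thesis by simp
  qed
  then have "is_proj q ?a ?b v1 (pderiv p)" unfolding is_proj_def using dp by blast
  then show "\<exists>p. degree p \<le> q \<and> (\<forall>x\<in>{?a..?b}. g x = poly p x) \<and> is_proj q ?a ?b v1 (pderiv p) \<and> v ?a = g ?a"
    using p e p(2)[of ?a] step[OF i] by (intro exI[of _ p]) auto
qed

end

lemma L2_inner_ae:
  assumes "Ltwo a b f" "Ltwo a b g" "negligible S" "\<And>x. x \<in> {a..b} - S \<Longrightarrow> h x = f x * g x"
  shows "L2_inner a b f g = integral {a..b} h"
  unfolding L2_inner_eq_integral[OF assms(1,2)]
  by (rule integral_spike[OF assms(3)]) (use assms(4) in auto)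

section \<open>Coercivity and Galerkin orthogonality\<close>

text \<open>Derivatives are passed explicitly, here and in \<open>bform\<close>, because \<open>wderiv\<close> is an arbitrary
  representative.\<close>

definition sob :: "(real \<Rightarrow> real) \<Rightarrow> (real \<Rightarrow> real) \<Rightarrow> bool" where
  "sob u u1 \<longleftrightarrow> AC 0 2 u u1 \<and> Ltwo 0 2 u1"

lemma sob_AC: "sob u u1 \<Longrightarrow> AC 0 2 u u1" and sob_Ltwo': "sob u u1 \<Longrightarrow> Ltwo 0 2 u1"
  by (simp_all add: sob_def)

lemma sob_Ltwo: "sob u u1 \<Longrightarrow> Ltwo 0 2 u"
  by (rule Ltwo_cont[OF AC_cont[OF sob_AC]])

lemma sob_cont: "sob u u1 \<Longrightarrow> continuous_on {0..2} u"
  by (rule AC_cont[OF sob_AC])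

lemma sob_diff: "sob u u1 \<Longrightarrow> sob y y1 \<Longrightarrow> sob (\<lambda>x. u x - y x) (\<lambda>x. u1 x - y1 x)"
  unfolding sob_def by (elim conjE, intro conjI AC_diff Ltwo_diff)

lemma sob_H1: "sob u u1 \<Longrightarrow> u \<in> H1 0 2"
  using AC_H1(1)[of 0 2 u u1] by (simp add: sob_def)

lemma sob_wderiv_ae: "sob u u1 \<Longrightarrow> negligible {x\<in>{0..2}. wderiv 0 2 u x \<noteq> u1 x}"
  using AC_H1(2)[of 0 2 u u1] by (simp add: sob_def)

lemma H1_sob: "u \<in> H1 0 2 \<Longrightarrow> sob u (wderiv 0 2 u)"
  using H1_AC[of u 0 2] by (simp add: sob_def)

lemma sob_shift: "sob u u1 \<Longrightarrow> Ltwo 1 2 (\<lambda>x. u (x - 1))"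
  by (rule Ltwo_cont, rule continuous_on_compose2[OF sob_cont]) (auto intro!: continuous_intros)

lemma integral_shift_1:
  fixes f :: "real \<Rightarrow> real"
  assumes "f integrable_on {0..1}"
  shows "(\<lambda>x. f (x - 1)) integrable_on {1..2}" "integral {1..2} (\<lambda>x. f (x - 1)) = integral {0..1} f"
proof -
  have "(f has_integral integral {0..1} f) (cbox 0 1)" using assms by (auto intro: integrable_integral)
  from has_integral_affinity'[OF this, of 1 "-1"]
  have "((\<lambda>x. f (x - 1)) has_integral integral {0..1} f) {1..2}" by simp
  then show "(\<lambda>x. f (x - 1)) integrable_on {1..2}" "integral {1..2} (\<lambda>x. f (x - 1)) = integral {0..1} f"
    by (auto simp: integral_unique)
qed

lemma energy_sq:
  assumes "sob y y1" "Ltwo 0 2 z" "\<delta> \<ge> 0"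
  shows "(energy_nrm \<beta> \<delta> (y, z))\<^sup>2 = sqint 0 2 z +
    \<beta>\<^sup>2 / 2 * sqint 0 2 y1 + \<delta> * sqint 0 2 y"
proof -
  have w: "Ltwo 0 2 (wderiv 0 2 y)" using H1_sob[OF sob_H1[OF assms(1)]] by (rule sob_Ltwo')
  have "sqint 0 2 (wderiv 0 2 y) = sqint 0 2 y1"
    by (rule integral_spike[OF sob_wderiv_ae[OF assms(1)]]) auto
  then have "(L2_nrm 0 2 z)\<^sup>2 = sqint 0 2 z"
    "(L2_nrm 0 2 (wderiv 0 2 y))\<^sup>2 = sqint 0 2 y1"
    "(L2_nrm 0 2 y)\<^sup>2 = sqint 0 2 y"
    using L2_nrm_sq[OF assms(2)] L2_nrm_sq[OF w] L2_nrm_sq[OF sob_Ltwo[OF assms(1)]] by auto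
  moreover have "0 \<le> (L2_nrm 0 2 z)\<^sup>2 + \<beta>\<^sup>2 / 2 * (L2_nrm 0 2 (wderiv 0 2 y))\<^sup>2 + \<delta> * (L2_nrm 0 2 y)\<^sup>2"
    using assms by (intro add_nonneg_nonneg mult_nonneg_nonneg) auto
  ultimately show ?thesis by (simp add: energy_nrm_def)
qed

lemma energy_nrm_nonneg: "\<delta> \<ge> 0 \<Longrightarrow> energy_nrm \<beta> \<delta> p \<ge> 0"
  by (cases p) (auto simp: energy_nrm_def intro!: add_nonneg_nonneg mult_nonneg_nonneg)

lemma integral_sq_add_le:
  assumes "Ltwo a b f" "Ltwo a b g"
  shows "sqint a b (\<lambda>x. f x + g x) \<le> 2 * sqint a b f + 2 * sqint a b g"
proof -
  note i = Ltwo_sq_int[OF assms(1)] Ltwo_sq_int[OF assms(2)]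
  have "sqint a b (\<lambda>x. f x + g x) \<le> integral {a..b} (\<lambda>x. 2 * (f x)\<^sup>2 + 2 * (g x)\<^sup>2)"
  proof (rule integral_le)
    fix x show "(f x + g x)\<^sup>2 \<le> 2 * (f x)\<^sup>2 + 2 * (g x)\<^sup>2"
      using zero_le_power2[of "f x - g x"] by (simp add: power2_eq_square algebra_simps)
  qed (use i in \<open>auto intro!: Ltwo_sq_int Ltwo_add assms integrable_add integrable_on_mult_right\<close>)
  then show ?thesis using i by (simp add: integral_add integrable_on_mult_right)
qed

section \<open>Interpolation error on the whole mesh\<close>

context mesh
begin

lemma piecewise_poly_diff:
  assumes "piecewise_poly q N X v" "piecewise_poly q N X w"
  shows "piecewise_poly q N X (\<lambda>x. v x - w x)"
  unfolding piecewise_poly_def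
proof
  fix i assume i: "i \<in> {1..N}"
  obtain p r where "degree p \<le> q" "\<forall>x\<in>{X (i - 1)..X i}. v x = poly p x"
    "degree r \<le> q" "\<forall>x\<in>{X (i - 1)..X i}. w x = poly r x"
    using assms i unfolding piecewise_poly_def by meson
  then show "\<exists>p. degree p \<le> q \<and> (\<forall>x\<in>{X (i - 1)..X i}. v x - w x = poly p x)"
    by (intro exI[of _ "p - r"]) (auto intro: degree_diff_le)
qed

lemma interp_error:
  assumes v: "AC (X 0) (X N) v v1" "Ltwo (X 0) (X N) v1" and q: "q \<ge> 1"
  defines "g \<equiv> interp q N X v"
  shows "\<exists>P. \<forall>i\<in>{1..N}. is_proj q (X (i - 1)) (X i) v1 (P i) \<and>
    negligible {x\<in>{X (i - 1)..X i}. deriv g x \<noteq> poly (P i) x} \<and>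
    (\<forall>x\<in>{X (i - 1)..X i}. v x - g x = integral {X (i - 1)..x} (\<lambda>x. v1 x - poly (P i) x))"
proof -
  note I = interp_props[OF v q, folded g_def]
  have "\<forall>i\<in>{1..N}. \<exists>p. degree p \<le> q \<and> (\<forall>x\<in>{X (i - 1)..X i}. g x = poly p x) \<and>
       is_proj q (X (i - 1)) (X i) v1 (pderiv p) \<and> v (X (i - 1)) = g (X (i - 1))"
    using I(6) by blast
  then obtain p where p: "\<And>i. i \<in> {1..N} \<Longrightarrow> (\<forall>x\<in>{X (i - 1)..X i}. g x = poly (p i) x) \<and>
       is_proj q (X (i - 1)) (X i) v1 (pderiv (p i)) \<and> v (X (i - 1)) = g (X (i - 1))"
    by metis
  show ?thesis
  proof (intro exI[of _ "\<lambda>i. pderiv (p i)"] ballI conjI)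
    fix i assume i: "i \<in> {1..N}"
    show "is_proj q (X (i - 1)) (X i) v1 (pderiv (p i))" using p[OF i] by blast
    have gp: "AC (X (i - 1)) (X i) g (poly (pderiv (p i)))" using p[OF i] by (intro cell_poly_AC[OF i]) auto
    have gd: "AC (X (i - 1)) (X i) g (deriv g)" using cell_bounds[OF i] by (intro AC_sub[OF I(1)]) auto
    show "negligible {x\<in>{X (i - 1)..X i}. deriv g x \<noteq> poly (pderiv (p i)) x}"
      by (rule AC_unique_deriv[OF gd gp]) simp
    have vc: "AC (X (i - 1)) (X i) v v1" using cell_bounds[OF i] by (intro AC_sub[OF v(1)]) auto
    fix x assume x: "x \<in> {X (i - 1)..X i}"
    show "v x - g x = integral {X (i - 1)..x} (\<lambda>x. v1 x - poly (pderiv (p i)) x)"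
      using AC_diff_eq[OF AC_diff[OF vc gp] order_refl, of x] x p[OF i] by auto
  qed
qed

lemma interp_orthogonal:
  assumes v: "AC (X 0) (X N) v v1" "Ltwo (X 0) (X N) v1" and q: "q \<ge> 1"
    and f: "piecewise_poly q N X f" "AC (X 0) (X N) f f1" and i: "i \<in> {1..N}"
  shows "integral {X (i - 1)..X i} (\<lambda>x. (v1 x - deriv (interp q N X v) x) * f1 x) = 0"
proof -
  obtain P where P: "is_proj q (X (i - 1)) (X i) v1 (P i)"
    "negligible {x\<in>{X (i - 1)..X i}. deriv (interp q N X v) x \<noteq> poly (P i) x}"
    using interp_error[OF v q] i by blast
  obtain s where s: "degree s \<le> q" "\<And>x. x \<in> {X (i - 1)..X i} \<Longrightarrow> f x = poly s x"
    using f(1) i unfolding piecewise_poly_def by blast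
  have fc: "AC (X (i - 1)) (X i) f f1" using cell_bounds[OF i] by (intro AC_sub[OF f(2)]) auto
  have n: "negligible {x\<in>{X (i - 1)..X i}. f1 x \<noteq> poly (pderiv s) x}"
    by (rule AC_unique_deriv[OF fc cell_poly_AC[OF i s(2)]]) auto
  have "degree_less q (pderiv s)" using s(1) q by (subst degree_less_iff) (auto simp: degree_pderiv)
  then have "integral {X (i - 1)..X i} (\<lambda>x. (v1 x - poly (P i) x) * poly (pderiv s) x) = 0"
    using P(1) unfolding is_proj_def by blast
  moreover have "integral {X (i - 1)..X i} (\<lambda>x. (v1 x - deriv (interp q N X v) x) * f1 x) =
    integral {X (i - 1)..X i} (\<lambda>x. (v1 x - poly (P i) x) * poly (pderiv s) x)"
    by (rule integral_spike[OF negligible_Un[OF P(2) n]]) auto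
  ultimately show ?thesis by simp
qed

end

text \<open>\<open>D\<close> and \<open>L\<close> stand for the essential suprema of d on (1,2) and
  of b' in the coercivity condition; \<open>M\<close> is a crude common bound that enters constants
  only. The second derivative \<open>b2\<close> occurs because the term with b' is later integrated
  by parts.\<close>

locale coeffs =
  fixes b b1 b2 c d :: "real \<Rightarrow> real" and \<beta> \<delta> D L M :: real
  assumes bAC: "AC 0 2 b b1" "AC 0 2 b1 b2"
    and cont: "continuous_on {0..2} b2" "continuous_on {0..2} c" "continuous_on {0..2} d"
    and pos: "\<beta> > 0" "\<delta> > 0"
    and bd: "\<And>x. x \<in> {0..2} \<Longrightarrow> \<bar>b1 x\<bar> \<le> M" "\<And>x. x \<in> {0..2} \<Longrightarrow> \<bar>b2 x\<bar> \<le> M"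
      "\<And>x. x \<in> {0..2} \<Longrightarrow> \<bar>c x\<bar> \<le> M" "\<And>x. x \<in> {0..2} \<Longrightarrow> \<bar>d x\<bar> \<le> M"
    and b\<beta>: "\<And>x. x \<in> {0..2} \<Longrightarrow> b x \<ge> \<beta>\<^sup>2"
    and dD: "\<And>x. x \<in> {1..2} \<Longrightarrow> \<bar>d x\<bar> \<le> D"
    and bL: "\<And>x. x \<in> {0..2} \<Longrightarrow> \<bar>b1 x\<bar> \<le> L"
    and c\<delta>: "\<And>x. x \<in> {0..2} \<Longrightarrow> c x - 1/2 * D - 1 / (2 * \<beta>\<^sup>2) * L\<^sup>2 \<ge> \<delta>"
begin

lemma bcont: "continuous_on {0..2} b" "continuous_on {0..2} b1"
  using AC_cont bAC by auto

definition bform where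
  "bform \<epsilon> u u1 w w1 y y1 z z1 = integral {0..2} (\<lambda>x. - \<epsilon> * (w1 x * y1 x) + b x * (u1 x * y1 x) + b1 x * (u1 x * y x)
     + c x * (u x * y x) + \<epsilon> * (u1 x * z1 x) + w x * z x) + integral {1..2} (\<lambda>x. d x * (u (x - 1) * y x))"

lemma cont_prod_int:
  assumes "continuous_on {s..t} k" "Ltwo s t f" "Ltwo s t g"
  shows "(\<lambda>x. k x * (f x * g x)) integrable_on {s..t}"
  by (rule absint_int[OF absint_cont_mult[OF assms(1) Ltwo_mult[OF assms(2,3)]]])

lemma delay_int:
  assumes "sob u u1" "sob y y1"
  shows "(\<lambda>x. d x * (u (x - 1) * y x)) integrable_on {1..2}"
  by (rule cont_prod_int) (use cont(3) sob_shift[OF assms(1)] sob_Ltwo[OF assms(2)] in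
      \<open>auto intro: continuous_on_subset Ltwo_subinterval\<close>)

lemma B_form_eq:
  assumes S: "sob u u1" "sob w w1" "sob y y1" "sob z z1" and e: "dern {0..2} 1 b = b1"
  shows "B_form \<epsilon> b c d (u, w) (y, z) = bform \<epsilon> u u1 w w1 y y1 z z1"
proof -
  note W = S[THEN sob_H1, THEN H1_sob, THEN sob_Ltwo']
  note n = S[THEN sob_wderiv_ae]
  note Ls = S[THEN sob_Ltwo] note L1s = S[THEN sob_Ltwo']
  have 1: "L2_inner 0 2 (wderiv 0 2 w) (wderiv 0 2 y) = integral {0..2} (\<lambda>x. w1 x * y1 x)"
    by (rule L2_inner_ae[OF W(2) W(3) negligible_Un[OF n(2) n(3)]]) auto
  have 2: "L2_inner 0 2 (\<lambda>x. b x * wderiv 0 2 u x) (wderiv 0 2 y) = integral {0..2} (\<lambda>x. b x * (u1 x * y1 x))"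
    by (rule L2_inner_ae[OF Ltwo_cont_mult[OF bcont(1) W(1)] W(3) negligible_Un[OF n(1) n(3)]]) auto
  have 3: "L2_inner 0 2 (\<lambda>x. dern {0..2} 1 b x * wderiv 0 2 u x) y = integral {0..2} (\<lambda>x. b1 x * (u1 x * y x))"
    unfolding e by (rule L2_inner_ae[OF Ltwo_cont_mult[OF bcont(2) W(1)] Ls(3) n(1)]) auto
  have 4: "L2_inner 0 2 (\<lambda>x. c x * u x) y = integral {0..2} (\<lambda>x. c x * (u x * y x))"
    by (rule L2_inner_ae[OF Ltwo_cont_mult[OF cont(2) Ls(1)] Ls(3) negligible_empty]) auto
  have 5: "L2_inner 1 2 (\<lambda>x. d x * u (x - 1)) y = integral {1..2} (\<lambda>x. d x * (u (x - 1) * y x))"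
    by (rule L2_inner_ae[OF Ltwo_cont_mult[OF _ sob_shift[OF S(1)]] _ negligible_empty])
       (use cont Ls(3) in \<open>auto intro: continuous_on_subset Ltwo_subinterval\<close>)
  have 6: "L2_inner 0 2 (wderiv 0 2 u) (wderiv 0 2 z) = integral {0..2} (\<lambda>x. u1 x * z1 x)"
    by (rule L2_inner_ae[OF W(1) W(4) negligible_Un[OF n(1) n(4)]]) auto
  have 7: "L2_inner 0 2 w z = integral {0..2} (\<lambda>x. w x * z x)"
    by (rule L2_inner_ae[OF Ls(2) Ls(4) negligible_empty]) auto
  show ?thesis
    unfolding B_form_def bform_def prod.case 1 2 3 4 5 6 7
    by (simp add: integral_add integral_diff integrable_add integrable_diff integrable_on_mult_right integrable_neg
        cont_prod_int cont bcont Ls L1s Ltwo_mult_int)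
qed

lemma bform_int:
  assumes "sob u u1" "sob w w1" "sob y y1" "sob z z1"
  shows "(\<lambda>x. - \<epsilon> * (w1 x * y1 x) + b x * (u1 x * y1 x) + b1 x * (u1 x * y x)
     + c x * (u x * y x) + \<epsilon> * (u1 x * z1 x) + w x * z x) integrable_on {0..2}"
  using assms[THEN sob_Ltwo] assms[THEN sob_Ltwo']
  by (intro integrable_add integrable_on_mult_right cont_prod_int cont bcont Ltwo_mult_int)

lemma bform_diff:
  assumes "sob u u1" "sob w w1" "sob u' u1'" "sob w' w1'" "sob y y1" "sob z z1"
  shows "bform \<epsilon> (\<lambda>x. u x - u' x) (\<lambda>x. u1 x - u1' x) (\<lambda>x. w x - w' x) (\<lambda>x. w1 x - w1' x) y y1 z z1
    = bform \<epsilon> u u1 w w1 y y1 z z1 - bform \<epsilon> u' u1' w' w1' y y1 z z1"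
proof -
  have "integral {0..2} (\<lambda>x. - \<epsilon> * ((w1 x - w1' x) * y1 x) + b x * ((u1 x - u1' x) * y1 x) + b1 x * ((u1 x - u1' x) * y x)
     + c x * ((u x - u' x) * y x) + \<epsilon> * ((u1 x - u1' x) * z1 x) + (w x - w' x) * z x)
    = integral {0..2} (\<lambda>x. (- \<epsilon> * (w1 x * y1 x) + b x * (u1 x * y1 x) + b1 x * (u1 x * y x)
     + c x * (u x * y x) + \<epsilon> * (u1 x * z1 x) + w x * z x) - (- \<epsilon> * (w1' x * y1 x) + b x * (u1' x * y1 x) + b1 x * (u1' x * y x)
     + c x * (u' x * y x) + \<epsilon> * (u1' x * z1 x) + w' x * z x))"
    by (rule Henstock_Kurzweil_Integration.integral_cong) (simp add: algebra_simps)
  moreover have "integral {1..2} (\<lambda>x. d x * ((u (x - 1) - u' (x - 1)) * y x))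
    = integral {1..2} (\<lambda>x. d x * (u (x - 1) * y x) - d x * (u' (x - 1) * y x))"
    by (rule Henstock_Kurzweil_Integration.integral_cong) (simp add: algebra_simps)
  ultimately show ?thesis unfolding bform_def
    using assms by (simp only: integral_diff bform_int delay_int)
qed

text \<open>The shift moves the square over (0,1) onto (1,2), so that both halves together give
  exactly one full norm. This is why the delay term costs D/2, and not D, in the coercivity
  estimate.\<close>

lemma shifted_sq:
  assumes "sob u u1"
  shows "(\<lambda>x. (u (x - 1))\<^sup>2) integrable_on {1..2}"
    "sqint 1 2 (\<lambda>x. u (x - 1)) + sqint 1 2 u = sqint 0 2 u"
proof -
  have "(\<lambda>x. (u x)\<^sup>2) integrable_on {0..2}" by (rule Ltwo_sq_int[OF sob_Ltwo[OF assms]])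
  moreover from this have "(\<lambda>x. (u x)\<^sup>2) integrable_on {0..1}" by (rule integrable_subinterval_real) auto
  ultimately show "(\<lambda>x. (u (x - 1))\<^sup>2) integrable_on {1..2}"
    "sqint 1 2 (\<lambda>x. u (x - 1)) + sqint 1 2 u = sqint 0 2 u"
    using integral_shift_1[of "\<lambda>x. (u x)\<^sup>2"]
      Henstock_Kurzweil_Integration.integral_combine[of 0 1 2 "\<lambda>x. (u x)\<^sup>2"] by auto
qed

lemma D_nonneg: "D \<ge> 0" using dD[of 1] by auto

text \<open>With equal arguments the two terms carrying \<open>\<epsilon>\<close> cancel. Young's
  inequality spends half of \<beta>^2 and the amount L^2/(2\<beta>^2) of c on the term with b', and
  the delay term spends D/2; these are precisely the deductions in \<open>c\<delta>\<close>.\<close>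

lemma coercive:
  assumes S: "sob y y1" "sob z z1"
  shows "bform \<epsilon> y y1 z z1 y y1 z z1 \<ge> sqint 0 2 z +
    \<beta>\<^sup>2 / 2 * sqint 0 2 y1 + \<delta> * sqint 0 2 y"
proof -
  note sq = Ltwo_sq_int[OF sob_Ltwo[OF S(1)]] Ltwo_sq_int[OF sob_Ltwo'[OF S(1)]] Ltwo_sq_int[OF sob_Ltwo[OF S(2)]]
  have sq2: "(\<lambda>x. (y x)\<^sup>2) integrable_on {1..2}" by (rule integrable_subinterval_real[OF sq(1)]) auto
  have "- (D / 2) * sqint 0 2 y = integral {1..2} (\<lambda>x. - (D / 2) * ((y (x - 1))\<^sup>2 + (y x)\<^sup>2))"
    using shifted_sq[OF S(1)] sq2 by (simp only: integral_mult_right integral_add)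
  also have "\<dots> \<le> integral {1..2} (\<lambda>x. d x * (y (x - 1) * y x))"
  proof (rule integral_le)
    fix x :: real assume x: "x \<in> {1..2}"
    have "\<bar>d x * (y (x - 1) * y x)\<bar> \<le> D * (\<bar>y (x - 1)\<bar> * \<bar>y x\<bar>)"
      using dD[OF x] by (auto simp: abs_mult intro!: mult_right_mono)
    also have "\<dots> \<le> D * (((y (x - 1))\<^sup>2 + (y x)\<^sup>2) / 2)"
      using sum_squares_bound[of "\<bar>y (x - 1)\<bar>" "\<bar>y x\<bar>"] D_nonneg by (intro mult_left_mono) auto
    finally show "- (D / 2) * ((y (x - 1))\<^sup>2 + (y x)\<^sup>2) \<le> d x * (y (x - 1) * y x)" by simp
  next
    show "(\<lambda>x. - (D / 2) * ((y (x - 1))\<^sup>2 + (y x)\<^sup>2)) integrable_on {1..2}"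
      by (intro integrable_on_mult_right integrable_add shifted_sq[OF S(1)] sq2)
  qed (rule delay_int[OF S(1) S(1)])
  finally have A: "- (D / 2) * sqint 0 2 y \<le> integral {1..2} (\<lambda>x. d x * (y (x - 1) * y x))" .
  have "sqint 0 2 z + \<beta>\<^sup>2 / 2 * sqint 0 2 y1 + (\<delta> + D / 2) * sqint 0 2 y
    = integral {0..2} (\<lambda>x. (z x)\<^sup>2 + \<beta>\<^sup>2 / 2 * (y1 x)\<^sup>2 + (\<delta> + D / 2) * (y x)\<^sup>2)"
    using sq by (simp only: integral_add integrable_add integrable_on_mult_right integral_mult_right)
  also have "\<dots> \<le> integral {0..2} (\<lambda>x. - \<epsilon> * (z1 x * y1 x) + b x * (y1 x * y1 x) + b1 x * (y1 x * y x)
     + c x * (y x * y x) + \<epsilon> * (y1 x * z1 x) + z x * z x)"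
  proof (rule integral_le)
    fix x :: real assume x: "x \<in> {0..2}"
    have "\<bar>b1 x * (y1 x * y x)\<bar> \<le> L * (\<bar>y1 x\<bar> * \<bar>y x\<bar>)"
      using bL[OF x] by (auto simp: abs_mult intro!: mult_right_mono)
    also have "\<dots> \<le> \<beta>\<^sup>2 / 2 * (y1 x)\<^sup>2 + L\<^sup>2 / (2 * \<beta>\<^sup>2) * (y x)\<^sup>2"
    proof -
      have "2 * (\<beta> * \<bar>y1 x\<bar>) * (L / \<beta> * \<bar>y x\<bar>) \<le> (\<beta> * \<bar>y1 x\<bar>)\<^sup>2 + (L / \<beta> * \<bar>y x\<bar>)\<^sup>2"
        by (rule sum_squares_bound)
      also have "2 * (\<beta> * \<bar>y1 x\<bar>) * (L / \<beta> * \<bar>y x\<bar>) = 2 * (L * (\<bar>y1 x\<bar> * \<bar>y x\<bar>))" using pos by simp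
      also have "(\<beta> * \<bar>y1 x\<bar>)\<^sup>2 + (L / \<beta> * \<bar>y x\<bar>)\<^sup>2 = 2 * (\<beta>\<^sup>2 / 2 * (y1 x)\<^sup>2 + L\<^sup>2 / (2 * \<beta>\<^sup>2) * (y x)\<^sup>2)"
        by (simp add: power_mult_distrib power_divide)
      finally show ?thesis by simp
    qed
    finally have 1: "b1 x * (y1 x * y x) \<ge> - (\<beta>\<^sup>2 / 2 * (y1 x)\<^sup>2 + L\<^sup>2 / (2 * \<beta>\<^sup>2) * (y x)\<^sup>2)" by linarith
    have 2: "b x * (y1 x)\<^sup>2 \<ge> \<beta>\<^sup>2 * (y1 x)\<^sup>2" using b\<beta>[OF x] by (intro mult_right_mono) auto
    have "c x \<ge> \<delta> + D / 2 + L\<^sup>2 / (2 * \<beta>\<^sup>2)" using c\<delta>[OF x] by (simp add: field_simps)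
    then have 3: "c x * (y x)\<^sup>2 \<ge> (\<delta> + D / 2 + L\<^sup>2 / (2 * \<beta>\<^sup>2)) * (y x)\<^sup>2" by (intro mult_right_mono) auto
    have "\<beta>\<^sup>2 * (y1 x)\<^sup>2 = 2 * (\<beta>\<^sup>2 / 2 * (y1 x)\<^sup>2)" by simp
    with 1 2 3 show "(z x)\<^sup>2 + \<beta>\<^sup>2 / 2 * (y1 x)\<^sup>2 + (\<delta> + D / 2) * (y x)\<^sup>2 \<le> - \<epsilon> * (z1 x * y1 x) + b x * (y1 x * y1 x)
       + b1 x * (y1 x * y x) + c x * (y x * y x) + \<epsilon> * (y1 x * z1 x) + z x * z x"
      unfolding power2_eq_square[of "z x", symmetric] by (simp add: power2_eq_square distrib_right)
  qed (use sq S in \<open>auto intro!: bform_int[OF S S, unfolded power2_eq_square, simplified] integrable_add integrable_on_mult_right\<close>)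
  finally show ?thesis unfolding bform_def using A by (simp add: distrib_right)
qed

section \<open>Galerkin error equation and stability\<close>

lemma young:
  fixes s t k :: real
  assumes "k > 0" shows "\<bar>s * t\<bar> \<le> k / 4 * s\<^sup>2 + 1 / k * t\<^sup>2"
proof -
  have "0 \<le> (k / 2 * \<bar>s\<bar> - \<bar>t\<bar>)\<^sup>2" by simp
  then have "k * (\<bar>s\<bar> * \<bar>t\<bar>) \<le> k\<^sup>2 / 4 * s\<^sup>2 + t\<^sup>2" by (simp add: power2_eq_square algebra_simps)
  also have "\<dots> = k * (k / 4 * s\<^sup>2 + 1 / k * t\<^sup>2)"
    using assms by (simp add: power2_eq_square field_simps)
  finally show ?thesis using assms by (simp add: abs_mult)
qed

lemma young_integral:
  fixes f g :: "real \<Rightarrow> real"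
  assumes k: "k > 0" and L: "Ltwo s t f" "Ltwo s t g" and h: "h integrable_on {s..t}"
    and "\<And>x. x \<in> {s..t} \<Longrightarrow> \<bar>h x\<bar> \<le> \<bar>f x\<bar> * (B * \<bar>g x\<bar>)"
  shows "\<bar>integral {s..t} h\<bar> \<le> k / 4 * sqint s t f + B\<^sup>2 / k * sqint s t g"
proof -
  note i = Ltwo_sq_int[OF L(1)] Ltwo_sq_int[OF L(2)]
  have "norm (integral {s..t} h) \<le> integral {s..t} (\<lambda>x. k / 4 * (f x)\<^sup>2 + B\<^sup>2 / k * (g x)\<^sup>2)"
  proof (rule Henstock_Kurzweil_Integration.integral_norm_bound_integral[OF h])
    show "(\<lambda>x. k / 4 * (f x)\<^sup>2 + B\<^sup>2 / k * (g x)\<^sup>2) integrable_on {s..t}"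
      by (intro integrable_add integrable_on_mult_right i)
    fix x assume x: "x \<in> {s..t}"
    have "\<bar>h x\<bar> \<le> \<bar>f x\<bar> * (B * \<bar>g x\<bar>)" by (rule assms(5)[OF x])
    also have "\<dots> \<le> \<bar>\<bar>f x\<bar> * (B * \<bar>g x\<bar>)\<bar>" by simp
    also have "\<dots> \<le> k / 4 * (f x)\<^sup>2 + B\<^sup>2 / k * (g x)\<^sup>2"
      using young[OF k, of "\<bar>f x\<bar>" "B * \<bar>g x\<bar>"] by (simp add: power_mult_distrib)
    finally show "norm (h x) \<le> k / 4 * (f x)\<^sup>2 + B\<^sup>2 / k * (g x)\<^sup>2" by simp
  qed
  then show ?thesis using i by (simp only: real_norm_def integral_add integrable_on_mult_right integral_mult_right)
qed

lemma M_nonneg: "M \<ge> 0" using bd(1)[of 0] by auto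

lemma b_lipschitz: "x \<in> {0..2} \<Longrightarrow> y \<in> {0..2} \<Longrightarrow> x \<le> y \<Longrightarrow> \<bar>b y - b x\<bar> \<le> M * (y - x)"
proof -
  assume xy: "x \<in> {0..2}" "y \<in> {0..2}" "x \<le> y"
  have "norm (integral {x..y} b1) \<le> integral {x..y} (\<lambda>_. M)"
    using xy bd(1) by (intro Henstock_Kurzweil_Integration.integral_norm_bound_integral
        integrable_continuous_real continuous_on_subset[OF bcont(2)]) auto
  then show ?thesis using AC_diff_eq[OF bAC(1), of x y] xy by (simp add: mult.commute)
qed

lemma transport_error:
  assumes mesh: "mesh N X" and X: "X 0 = 0" "X N = 2"
    and H: "\<And>i. i \<in> {1..N} \<Longrightarrow> X i - X (i - 1) \<le> H"
    and L: "Ltwo 0 2 f" "Ltwo 0 2 g"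
    and o: "\<And>i. i \<in> {1..N} \<Longrightarrow> integral {X (i - 1)..X i} (\<lambda>x. g x * f x) = 0"
    and k: "k > 0"
  shows "\<bar>integral {0..2} (\<lambda>x. b x * (g x * f x))\<bar>
    \<le> k / 4 * sqint 0 2 f + (M * H)\<^sup>2 / k * sqint 0 2 g"
proof -
  interpret mesh N X by (rule mesh)
  have bi: "(\<lambda>x. b x * (g x * f x)) integrable_on {0..2}" by (intro cont_prod_int bcont L)
  have "\<bar>integral {0..2} (\<lambda>x. b x * (g x * f x))\<bar> = \<bar>\<Sum>i\<in>{1..N}. integral {X (i - 1)..X i} (\<lambda>x. b x * (g x * f x))\<bar>"
    using integral_cells[of "\<lambda>x. b x * (g x * f x)"] bi X by simp
  also have "\<dots> \<le> (\<Sum>i\<in>{1..N}. \<bar>integral {X (i - 1)..X i} (\<lambda>x. b x * (g x * f x))\<bar>)" by (rule sum_abs)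
  also have "\<dots> \<le> (\<Sum>i\<in>{1..N}. k / 4 * sqint (X (i - 1)) (X i) f + (M * H)\<^sup>2 / k * sqint (X (i - 1)) (X i) g)"
  proof (rule sum_mono)
    fix i assume i: "i \<in> {1..N}"
    let ?a = "X (i - 1)" and ?b = "X i"
    have s: "{?a..?b} \<subseteq> {0..2}" using cell_sub[OF i] X by simp
    have Lc: "Ltwo ?a ?b f" "Ltwo ?a ?b g" using L s by (auto intro: Ltwo_subinterval)
    have bc: "continuous_on {?a..?b} (\<lambda>x. b x - b ?a)" by (intro continuous_intros continuous_on_subset[OF bcont(1) s])
    have i1: "(\<lambda>x. b x * (g x * f x)) integrable_on {?a..?b}" by (rule integrable_subinterval_real[OF bi s])
    have i2: "(\<lambda>x. b ?a * (g x * f x)) integrable_on {?a..?b}" by (intro integrable_on_mult_right Ltwo_mult_int Lc)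
    have "integral {?a..?b} (\<lambda>x. b x * (g x * f x)) = integral {?a..?b} (\<lambda>x. b x * (g x * f x) - b ?a * (g x * f x))"
      using o[OF i] integral_diff[OF i1 i2] by simp
    also have "\<dots> = integral {?a..?b} (\<lambda>x. (b x - b ?a) * (g x * f x))" by (simp add: left_diff_distrib)
    also have "\<bar>\<dots>\<bar> \<le> k / 4 * sqint ?a ?b f + (M * H)\<^sup>2 / k * sqint ?a ?b g"
    proof (rule young_integral[OF k Lc cont_prod_int[OF bc Lc(2) Lc(1)]])
      fix x assume x: "x \<in> {?a..?b}"
      have "\<bar>b x - b ?a\<bar> \<le> M * (x - ?a)" using b_lipschitz[of ?a x] x s by auto
      also have "\<dots> \<le> M * H" using x H[OF i] M_nonneg by (intro mult_left_mono) auto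
      finally have "\<bar>b x - b ?a\<bar> * (\<bar>g x\<bar> * \<bar>f x\<bar>) \<le> M * H * (\<bar>g x\<bar> * \<bar>f x\<bar>)" by (intro mult_right_mono) auto
      then show "\<bar>(b x - b ?a) * (g x * f x)\<bar> \<le> \<bar>f x\<bar> * (M * H * \<bar>g x\<bar>)" by (simp add: abs_mult mult_ac)
    qed
    finally show "\<bar>integral {?a..?b} (\<lambda>x. b x * (g x * f x))\<bar> \<le> k / 4 * sqint ?a ?b f + (M * H)\<^sup>2 / k * sqint ?a ?b g" .
  qed
  also have "\<dots> = k / 4 * sqint 0 2 f + (M * H)\<^sup>2 / k * sqint 0 2 g"
    using integral_cells[of "\<lambda>x. (f x)\<^sup>2"] integral_cells[of "\<lambda>x. (g x)\<^sup>2"] X L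
    by (simp only: sum.distrib sum_distrib_left[symmetric] Ltwo_sq_int)
  finally show ?thesis .
qed

text \<open>The sum of the Young constants: 2M^2/\<beta>^2 each from the oscillation of b and from
  the b' term tested with the derivative, 2M^2/\<delta> from each of the three terms tested with the
  function. The summand 1 is for \<theta>.\<close>

definition C0 where "C0 = 4 * M\<^sup>2 / \<beta>\<^sup>2 + 6 * M\<^sup>2 / \<delta> + 1"

lemma supercloseness_identity_bound:
  assumes mesh: "mesh N X" and X: "X 0 = 0" "X N = 2"
    and H: "\<And>i. i \<in> {1..N} \<Longrightarrow> X i - X (i - 1) \<le> H"
    and S: "sob \<eta> \<eta>1" "sob \<theta> \<theta>1" "sob \<xi> \<xi>1" "sob \<zeta> \<zeta>1"
    and bdry: "\<xi> 0 = 0" "\<xi> 2 = 0"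
    and o1: "\<And>i. i \<in> {1..N} \<Longrightarrow> integral {X (i - 1)..X i} (\<lambda>x. \<eta>1 x * \<xi>1 x) = 0"
    and o2: "\<And>i. i \<in> {1..N} \<Longrightarrow> integral {X (i - 1)..X i} (\<lambda>x. \<eta>1 x * \<zeta>1 x) = 0"
    and o3: "\<And>i. i \<in> {1..N} \<Longrightarrow> integral {X (i - 1)..X i} (\<lambda>x. \<theta>1 x * \<xi>1 x) = 0"
    and eq: "bform \<epsilon> \<xi> \<xi>1 \<zeta> \<zeta>1 \<xi> \<xi>1 \<zeta> \<zeta>1 = - bform \<epsilon> \<eta> \<eta>1 \<theta> \<theta>1 \<xi> \<xi>1 \<zeta> \<zeta>1"
    and A: "sqint 0 2 \<eta> \<le> H\<^sup>2 * sqint 0 2 \<eta>1"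
  shows "sqint 0 2 \<zeta> + \<beta>\<^sup>2 / 2 * sqint 0 2 \<xi>1 + \<delta> * sqint 0 2 \<xi>
    \<le> 2 * C0 * (H\<^sup>2 * sqint 0 2 \<eta>1 + sqint 0 2 \<theta>)"
proof -
  interpret mesh N X by (rule mesh)
  note Ls = S[THEN sob_Ltwo] note L1s = S[THEN sob_Ltwo']
  define Z where "Z = sqint 0 2 \<zeta>"
  define Y1 where "Y1 = sqint 0 2 \<xi>1"
  define Y where "Y = sqint 0 2 \<xi>"
  define E1 where "E1 = sqint 0 2 \<eta>1"
  define E where "E = sqint 0 2 \<eta>"
  define T where "T = sqint 0 2 \<theta>"
  \<comment> \<open>the terms multiplied by \<open>\<epsilon>\<close>\<close>
  have z: "integral {0..2} (\<lambda>x. \<theta>1 x * \<xi>1 x) = 0" "integral {0..2} (\<lambda>x. \<eta>1 x * \<zeta>1 x) = 0"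
    using integral_cells[of "\<lambda>x. \<theta>1 x * \<xi>1 x"] integral_cells[of "\<lambda>x. \<eta>1 x * \<zeta>1 x"] X o2 o3
      Ltwo_mult_int[OF L1s(2) L1s(3)] Ltwo_mult_int[OF L1s(1) L1s(4)] by auto
  \<comment> \<open>The Young parameters are chosen for absorption: two terms take a quarter of the
    coefficient \<beta>^2/2 each, three take \<delta>/8 each, and one takes a quarter of the norm of
    \<zeta>. At most half of every norm on the left is consumed, whence the factor 2 in the
    result.\<close>
  have k: "\<beta>\<^sup>2 / 2 > 0" "\<delta> / 2 > 0" "(1::real) > 0" using pos by auto
  have b1: "\<bar>integral {0..2} (\<lambda>x. b x * (\<eta>1 x * \<xi>1 x))\<bar> \<le> \<beta>\<^sup>2 / 2 / 4 * Y1 + (M * H)\<^sup>2 / (\<beta>\<^sup>2 / 2) * E1"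
    unfolding Y1_def E1_def by (rule transport_error[OF mesh X H L1s(3) L1s(1) o1 k(1)])
  \<comment> \<open>The derivative is moved off \<open>\<eta>\<close>, since only
    \<open>\<eta>\<close> itself carries the extra factor H. The boundary terms vanish because
    \<open>\<xi>\<close> is zero at 0 and 2.\<close>
  have parts: "integral {0..2} (\<lambda>x. b1 x * (\<eta>1 x * \<xi> x)) = - integral {0..2} (\<lambda>x. b2 x * (\<eta> x * \<xi> x)) - integral {0..2} (\<lambda>x. b1 x * (\<eta> x * \<xi>1 x))"
  proof -
    have "AC 0 2 (\<lambda>x. b1 x * \<xi> x) (\<lambda>x. b2 x * \<xi> x + b1 x * \<xi>1 x)"
      by (rule AC_mult[OF bAC(2) sob_AC[OF S(3)]])
    from AC_by_parts[OF sob_AC[OF S(1)] this] bdry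
    have "integral {0..2} (\<lambda>x. \<eta>1 x * (b1 x * \<xi> x)) = - integral {0..2} (\<lambda>x. \<eta> x * (b2 x * \<xi> x + b1 x * \<xi>1 x))" by simp
    also have "(\<lambda>x. \<eta> x * (b2 x * \<xi> x + b1 x * \<xi>1 x)) = (\<lambda>x. b2 x * (\<eta> x * \<xi> x) + b1 x * (\<eta> x * \<xi>1 x))"
      by (auto simp: algebra_simps)
    also have "integral {0..2} \<dots> = integral {0..2} (\<lambda>x. b2 x * (\<eta> x * \<xi> x)) + integral {0..2} (\<lambda>x. b1 x * (\<eta> x * \<xi>1 x))"
      by (intro integral_add cont_prod_int cont bcont Ls L1s)
    finally show ?thesis by (simp add: mult.left_commute)
  qed
  have p1: "\<bar>integral {0..2} (\<lambda>x. b2 x * (\<eta> x * \<xi> x))\<bar> \<le> \<delta> / 2 / 4 * Y + M\<^sup>2 / (\<delta> / 2) * E"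
    unfolding Y_def E_def
  proof (rule young_integral[OF k(2) Ls(3) Ls(1)], intro cont_prod_int cont Ls)
    fix x :: real assume "x \<in> {0..2}"
    then have "\<bar>b2 x\<bar> * (\<bar>\<eta> x\<bar> * \<bar>\<xi> x\<bar>) \<le> M * (\<bar>\<eta> x\<bar> * \<bar>\<xi> x\<bar>)" using bd by (intro mult_right_mono) auto
    then show "\<bar>b2 x * (\<eta> x * \<xi> x)\<bar> \<le> \<bar>\<xi> x\<bar> * (M * \<bar>\<eta> x\<bar>)" by (simp add: abs_mult mult_ac)
  qed
  have p2: "\<bar>integral {0..2} (\<lambda>x. b1 x * (\<eta> x * \<xi>1 x))\<bar> \<le> \<beta>\<^sup>2 / 2 / 4 * Y1 + M\<^sup>2 / (\<beta>\<^sup>2 / 2) * E"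
    unfolding Y1_def E_def
  proof (rule young_integral[OF k(1) L1s(3) Ls(1)], intro cont_prod_int bcont Ls L1s)
    fix x :: real assume "x \<in> {0..2}"
    then have "\<bar>b1 x\<bar> * (\<bar>\<eta> x\<bar> * \<bar>\<xi>1 x\<bar>) \<le> M * (\<bar>\<eta> x\<bar> * \<bar>\<xi>1 x\<bar>)" using bd by (intro mult_right_mono) auto
    then show "\<bar>b1 x * (\<eta> x * \<xi>1 x)\<bar> \<le> \<bar>\<xi>1 x\<bar> * (M * \<bar>\<eta> x\<bar>)" by (simp add: abs_mult mult_ac)
  qed
  have p3: "\<bar>integral {0..2} (\<lambda>x. c x * (\<eta> x * \<xi> x))\<bar> \<le> \<delta> / 2 / 4 * Y + M\<^sup>2 / (\<delta> / 2) * E"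
    unfolding Y_def E_def
  proof (rule young_integral[OF k(2) Ls(3) Ls(1)], intro cont_prod_int cont Ls)
    fix x :: real assume "x \<in> {0..2}"
    then have "\<bar>c x\<bar> * (\<bar>\<eta> x\<bar> * \<bar>\<xi> x\<bar>) \<le> M * (\<bar>\<eta> x\<bar> * \<bar>\<xi> x\<bar>)" using bd by (intro mult_right_mono) auto
    then show "\<bar>c x * (\<eta> x * \<xi> x)\<bar> \<le> \<bar>\<xi> x\<bar> * (M * \<bar>\<eta> x\<bar>)" by (simp add: abs_mult mult_ac)
  qed
  have p4: "\<bar>integral {0..2} (\<lambda>x. \<theta> x * \<zeta> x)\<bar> \<le> 1 / 4 * Z + 1\<^sup>2 / 1 * T"
    unfolding Z_def T_def
    by (rule young_integral[OF k(3) Ls(4) Ls(2) Ltwo_mult_int[OF Ls(2) Ls(4)]]) (simp add: abs_mult)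
  have p5: "\<bar>integral {1..2} (\<lambda>x. d x * (\<eta> (x - 1) * \<xi> x))\<bar> \<le> \<delta> / 2 / 4 * Y + M\<^sup>2 / (\<delta> / 2) * E"
  proof -
    have L12: "Ltwo 1 2 \<xi>" by (rule Ltwo_subinterval[OF Ls(3)]) auto
    have "\<bar>integral {1..2} (\<lambda>x. d x * (\<eta> (x - 1) * \<xi> x))\<bar> \<le> \<delta> / 2 / 4 * sqint 1 2 \<xi>
       + M\<^sup>2 / (\<delta> / 2) * sqint 1 2 (\<lambda>x. \<eta> (x - 1))"
    proof (rule young_integral[OF k(2) L12 sob_shift[OF S(1)] delay_int[OF S(1) S(3)]])
      fix x :: real assume "x \<in> {1..2}"
      then have "\<bar>d x\<bar> * (\<bar>\<eta> (x - 1)\<bar> * \<bar>\<xi> x\<bar>) \<le> M * (\<bar>\<eta> (x - 1)\<bar> * \<bar>\<xi> x\<bar>)" using bd by (intro mult_right_mono) auto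
      then show "\<bar>d x * (\<eta> (x - 1) * \<xi> x)\<bar> \<le> \<bar>\<xi> x\<bar> * (M * \<bar>\<eta> (x - 1)\<bar>)" by (simp add: abs_mult mult_ac)
    qed
    also have "\<dots> \<le> \<delta> / 2 / 4 * Y + M\<^sup>2 / (\<delta> / 2) * E"
    proof -
      have "sqint 1 2 (\<lambda>x. \<xi> (x - 1)) \<ge> 0" by (intro integral_nonneg shifted_sq[OF S(3)]) auto
      then have "sqint 1 2 \<xi> \<le> Y" using shifted_sq(2)[OF S(3)] by (simp add: Y_def)
      moreover have "sqint 1 2 \<eta> \<ge> 0"
        by (intro integral_nonneg Ltwo_sq_int Ltwo_subinterval[OF Ls(1)]) auto
      then have "sqint 1 2 (\<lambda>x. \<eta> (x - 1)) \<le> E" using shifted_sq(2)[OF S(1)] by (simp add: E_def)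
      ultimately show ?thesis using k by (intro add_mono mult_left_mono) auto
    qed
    finally show ?thesis .
  qed
  have B: "bform \<epsilon> \<eta> \<eta>1 \<theta> \<theta>1 \<xi> \<xi>1 \<zeta> \<zeta>1 = integral {0..2} (\<lambda>x. b x * (\<eta>1 x * \<xi>1 x))
     + integral {0..2} (\<lambda>x. b1 x * (\<eta>1 x * \<xi> x)) + integral {0..2} (\<lambda>x. c x * (\<eta> x * \<xi> x))
     + integral {0..2} (\<lambda>x. \<theta> x * \<zeta> x) + integral {1..2} (\<lambda>x. d x * (\<eta> (x - 1) * \<xi> x))"
    unfolding bform_def using z
    by (simp add: integral_add integral_diff integrable_add integrable_diff integrable_on_mult_right integrable_neg
        cont_prod_int cont bcont Ls L1s Ltwo_mult_int)
  have "Z + \<beta>\<^sup>2 / 2 * Y1 + \<delta> * Y \<le> - bform \<epsilon> \<eta> \<eta>1 \<theta> \<theta>1 \<xi> \<xi>1 \<zeta> \<zeta>1"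
    using coercive[OF S(3,4), of \<epsilon>] eq by (simp add: Z_def Y1_def Y_def)
  also have "\<dots> \<le> (\<beta>\<^sup>2 / 2 / 4 * Y1 + (M * H)\<^sup>2 / (\<beta>\<^sup>2 / 2) * E1) + (\<delta> / 2 / 4 * Y + M\<^sup>2 / (\<delta> / 2) * E)
    + (\<beta>\<^sup>2 / 2 / 4 * Y1 + M\<^sup>2 / (\<beta>\<^sup>2 / 2) * E) + (\<delta> / 2 / 4 * Y + M\<^sup>2 / (\<delta> / 2) * E) + (1 / 4 * Z + 1\<^sup>2 / 1 * T)
    + (\<delta> / 2 / 4 * Y + M\<^sup>2 / (\<delta> / 2) * E)"
  proof -
    have "- (s1 + (- s2 - s3) + s4 + s5 + s6) \<le> t1 + t2 + t3 + t4 + t5 + t6"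
      if "\<bar>s1\<bar> \<le> t1" "\<bar>s2\<bar> \<le> t2" "\<bar>s3\<bar> \<le> t3" "\<bar>s4\<bar> \<le> t4" "\<bar>s5\<bar> \<le> t5" "\<bar>s6\<bar> \<le> t6"
      for s1 s2 s3 s4 s5 s6 t1 t2 t3 t4 t5 t6 :: real
      using that by linarith
    from this[OF b1 p1 p2 p3 p4 p5] show ?thesis unfolding B parts .
  qed
  also have "\<dots> = \<beta>\<^sup>2 / 2 * Y1 / 2 + 3 / 8 * (\<delta> * Y) + Z / 4 + 2 * (M\<^sup>2 / \<beta>\<^sup>2) * (H\<^sup>2 * E1) + (2 * (M\<^sup>2 / \<beta>\<^sup>2) + 6 * (M\<^sup>2 / \<delta>)) * E + T"
    using pos by (simp add: power_mult_distrib field_simps)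
  also have "\<dots> \<le> \<beta>\<^sup>2 / 2 * Y1 / 2 + 3 / 8 * (\<delta> * Y) + Z / 4 + 2 * (M\<^sup>2 / \<beta>\<^sup>2) * (H\<^sup>2 * E1) + (2 * (M\<^sup>2 / \<beta>\<^sup>2) + 6 * (M\<^sup>2 / \<delta>)) * (H\<^sup>2 * E1) + T"
    using A pos unfolding E_def E1_def by (intro add_mono mult_left_mono) auto
  finally have *: "Z + \<beta>\<^sup>2 / 2 * Y1 + \<delta> * Y \<le> \<beta>\<^sup>2 / 2 * Y1 / 2 + 3 / 8 * (\<delta> * Y) + Z / 4 + (C0 - 1) * (H\<^sup>2 * E1) + T"
    by (simp add: C0_def algebra_simps)
  have nn: "Z \<ge> 0" "Y \<ge> 0" "E1 \<ge> 0" "T \<ge> 0" unfolding Z_def Y_def E1_def T_def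
    by (auto intro!: integral_nonneg Ltwo_sq_int Ls L1s)
  have "C0 \<ge> 1" using pos by (simp add: C0_def)
  then have "T \<le> C0 * T" "0 \<le> H\<^sup>2 * E1" using nn mult_right_mono[of 1 C0 T] by auto
  have "\<delta> * Y \<ge> 0" using nn pos by simp
  have "Z + \<beta>\<^sup>2 / 2 * Y1 + \<delta> * Y \<le> 2 * (C0 * (H\<^sup>2 * E1) + C0 * T)"
  proof -
    have "Z + P + Q \<le> 2 * (s + t)" if "Z + P + Q \<le> P / 2 + 3 / 8 * Q + Z / 4 + (s - v) + T"
      "T \<le> t" "0 \<le> v" "0 \<le> Q" "0 \<le> Z" for P Q s t v :: real
      using that by argo
    from this[of "\<beta>\<^sup>2 / 2 * Y1" "\<delta> * Y" "C0 * (H\<^sup>2 * E1)" "H\<^sup>2 * E1" "C0 * T"]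
    show ?thesis using * \<open>T \<le> C0 * T\<close> \<open>0 \<le> H\<^sup>2 * E1\<close> \<open>\<delta> * Y \<ge> 0\<close> nn
      by (simp only: left_diff_distrib mult_1)
  qed
  then show ?thesis unfolding Z_def Y1_def Y_def E1_def T_def by (simp add: algebra_simps)
qed

text \<open>The conclusion is stated for arbitrary bounds \<open>A\<close> and \<open>T\<close> of
  the two projection errors, which separates the Galerkin argument from the solution decomposition.
  \<open>A\<close> enters the discrete error only with the factor H^2, but the full error with a
  constant factor; this accounts for the two different orders.\<close>

theorem stability:
  assumes mesh: "mesh N X" and X: "X 0 = 0" "X N = 2" and q: "q \<ge> 1"
    and H: "\<And>i. i \<in> {1..N} \<Longrightarrow> X i - X (i - 1) \<le> H"
    and U: "(u, w) \<in> U_space m" "(uh, wh) \<in> Uh_space m q N X"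
    and eq: "\<And>y z. (y, z) \<in> U_space m \<Longrightarrow> B_form \<epsilon> b c d (u, w) (y, z) = F y"
      "\<And>y z. (y, z) \<in> Uh_space m q N X \<Longrightarrow> B_form \<epsilon> b c d (uh, wh) (y, z) = F y"
    and b1: "dern {0..2} 1 b = b1"
  obtains P R where
    "\<And>i. i \<in> {1..N} \<Longrightarrow> is_proj q (X (i - 1)) (X i) (wderiv 0 2 u) (P i)"
    "\<And>i. i \<in> {1..N} \<Longrightarrow> is_proj q (X (i - 1)) (X i) (wderiv 0 2 w) (R i)"
    "\<And>A T. (\<Sum>i\<in>{1..N}. sqint (X (i - 1)) (X i) (\<lambda>x. wderiv 0 2 u x - poly (P i) x)) \<le> A \<Longrightarrow>
      (\<Sum>i\<in>{1..N}. sqint (X (i - 1)) (X i) (\<lambda>x. integral {X (i - 1)..x} (\<lambda>x. wderiv 0 2 w x - poly (R i) x))) \<le> T \<Longrightarrow>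
      (energy_nrm \<beta> \<delta> (\<lambda>x. interp q N X u x - uh x, \<lambda>x. interp q N X w x - wh x))\<^sup>2 \<le> 2 * C0 * (H\<^sup>2 * A + T) \<and>
      (energy_nrm \<beta> \<delta> (\<lambda>x. u x - uh x, \<lambda>x. w x - wh x))\<^sup>2
        \<le> 2 * (T + \<beta>\<^sup>2 / 2 * A + \<delta> * (H\<^sup>2 * A)) + 2 * (2 * C0 * (H\<^sup>2 * A + T))"
proof -
  interpret mesh N X by (rule mesh)
  define u1 where "u1 = wderiv 0 2 u"
  define w1 where "w1 = wderiv 0 2 w"
  define uh1 where "uh1 = wderiv 0 2 uh"
  define wh1 where "wh1 = wderiv 0 2 wh"
  have Uh: "(uh, wh) \<in> U_space m" "piecewise_poly q N X uh" "piecewise_poly q N X wh"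
    using U(2) by (auto simp: Uh_space_def)
  have HU: "u \<in> H1 0 2" "w \<in> H1 0 2" "uh \<in> H1 0 2" "wh \<in> H1 0 2"
    and bu: "u 0 = 0" "u 2 = 0" "uh 0 = 0" "uh 2 = 0"
    and bw: "m \<noteq> 1 \<Longrightarrow> w 0 = 0 \<and> w 2 = 0 \<and> wh 0 = 0 \<and> wh 2 = 0"
    using U(1) Uh(1) by (auto simp: U_space_def H10_def split: if_splits)
  have S: "sob u u1" "sob w w1" "sob uh uh1" "sob wh wh1"
    unfolding u1_def w1_def uh1_def wh1_def using HU by (auto intro: H1_sob)
  define gu where "gu = interp q N X u"
  define gw where "gw = interp q N X w"
  have ACu: "AC (X 0) (X N) u u1" "Ltwo (X 0) (X N) u1" "AC (X 0) (X N) w w1" "Ltwo (X 0) (X N) w1"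
    using S X by (auto simp: sob_def)
  note Iu = interp_props[OF ACu(1,2) q, folded gu_def] and Iw = interp_props[OF ACu(3,4) q, folded gw_def]
  have G: "sob gu (deriv gu)" "sob gw (deriv gw)" using Iu(1,2) Iw(1,2) X by (auto simp: sob_def)
  obtain P where P_all: "\<forall>i\<in>{1..N}. is_proj q (X (i - 1)) (X i) u1 (P i) \<and>
    negligible {x\<in>{X (i - 1)..X i}. deriv gu x \<noteq> poly (P i) x} \<and>
    (\<forall>x\<in>{X (i - 1)..X i}. u x - gu x = integral {X (i - 1)..x} (\<lambda>x. u1 x - poly (P i) x))"
    using interp_error[OF ACu(1,2) q] unfolding gu_def by blast
  have P: "\<And>i. i \<in> {1..N} \<Longrightarrow> is_proj q (X (i - 1)) (X i) u1 (P i)"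
    "\<And>i. i \<in> {1..N} \<Longrightarrow> negligible {x\<in>{X (i - 1)..X i}. deriv gu x \<noteq> poly (P i) x}"
    "\<And>i x. i \<in> {1..N} \<Longrightarrow> x \<in> {X (i - 1)..X i} \<Longrightarrow> u x - gu x = integral {X (i - 1)..x} (\<lambda>x. u1 x - poly (P i) x)"
    using P_all by blast+
  obtain R where R_all: "\<forall>i\<in>{1..N}. is_proj q (X (i - 1)) (X i) w1 (R i) \<and>
    negligible {x\<in>{X (i - 1)..X i}. deriv gw x \<noteq> poly (R i) x} \<and>
    (\<forall>x\<in>{X (i - 1)..X i}. w x - gw x = integral {X (i - 1)..x} (\<lambda>x. w1 x - poly (R i) x))"
    using interp_error[OF ACu(3,4) q] unfolding gw_def by blast
  have R: "\<And>i. i \<in> {1..N} \<Longrightarrow> is_proj q (X (i - 1)) (X i) w1 (R i)"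
    "\<And>i. i \<in> {1..N} \<Longrightarrow> negligible {x\<in>{X (i - 1)..X i}. deriv gw x \<noteq> poly (R i) x}"
    "\<And>i x. i \<in> {1..N} \<Longrightarrow> x \<in> {X (i - 1)..X i} \<Longrightarrow> w x - gw x = integral {X (i - 1)..x} (\<lambda>x. w1 x - poly (R i) x)"
    using R_all by blast+
  have \<eta>: "sob (\<lambda>x. u x - gu x) (\<lambda>x. u1 x - deriv gu x)" and \<theta>: "sob (\<lambda>x. w x - gw x) (\<lambda>x. w1 x - deriv gw x)"
    and \<xi>: "sob (\<lambda>x. gu x - uh x) (\<lambda>x. deriv gu x - uh1 x)" and \<zeta>: "sob (\<lambda>x. gw x - wh x) (\<lambda>x. deriv gw x - wh1 x)"
    and e: "sob (\<lambda>x. u x - uh x) (\<lambda>x. u1 x - uh1 x)" "sob (\<lambda>x. w x - wh x) (\<lambda>x. w1 x - wh1 x)"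
    by (intro sob_diff S G)+
  have pp: "piecewise_poly q N X (\<lambda>x. gu x - uh x)" "piecewise_poly q N X (\<lambda>x. gw x - wh x)"
    by (intro piecewise_poly_diff Iu(3) Iw(3) Uh)+
  have bg: "gu 0 = 0" "gu 2 = 0" "m \<noteq> 1 \<Longrightarrow> gw 0 = 0 \<and> gw 2 = 0"
    using Iu(4,5) Iw(4,5) X bu bw by auto
  \<comment> \<open>The discrete error must itself be an admissible test pair. Interpolation
    preserves the values at 0 and 2, and for m = 1 no boundary condition is imposed on the second
    component.\<close>
  have mem: "(\<lambda>x. gu x - uh x, \<lambda>x. gw x - wh x) \<in> Uh_space m q N X"
    using sob_H1[OF \<xi>] sob_H1[OF \<zeta>] bu bw bg pp by (auto simp: Uh_space_def U_space_def H10_def)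
  then have mem': "(\<lambda>x. gu x - uh x, \<lambda>x. gw x - wh x) \<in> U_space m" by (auto simp: Uh_space_def)
  define \<xi>1 where "\<xi>1 x = deriv gu x - uh1 x" for x
  define \<zeta>1 where "\<zeta>1 x = deriv gw x - wh1 x" for x
  have gal: "bform \<epsilon> (\<lambda>x. u x - uh x) (\<lambda>x. u1 x - uh1 x) (\<lambda>x. w x - wh x) (\<lambda>x. w1 x - wh1 x)
      (\<lambda>x. gu x - uh x) \<xi>1 (\<lambda>x. gw x - wh x) \<zeta>1 = 0"
    using eq(1)[OF mem'] eq(2)[OF mem] bform_diff[OF S \<xi> \<zeta>, of \<epsilon>]
      B_form_eq[OF S(1,2) \<xi> \<zeta> b1, of \<epsilon>] B_form_eq[OF S(3,4) \<xi> \<zeta> b1, of \<epsilon>]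
    unfolding \<xi>1_def \<zeta>1_def by simp
  \<comment> \<open>The error is interpolation error plus discrete error, so Galerkin orthogonality
    expresses the form of the discrete error by that of the interpolation error.\<close>
  have split: "bform \<epsilon> (\<lambda>x. gu x - uh x) \<xi>1 (\<lambda>x. gw x - wh x) \<zeta>1 (\<lambda>x. gu x - uh x) \<xi>1 (\<lambda>x. gw x - wh x) \<zeta>1
     = - bform \<epsilon> (\<lambda>x. u x - gu x) (\<lambda>x. u1 x - deriv gu x) (\<lambda>x. w x - gw x) (\<lambda>x. w1 x - deriv gw x)
        (\<lambda>x. gu x - uh x) \<xi>1 (\<lambda>x. gw x - wh x) \<zeta>1"
    using bform_diff[OF e \<eta> \<theta> \<xi> \<zeta>, of \<epsilon>] gal by (simp add: \<xi>1_def[abs_def] \<zeta>1_def[abs_def])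
  define A0 where "A0 = sqint 0 2 (\<lambda>x. u1 x - deriv gu x)"
  define T0 where "T0 = sqint 0 2 (\<lambda>x. w x - gw x)"
  have cA: "sqint (X (i - 1)) (X i) (\<lambda>x. u1 x - deriv gu x) = sqint (X (i - 1)) (X i) (\<lambda>x. u1 x - poly (P i) x)"
    if "i \<in> {1..N}" for i by (rule integral_spike[OF P(2)[OF that]]) auto
  have A0c: "A0 = (\<Sum>i\<in>{1..N}. sqint (X (i - 1)) (X i) (\<lambda>x. u1 x - deriv gu x))"
    unfolding A0_def using integral_cells[of "\<lambda>x. (u1 x - deriv gu x)\<^sup>2"] X Ltwo_sq_int[OF sob_Ltwo'[OF \<eta>]] by simp
  also have "\<dots> = (\<Sum>i\<in>{1..N}. sqint (X (i - 1)) (X i) (\<lambda>x. u1 x - poly (P i) x))"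
    by (intro sum.cong refl cA)
  finally have A0: "A0 = (\<Sum>i\<in>{1..N}. sqint (X (i - 1)) (X i) (\<lambda>x. u1 x - poly (P i) x))" .
  have T0: "T0 = (\<Sum>i\<in>{1..N}. sqint (X (i - 1)) (X i) (\<lambda>x. integral {X (i - 1)..x} (\<lambda>x. w1 x - poly (R i) x)))"
  proof -
    have "T0 = (\<Sum>i\<in>{1..N}. sqint (X (i - 1)) (X i) (\<lambda>x. w x - gw x))"
      unfolding T0_def using integral_cells[of "\<lambda>x. (w x - gw x)\<^sup>2"] X Ltwo_sq_int[OF sob_Ltwo[OF \<theta>]] by simp
    also have "\<dots> = (\<Sum>i\<in>{1..N}. sqint (X (i - 1)) (X i) (\<lambda>x. integral {X (i - 1)..x} (\<lambda>x. w1 x - poly (R i) x)))"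
      by (intro sum.cong refl Henstock_Kurzweil_Integration.integral_cong) (simp only: R(3))
    finally show ?thesis .
  qed
  \<comment> \<open>The interpolation error vanishes at every node, so the Poincare inequality on
    each cell gains the width. This avoids a separate estimate of u itself.\<close>
  have \<eta>L2: "sqint 0 2 (\<lambda>x. u x - gu x) \<le> H\<^sup>2 * A0"
  proof -
    have "sqint 0 2 (\<lambda>x. u x - gu x) = (\<Sum>i\<in>{1..N}. sqint (X (i - 1)) (X i) (\<lambda>x. u x - gu x))"
      using integral_cells[of "\<lambda>x. (u x - gu x)\<^sup>2"] X Ltwo_sq_int[OF sob_Ltwo[OF \<eta>]] by simp
    also have "\<dots> \<le> (\<Sum>i\<in>{1..N}. H\<^sup>2 * sqint (X (i - 1)) (X i) (\<lambda>x. u1 x - deriv gu x))"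
    proof (rule sum_mono)
      fix i assume i: "i \<in> {1..N}"
      have s: "{X (i - 1)..X i} \<subseteq> {0..2}" using cell_sub[OF i] X by simp
      have L: "Ltwo (X (i - 1)) (X i) (\<lambda>x. u1 x - deriv gu x)" by (rule Ltwo_subinterval[OF sob_Ltwo'[OF \<eta>] s])
      have "sqint (X (i - 1)) (X i) (\<lambda>x. u x - gu x) \<le> (X i - X (i - 1))\<^sup>2 * sqint (X (i - 1)) (X i) (\<lambda>x. u1 x - deriv gu x)"
      proof (rule AC_Poincare[OF _ L _ step[OF i]])
        show "AC (X (i - 1)) (X i) (\<lambda>x. u x - gu x) (\<lambda>x. u1 x - deriv gu x)"
          using cell_bounds[OF i] X by (intro AC_sub[OF sob_AC[OF \<eta>]]) auto
        show "u (X (i - 1)) - gu (X (i - 1)) = 0" using P(3)[OF i, of "X (i - 1)"] step[OF i] by simp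
      qed
      also have "\<dots> \<le> H\<^sup>2 * sqint (X (i - 1)) (X i) (\<lambda>x. u1 x - deriv gu x)"
        using H[OF i] step[OF i] by (intro mult_right_mono power_mono integral_nonneg Ltwo_sq_int L) auto
      finally show "sqint (X (i - 1)) (X i) (\<lambda>x. u x - gu x) \<le> H\<^sup>2 * sqint (X (i - 1)) (X i) (\<lambda>x. u1 x - deriv gu x)" .
    qed
    also have "\<dots> = H\<^sup>2 * A0" unfolding A0c by (simp add: sum_distrib_left)
    finally show ?thesis .
  qed
  have main: "sqint 0 2 (\<lambda>x. gw x - wh x) + \<beta>\<^sup>2 / 2 * sqint 0 2 \<xi>1 + \<delta> * sqint 0 2 (\<lambda>x. gu x - uh x)
    \<le> 2 * C0 * (H\<^sup>2 * A0 + T0)"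
    unfolding A0_def T0_def
  proof (rule supercloseness_identity_bound[OF mesh X H \<eta> \<theta> \<xi>[folded \<xi>1_def] \<zeta>[folded \<zeta>1_def] _ _ _ _ _ split])
    show "gu 0 - uh 0 = 0" "gu 2 - uh 2 = 0" using bg bu by auto
    have AC\<xi>: "AC (X 0) (X N) (\<lambda>x. gu x - uh x) \<xi>1" "AC (X 0) (X N) (\<lambda>x. gw x - wh x) \<zeta>1"
      using sob_AC[OF \<xi>] sob_AC[OF \<zeta>] X by (auto simp: \<xi>1_def[abs_def] \<zeta>1_def[abs_def])
    fix i assume i: "i \<in> {1..N}"
    show "integral {X (i - 1)..X i} (\<lambda>x. (u1 x - deriv gu x) * \<xi>1 x) = 0"
      unfolding gu_def by (rule interp_orthogonal[OF ACu(1,2) q pp(1) AC\<xi>(1) i])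
    show "integral {X (i - 1)..X i} (\<lambda>x. (u1 x - deriv gu x) * \<zeta>1 x) = 0"
      unfolding gu_def by (rule interp_orthogonal[OF ACu(1,2) q pp(2) AC\<xi>(2) i])
    show "integral {X (i - 1)..X i} (\<lambda>x. (w1 x - deriv gw x) * \<xi>1 x) = 0"
      unfolding gw_def by (rule interp_orthogonal[OF ACu(3,4) q pp(1) AC\<xi>(1) i])
  next
    show "sqint 0 2 (\<lambda>x. u x - gu x) \<le> H\<^sup>2 * sqint 0 2 (\<lambda>x. u1 x - deriv gu x)"
      using \<eta>L2 by (simp add: A0_def)
  qed
  have E1: "(energy_nrm \<beta> \<delta> (\<lambda>x. gu x - uh x, \<lambda>x. gw x - wh x))\<^sup>2 \<le> 2 * C0 * (H\<^sup>2 * A0 + T0)"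
    using main energy_sq[OF \<xi> sob_Ltwo[OF \<zeta>], of \<delta> \<beta>] pos by (simp add: \<xi>1_def)
  have E2: "(energy_nrm \<beta> \<delta> (\<lambda>x. u x - uh x, \<lambda>x. w x - wh x))\<^sup>2
     \<le> 2 * (T0 + \<beta>\<^sup>2 / 2 * A0 + \<delta> * (H\<^sup>2 * A0)) + 2 * (2 * C0 * (H\<^sup>2 * A0 + T0))"
  proof -
    have 1: "sqint 0 2 (\<lambda>x. w x - wh x) \<le> 2 * T0 + 2 * sqint 0 2 (\<lambda>x. gw x - wh x)"
      using integral_sq_add_le[OF sob_Ltwo[OF \<theta>] sob_Ltwo[OF \<zeta>]] by (simp add: T0_def)
    have 2: "sqint 0 2 (\<lambda>x. u1 x - uh1 x) \<le> 2 * A0 + 2 * sqint 0 2 \<xi>1"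
      using integral_sq_add_le[OF sob_Ltwo'[OF \<eta>] sob_Ltwo'[OF \<xi>]] by (simp add: A0_def \<xi>1_def)
    have 3: "sqint 0 2 (\<lambda>x. u x - uh x) \<le> 2 * (H\<^sup>2 * A0) + 2 * sqint 0 2 (\<lambda>x. gu x - uh x)"
      using integral_sq_add_le[OF sob_Ltwo[OF \<eta>] sob_Ltwo[OF \<xi>]] \<eta>L2 by simp
    have u2: "\<beta>\<^sup>2 / 2 * sqint 0 2 (\<lambda>x. u1 x - uh1 x) \<le> \<beta>\<^sup>2 / 2 * (2 * A0 + 2 * sqint 0 2 \<xi>1)"
      by (intro mult_left_mono[OF 2]) simp
    have u3: "\<delta> * sqint 0 2 (\<lambda>x. u x - uh x) \<le> \<delta> * (2 * (H\<^sup>2 * A0) + 2 * sqint 0 2 (\<lambda>x. gu x - uh x))"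
      using pos by (intro mult_left_mono[OF 3]) simp
    show ?thesis unfolding energy_sq[OF e(1) sob_Ltwo[OF e(2)] less_imp_le[OF pos(2)]]
      using add_mono[OF add_mono[OF 1 u2] u3] main by (simp add: algebra_simps)
  qed
  have C0: "C0 \<ge> 0" using pos by (simp add: C0_def)
  show ?thesis
  proof (rule that[OF P(1)[unfolded u1_def] R(1)[unfolded w1_def]])
    fix A T :: real
    assume A: "(\<Sum>i\<in>{1..N}. sqint (X (i - 1)) (X i) (\<lambda>x. wderiv 0 2 u x - poly (P i) x)) \<le> A"
      and T: "(\<Sum>i\<in>{1..N}. sqint (X (i - 1)) (X i) (\<lambda>x. integral {X (i - 1)..x} (\<lambda>x. wderiv 0 2 w x - poly (R i) x))) \<le> T"
    have AT: "A0 \<le> A" "T0 \<le> T" using A T unfolding A0 T0 u1_def w1_def by auto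
    have m1: "2 * C0 * (H\<^sup>2 * A0 + T0) \<le> 2 * C0 * (H\<^sup>2 * A + T)"
      using AT C0 by (intro mult_left_mono add_mono) auto
    have m2: "T0 + \<beta>\<^sup>2 / 2 * A0 + \<delta> * (H\<^sup>2 * A0) \<le> T + \<beta>\<^sup>2 / 2 * A + \<delta> * (H\<^sup>2 * A)"
      using AT pos by (intro mult_left_mono add_mono) auto
    show "(energy_nrm \<beta> \<delta> (\<lambda>x. interp q N X u x - uh x, \<lambda>x. interp q N X w x - wh x))\<^sup>2 \<le> 2 * C0 * (H\<^sup>2 * A + T) \<and>
      (energy_nrm \<beta> \<delta> (\<lambda>x. u x - uh x, \<lambda>x. w x - wh x))\<^sup>2
        \<le> 2 * (T + \<beta>\<^sup>2 / 2 * A + \<delta> * (H\<^sup>2 * A)) + 2 * (2 * C0 * (H\<^sup>2 * A + T))"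
      using order_trans[OF E1 m1] order_trans[OF E2 add_mono[OF mult_left_mono[OF m2, of 2] mult_left_mono[OF m1, of 2]]]
      unfolding gu_def gw_def by simp
  qed
qed

end

text \<open>Only an upper bound of the derivative off a finite set is at hand, which is all that
  piecewise differentiability of \<phi> and \<psi> provides. The gauge integral still recovers the
  increment.\<close>

lemma increment_le_of_deriv_le:
  fixes f :: "real \<Rightarrow> real"
  assumes "a \<le> b" "continuous_on {a..b} f" "finite S"
    and d: "\<And>x. x \<in> {a<..<b} - S \<Longrightarrow> (f has_real_derivative f' x) (at x)"
    and B: "\<And>x. x \<in> {a<..<b} - S \<Longrightarrow> f' x \<le> B"
  shows "f b - f a \<le> B * (b - a)"
proof -
  define g where "g x = (if x \<in> {a<..<b} - S then f' x else B)" for x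
  have "(g has_integral (f b - f a)) {a..b}"
    by (rule fundamental_theorem_of_calculus_interior_strong[OF assms(3,1) _ assms(2)])
      (use d in \<open>auto simp: g_def has_real_derivative_iff_has_vector_derivative\<close>)
  moreover have "((\<lambda>x. B) has_integral (b - a) * B) {a..b}"
    using has_integral_const_real[of B a b] assms(1) by simp
  ultimately show ?thesis
    using has_integral_le[of g "f b - f a" "{a..b}" "\<lambda>x. B" "(b - a) * B"] B
    by (auto simp: g_def mult.commute)
qed

section \<open>The mesh\<close>

text \<open>Derived quantities are parameters pinned by equations, which keeps the statements short.
  In \<open>Cf\<close>, the factor 4\<sigma>/\<beta> stems from the scaling of the nodes and the
  step 4/N of the argument of \<phi>, and e^(4\<bar>K\<bar>) bounds the ratio of \<psi> at
  neighbouring nodes.\<close>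

locale stype_mesh =
  fixes q N n :: nat and \<sigma> \<beta> \<epsilon> K :: real and \<phi> :: "real \<Rightarrow> real"
    and X :: "nat \<Rightarrow> real" and h m r \<mu> l k Cf :: real
  assumes q: "q \<ge> 1" and \<beta>: "\<beta> > 0" and \<sigma>: "\<sigma> > 0" "\<sigma> \<ge> real q + 1" and \<epsilon>: "\<epsilon> > 0"
    and N: "N > 0" and N_n: "N = 8 * n"
    and lam: "mesh_lambda \<sigma> \<beta> \<epsilon> N < 1/4"
    and mu: "q > 2 \<Longrightarrow> mesh_mu q \<beta> \<epsilon> < 1/4"
    and \<phi>: "mesh_defining K N \<phi>"
    and X_def: "X = mesh_node q \<sigma> \<beta> \<epsilon> N \<phi>"
    and h_def: "h = layer_width N X"
    and m_def: "m = max_abs_psi' \<phi>"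
    and r_def: "r = h + m / real N"
    and \<mu>_def: "\<mu> = mesh_mu q \<beta> \<epsilon>"
    and l_def: "l = mesh_lambda \<sigma> \<beta> \<epsilon> N"
    and k_def: "k = \<sigma> * \<epsilon> / \<beta>"
    and Cf_def: "Cf = 4 * \<sigma> / \<beta> * exp (4 * \<bar>K\<bar>)"
begin

lemma n_pos: "n \<ge> 1" and N8: "N \<ge> 8"
  using N N_n by auto

lemma k_pos: "k > 0" using \<sigma> \<epsilon> \<beta> by (simp add: k_def)

lemma l_eq: "l = k * ln (real N)" by (simp add: l_def mesh_lambda_def k_def)

lemma lnN: "ln (real N) \<ge> 1"
proof -
  have "exp 1 \<le> (3::real)" by (rule exp_le)
  then have "exp 1 \<le> real N" using N8 by linarith
  then show ?thesis using N by (simp add: ln_ge_iff)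
qed

text \<open>The bound \<lambda> < 1/4 together with ln N \<ge> 1 limits \<epsilon> independently of
  N; this bound absorbs surplus powers of \<epsilon> later.\<close>

lemma eps_le: "\<epsilon> \<le> \<beta> / (4 * \<sigma>)"
proof -
  have "k * 1 \<le> k * ln (real N)" using lnN k_pos by (intro mult_left_mono) auto
  then have "k < 1/4" using lam l_eq l_def by simp
  then show ?thesis using \<sigma> \<beta> by (simp add: k_def field_simps)
qed

lemma mu_bounds: "0 < \<mu>" "\<mu> \<le> 1/4"
  using mu \<beta> \<epsilon> by (cases "q \<le> 2"; force simp: \<mu>_def mesh_mu_def)+

lemma l_bounds: "0 \<le> l" "l < 1/4"
  using lam k_pos lnN by (auto simp: l_eq[symmetric] l_def[symmetric]) (simp add: l_eq)

lemma \<phi>_mono: "0 \<le> s \<Longrightarrow> s \<le> t \<Longrightarrow> t \<le> 1/2 \<Longrightarrow> \<phi> s \<le> \<phi> t"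
  using \<phi> unfolding mesh_defining_def mono_on_def by auto

lemma \<phi>_ends: "\<phi> 0 = 0" "\<phi> (1/2) = ln (real N)"
  using \<phi> unfolding mesh_defining_def by auto

lemma \<phi>_nonneg: "0 \<le> t \<Longrightarrow> t \<le> 1/2 \<Longrightarrow> \<phi> t \<ge> 0"
  using \<phi>_mono[of 0 t] \<phi>_ends by simp

lemma \<phi>_deriv:
  assumes "0 < t" "t < 1/2" "(\<phi> has_real_derivative D) (at t)"
  shows "0 \<le> D" "D \<le> K * real N"
proof -
  have "mono_on {0..1/2} \<phi>" using \<phi> unfolding mesh_defining_def by auto
  then show "0 \<le> D"
    by (rule mono_on_imp_deriv_nonneg[OF _ assms(3)]) (use assms in simp)
  have "deriv \<phi> t = D" using assms(3) by (rule DERIV_imp_deriv)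
  moreover have "\<phi> differentiable (at t)"
    using assms(3) real_differentiable_def by blast
  ultimately show "D \<le> K * real N" using \<phi> assms unfolding mesh_defining_def by auto
qed

lemma \<phi>_piecewise:
  "\<exists>S D. finite S \<and> (\<forall>x\<in>{0<..<1/2} - S. (\<phi> has_real_derivative D x) (at x)) \<and> continuous_on {0..1/2} \<phi>"
proof -
  have "\<phi> piecewise_C1_differentiable_on {0..1/2}" using \<phi> unfolding mesh_defining_def by auto
  then obtain S D where S: "finite S" "continuous_on {0..1/2} \<phi>"
    "\<forall>x\<in>{0..1/2} - S. (\<phi> has_vector_derivative D x) (at x)"
    unfolding piecewise_C1_differentiable_on_def C1_differentiable_on_def by blast
  then show ?thesis
    by (intro exI[of _ S] exI[of _ D]) (auto simp: has_real_derivative_iff_has_vector_derivative)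
qed

lemma \<phi>_increment:
  assumes "0 \<le> s" "s \<le> t" "t \<le> 1/2"
  shows "\<phi> t - \<phi> s \<le> \<bar>K\<bar> * real N * (t - s)"
proof -
  obtain S D where S: "finite S" "\<And>x. x \<in> {0<..<1/2} - S \<Longrightarrow> (\<phi> has_real_derivative D x) (at x)"
    "continuous_on {0..1/2} \<phi>" using \<phi>_piecewise by blast
  show ?thesis
  proof (rule increment_le_of_deriv_le[OF assms(2) _ S(1), of _ D])
    show "continuous_on {s..t} \<phi>" using S(3) assms by (auto intro: continuous_on_subset)
    fix x assume "x \<in> {s<..<t} - S"
    then have x: "x \<in> {0<..<1/2} - S" using assms by auto
    show "(\<phi> has_real_derivative D x) (at x)" by (rule S(2)[OF x])
    have "D x \<le> K * real N" using \<phi>_deriv(2)[OF _ _ S(2)[OF x]] x by auto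
    also have "\<dots> \<le> \<bar>K\<bar> * real N" by (intro mult_right_mono) auto
    finally show "D x \<le> \<bar>K\<bar> * real N" .
  qed
qed

text \<open>The supremum defining max \<bar>\<psi>'\<bar> is meaningful only over a bounded set.
  Where \<psi> is differentiable, so is \<phi> = -ln \<psi>, and 0 < \<psi> \<le> 1 transfers the
  bound of \<phi>'.\<close>

lemma \<psi>_deriv_bound:
  assumes "t \<in> {t \<in> {0<..<1/2}. (\<lambda>t. exp (- \<phi> t)) differentiable (at t)}"
  shows "\<bar>deriv (\<lambda>t. exp (- \<phi> t)) t\<bar> \<le> \<bar>K\<bar> * real N"
proof -
  obtain D where D: "((\<lambda>t. exp (- \<phi> t)) has_real_derivative D) (at t)"
    using assms real_differentiable_def by blast
  have "((\<lambda>t. - ln (exp (- \<phi> t))) has_real_derivative - (1 / exp (- \<phi> t) * D)) (at t)"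
    by (rule DERIV_minus, rule DERIV_chain2[OF DERIV_ln_divide D]) simp
  moreover have "(\<lambda>t. - ln (exp (- \<phi> t))) = \<phi>" by simp
  ultimately have \<phi>D: "(\<phi> has_real_derivative - (D / exp (- \<phi> t))) (at t)" by simp
  have t: "0 < t" "t < 1/2" using assms by auto
  note b = \<phi>_deriv[OF t \<phi>D]
  have "D \<le> 0" using b(1) by (simp add: field_simps)
  have "exp (- \<phi> t) \<le> 1" using \<phi>_nonneg[of t] t by simp
  have "\<bar>D\<bar> = - (D / exp (- \<phi> t)) * exp (- \<phi> t)" using \<open>D \<le> 0\<close> by simp
  also have "\<dots> \<le> - (D / exp (- \<phi> t)) * 1" using b(1) \<open>exp (- \<phi> t) \<le> 1\<close> by (intro mult_left_mono) auto
  also have "\<dots> \<le> K * real N" using b(2) by simp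
  also have "\<dots> \<le> \<bar>K\<bar> * real N" by (intro mult_right_mono) auto
  finally show ?thesis using DERIV_imp_deriv[OF D] by simp
qed

lemma m_eq: "m = (SUP t\<in>{t \<in> {0<..<1/2}. (\<lambda>t. exp (- \<phi> t)) differentiable (at t)}. \<bar>deriv (\<lambda>t. exp (- \<phi> t)) t\<bar>)"
  by (simp add: m_def max_abs_psi'_def Let_def)

lemma \<psi>_increment:
  assumes "0 \<le> s" "s \<le> t" "t \<le> 1/2"
  shows "exp (- \<phi> s) - exp (- \<phi> t) \<le> m * (t - s)"
proof -
  obtain S D where S: "finite S" "\<And>x. x \<in> {0<..<1/2} - S \<Longrightarrow> (\<phi> has_real_derivative D x) (at x)"
    "continuous_on {0..1/2} \<phi>" using \<phi>_piecewise by blast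
  have "- exp (- \<phi> t) - - exp (- \<phi> s) \<le> m * (t - s)"
  proof (rule increment_le_of_deriv_le[OF assms(2) _ S(1), of _ "\<lambda>x. exp (- \<phi> x) * D x"])
    show "continuous_on {s..t} (\<lambda>x. - exp (- \<phi> x))"
      using S(3) assms by (auto intro!: continuous_intros intro: continuous_on_subset)
    fix x assume "x \<in> {s<..<t} - S"
    then have x: "x \<in> {0<..<1/2} - S" using assms by auto
    have d: "((\<lambda>x. exp (- \<phi> x)) has_real_derivative - (exp (- \<phi> x) * D x)) (at x)"
      using S(2)[OF x] by (auto intro!: derivative_eq_intros)
    then show "((\<lambda>x. - exp (- \<phi> x)) has_real_derivative exp (- \<phi> x) * D x) (at x)"
      using DERIV_minus by fastforce
    have "x \<in> {t \<in> {0<..<1/2}. (\<lambda>t. exp (- \<phi> t)) differentiable (at t)}"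
      using x d real_differentiable_def by blast
    then have "\<bar>deriv (\<lambda>t. exp (- \<phi> t)) x\<bar> \<le> m" unfolding m_eq
      by (rule cSUP_upper) (use \<psi>_deriv_bound in \<open>auto intro!: bdd_aboveI2\<close>)
    then show "exp (- \<phi> x) * D x \<le> m" using DERIV_imp_deriv[OF d] by simp
  qed
  then show ?thesis by simp
qed

text \<open>\<psi> falls from 1 to 1/N over an interval of length 1/2, so its slope cannot be small.
  Consequently r dominates 1/N, and with it all mesh widths.\<close>

lemma m_ge_1: "m \<ge> 1"
proof -
  have "1 / real N \<le> 1 / 8" using N8 by (simp add: field_simps)
  moreover have "exp (- ln (real N)) = 1 / real N" using N by (simp add: exp_minus inverse_eq_divide)
  ultimately show ?thesis using \<psi>_increment[of 0 "1/2"] \<phi>_ends by simp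
qed

text \<open>It keeps r bounded independently of \<epsilon> and N. A differentiability point must be
  exhibited, since the supremum over an empty set would be arbitrary.\<close>

lemma m_le: "m \<le> \<bar>K\<bar> * real N"
proof -
  obtain S D where S: "finite S" "\<And>x. x \<in> {0<..<1/2} - S \<Longrightarrow> (\<phi> has_real_derivative D x) (at x)"
    "continuous_on {0..1/2} \<phi>" using \<phi>_piecewise by blast
  have "infinite ({0<..<1/2::real} - S)" using S(1) infinite_Ioo[of 0 "1/2::real"] by simp
  then obtain x where x: "x \<in> {0<..<1/2} - S" by (metis ex_in_conv finite.emptyI)
  have d: "((\<lambda>x. exp (- \<phi> x)) has_real_derivative - (exp (- \<phi> x) * D x)) (at x)"
    using S(2)[OF x] by (auto intro!: derivative_eq_intros)
  have "x \<in> {t \<in> {0<..<1/2}. (\<lambda>t. exp (- \<phi> t)) differentiable (at t)}"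
    using x d real_differentiable_def by blast
  then show ?thesis unfolding m_eq by (intro cSUP_least) (use \<psi>_deriv_bound in blast)+
qed

section \<open>Nodes, cell widths and decay on cells\<close>

lemma X_fine: "i \<le> n \<Longrightarrow> X i = k * \<phi> (real i / (2 * real n))"
  by (simp add: X_def mesh_node_def Let_def k_def N_n)

text \<open>The formula includes the transition node, which the definition assigns to the
  neighbouring branch; agreement there lets the width of a cell be computed from a single formula at
  both of its ends.\<close>

lemma X_left: "n \<le> i \<Longrightarrow> i \<le> 3 * n \<Longrightarrow> X i = l + (real i - real n) * ((1 - \<mu> - l) / (2 * real n))"
proof (cases "i = n")
  case True
  then show ?thesis using X_fine[of i] n_pos \<phi>_ends by (simp add: l_eq)
next
  case False
  assume "n \<le> i" "i \<le> 3 * n"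
  then have "\<not> real i \<le> real N / 8" "real i \<le> 3 * real N / 8" using False by (auto simp: N_n)
  then show ?thesis by (simp add: X_def mesh_node_def Let_def \<mu>_def l_def N_n)
qed

lemma X_mid: "3 * n \<le> i \<Longrightarrow> i \<le> 5 * n \<Longrightarrow> X i = (1 - \<mu>) + (real i - 3 * real n) * (\<mu> / real n)"
proof (cases "i = 3 * n")
  case True
  then have "real i - real n = 2 * real n" "real i - 3 * real n = 0" by auto
  then show ?thesis using X_left[of i] True n_pos by simp
next
  case False
  assume "3 * n \<le> i" "i \<le> 5 * n"
  then have "\<not> real i \<le> real N / 8" "\<not> real i \<le> 3 * real N / 8" "real i \<le> 5 * real N / 8"
    using False by (auto simp: N_n)
  then show ?thesis using n_pos by (simp add: X_def mesh_node_def Let_def \<mu>_def N_n)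
qed

lemma X_right: "5 * n \<le> i \<Longrightarrow> i \<le> 7 * n \<Longrightarrow> X i = (1 + \<mu>) + (real i - 5 * real n) * ((1 - \<mu> - l) / (2 * real n))"
proof (cases "i = 5 * n")
  case True
  then have "real i - 3 * real n = 2 * real n" "real i - 5 * real n = 0" by auto
  then show ?thesis using X_mid[of i] True n_pos by simp
next
  case False
  assume "5 * n \<le> i" "i \<le> 7 * n"
  then have "\<not> real i \<le> real N / 8" "\<not> real i \<le> 3 * real N / 8" "\<not> real i \<le> 5 * real N / 8" "real i \<le> 7 * real N / 8"
    using False by (auto simp: N_n)
  then show ?thesis by (simp add: X_def mesh_node_def Let_def \<mu>_def l_def N_n)
qed

lemma X_fine_right: "7 * n \<le> i \<Longrightarrow> i \<le> N \<Longrightarrow> X i = 2 - X (N - i)"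
proof -
  assume i: "7 * n \<le> i" "i \<le> N"
  then have f: "X (N - i) = k * \<phi> (real (N - i) / (2 * real n))" by (intro X_fine) (simp add: N_n)
  show ?thesis
  proof (cases "i = 7 * n")
    case True
    then have "X (N - i) = l" using f n_pos \<phi>_ends by (simp add: N_n l_eq)
    moreover have "real i - 5 * real n = 2 * real n" using True by simp
    ultimately show ?thesis using X_right[of i] True n_pos by simp
  next
    case False
    then have "\<not> real i \<le> real N / 8" "\<not> real i \<le> 3 * real N / 8" "\<not> real i \<le> 5 * real N / 8" "\<not> real i \<le> 7 * real N / 8"
      using i by (auto simp: N_n)
    then have "X i = 2 - k * \<phi> (4 * (real N - real i) / real N)"
      by (simp add: X_def mesh_node_def Let_def k_def)
    also have "4 * (real N - real i) / real N = real (N - i) / (2 * real n)"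
      using i n_pos by (simp add: N_n of_nat_diff field_simps)
    finally show ?thesis using f by simp
  qed
qed

lemma X_ends: "X 0 = 0" "X N = 2" "X (4 * n) = 1" "X n = l"
  using X_fine[of 0] X_fine_right[of N] X_mid[of "4 * n"] X_left[of n] n_pos \<phi>_ends by (auto simp: N_n)

text \<open>The last estimate is the core of S-type meshes: the width of a cell times \<psi> at its
  left node is controlled by the increment of \<psi>, that is, by \<epsilon> max \<bar>\<psi>'\<bar>
  / N.\<close>

lemma fine_step:
  assumes "1 \<le> i" "i \<le> n"
  shows "X (i - 1) \<le> X i" "X i - X (i - 1) \<le> 1/4" "0 \<le> X (i - 1)"
    "(X i - X (i - 1)) * exp (- \<phi> (real (i - 1) / (2 * real n))) \<le> k * (4 * m / real N * exp (4 * \<bar>K\<bar>))"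
proof -
  let ?s = "real (i - 1) / (2 * real n)" and ?t = "real i / (2 * real n)"
  have st: "0 \<le> ?s" "?s \<le> ?t" "?t \<le> 1/2" "?t - ?s = 4 / real N"
    using assms n_pos by (auto simp: field_simps N_n of_nat_diff)
  have e: "X i = k * \<phi> ?t" "X (i - 1) = k * \<phi> ?s" using X_fine[of i] X_fine[of "i - 1"] assms by auto
  have mono: "\<phi> ?s \<le> \<phi> ?t" by (rule \<phi>_mono[OF st(1,2,3)])
  then show "X (i - 1) \<le> X i" using e k_pos by (simp add: mult_left_mono)
  show X0: "0 \<le> X (i - 1)" using e k_pos \<phi>_nonneg[of ?s] st by simp
  have "\<phi> ?t \<le> ln (real N)" using \<phi>_mono[of ?t "1/2"] st \<phi>_ends by simp
  then have "X i \<le> l" unfolding e l_eq using k_pos by (intro mult_left_mono) auto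
  then show "X i - X (i - 1) \<le> 1/4" using X0 l_bounds by simp
  define \<Delta> where "\<Delta> = \<phi> ?t - \<phi> ?s"
  have \<Delta>: "0 \<le> \<Delta>" "\<Delta> \<le> 4 * \<bar>K\<bar>"
    using mono \<phi>_increment[OF st(1,2,3)] N st(4) by (auto simp: \<Delta>_def mult.commute)
  \<comment> \<open>This converts an increment of \<phi> into one of \<psi>, but with \<psi>
    evaluated at the right node.\<close>
  have "\<Delta> \<le> exp \<Delta> - 1" using exp_ge_add_one_self[of \<Delta>] by linarith
  then have "\<Delta> * exp (- \<phi> ?t) \<le> (exp \<Delta> - 1) * exp (- \<phi> ?t)" by (intro mult_right_mono) auto
  also have "\<dots> = exp (- \<phi> ?s) - exp (- \<phi> ?t)" by (simp add: left_diff_distrib \<Delta>_def flip: exp_add)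
  also have "\<dots> \<le> 4 * m / real N" using \<psi>_increment[OF st(1,2,3)] st(4) by (simp add: mult.commute)
  finally have 1: "\<Delta> * exp (- \<phi> ?t) \<le> 4 * m / real N" .
  \<comment> \<open>Moving from the right to the left node, where the layer is largest, costs
    e^\<Delta> with \<Delta> \<le> 4\<bar>K\<bar>.\<close>
  have "\<Delta> * exp (- \<phi> ?s) = \<Delta> * exp (- \<phi> ?t) * exp \<Delta>" by (simp add: \<Delta>_def mult.assoc flip: exp_add)
  also have "\<dots> \<le> 4 * m / real N * exp (4 * \<bar>K\<bar>)"
    using 1 \<Delta> m_ge_1 by (intro mult_mono) auto
  finally have "k * (\<Delta> * exp (- \<phi> ?s)) \<le> k * (4 * m / real N * exp (4 * \<bar>K\<bar>))"
    using k_pos by (intro mult_left_mono) auto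
  then show "(X i - X (i - 1)) * exp (- \<phi> ?s) \<le> k * (4 * m / real N * exp (4 * \<bar>K\<bar>))"
    unfolding e \<Delta>_def by (simp only: right_diff_distrib left_diff_distrib mult.assoc)
qed

lemma lin_diff:
  "1 \<le> i \<Longrightarrow> x = A + (real i - B) * c \<Longrightarrow> y = A + (real (i - 1) - B) * c \<Longrightarrow> x - y = c"
  by (simp add: of_nat_diff algebra_simps)

text \<open>In the right layer, cell \<open>i\<close> is the mirror image of cell N - i + 1 in the
  left one, so its end points exchange roles.\<close>

lemma cell_cases:
  assumes "i \<in> {1..N}"
  obtains (fl) "i \<le> n" | (cl) "n < i" "i \<le> 3 * n" "X i - X (i - 1) = (1 - \<mu> - l) / (2 * real n)"
    | (mid) "3 * n < i" "i \<le> 5 * n" "X i - X (i - 1) = \<mu> / real n"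
    | (cr) "5 * n < i" "i \<le> 7 * n" "X i - X (i - 1) = (1 - \<mu> - l) / (2 * real n)"
    | (fr) "7 * n < i" "X i = 2 - X (N - i)" "X (i - 1) = 2 - X (N - i + 1)" "1 \<le> N - i + 1" "N - i + 1 \<le> n"
proof -
  consider "i \<le> n" | "n < i \<and> i \<le> 3 * n" | "3 * n < i \<and> i \<le> 5 * n" | "5 * n < i \<and> i \<le> 7 * n" | "7 * n < i"
    by linarith
  then show ?thesis
  proof cases
    case 1 then show ?thesis by (rule fl)
  next
    case 2
    then show ?thesis by (intro cl lin_diff[OF _ X_left[of i] X_left[of "i - 1"]]) auto
  next
    case 3
    then show ?thesis by (intro mid lin_diff[OF _ X_mid[of i] X_mid[of "i - 1"]]) auto
  next
    case 4
    then show ?thesis by (intro cr lin_diff[OF _ X_right[of i] X_right[of "i - 1"]]) auto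
  next
    case 5
    then have "N - (i - 1) = N - i + 1" using assms by auto
    then show ?thesis using 5 assms X_fine_right[of i] X_fine_right[of "i - 1"]
      by (intro fr) (auto simp: N_n)
  qed
qed

lemma mesh: "mesh N X"
proof
  fix i assume i: "i \<in> {1..N}"
  have p: "(1 - \<mu> - l) / (2 * real n) \<ge> 0" "\<mu> / real n \<ge> 0" using mu_bounds l_bounds by auto
  show "X (i - 1) \<le> X i"
    using i
  proof (cases rule: cell_cases)
    case fl then show ?thesis using fine_step(1)[of i] i by auto
  next
    case fr then show ?thesis using fine_step(1)[of "N - i + 1"] by auto
  qed (use p in auto)
qed (rule N)

lemma h_ge: "i \<in> {1..n} \<union> {7 * n + 1..N} \<Longrightarrow> X i - X (i - 1) \<le> h"
  unfolding h_def layer_width_def by (rule Max_ge) (auto simp: N_n)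

lemma h_bounds: "0 \<le> h" "h \<le> 1/4"
proof -
  have "X 0 \<le> X 1" using fine_step(1)[of 1] n_pos by simp
  then show "0 \<le> h" using h_ge[of 1] n_pos by simp
  show "h \<le> 1/4" unfolding h_def layer_width_def
  proof (rule Max.boundedI)
    fix x assume "x \<in> (\<lambda>i. X i - X (i - 1)) ` ({1..N div 8} \<union> {7 * N div 8 + 1..N})"
    then obtain i where i: "x = X i - X (i - 1)" "i \<in> {1..n} \<union> {7 * n + 1..N}" by (auto simp: N_n)
    then have "i \<in> {1..N}" by (auto simp: N_n)
    then have "X i - X (i - 1) \<le> 1/4"
    proof (cases rule: cell_cases)
      case fl then show ?thesis using fine_step(2)[of i] i by auto
    next
      case fr then show ?thesis using fine_step(2)[of "N - i + 1"] by auto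
    qed (use i in auto)
    then show "x \<le> 1/4" by (simp add: i(1))
  qed (use n_pos in \<open>auto simp: N_n\<close>)
qed

lemma width_le: "i \<in> {1..N} \<Longrightarrow> X i - X (i - 1) \<le> 4 * (h + 1 / real N)"
proof -
  assume i: "i \<in> {1..N}"
  have "(1 - \<mu> - l) / (2 * real n) \<le> 1 / (2 * real n)" using mu_bounds l_bounds by (intro divide_right_mono) auto
  also have "\<dots> = 4 * (1 / real N)" by (simp add: N_n)
  finally have 1: "(1 - \<mu> - l) / (2 * real n) \<le> 4 * (1 / real N)" .
  have "0 \<le> t \<Longrightarrow> h \<le> 4 * (h + t)" for t using h_bounds by simp
  from this[of "1 / real N"] have p: "h \<le> 4 * (h + 1 / real N)" by fastforce
  have "\<mu> / real n \<le> (1/4) / real n" using mu_bounds by (intro divide_right_mono) auto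
  also have "\<dots> \<le> 4 * (1 / real N)" using n_pos by (simp add: N_n field_simps)
  finally have 2: "\<mu> / real n \<le> 4 * (1 / real N)" .
  show ?thesis
    using i
  proof (cases rule: cell_cases)
    case fl then show ?thesis using order_trans[OF h_ge[of i] p] i by auto
  next
    case fr then show ?thesis using order_trans[OF h_ge[of i] p] i by auto
  qed (use 1 2 h_bounds in auto)
qed

lemma r_ge: "h + 1 / real N \<le> r" "0 < h + 1 / real N" "1 / real N \<le> r" "m / real N \<le> r" "r > 0"
proof -
  have "1 / real N \<le> m / real N" using m_ge_1 by (intro divide_right_mono) auto
  moreover have "1 / real N > 0" using N by simp
  ultimately show "h + 1 / real N \<le> r" "0 < h + 1 / real N" "1 / real N \<le> r" "m / real N \<le> r" "r > 0"
    using h_bounds unfolding r_def by linarith+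
qed

lemma r_le: "r \<le> 1/4 + \<bar>K\<bar>"
proof -
  have "m / real N \<le> \<bar>K\<bar>" using m_le N by (simp add: field_simps)
  then show ?thesis using h_bounds by (simp add: r_def)
qed

text \<open>The power \<open>q + 1\<close> stands in for the root $e^{-\beta x/((q+1)\varepsilon)} \le \psi$, valid as
  $\sigma \ge q + 1$.\<close>

lemma fine_layer:
  assumes "1 \<le> i" "i \<le> n"
  shows "(X i - X (i - 1)) ^ (q + 1) * exp (- \<beta> * X (i - 1) / \<epsilon>) \<le> (Cf * \<epsilon> * r) ^ (q + 1)"
proof -
  define p where "p = \<phi> (real (i - 1) / (2 * real n))"
  have p0: "p \<ge> 0" unfolding p_def using assms by (intro \<phi>_nonneg) (auto simp: field_simps)
  have "X (i - 1) = k * p" using X_fine[of "i - 1"] assms by (simp add: p_def)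
  then have "- \<beta> * X (i - 1) / \<epsilon> = - \<sigma> * p" using \<beta> \<epsilon> by (simp add: k_def)
  also have "\<dots> \<le> - (real q + 1) * p" using \<sigma> p0 by (intro mult_right_mono) auto
  also have "\<dots> = real (q + 1) * (- p)" by (simp add: algebra_simps)
  finally have "exp (- \<beta> * X (i - 1) / \<epsilon>) \<le> exp (- p) ^ (q + 1)"
    unfolding exp_of_nat_mult[symmetric] by simp
  then have "(X i - X (i - 1)) ^ (q + 1) * exp (- \<beta> * X (i - 1) / \<epsilon>) \<le> (X i - X (i - 1)) ^ (q + 1) * exp (- p) ^ (q + 1)"
    using fine_step(1)[OF assms] by (intro mult_left_mono) auto
  also have "\<dots> = ((X i - X (i - 1)) * exp (- p)) ^ (q + 1)" by (simp only: power_mult_distrib)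
  also have "\<dots> \<le> (Cf * \<epsilon> * r) ^ (q + 1)"
  proof (rule power_mono)
    have "(X i - X (i - 1)) * exp (- p) \<le> k * (4 * m / real N * exp (4 * \<bar>K\<bar>))"
      using fine_step(4)[OF assms] by (simp add: p_def)
    also have "\<dots> = Cf * \<epsilon> * (m / real N)" by (simp add: k_def Cf_def)
    also have "\<dots> \<le> Cf * \<epsilon> * r" using r_ge \<sigma> \<beta> \<epsilon> by (intro mult_left_mono) (auto simp: Cf_def)
    finally show "(X i - X (i - 1)) * exp (- p) \<le> Cf * \<epsilon> * r" .
  qed (use fine_step(1)[OF assms] in auto)
  finally show ?thesis .
qed

lemma outside_layer:
  assumes "s \<ge> l" shows "exp (- \<beta> * s / \<epsilon>) \<le> r ^ (q + 1)"
proof -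
  have "- \<beta> * s / \<epsilon> \<le> - \<beta> * l / \<epsilon>" using assms \<beta> \<epsilon> by (simp add: divide_right_mono)
  also have "\<dots> = - \<sigma> * ln (real N)" using \<beta> \<epsilon> by (simp add: l_eq k_def)
  also have "\<dots> \<le> - (real q + 1) * ln (real N)" using \<sigma> lnN by (intro mult_right_mono) auto
  also have "\<dots> = real (q + 1) * (- ln (real N))" by (simp add: algebra_simps)
  finally have "exp (- \<beta> * s / \<epsilon>) \<le> exp (- ln (real N)) ^ (q + 1)"
    unfolding exp_of_nat_mult[symmetric] by simp
  also have "\<dots> = (1 / real N) ^ (q + 1)" using N by (simp add: exp_minus inverse_eq_divide)
  also have "\<dots> \<le> r ^ (q + 1)" using r_ge by (intro power_mono) auto
  finally show ?thesis .
qed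

text \<open>A uniform description of all cells: either the width compensates the powers of
  1/\<epsilon>, or the layer has already decayed. The cellwise estimates use this alternative and no
  other property of the mesh.\<close>

lemma left_layer_cell:
  assumes "i \<in> {1..N}"
  shows "(X i - X (i - 1)) ^ (q + 1) * exp (- \<beta> * X (i - 1) / \<epsilon>) \<le> (Cf * \<epsilon> * r) ^ (q + 1) \<or>
    exp (- \<beta> * X (i - 1) / \<epsilon>) \<le> r ^ (q + 1)"
proof (cases "i \<le> n")
  case True then show ?thesis using fine_layer[of i] assms by auto
next
  case False
  then have "X n \<le> X (i - 1)" using assms by (intro mesh.node_mono[OF mesh]) auto
  then show ?thesis using outside_layer X_ends by auto
qed

lemma right_layer_cell:
  assumes "i \<in> {1..N}"
  shows "(X i - X (i - 1)) ^ (q + 1) * exp (- \<beta> * (2 - X i) / \<epsilon>) \<le> (Cf * \<epsilon> * r) ^ (q + 1) \<or>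
    exp (- \<beta> * (2 - X i) / \<epsilon>) \<le> r ^ (q + 1)"
proof (cases "i \<le> 7 * n")
  case True
  then have "X i \<le> X (7 * n)" by (intro mesh.node_mono[OF mesh]) (auto simp: N_n)
  also have "X (7 * n) = 2 - l" using X_fine_right[of "7 * n"] X_ends by (simp add: N_n)
  finally show ?thesis using outside_layer[of "2 - X i"] by auto
next
  case False
  from assms show ?thesis
  proof (cases rule: cell_cases)
    case fr
    then show ?thesis using fine_layer[of "N - i + 1"] by auto
  qed (use False in auto)
qed

lemma interior_layer_cell:
  assumes "i \<in> {1..N}"
  shows "X i - X (i - 1) \<le> 8 * \<mu> / real N \<or> X i \<le> 1 - \<mu> \<or> X (i - 1) \<ge> 1 + \<mu>"
proof -
  consider "i \<le> 3 * n" | "5 * n < i" | "3 * n < i \<and> i \<le> 5 * n" by linarith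
  then show ?thesis
  proof cases
    case 1
    then have "X i \<le> X (3 * n)" by (intro mesh.node_mono[OF mesh]) (auto simp: N_n)
    then show ?thesis using X_mid[of "3 * n"] by auto
  next
    case 2
    then have "X (5 * n) \<le> X (i - 1)" using assms by (intro mesh.node_mono[OF mesh]) (auto simp: N_n)
    then show ?thesis using X_right[of "5 * n"] by auto
  next
    case 3
    from assms show ?thesis by (cases rule: cell_cases) (use 3 in \<open>auto simp: N_n\<close>)
  qed
qed

text \<open>The point x = 1 is the node with index N/2, so no cell straddles the place where the
  components of the solution may break.\<close>

lemma half_cells:
  assumes "i \<in> {1..N}" shows "X i \<le> 1 \<and> i \<le> 4 * n \<or> 1 \<le> X (i - 1) \<and> i > 4 * n"
proof (cases "i \<le> 4 * n")
  case True
  then have "X i \<le> X (4 * n)" by (intro mesh.node_mono[OF mesh]) (auto simp: N_n)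
  then show ?thesis using X_ends True by auto
next
  case False
  then have "X (4 * n) \<le> X (i - 1)" using assms by (intro mesh.node_mono[OF mesh]) auto
  then show ?thesis using X_ends False by auto
qed

end

section \<open>Projection errors of layer functions\<close>

lemma Ltwo_refl: "Ltwo a a f"
  using integrable_on_refl[of f a] integrable_on_refl[of "\<lambda>x. (f x)\<^sup>2" a] by (auto simp: Ltwo_def)

lemma wderiv_on_refl: "wderiv_on a a v g"
  by (auto simp: wderiv_on_def Ltwo_refl intro: negligible_subset[of "{a}"])

lemma is_proj_exists':
  assumes "a \<le> b" "Ltwo a b g" shows "\<exists>p. is_proj q a b g p"
proof (cases "a = b")
  case True
  have "is_proj q a b g 0" unfolding is_proj_def True by simp
  then show ?thesis by blast
qed (use assms is_proj_exists[of a b g q] in auto)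

lemma is_proj_diff:
  assumes "is_proj q a b g p" "is_proj q a b f s" "Ltwo a b g" "Ltwo a b f"
  shows "is_proj q a b (\<lambda>x. g x - f x) (p - s)"
  unfolding is_proj_def
proof (intro conjI allI impI)
  fix i assume "q \<le> i" then show "coeff (p - s) i = 0" using assms(1,2) by (simp add: is_proj_def)
next
  fix \<xi> assume x: "degree_less q \<xi>"
  have i: "(\<lambda>x. (g x - poly p x) * poly \<xi> x) integrable_on {a..b}" "(\<lambda>x. (f x - poly s x) * poly \<xi> x) integrable_on {a..b}"
    by (intro Ltwo_mult_int Ltwo_diff Ltwo_poly assms)+
  have "(\<lambda>x. (g x - f x - poly (p - s) x) * poly \<xi> x) = (\<lambda>x. (g x - poly p x) * poly \<xi> x - (f x - poly s x) * poly \<xi> x)"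
    by (auto simp: algebra_simps)
  moreover have "integral {a..b} (\<lambda>x. (g x - poly p x) * poly \<xi> x) = 0" "integral {a..b} (\<lambda>x. (f x - poly s x) * poly \<xi> x) = 0"
    using assms(1,2) x unfolding is_proj_def by blast+
  ultimately show "integral {a..b} (\<lambda>x. (g x - f x - poly (p - s) x) * poly \<xi> x) = 0"
    using i by (simp add: integral_diff)
qed

lemma is_proj_spike:
  assumes "is_proj q a b g p" "negligible S" "\<And>x. x \<in> {a..b} - S \<Longrightarrow> f x = g x"
  shows "is_proj q a b f p"
proof -
  have "integral {a..b} (\<lambda>x. (g x - poly p x) * poly \<xi> x) = integral {a..b} (\<lambda>x. (f x - poly p x) * poly \<xi> x)" for \<xi>
    by (rule integral_spike[OF assms(2)]) (simp add: assms(3))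
  with assms(1) show ?thesis by (simp add: is_proj_def)
qed

lemma Ltwo_indef:
  "Ltwo a b g \<Longrightarrow> Ltwo a b (\<lambda>x. integral {a..x} g)"
  using AC_cont[OF AC_indef[OF Ltwo_absint, of a b g 0]] by (auto intro: Ltwo_cont)

text \<open>With \<open>g\<close> the derivative of an interpolated function \<open>v\<close>, the first predicate bounds the error of
  \<open>v'\<close> and the second one that of \<open>v\<close>: $v - Iv$ is the primitive of $g - p$ vanishing at \<open>a\<close>.\<close>

definition proj_err_le :: "nat \<Rightarrow> real \<Rightarrow> real \<Rightarrow> (real \<Rightarrow> real) \<Rightarrow> real \<Rightarrow> bool" where
  "proj_err_le q a b g B \<longleftrightarrow> Ltwo a b g \<and>
    (\<forall>p. is_proj q a b g p \<longrightarrow> sqint a b (\<lambda>x. g x - poly p x) \<le> B)"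

definition prim_err_le :: "nat \<Rightarrow> real \<Rightarrow> real \<Rightarrow> (real \<Rightarrow> real) \<Rightarrow> real \<Rightarrow> bool" where
  "prim_err_le q a b g B \<longleftrightarrow> Ltwo a b g \<and>
    (\<forall>p. is_proj q a b g p \<longrightarrow> sqint a b (\<lambda>x. integral {a..x} (\<lambda>x. g x - poly p x)) \<le> B)"

lemma proj_err_le_mono: "proj_err_le q a b g B \<Longrightarrow> B \<le> B' \<Longrightarrow> proj_err_le q a b g B'"
  unfolding proj_err_le_def by force

lemma prim_err_le_mono: "prim_err_le q a b g B \<Longrightarrow> B \<le> B' \<Longrightarrow> prim_err_le q a b g B'"
  unfolding prim_err_le_def by force

text \<open>A projection of the sum is split by choosing one of \<open>f\<close> and assigning the
  remainder to \<open>g\<close>. As the bounds hold for every projection, uniqueness is not an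
  issue.\<close>

lemma proj_err_le_add:
  assumes ab: "a \<le> b" and g: "proj_err_le q a b g B" and f: "proj_err_le q a b f C"
  shows "proj_err_le q a b (\<lambda>x. g x + f x) (2 * B + 2 * C)"
  unfolding proj_err_le_def
proof (intro conjI allI impI)
  have L: "Ltwo a b g" "Ltwo a b f" using g f by (auto simp: proj_err_le_def)
  show "Ltwo a b (\<lambda>x. g x + f x)" by (intro Ltwo_add L)
  fix p assume p: "is_proj q a b (\<lambda>x. g x + f x) p"
  obtain s where s: "is_proj q a b f s" using is_proj_exists'[OF ab L(2)] by blast
  have "is_proj q a b (\<lambda>x. (g x + f x) - f x) (p - s)" by (rule is_proj_diff[OF p s Ltwo_add[OF L] L(2)])
  then have ps: "is_proj q a b g (p - s)" by simp
  have "sqint a b (\<lambda>x. g x + f x - poly p x) = sqint a b (\<lambda>x. (g x - poly (p - s) x) + (f x - poly s x))"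
    by (simp add: algebra_simps)
  also have "\<dots> \<le> 2 * sqint a b (\<lambda>x. g x - poly (p - s) x) + 2 * sqint a b (\<lambda>x. f x - poly s x)"
    by (intro integral_sq_add_le Ltwo_diff L Ltwo_poly)
  also have "\<dots> \<le> 2 * B + 2 * C" using g f s ps unfolding proj_err_le_def by (intro add_mono mult_left_mono) auto
  finally show "sqint a b (\<lambda>x. g x + f x - poly p x) \<le> 2 * B + 2 * C" .
qed

lemma prim_err_le_add:
  assumes ab: "a \<le> b" and g: "prim_err_le q a b g B" and f: "prim_err_le q a b f C"
  shows "prim_err_le q a b (\<lambda>x. g x + f x) (2 * B + 2 * C)"
  unfolding prim_err_le_def
proof (intro conjI allI impI)
  have L: "Ltwo a b g" "Ltwo a b f" using g f by (auto simp: prim_err_le_def)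
  show "Ltwo a b (\<lambda>x. g x + f x)" by (intro Ltwo_add L)
  fix p assume p: "is_proj q a b (\<lambda>x. g x + f x) p"
  obtain s where s: "is_proj q a b f s" using is_proj_exists'[OF ab L(2)] by blast
  have "is_proj q a b (\<lambda>x. (g x + f x) - f x) (p - s)" by (rule is_proj_diff[OF p s Ltwo_add[OF L] L(2)])
  then have ps: "is_proj q a b g (p - s)" by simp
  have L2: "Ltwo a b (\<lambda>x. g x - poly (p - s) x)" "Ltwo a b (\<lambda>x. f x - poly s x)" by (intro Ltwo_diff L Ltwo_poly)+
  have "sqint a b (\<lambda>x. integral {a..x} (\<lambda>x. g x + f x - poly p x))
     = sqint a b (\<lambda>x. integral {a..x} (\<lambda>x. g x - poly (p - s) x) + integral {a..x} (\<lambda>x. f x - poly s x))"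
  proof (rule Henstock_Kurzweil_Integration.integral_cong)
    fix x assume x: "x \<in> {a..b}"
    have "integral {a..x} (\<lambda>x. g x + f x - poly p x) = integral {a..x} (\<lambda>x. (g x - poly (p - s) x) + (f x - poly s x))"
      by (simp add: algebra_simps)
    also have "\<dots> = integral {a..x} (\<lambda>x. g x - poly (p - s) x) + integral {a..x} (\<lambda>x. f x - poly s x)"
      using x L2 by (intro integral_add) (auto simp: Ltwo_def intro: integrable_subinterval_real)
    finally show "(integral {a..x} (\<lambda>x. g x + f x - poly p x))\<^sup>2 =
      (integral {a..x} (\<lambda>x. g x - poly (p - s) x) + integral {a..x} (\<lambda>x. f x - poly s x))\<^sup>2" by simp
  qed
  also have "\<dots> \<le> 2 * sqint a b (\<lambda>x. integral {a..x} (\<lambda>x. g x - poly (p - s) x))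
      + 2 * sqint a b (\<lambda>x. integral {a..x} (\<lambda>x. f x - poly s x))"
    by (intro integral_sq_add_le Ltwo_indef L2)
  also have "\<dots> \<le> 2 * B + 2 * C" using g f s ps unfolding prim_err_le_def by (intro add_mono mult_left_mono) auto
  finally show "sqint a b (\<lambda>x. integral {a..x} (\<lambda>x. g x + f x - poly p x)) \<le> 2 * B + 2 * C" .
qed

lemma proj_err_le_spike:
  assumes "proj_err_le q a b g B" "negligible S" "\<And>x. x \<in> {a..b} - S \<Longrightarrow> f x = g x"
  shows "proj_err_le q a b f B"
  unfolding proj_err_le_def
proof (intro conjI allI impI)
  show "Ltwo a b f" using Ltwo_spike[OF _ assms(2)] assms(1,3) unfolding proj_err_le_def by blast
  fix p assume "is_proj q a b f p"
  then have "is_proj q a b g p" by (rule is_proj_spike[OF _ assms(2)]) (simp add: assms(3))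
  then have "sqint a b (\<lambda>x. g x - poly p x) \<le> B" using assms(1) unfolding proj_err_le_def by blast
  moreover have "sqint a b (\<lambda>x. f x - poly p x) = sqint a b (\<lambda>x. g x - poly p x)"
    by (rule integral_spike[OF assms(2)]) (simp add: assms(3))
  ultimately show "sqint a b (\<lambda>x. f x - poly p x) \<le> B" by simp
qed

lemma prim_err_le_spike:
  assumes "prim_err_le q a b g B" "negligible S" "\<And>x. x \<in> {a..b} - S \<Longrightarrow> f x = g x"
  shows "prim_err_le q a b f B"
  unfolding prim_err_le_def
proof (intro conjI allI impI)
  show "Ltwo a b f" using Ltwo_spike[OF _ assms(2)] assms(1,3) unfolding prim_err_le_def by blast
  fix p assume "is_proj q a b f p"
  then have "is_proj q a b g p" by (rule is_proj_spike[OF _ assms(2)]) (simp add: assms(3))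
  then have "sqint a b (\<lambda>x. integral {a..x} (\<lambda>x. g x - poly p x)) \<le> B" using assms(1) unfolding prim_err_le_def by blast
  moreover have "sqint a b (\<lambda>x. integral {a..x} (\<lambda>x. f x - poly p x)) = sqint a b (\<lambda>x. integral {a..x} (\<lambda>x. g x - poly p x))"
  proof (rule Henstock_Kurzweil_Integration.integral_cong)
    fix x assume x: "x \<in> {a..b}"
    have "integral {a..x} (\<lambda>x. f x - poly p x) = integral {a..x} (\<lambda>x. g x - poly p x)"
      by (rule integral_spike[OF assms(2)]) (use x assms(3) in simp)
    then show "(integral {a..x} (\<lambda>x. f x - poly p x))\<^sup>2 = (integral {a..x} (\<lambda>x. g x - poly p x))\<^sup>2" by simp
  qed
  ultimately show "sqint a b (\<lambda>x. integral {a..x} (\<lambda>x. f x - poly p x)) \<le> B" by simp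
qed

lemma proj_err_le_chain:
  assumes "a \<le> b" "Ltwo a b (g 0)" "n \<le> q" "\<And>j. j < n \<Longrightarrow> wderiv_on a b (g j) (g (Suc j))"
  shows "proj_err_le q a b (g 0) ((b - a) ^ (2 * n) * sqint a b (g n))"
  unfolding proj_err_le_def
proof (intro conjI allI impI)
  fix p assume "is_proj q a b (g 0) p"
  then show "sqint a b (\<lambda>x. g 0 x - poly p x) \<le> (b - a) ^ (2 * n) * sqint a b (g n)"
    by (rule is_proj_chain[where g = g]) (use assms in auto)
qed (rule assms)

lemma prim_err_le_chain:
  assumes "a \<le> b" "Ltwo a b (g 0)" "n \<le> q" "\<And>j. j < n \<Longrightarrow> wderiv_on a b (g j) (g (Suc j))"
  shows "prim_err_le q a b (g 0) ((b - a) ^ (2 * n + 2) * sqint a b (g n))"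
  unfolding prim_err_le_def
proof (intro conjI allI impI)
  fix p assume p: "is_proj q a b (g 0) p"
  have L: "Ltwo a b (\<lambda>x. g 0 x - poly p x)" by (intro Ltwo_diff assms Ltwo_poly)
  have A: "AC a b (\<lambda>x. 0 + integral {a..x} (\<lambda>x. g 0 x - poly p x)) (\<lambda>x. g 0 x - poly p x)"
    by (rule AC_indef[OF Ltwo_absint[OF L]])
  have "sqint a b (\<lambda>x. integral {a..x} (\<lambda>x. g 0 x - poly p x)) \<le> (b - a)\<^sup>2 * sqint a b (\<lambda>x. g 0 x - poly p x)"
    using AC_Poincare[OF A L] assms(1) by simp
  also have "\<dots> \<le> (b - a)\<^sup>2 * ((b - a) ^ (2 * n) * sqint a b (g n))"
    using is_proj_chain[OF p assms] by (intro mult_left_mono) auto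
  also have "\<dots> = (b - a) ^ (2 * n + 2) * sqint a b (g n)"
    by (simp only: power_add mult_ac)
  finally show "sqint a b (\<lambda>x. integral {a..x} (\<lambda>x. g 0 x - poly p x)) \<le> (b - a) ^ (2 * n + 2) * sqint a b (g n)" .
qed (rule assms)

lemma prim_err_le_L1:
  "\<exists>C>0. \<forall>a b g. a \<le> b \<longrightarrow> Ltwo a b g \<longrightarrow> prim_err_le q a b g ((b - a) * (C * (integral {a..b} (\<lambda>x. \<bar>g x\<bar>))\<^sup>2))"
proof -
  obtain C where C: "C > 0" "\<forall>a b g p x. a < b \<longrightarrow> Ltwo a b g \<longrightarrow> is_proj q a b g p \<longrightarrow> x \<in> {a..b} \<longrightarrow>
     (integral {a..x} (\<lambda>x. g x - poly p x))\<^sup>2 \<le> C * (integral {a..b} (\<lambda>x. \<bar>g x\<bar>))\<^sup>2"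
    using is_proj_L1 by blast
  show ?thesis
  proof (intro exI[of _ C] conjI allI impI C(1))
    fix a b :: real and g :: "real \<Rightarrow> real" assume ab: "a \<le> b" and L: "Ltwo a b g"
    show "prim_err_le q a b g ((b - a) * (C * (integral {a..b} (\<lambda>x. \<bar>g x\<bar>))\<^sup>2))"
      unfolding prim_err_le_def
    proof (intro conjI allI impI L)
      fix p assume p: "is_proj q a b g p"
      show "sqint a b (\<lambda>x. integral {a..x} (\<lambda>x. g x - poly p x)) \<le> (b - a) * (C * (integral {a..b} (\<lambda>x. \<bar>g x\<bar>))\<^sup>2)"
      proof (cases "a = b")
        case False
        have "sqint a b (\<lambda>x. integral {a..x} (\<lambda>x. g x - poly p x)) \<le> integral {a..b} (\<lambda>x. C * (integral {a..b} (\<lambda>x. \<bar>g x\<bar>))\<^sup>2)"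
        proof (rule integral_le)
          show "(\<lambda>x. (integral {a..x} (\<lambda>x. g x - poly p x))\<^sup>2) integrable_on {a..b}"
            by (intro Ltwo_sq_int Ltwo_indef Ltwo_diff L Ltwo_poly)
        qed (use C p False ab L in auto)
        then show ?thesis using ab by (simp add: mult_ac)
      qed simp
    qed
  qed
qed

lemma integral_sq_le_weight:
  assumes "Ltwo a b g" "continuous_on {a..b} e" "\<And>x. a < x \<Longrightarrow> x < b \<Longrightarrow> \<bar>g x\<bar> \<le> c * e x"
  shows "sqint a b g \<le> c\<^sup>2 * sqint a b e"
proof -
  have i: "(\<lambda>x. (g x)\<^sup>2) integrable_on {a<..<b}" "(\<lambda>x. c\<^sup>2 * (e x)\<^sup>2) integrable_on {a<..<b}"
    using Ltwo_sq_int[OF assms(1)] Ltwo_sq_int[OF Ltwo_cont[OF assms(2)]]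
    by (auto simp: integrable_on_open_interval_real intro: integrable_on_mult_right)
  have "integral {a<..<b} (\<lambda>x. (g x)\<^sup>2) \<le> integral {a<..<b} (\<lambda>x. c\<^sup>2 * (e x)\<^sup>2)"
  proof (rule integral_le[OF i])
    fix x assume "x \<in> {a<..<b}"
    then have "\<bar>g x\<bar> \<le> \<bar>c * e x\<bar>" using assms(3)[of x] by auto
    then show "(g x)\<^sup>2 \<le> c\<^sup>2 * (e x)\<^sup>2" by (simp add: abs_le_square_iff power_mult_distrib)
  qed
  then show ?thesis by (simp add: integral_open_interval_real)
qed

lemma integral_abs_le_weight:
  assumes "Ltwo a b g" "continuous_on {a..b} e" "\<And>x. a < x \<Longrightarrow> x < b \<Longrightarrow> \<bar>g x\<bar> \<le> c * e x"
  shows "integral {a..b} (\<lambda>x. \<bar>g x\<bar>) \<le> c * integral {a..b} e"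
proof -
  have i: "(\<lambda>x. \<bar>g x\<bar>) integrable_on {a<..<b}" "(\<lambda>x. c * e x) integrable_on {a<..<b}"
    using Ltwo_absint[OF assms(1)] integrable_continuous_real[OF assms(2)]
    by (auto simp: integrable_on_open_interval_real absolutely_integrable_on_def intro: integrable_on_mult_right)
  have "integral {a<..<b} (\<lambda>x. \<bar>g x\<bar>) \<le> integral {a<..<b} (\<lambda>x. c * e x)"
    by (rule integral_le[OF i]) (use assms(3) in auto)
  then show ?thesis by (simp add: integral_open_interval_real)
qed

lemma integral_weight_sq_le:
  assumes "a \<le> b" "continuous_on {a..b} e" "\<And>x. x \<in> {a..b} \<Longrightarrow> 0 \<le> e x \<and> e x \<le> (E::real)"
  shows "sqint a b e \<le> E\<^sup>2 * (b - a)"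
proof -
  have "sqint a b e \<le> integral {a..b} (\<lambda>x. E\<^sup>2)"
    by (rule integral_le) (use assms in \<open>auto intro!: Ltwo_sq_int Ltwo_cont power_mono\<close>)
  then show ?thesis using assms by (simp add: mult.commute)
qed

text \<open>The width factors are traded against the decay of the layer: \<open>H^(q+1) E \<le> Z^(q+1)\<close> with
  \<open>E \<le> 1\<close> interpolates to the power \<open>q\<close>.\<close>

lemma power_interpolate:
  fixes H E Z :: real
  assumes "H \<ge> 0" "Z \<ge> 0" "0 \<le> E" "E \<le> 1" "H ^ (q + 1) * E \<le> Z ^ (q + 1)"
  shows "H ^ q * E \<le> Z ^ q"
proof (cases "H \<le> Z")
  case True
  have "H ^ q * E \<le> Z ^ q * 1" using True assms by (intro mult_mono power_mono) auto
  then show ?thesis by simp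
next
  case False
  have "H * (H ^ q * E) \<le> Z * Z ^ q" using assms(5) by (simp add: mult_ac)
  also have "\<dots> \<le> H * Z ^ q" using False assms by (intro mult_right_mono) auto
  finally show ?thesis using False assms by simp
qed

text \<open>Only the power q of the width is available for the derivative, while \<open>c\<close> is
  stated for q + 1; \<open>power_interpolate\<close> closes the gap because E \<le> 1. The factor b
  - a is kept so that the bounds sum up over all cells.\<close>

lemma layer_cell_A:
  assumes ab: "a \<le> b" and L: "Ltwo a b (g 0)" and w: "\<And>j. j < q \<Longrightarrow> wderiv_on a b (g j) (g (Suc j))"
    and bd: "\<And>j x. j \<le> q \<Longrightarrow> a < x \<Longrightarrow> x < b \<Longrightarrow> \<bar>g j x\<bar> \<le> K1 * (1 / \<epsilon>) ^ j * e x"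
    and e: "continuous_on {a..b} e" "\<And>x. x \<in> {a..b} \<Longrightarrow> 0 \<le> e x \<and> e x \<le> E" "0 \<le> E" "E \<le> 1"
    and c: "(b - a) ^ (q + 1) * E \<le> (Z * \<epsilon> * r) ^ (q + 1) \<or> E \<le> r ^ (q + 1)"
    and pos: "\<epsilon> > 0" "Z \<ge> 0" "r > 0"
  shows "proj_err_le q a b (g 0) (K1\<^sup>2 * (Z ^ (2 * q) + r\<^sup>2) * r ^ (2 * q) * (b - a))"
proof -
  have Lg: "Ltwo a b (g j)" if "j \<le> q" for j using that L wderiv_on_Ltwo[OF w[of "j - 1"]] by (cases j) auto
  have ie: "sqint a b e \<le> E\<^sup>2 * (b - a)" by (rule integral_weight_sq_le[OF ab e(1,2)])
  have ie0: "sqint a b e \<ge> 0" by (intro integral_nonneg Ltwo_sq_int Ltwo_cont e) auto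
  have nn: "0 \<le> K1\<^sup>2 * Z ^ (2 * q) * r ^ (2 * q) * (b - a)" "0 \<le> K1\<^sup>2 * r\<^sup>2 * r ^ (2 * q) * (b - a)"
    using ab pos by auto
  have *: "K1\<^sup>2 * (Z ^ (2 * q) + r\<^sup>2) * r ^ (2 * q) * (b - a) = K1\<^sup>2 * Z ^ (2 * q) * r ^ (2 * q) * (b - a) + K1\<^sup>2 * r\<^sup>2 * r ^ (2 * q) * (b - a)"
    by (simp add: algebra_simps)
  from c show ?thesis
  proof
    assume c: "(b - a) ^ (q + 1) * E \<le> (Z * \<epsilon> * r) ^ (q + 1)"
    have pq: "(b - a) ^ q * E \<le> (Z * \<epsilon> * r) ^ q"
      by (rule power_interpolate[OF _ _ e(3,4) c]) (use ab pos in auto)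
    have "(b - a) ^ (2 * q) * sqint a b (g q) \<le> (b - a) ^ (2 * q) * ((K1 * (1 / \<epsilon>) ^ q)\<^sup>2 * (E\<^sup>2 * (b - a)))"
      using integral_sq_le_weight[OF Lg[OF order_refl] e(1) bd[OF order_refl]] ie ab
      by (intro mult_left_mono order_trans[OF integral_sq_le_weight[OF Lg[OF order_refl] e(1) bd[OF order_refl]]]) auto
    also have "\<dots> = K1\<^sup>2 * ((1 / \<epsilon>) ^ q)\<^sup>2 * ((b - a) ^ q * E)\<^sup>2 * (b - a)"
      by (simp only: power_mult_distrib power_mult[symmetric] mult_ac)
    also have "\<dots> \<le> K1\<^sup>2 * ((1 / \<epsilon>) ^ q)\<^sup>2 * ((Z * \<epsilon> * r) ^ q)\<^sup>2 * (b - a)"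
      using pq ab e by (intro mult_right_mono mult_left_mono power_mono) auto
    also have "\<dots> = K1\<^sup>2 * (((1 / \<epsilon>) * (Z * \<epsilon> * r)) ^ q)\<^sup>2 * (b - a)"
      by (simp only: power_mult_distrib mult_ac)
    also have "(1 / \<epsilon>) * (Z * \<epsilon> * r) = Z * r" using pos by simp
    also have "K1\<^sup>2 * ((Z * r) ^ q)\<^sup>2 * (b - a) = K1\<^sup>2 * Z ^ (2 * q) * r ^ (2 * q) * (b - a)"
      by (simp only: power_mult_distrib power_mult[symmetric] mult_ac)
    finally show ?thesis
      using nn by (intro proj_err_le_mono[OF proj_err_le_chain[OF ab L order_refl w]]) (auto simp only: *)
  next
    assume c: "E \<le> r ^ (q + 1)"
    have "(b - a) ^ (2 * 0) * sqint a b (g 0) \<le> K1\<^sup>2 * (E\<^sup>2 * (b - a))"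
      using order_trans[OF integral_sq_le_weight[OF L e(1), of "K1"] mult_left_mono[OF ie]] bd[of 0] by simp
    also have "\<dots> \<le> K1\<^sup>2 * ((r ^ (q + 1))\<^sup>2 * (b - a))"
      using c e ab by (intro mult_left_mono mult_right_mono power_mono) auto
    also have "\<dots> = K1\<^sup>2 * r\<^sup>2 * r ^ (2 * q) * (b - a)"
      by (simp add: power_mult_distrib power_mult[symmetric] mult_ac)
    finally show ?thesis
      using nn by (intro proj_err_le_mono[OF proj_err_le_chain[of a b g 0, OF ab L le0]]) (auto simp only: *)
  qed
qed

text \<open>The primitive supplies one more width, so the alternative \<open>c\<close> is used with
  its full power q + 1. On unresolved cells \<open>g 0\<close> is of size 1/\<epsilon>, and the
  integral of the exponential in \<open>ei\<close> gives this \<epsilon> back; that is why the L1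
  bound is needed there.\<close>

lemma layer_cell_T:
  assumes ab: "a \<le> b" and L: "Ltwo a b (g 0)" and w: "\<And>j. j < q \<Longrightarrow> wderiv_on a b (g j) (g (Suc j))"
    and bd: "\<And>j x. j \<le> q \<Longrightarrow> a < x \<Longrightarrow> x < b \<Longrightarrow> \<bar>g j x\<bar> \<le> K1 / \<epsilon> * (1 / \<epsilon>) ^ j * e x"
    and e: "continuous_on {a..b} e" "\<And>x. x \<in> {a..b} \<Longrightarrow> 0 \<le> e x \<and> e x \<le> E" "0 \<le> E"
    and ei: "integral {a..b} e \<le> \<epsilon> / \<beta> * E"
    and c: "(b - a) ^ (q + 1) * E \<le> (Z * \<epsilon> * r) ^ (q + 1) \<or> E \<le> r ^ (q + 1)"
    and pos: "\<epsilon> > 0" "Z \<ge> 0" "r > 0" "\<beta> > 0" "K1 \<ge> 0"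
    and CL: "CL > 0" "prim_err_le q a b (g 0) ((b - a) * (CL * (integral {a..b} (\<lambda>x. \<bar>g 0 x\<bar>))\<^sup>2))"
  shows "prim_err_le q a b (g 0) (K1\<^sup>2 * (Z ^ (2 * q + 2) + CL / \<beta>\<^sup>2) * r ^ (2 * q + 2) * (b - a))"
proof -
  have Lg: "Ltwo a b (g j)" if "j \<le> q" for j using that L wderiv_on_Ltwo[OF w[of "j - 1"]] by (cases j) auto
  have ie: "sqint a b e \<le> E\<^sup>2 * (b - a)" by (rule integral_weight_sq_le[OF ab e(1,2)])
  have nn: "0 \<le> K1\<^sup>2 * Z ^ (2 * q + 2) * r ^ (2 * q + 2) * (b - a)" "0 \<le> K1\<^sup>2 * (CL / \<beta>\<^sup>2) * r ^ (2 * q + 2) * (b - a)"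
    using ab pos CL by auto
  have *: "K1\<^sup>2 * (Z ^ (2 * q + 2) + CL / \<beta>\<^sup>2) * r ^ (2 * q + 2) * (b - a) = K1\<^sup>2 * Z ^ (2 * q + 2) * r ^ (2 * q + 2) * (b - a) + K1\<^sup>2 * (CL / \<beta>\<^sup>2) * r ^ (2 * q + 2) * (b - a)"
    by (simp only: distrib_left distrib_right)
  from c show ?thesis
  proof
    assume c: "(b - a) ^ (q + 1) * E \<le> (Z * \<epsilon> * r) ^ (q + 1)"
    have "(b - a) ^ (2 * q + 2) * sqint a b (g q) \<le> (b - a) ^ (2 * q + 2) * ((K1 / \<epsilon> * (1 / \<epsilon>) ^ q)\<^sup>2 * (E\<^sup>2 * (b - a)))"
      using ie ab
      by (intro mult_left_mono order_trans[OF integral_sq_le_weight[OF Lg[OF order_refl] e(1) bd[OF order_refl]]]) auto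
    also have "\<dots> = K1\<^sup>2 * ((1 / \<epsilon>) ^ (q + 1))\<^sup>2 * ((b - a) ^ (q + 1) * E)\<^sup>2 * (b - a)"
    proof -
      have "K1 / \<epsilon> * (1 / \<epsilon>) ^ q = K1 * (1 / \<epsilon>) ^ (q + 1)" by simp
      moreover have "(b - a) ^ (2 * q + 2) = ((b - a) ^ (q + 1))\<^sup>2" by (simp only: power_mult[symmetric]) (simp add: algebra_simps)
      ultimately show ?thesis by (simp only: power_mult_distrib mult_ac)
    qed
    also have "\<dots> \<le> K1\<^sup>2 * ((1 / \<epsilon>) ^ (q + 1))\<^sup>2 * ((Z * \<epsilon> * r) ^ (q + 1))\<^sup>2 * (b - a)"
      using c ab e by (intro mult_right_mono mult_left_mono power_mono) auto
    also have "\<dots> = K1\<^sup>2 * (((1 / \<epsilon>) * (Z * \<epsilon> * r)) ^ (q + 1))\<^sup>2 * (b - a)"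
      by (simp only: power_mult_distrib mult_ac)
    also have "(1 / \<epsilon>) * (Z * \<epsilon> * r) = Z * r" using pos by simp
    also have "K1\<^sup>2 * ((Z * r) ^ (q + 1))\<^sup>2 * (b - a) = K1\<^sup>2 * Z ^ (2 * q + 2) * r ^ (2 * q + 2) * (b - a)"
    proof -
      have "(q + 1) * 2 = 2 * q + 2" by simp
      then show ?thesis by (simp only: power_mult_distrib power_mult[symmetric] mult.assoc)
    qed
    finally show ?thesis
      using nn by (intro prim_err_le_mono[OF prim_err_le_chain[OF ab L order_refl w]]) (auto simp only: *)
  next
    assume c: "E \<le> r ^ (q + 1)"
    have "integral {a..b} (\<lambda>x. \<bar>g 0 x\<bar>) \<le> K1 / \<epsilon> * integral {a..b} e"
      by (rule integral_abs_le_weight[OF L e(1)]) (use bd[of 0] in auto)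
    also have "\<dots> \<le> K1 / \<epsilon> * (\<epsilon> / \<beta> * E)" using ei pos by (intro mult_left_mono) auto
    also have "\<dots> = K1 / \<beta> * E" using pos by simp
    also have "\<dots> \<le> K1 / \<beta> * r ^ (q + 1)" using c pos by (intro mult_left_mono) auto
    finally have I: "integral {a..b} (\<lambda>x. \<bar>g 0 x\<bar>) \<le> K1 / \<beta> * r ^ (q + 1)" .
    have I0: "integral {a..b} (\<lambda>x. \<bar>g 0 x\<bar>) \<ge> 0"
      using Ltwo_absint[OF L] by (intro integral_nonneg) (auto simp: absolutely_integrable_on_def)
    have "(b - a) * (CL * (integral {a..b} (\<lambda>x. \<bar>g 0 x\<bar>))\<^sup>2) \<le> (b - a) * (CL * (K1 / \<beta> * r ^ (q + 1))\<^sup>2)"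
      using I I0 ab CL by (intro mult_left_mono power_mono) auto
    also have "\<dots> = K1\<^sup>2 * (CL / \<beta>\<^sup>2) * r ^ (2 * q + 2) * (b - a)"
    proof -
      have "(r ^ (q + 1))\<^sup>2 = r ^ (2 * q + 2)" by (simp only: power_mult[symmetric]) (simp add: algebra_simps)
      then show ?thesis by (simp only: power_mult_distrib power_divide) simp
    qed
    finally show ?thesis using nn by (intro prim_err_le_mono[OF CL(2)]) (auto simp only: *)
  qed
qed

lemma integral_exp_affine:
  fixes a b \<alpha> \<gamma> :: real
  assumes "a \<le> b" "\<alpha> \<noteq> 0"
  shows "integral {a..b} (\<lambda>x. exp (\<alpha> * x + \<gamma>)) = (exp (\<alpha> * b + \<gamma>) - exp (\<alpha> * a + \<gamma>)) / \<alpha>"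
proof -
  have "((\<lambda>x. exp (\<alpha> * x + \<gamma>)) has_integral exp (\<alpha> * b + \<gamma>) / \<alpha> - exp (\<alpha> * a + \<gamma>) / \<alpha>) {a..b}"
  proof (rule fundamental_theorem_of_calculus[OF assms(1)])
    fix x
    have "((\<lambda>x. exp (\<alpha> * x + \<gamma>) / \<alpha>) has_real_derivative exp (\<alpha> * x + \<gamma>) * \<alpha> / \<alpha>) (at x within {a..b})"
      by (auto intro!: derivative_eq_intros)
    then show "((\<lambda>x. exp (\<alpha> * x + \<gamma>) / \<alpha>) has_vector_derivative exp (\<alpha> * x + \<gamma>)) (at x within {a..b})"
      using assms(2) by (simp add: has_real_derivative_iff_has_vector_derivative)
  qed
  then show ?thesis by (simp add: integral_unique diff_divide_distrib)
qed

text \<open>The exponent on the left is $\beta\mu/\varepsilon$, the decay of the weak layers at distance $\mu$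
  from \<open>x = 1\<close>.\<close>

lemma exp_decay_dominated:
  assumes "q \<ge> (3::nat)"
  shows "\<exists>C>0. \<forall>\<epsilon>>0. exp (- (\<epsilon> powr (- (5 / (2 * (real q + 1)))))) \<le> C * \<epsilon> * exp (- (\<epsilon> powr (- 1 / real q)))"
proof -
  define C where "C = 4 ^ q * exp 4 + (fact q :: real)"
  show ?thesis
  proof (intro exI[of _ C] conjI allI impI)
    show "C > 0" by (simp add: C_def add_pos_pos)
    fix \<epsilon> :: real assume \<epsilon>: "\<epsilon> > 0"
    define t where "t = \<epsilon> powr (- 1 / real q)"
    \<comment> \<open>In terms of t the claim is t^q e^t \<le> C e^(t^s). Since s \<ge> 3/2, t^s
      exceeds 2t beyond t = 4, and e^(-2t) absorbs both e^t and t^q \<le> q! e^t. The two summands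
      of \<open>C\<close> belong to the two ranges of t.\<close>
    define s where "s = 5 * real q / (2 * (real q + 1))"
    have t: "t > 0" using \<epsilon> by (simp add: t_def)
    have s: "s \<ge> 3 / 2" using assms by (simp add: s_def field_simps)
    have "t powr s = \<epsilon> powr (- (5 / (2 * (real q + 1))))"
      using assms by (simp add: t_def s_def powr_powr field_simps)
    moreover have "exp (- (t powr s)) * (t ^ q * exp t) \<le> C"
    proof (cases "t \<le> 4")
      case True
      have "exp (- (t powr s)) * (t ^ q * exp t) \<le> 1 * (4 ^ q * exp 4)"
        using True t by (intro mult_mono power_mono) auto
      also have "\<dots> \<le> C" by (simp add: C_def)
      finally show ?thesis .
    next
      case False
      have "t * 2 \<le> t * sqrt t" using False by (intro mult_left_mono real_le_rsqrt) auto
      also have "\<dots> = t powr (1 + 1 / 2)" using t by (simp only: powr_add powr_half_sqrt) simp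
      also have "\<dots> \<le> t powr s" using s False by (intro powr_mono) auto
      finally have 1: "2 * t \<le> t powr s" by simp
      have "t ^ q / fact q \<le> exp t"
      proof -
        have "(\<Sum>n\<in>{q}. t ^ n /\<^sub>R fact n) \<le> (\<Sum>n. t ^ n /\<^sub>R fact n)"
          by (rule sum_le_suminf[OF summable_exp_generic]) (use t in auto)
        then show ?thesis by (simp add: exp_def divide_inverse mult.commute)
      qed
      then have 2: "t ^ q \<le> fact q * exp t" by (simp add: field_simps)
      have "exp (- (t powr s)) * (t ^ q * exp t) \<le> exp (- (2 * t)) * ((fact q * exp t) * exp t)"
        using 1 2 t by (intro mult_mono) auto
      also have "\<dots> = fact q" by (simp add: exp_minus field_simps flip: exp_add)
      also have "\<dots> \<le> C" by (simp add: C_def)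
      finally show ?thesis .
    qed
    ultimately have "exp (- (\<epsilon> powr (- (5 / (2 * (real q + 1)))))) * (t ^ q * exp t) * (\<epsilon> * exp (- t)) \<le> C * (\<epsilon> * exp (- t))"
      using \<epsilon> by (intro mult_right_mono) auto
    then have "exp (- (\<epsilon> powr (- (5 / (2 * (real q + 1)))))) * (t ^ q * exp t * (\<epsilon> * exp (- t))) \<le> C * (\<epsilon> * exp (- t))"
      by (simp only: mult.assoc)
    moreover have "t ^ q * exp t * (\<epsilon> * exp (- t)) = t ^ q * \<epsilon>" by (simp add: exp_minus)
    moreover have "t ^ q * \<epsilon> = 1"
    proof -
      have "t ^ q = \<epsilon> powr (- 1)" using assms t by (simp add: t_def powr_powr flip: powr_realpow)
      then show ?thesis using \<epsilon> by (simp add: powr_minus)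
    qed
    ultimately have "exp (- (\<epsilon> powr (- (5 / (2 * (real q + 1)))))) \<le> C * (\<epsilon> * exp (- t))" by simp
    then show "exp (- (\<epsilon> powr (- (5 / (2 * (real q + 1)))))) \<le> C * \<epsilon> * exp (- (\<epsilon> powr (- 1 / real q)))"
      by (simp only: t_def mult.assoc)
  qed
qed

section \<open>Error contributions of the boundary layers and of the weak layers\<close>

context stype_mesh
begin

lemma cell_interior:
  assumes "i \<in> {1..N}" "X (i - 1) < x" "x < X i" shows "x \<in> {0<..<2} - {1}"
  using half_cells[OF assms(1)] mesh.cell_bounds[OF mesh assms(1)] assms X_ends by auto

lemma cell_in: "i \<in> {1..N} \<Longrightarrow> 0 \<le> X (i - 1) \<and> X (i - 1) \<le> X i \<and> X i \<le> 2"
  using mesh.cell_bounds[OF mesh] mesh.step[OF mesh] X_ends by auto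

lemma sum_cells:
  fixes f :: "real \<Rightarrow> real"
  assumes "f integrable_on {0..2}"
  shows "(\<Sum>i\<in>{1..N}. integral {X (i - 1)..X i} f) = integral {0..2} f"
  using mesh.integral_cells[OF mesh, of f] assms X_ends by simp

lemma sum_widths: "(\<Sum>i\<in>{1..N}. X i - X (i - 1)) = 2"
proof -
  have "(\<Sum>i\<in>{1..N}. X i - X (i - 1)) = (\<Sum>i\<in>{1..N}. integral {X (i - 1)..X i} (\<lambda>x. 1))"
    by (intro sum.cong refl) (use cell_in in simp)
  also have "\<dots> = integral {0..2} (\<lambda>x::real. 1::real)" by (rule sum_cells) auto
  finally show ?thesis by simp
qed

lemma width_r: "i \<in> {1..N} \<Longrightarrow> X i - X (i - 1) \<le> 4 * r"
  by (rule order_trans[OF width_le mult_left_mono[OF r_ge(1)]]) auto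

text \<open>\<open>g 0\<close> is the first derivative of a component, so q links exhaust the q + 1
  derivatives of the decomposition. The chain is required cell by cell, which admits breaks at the
  node x = 1.\<close>

definition deriv_chain :: "(nat \<Rightarrow> real \<Rightarrow> real) \<Rightarrow> bool" where
  "deriv_chain g \<longleftrightarrow> (\<forall>i\<in>{1..N}. Ltwo (X (i - 1)) (X i) (g 0) \<and> (\<forall>j<q. wderiv_on (X (i - 1)) (X i) (g j) (g (Suc j))))"

lemma deriv_chain_wderiv_on: "deriv_chain g \<Longrightarrow> i \<in> {1..N} \<Longrightarrow> j < q \<Longrightarrow> wderiv_on (X (i - 1)) (X i) (g j) (g (Suc j))"
  unfolding deriv_chain_def by auto

lemma deriv_chain_Ltwo:
  assumes "deriv_chain g" "i \<in> {1..N}" "j \<le> q" shows "Ltwo (X (i - 1)) (X i) (g j)"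
proof (cases j)
  case 0 then show ?thesis using assms unfolding deriv_chain_def by auto
next
  case (Suc j')
  then show ?thesis using wderiv_on_Ltwo[OF deriv_chain_wderiv_on[OF assms(1,2), of j']] assms(3) by simp
qed

text \<open>The summand 1 makes it a bound of \<epsilon>^0 as well as of \<epsilon>, as the cases m
  = 1 and m = 2 require.\<close>

definition eps_bd where "eps_bd = 1 + \<beta> / (4 * \<sigma>)"

lemma eps_bd: "eps_bd \<ge> 1" "\<epsilon> \<le> eps_bd"
  using eps_le \<beta> \<sigma> by (auto simp: eps_bd_def)

lemma left_A:
  assumes ch: "deriv_chain g" and bd: "\<And>j x. j \<le> q \<Longrightarrow> x \<in> {0<..<2} - {1} \<Longrightarrow> \<bar>g j x\<bar> \<le> K1 * (1 / \<epsilon>) ^ j * exp (- \<beta> * x / \<epsilon>)"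
    and i: "i \<in> {1..N}"
  shows "proj_err_le q (X (i - 1)) (X i) (g 0) (K1\<^sup>2 * (Cf ^ (2 * q) + r\<^sup>2) * r ^ (2 * q) * (X i - X (i - 1)))"
proof (rule layer_cell_A[where g = g and e = "\<lambda>x. exp (- \<beta> * x / \<epsilon>)", OF _ _ deriv_chain_wderiv_on[OF ch i] _ _ _ _ _ left_layer_cell[OF i] \<epsilon>])
  show "continuous_on {X (i - 1)..X i} (\<lambda>x. exp (- \<beta> * x / \<epsilon>))" using \<epsilon> by (intro continuous_intros) auto
  show "0 \<le> exp (- \<beta> * x / \<epsilon>) \<and> exp (- \<beta> * x / \<epsilon>) \<le> exp (- \<beta> * X (i - 1) / \<epsilon>)" if "x \<in> {X (i - 1)..X i}" for x
    using that \<beta> \<epsilon> by (auto simp: divide_right_mono)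
  show "exp (- \<beta> * X (i - 1) / \<epsilon>) \<le> 1" using cell_in[OF i] \<beta> \<epsilon> by simp
  show "Ltwo (X (i - 1)) (X i) (g 0)" using deriv_chain_Ltwo[OF ch i] by simp
qed (use cell_in[OF i] bd cell_interior[OF i] r_ge \<sigma> \<beta> in \<open>auto simp: Cf_def\<close>)

lemma right_A:
  assumes ch: "deriv_chain g" and bd: "\<And>j x. j \<le> q \<Longrightarrow> x \<in> {0<..<2} - {1} \<Longrightarrow> \<bar>g j x\<bar> \<le> K1 * (1 / \<epsilon>) ^ j * exp (- \<beta> * (2 - x) / \<epsilon>)"
    and i: "i \<in> {1..N}"
  shows "proj_err_le q (X (i - 1)) (X i) (g 0) (K1\<^sup>2 * (Cf ^ (2 * q) + r\<^sup>2) * r ^ (2 * q) * (X i - X (i - 1)))"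
proof (rule layer_cell_A[where g = g and e = "\<lambda>x. exp (- \<beta> * (2 - x) / \<epsilon>)", OF _ _ deriv_chain_wderiv_on[OF ch i] _ _ _ _ _ right_layer_cell[OF i] \<epsilon>])
  show "continuous_on {X (i - 1)..X i} (\<lambda>x. exp (- \<beta> * (2 - x) / \<epsilon>))" using \<epsilon> by (intro continuous_intros) auto
  show "0 \<le> exp (- \<beta> * (2 - x) / \<epsilon>) \<and> exp (- \<beta> * (2 - x) / \<epsilon>) \<le> exp (- \<beta> * (2 - X i) / \<epsilon>)" if "x \<in> {X (i - 1)..X i}" for x
    using that \<beta> \<epsilon> by (auto simp: divide_right_mono)
  show "exp (- \<beta> * (2 - X i) / \<epsilon>) \<le> 1" using cell_in[OF i] \<beta> \<epsilon> by simp
  show "Ltwo (X (i - 1)) (X i) (g 0)" using deriv_chain_Ltwo[OF ch i] by simp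
qed (use cell_in[OF i] bd cell_interior[OF i] r_ge \<sigma> \<beta> in \<open>auto simp: Cf_def\<close>)

lemma left_T:
  assumes ch: "deriv_chain g" and bd: "\<And>j x. j \<le> q \<Longrightarrow> x \<in> {0<..<2} - {1} \<Longrightarrow> \<bar>g j x\<bar> \<le> K1 / \<epsilon> * (1 / \<epsilon>) ^ j * exp (- \<beta> * x / \<epsilon>)"
    and i: "i \<in> {1..N}" and K1: "K1 \<ge> 0"
    and CL: "CL > 0" "\<And>a b g. a \<le> b \<Longrightarrow> Ltwo a b g \<Longrightarrow> prim_err_le q a b g ((b - a) * (CL * (integral {a..b} (\<lambda>x. \<bar>g x\<bar>))\<^sup>2))"
  shows "prim_err_le q (X (i - 1)) (X i) (g 0) (K1\<^sup>2 * (Cf ^ (2 * q + 2) + CL / \<beta>\<^sup>2) * r ^ (2 * q + 2) * (X i - X (i - 1)))"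
proof (rule layer_cell_T[where g = g and e = "\<lambda>x. exp (- \<beta> * x / \<epsilon>)", OF _ _ deriv_chain_wderiv_on[OF ch i] _ _ _ _ _ left_layer_cell[OF i] \<epsilon> _ _ \<beta> K1 CL(1) CL(2)])
  show "continuous_on {X (i - 1)..X i} (\<lambda>x. exp (- \<beta> * x / \<epsilon>))" using \<epsilon> by (intro continuous_intros) auto
  show "0 \<le> exp (- \<beta> * x / \<epsilon>) \<and> exp (- \<beta> * x / \<epsilon>) \<le> exp (- \<beta> * X (i - 1) / \<epsilon>)" if "x \<in> {X (i - 1)..X i}" for x
    using that \<beta> \<epsilon> by (auto simp: divide_right_mono)
  show "Ltwo (X (i - 1)) (X i) (g 0)" using deriv_chain_Ltwo[OF ch i] by simp
  then show "Ltwo (X (i - 1)) (X i) (g 0)" .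
  have "integral {X (i - 1)..X i} (\<lambda>x. exp (- \<beta> * x / \<epsilon>)) = integral {X (i - 1)..X i} (\<lambda>x. exp ((- \<beta> / \<epsilon>) * x + 0))" by simp
  also have "\<dots> = (exp ((- \<beta> / \<epsilon>) * X i + 0) - exp ((- \<beta> / \<epsilon>) * X (i - 1) + 0)) / (- \<beta> / \<epsilon>)"
    by (rule integral_exp_affine) (use cell_in[OF i] \<beta> \<epsilon> in auto)
  also have "\<dots> = \<epsilon> / \<beta> * exp (- \<beta> * X (i - 1) / \<epsilon>) - \<epsilon> / \<beta> * exp (- \<beta> * X i / \<epsilon>)"
    using \<beta> \<epsilon> by (simp add: field_simps)
  also have "\<dots> \<le> \<epsilon> / \<beta> * exp (- \<beta> * X (i - 1) / \<epsilon>)" using \<beta> \<epsilon> by simp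
  finally show "integral {X (i - 1)..X i} (\<lambda>x. exp (- \<beta> * x / \<epsilon>)) \<le> \<epsilon> / \<beta> * exp (- \<beta> * X (i - 1) / \<epsilon>)" .
qed (use cell_in[OF i] bd cell_interior[OF i] r_ge \<sigma> \<beta> in \<open>auto simp: Cf_def\<close>)

lemma right_T:
  assumes ch: "deriv_chain g" and bd: "\<And>j x. j \<le> q \<Longrightarrow> x \<in> {0<..<2} - {1} \<Longrightarrow> \<bar>g j x\<bar> \<le> K1 / \<epsilon> * (1 / \<epsilon>) ^ j * exp (- \<beta> * (2 - x) / \<epsilon>)"
    and i: "i \<in> {1..N}" and K1: "K1 \<ge> 0"
    and CL: "CL > 0" "\<And>a b g. a \<le> b \<Longrightarrow> Ltwo a b g \<Longrightarrow> prim_err_le q a b g ((b - a) * (CL * (integral {a..b} (\<lambda>x. \<bar>g x\<bar>))\<^sup>2))"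
  shows "prim_err_le q (X (i - 1)) (X i) (g 0) (K1\<^sup>2 * (Cf ^ (2 * q + 2) + CL / \<beta>\<^sup>2) * r ^ (2 * q + 2) * (X i - X (i - 1)))"
proof (rule layer_cell_T[where g = g and e = "\<lambda>x. exp (- \<beta> * (2 - x) / \<epsilon>)", OF _ _ deriv_chain_wderiv_on[OF ch i] _ _ _ _ _ right_layer_cell[OF i] \<epsilon> _ _ \<beta> K1 CL(1) CL(2)])
  show "continuous_on {X (i - 1)..X i} (\<lambda>x. exp (- \<beta> * (2 - x) / \<epsilon>))" using \<epsilon> by (intro continuous_intros) auto
  show "0 \<le> exp (- \<beta> * (2 - x) / \<epsilon>) \<and> exp (- \<beta> * (2 - x) / \<epsilon>) \<le> exp (- \<beta> * (2 - X i) / \<epsilon>)" if "x \<in> {X (i - 1)..X i}" for x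
    using that \<beta> \<epsilon> by (auto simp: divide_right_mono)
  show "Ltwo (X (i - 1)) (X i) (g 0)" using deriv_chain_Ltwo[OF ch i] by simp
  then show "Ltwo (X (i - 1)) (X i) (g 0)" .
  have ex: "- \<beta> * (2 - x) / \<epsilon> = \<beta> / \<epsilon> * x + (- 2 * \<beta> / \<epsilon>)" for x using \<epsilon> by (simp add: field_simps)
  have "integral {X (i - 1)..X i} (\<lambda>x. exp (- \<beta> * (2 - x) / \<epsilon>)) = (exp (\<beta> / \<epsilon> * X i + (- 2 * \<beta> / \<epsilon>)) - exp (\<beta> / \<epsilon> * X (i - 1) + (- 2 * \<beta> / \<epsilon>))) / (\<beta> / \<epsilon>)"
    unfolding ex by (rule integral_exp_affine) (use cell_in[OF i] \<beta> \<epsilon> in auto)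
  also have "\<dots> = \<epsilon> / \<beta> * exp (- \<beta> * (2 - X i) / \<epsilon>) - \<epsilon> / \<beta> * exp (- \<beta> * (2 - X (i - 1)) / \<epsilon>)"
    unfolding ex using \<beta> \<epsilon> by (simp add: field_simps)
  also have "\<dots> \<le> \<epsilon> / \<beta> * exp (- \<beta> * (2 - X i) / \<epsilon>)" using \<beta> \<epsilon> by simp
  finally show "integral {X (i - 1)..X i} (\<lambda>x. exp (- \<beta> * (2 - x) / \<epsilon>)) \<le> \<epsilon> / \<beta> * exp (- \<beta> * (2 - X i) / \<epsilon>)" .
qed (use cell_in[OF i] bd cell_interior[OF i] r_ge \<sigma> \<beta> in \<open>auto simp: Cf_def\<close>)

text \<open>One weight for the layers on both sides of x = 1, so that they can be treated as a
  single function.\<close>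

definition int_weight where "int_weight x = exp (- \<beta> * \<bar>x - 1\<bar> / \<epsilon>)"

lemma int_weight_cont: "continuous_on S int_weight"
  unfolding int_weight_def[abs_def] using \<epsilon> by (intro continuous_intros) auto

lemma int_weight_bounds: "0 \<le> int_weight x" "int_weight x \<le> 1"
  using \<beta> \<epsilon> by (auto simp: int_weight_def)

text \<open>The weak layers live on a strip of width of order \<epsilon>. This single factor
  \<epsilon> yields the half order in the critical case q = 2 and completes the fifth power of
  \<epsilon> for q > 2.\<close>

lemma int_weight_sq_integral: "sqint 0 2 int_weight \<le> \<epsilon> / \<beta>"
proof -
  have ii: "(\<lambda>x. (int_weight x)\<^sup>2) integrable_on {0..2}" by (intro Ltwo_sq_int Ltwo_cont int_weight_cont)
  have sq: "(int_weight x)\<^sup>2 = exp (- 2 * \<beta> * \<bar>x - 1\<bar> / \<epsilon>)" for x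
    by (simp add: int_weight_def power2_eq_square flip: exp_add)
  have "sqint 0 1 int_weight = integral {0..1} (\<lambda>x. exp ((2 * \<beta> / \<epsilon>) * x + (- 2 * \<beta> / \<epsilon>)))"
    using \<epsilon> by (intro Henstock_Kurzweil_Integration.integral_cong) (auto simp: sq field_simps)
  also have "\<dots> = (exp ((2 * \<beta> / \<epsilon>) * 1 + (- 2 * \<beta> / \<epsilon>)) - exp ((2 * \<beta> / \<epsilon>) * 0 + (- 2 * \<beta> / \<epsilon>))) / (2 * \<beta> / \<epsilon>)"
    by (rule integral_exp_affine) (use \<beta> \<epsilon> in auto)
  also have "\<dots> = \<epsilon> / (2 * \<beta>) * (1 - exp (- 2 * \<beta> / \<epsilon>))" using \<beta> \<epsilon> by (simp add: field_simps)
  also have "\<dots> \<le> \<epsilon> / (2 * \<beta>) * 1" using \<beta> \<epsilon> by (intro mult_left_mono) auto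
  finally have 1: "sqint 0 1 int_weight \<le> \<epsilon> / (2 * \<beta>)" by simp
  have "sqint 1 2 int_weight = integral {1..2} (\<lambda>x. exp ((- 2 * \<beta> / \<epsilon>) * x + (2 * \<beta> / \<epsilon>)))"
    using \<epsilon> by (intro Henstock_Kurzweil_Integration.integral_cong) (auto simp: sq field_simps)
  also have "\<dots> = (exp ((- 2 * \<beta> / \<epsilon>) * 2 + (2 * \<beta> / \<epsilon>)) - exp ((- 2 * \<beta> / \<epsilon>) * 1 + (2 * \<beta> / \<epsilon>))) / (- 2 * \<beta> / \<epsilon>)"
    by (rule integral_exp_affine) (use \<beta> \<epsilon> in auto)
  also have "\<dots> = \<epsilon> / (2 * \<beta>) * (1 - exp ((- 2 * \<beta> / \<epsilon>) * 2 + (2 * \<beta> / \<epsilon>)))" using \<beta> \<epsilon> by (simp add: field_simps)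
  also have "\<dots> \<le> \<epsilon> / (2 * \<beta>) * 1" using \<beta> \<epsilon> by (intro mult_left_mono) auto
  finally have 2: "sqint 1 2 int_weight \<le> \<epsilon> / (2 * \<beta>)" by simp
  have "sqint 0 2 int_weight = sqint 0 1 int_weight + sqint 1 2 int_weight"
    using Henstock_Kurzweil_Integration.integral_combine[of 0 1 2 "\<lambda>x. (int_weight x)\<^sup>2"] ii by simp
  also have "\<dots> \<le> \<epsilon> / (2 * \<beta>) + \<epsilon> / (2 * \<beta>)" by (rule add_mono[OF 1 2])
  also have "\<dots> = \<epsilon> / \<beta>" by simp
  finally show ?thesis .
qed

lemma int_weight_cell_nonneg: "sqint (X (i - 1)) (X i) int_weight \<ge> 0"
  by (intro integral_nonneg Ltwo_sq_int Ltwo_cont int_weight_cont) auto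

lemma int_weight_cell: "i \<in> {1..N} \<Longrightarrow> sqint (X (i - 1)) (X i) int_weight \<le> X i - X (i - 1)"
  using integral_weight_sq_le[of "X (i - 1)" "X i" int_weight 1] int_weight_cont int_weight_bounds cell_in[of i] by simp

lemma int_weight_sum: "(\<Sum>i\<in>{1..N}. sqint (X (i - 1)) (X i) int_weight) \<le> \<epsilon> / \<beta>"
  using sum_cells[of "\<lambda>x. (int_weight x)\<^sup>2"] int_weight_sq_integral by (simp add: Ltwo_sq_int Ltwo_cont int_weight_cont)

lemma weight_A:
  assumes ch: "deriv_chain g" and i: "i \<in> {1..N}" and nq: "nn \<le> q"
    and bd: "\<And>x. x \<in> {0<..<2} - {1} \<Longrightarrow> \<bar>g nn x\<bar> \<le> c * int_weight x" and H: "X i - X (i - 1) \<le> H"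
  shows "proj_err_le q (X (i - 1)) (X i) (g 0) (H ^ (2 * nn) * (c\<^sup>2 * sqint (X (i - 1)) (X i) int_weight))"
proof (rule proj_err_le_mono[OF proj_err_le_chain[where n = nn and g = g]])
  show "(X i - X (i - 1)) ^ (2 * nn) * sqint (X (i - 1)) (X i) (g nn)
    \<le> H ^ (2 * nn) * (c\<^sup>2 * sqint (X (i - 1)) (X i) int_weight)"
  proof (rule mult_mono)
    show "sqint (X (i - 1)) (X i) (g nn) \<le> c\<^sup>2 * sqint (X (i - 1)) (X i) int_weight"
      by (rule integral_sq_le_weight[OF deriv_chain_Ltwo[OF ch i nq] int_weight_cont]) (use bd cell_interior[OF i] in auto)
    show "0 \<le> sqint (X (i - 1)) (X i) (g nn)" by (intro integral_nonneg Ltwo_sq_int deriv_chain_Ltwo[OF ch i nq]) auto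
  qed (use H cell_in[OF i] in \<open>auto intro!: power_mono\<close>)
qed (use cell_in[OF i] nq deriv_chain_Ltwo[OF ch i, of 0] deriv_chain_wderiv_on[OF ch i] in auto)

lemma weight_T:
  assumes ch: "deriv_chain g" and i: "i \<in> {1..N}" and nq: "nn \<le> q"
    and bd: "\<And>x. x \<in> {0<..<2} - {1} \<Longrightarrow> \<bar>g nn x\<bar> \<le> c * int_weight x" and H: "X i - X (i - 1) \<le> H"
  shows "prim_err_le q (X (i - 1)) (X i) (g 0) (H ^ (2 * nn + 2) * (c\<^sup>2 * sqint (X (i - 1)) (X i) int_weight))"
proof (rule prim_err_le_mono[OF prim_err_le_chain[where n = nn and g = g]])
  show "(X i - X (i - 1)) ^ (2 * nn + 2) * sqint (X (i - 1)) (X i) (g nn)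
    \<le> H ^ (2 * nn + 2) * (c\<^sup>2 * sqint (X (i - 1)) (X i) int_weight)"
  proof (rule mult_mono)
    show "sqint (X (i - 1)) (X i) (g nn) \<le> c\<^sup>2 * sqint (X (i - 1)) (X i) int_weight"
      by (rule integral_sq_le_weight[OF deriv_chain_Ltwo[OF ch i nq] int_weight_cont]) (use bd cell_interior[OF i] in auto)
    show "0 \<le> sqint (X (i - 1)) (X i) (g nn)" by (intro integral_nonneg Ltwo_sq_int deriv_chain_Ltwo[OF ch i nq]) auto
    show "(X i - X (i - 1)) ^ (2 * nn + 2) \<le> H ^ (2 * nn + 2)" using H cell_in[OF i] by (intro power_mono) auto
    show "0 \<le> H ^ (2 * nn + 2)" using H cell_in[OF i] by (intro zero_le_power) auto
  qed
qed (use cell_in[OF i] nq deriv_chain_Ltwo[OF ch i, of 0] deriv_chain_wderiv_on[OF ch i] in auto)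

definition R where "R = 1/4 + \<bar>K\<bar>"

lemma r_R: "r \<le> R" using r_le by (simp add: R_def)

lemma R_nonneg: "R \<ge> 0" by (simp add: R_def)

lemma r_pow_Suc: "r ^ (2 * q + 2) \<le> R * r ^ (2 * q + 1)"
  using mult_right_mono[OF r_R, of "r ^ (2 * q + 1)"] r_ge by simp

text \<open>It is at once the decay exponent of the weak layers at distance \<mu> and, up to
  8/\<beta>, the width of the inner cells in units of \<epsilon>/N.\<close>

definition \<rho> where "\<rho> = \<beta> * \<mu> / \<epsilon>"

lemma \<rho>_eq: assumes "q > 2" shows "\<rho> = \<epsilon> powr (- (5 / (2 * (real q + 1))))"
proof -
  have "\<beta> * \<mu> = \<epsilon> powr (1 + - (5 / (2 * (real q + 1))))"
    using assms \<beta> by (simp add: \<mu>_def mesh_mu_def)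
  also have "\<dots> = \<epsilon> * \<epsilon> powr (- (5 / (2 * (real q + 1))))"
    unfolding powr_add using \<epsilon> by simp
  finally show ?thesis using \<epsilon> by (simp add: \<rho>_def)
qed

lemma \<rho>_pos: "\<rho> > 0" using \<beta> \<epsilon> mu_bounds by (simp add: \<rho>_def)

text \<open>The origin of the exponent in \<mu>. In the squared error of w the inner cells
  contribute (\<epsilon>\<rho>/N)^(2q+2), the q-th member of the chain \<epsilon>^(2-2q), and the
  support of the layer \<epsilon>; all powers of \<epsilon> combine to the fifth.\<close>

lemma \<rho>_power: assumes "q > 2" shows "\<rho> ^ (2 * q + 2) * \<epsilon> ^ 5 = 1"
proof -
  have "\<rho> ^ (2 * q + 2) = \<rho> powr real (2 * q + 2)" by (rule powr_realpow[OF \<rho>_pos, symmetric])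
  also have "\<dots> = \<epsilon> powr (- (5 / (2 * (real q + 1))) * real (2 * q + 2))"
    by (simp only: \<rho>_eq[OF assms] powr_powr)
  also have "- (5 / (2 * (real q + 1))) * real (2 * q + 2) = - 5"
    by (simp add: field_simps)
  also have "\<epsilon> powr (- 5) = 1 / \<epsilon> ^ 5" using \<epsilon> by (simp add: powr_minus inverse_eq_divide)
  finally show ?thesis using \<epsilon> by simp
qed

lemma \<rho>_inverse: assumes "q > 2" shows "1 / \<rho> \<le> eps_bd"
proof -
  have "1 / \<rho> = \<epsilon> powr (5 / (2 * (real q + 1)))"
    unfolding \<rho>_eq[OF assms] using \<epsilon> by (simp add: powr_minus inverse_eq_divide)
  also have "\<dots> \<le> eps_bd powr (5 / (2 * (real q + 1)))" using \<epsilon> eps_bd by (intro powr_mono2) auto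
  also have "\<dots> \<le> eps_bd powr 1" using eps_bd assms by (intro powr_mono) (auto simp: field_simps)
  finally show ?thesis using eps_bd by simp
qed

definition mesh_size where "mesh_size = h + 1 / real N"

lemma mesh_size: "0 < mesh_size" "mesh_size \<le> r" using r_ge by (auto simp: mesh_size_def)

lemma far_int_weight:
  assumes "X i \<le> 1 - \<mu> \<or> 1 + \<mu> \<le> X (i - 1)" "i \<in> {1..N}"
  shows "sqint (X (i - 1)) (X i) int_weight \<le> (exp (- \<rho>))\<^sup>2 * (X i - X (i - 1))"
proof (rule integral_weight_sq_le[OF _ int_weight_cont])
  fix x assume x: "x \<in> {X (i - 1)..X i}"
  then have "\<mu> \<le> \<bar>x - 1\<bar>" using assms by auto
  then have "\<beta> * \<mu> / \<epsilon> \<le> \<beta> * \<bar>x - 1\<bar> / \<epsilon>" using \<beta> \<epsilon> by (intro divide_right_mono mult_left_mono) auto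
  then show "0 \<le> int_weight x \<and> int_weight x \<le> exp (- \<rho>)" by (simp add: int_weight_def \<rho>_def)
qed (use cell_in[OF assms(2)] in auto)

lemma int_weight_sum_le_2: "(\<Sum>i\<in>{1..N}. sqint (X (i - 1)) (X i) int_weight) \<le> 2"
  by (rule order_trans[OF sum_mono sum_widths[THEN eq_refl]]) (rule int_weight_cell)

lemma near_width: "(8 * \<mu> / real N) = 8 / \<beta> * (1 / real N) * \<epsilon> * \<rho>"
  using \<beta> \<epsilon> by (simp add: \<rho>_def)

text \<open>These constants, like \<open>CWT\<close>, \<open>CA\<close> and \<open>CT\<close> below, depend neither on \<open>\<epsilon>\<close> nor on \<open>N\<close> or \<open>\<phi>\<close>; hence
  they serve all meshes at once when exported from the locale.\<close>

definition CWA where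
  "CWA KW Cx = 2 * 16 ^ q * KW\<^sup>2 * eps_bd\<^sup>2 + (8 / \<beta>) ^ (2 * q) * KW\<^sup>2 * eps_bd\<^sup>2 / \<beta> + 512 * KW\<^sup>2 * Cx\<^sup>2 * eps_bd\<^sup>2"

text \<open>For q \<le> 2 the powers of \<epsilon> never become negative, and q derivatives on the
  plain mesh suffice. For q > 2, \<open>B1\<close> collects the inner cells, estimated with q
  derivatives, and \<open>B2\<close> the remaining ones, estimated with two derivatives and the
  decay.\<close>

lemma W_A:
  assumes ch: "deriv_chain g" and KW: "KW \<ge> 0"
    and bd: "\<And>j x. j \<le> q \<Longrightarrow> x \<in> {0<..<2} - {1} \<Longrightarrow> \<bar>g j x\<bar> \<le> KW * \<epsilon>\<^sup>2 * (1 / \<epsilon>) ^ j * int_weight x"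
    and cx: "q > 2 \<Longrightarrow> exp (- \<rho>) \<le> Cx * \<epsilon> * mesh_size ^ (q - 2)"
  shows "\<exists>B. (\<forall>i\<in>{1..N}. proj_err_le q (X (i - 1)) (X i) (g 0) (B i)) \<and> (\<Sum>i\<in>{1..N}. B i) \<le> CWA KW Cx * r ^ (2 * q)"
proof -
  define I where "I i = sqint (X (i - 1)) (X i) int_weight" for i
  have I0: "I i \<ge> 0" for i unfolding I_def by (rule int_weight_cell_nonneg)
  define c where "c = KW * \<epsilon>\<^sup>2 * (1 / \<epsilon>) ^ q"
  have nn: "0 \<le> 2 * 16 ^ q * KW\<^sup>2 * eps_bd\<^sup>2 * r ^ (2 * q)" "0 \<le> (8 / \<beta>) ^ (2 * q) * KW\<^sup>2 * eps_bd\<^sup>2 / \<beta> * r ^ (2 * q)"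
    "0 \<le> 512 * KW\<^sup>2 * Cx\<^sup>2 * eps_bd\<^sup>2 * r ^ (2 * q)"
    using \<beta> r_ge by auto
  have C: "CWA KW Cx * r ^ (2 * q) = 2 * 16 ^ q * KW\<^sup>2 * eps_bd\<^sup>2 * r ^ (2 * q) + (8 / \<beta>) ^ (2 * q) * KW\<^sup>2 * eps_bd\<^sup>2 / \<beta> * r ^ (2 * q)
    + 512 * KW\<^sup>2 * Cx\<^sup>2 * eps_bd\<^sup>2 * r ^ (2 * q)"
    unfolding CWA_def by (simp only: distrib_right)
  show ?thesis
  proof (cases "q > 2")
    case False
    have "\<epsilon>\<^sup>2 * (1 / \<epsilon>) ^ q \<le> eps_bd"
    proof -
      consider "q = 1" | "q = 2" using False q by linarith
      then show ?thesis using eps_bd \<epsilon> by cases (auto simp: power2_eq_square)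
    qed
    then have "c \<le> KW * eps_bd" unfolding c_def mult.assoc using KW by (intro mult_left_mono) auto
    moreover have "c \<ge> 0" using KW \<epsilon> by (simp add: c_def)
    ultimately have c2: "c\<^sup>2 \<le> KW\<^sup>2 * eps_bd\<^sup>2" unfolding power_mult_distrib[symmetric] by (intro power_mono) auto
    show ?thesis
    proof (intro exI[of _ "\<lambda>i. (4 * r) ^ (2 * q) * (c\<^sup>2 * I i)"] conjI ballI)
      fix i assume i: "i \<in> {1..N}"
      show "proj_err_le q (X (i - 1)) (X i) (g 0) ((4 * r) ^ (2 * q) * (c\<^sup>2 * I i))"
        unfolding I_def by (rule weight_A[OF ch i order_refl _ width_r[OF i]]) (use bd[OF order_refl] in \<open>simp add: c_def\<close>)
    next
      have "(\<Sum>i\<in>{1..N}. (4 * r) ^ (2 * q) * (c\<^sup>2 * I i)) = (4 * r) ^ (2 * q) * (c\<^sup>2 * (\<Sum>i\<in>{1..N}. I i))"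
        by (simp only: sum_distrib_left)
      also have "\<dots> \<le> (4 * r) ^ (2 * q) * ((KW\<^sup>2 * eps_bd\<^sup>2) * 2)"
        using c2 int_weight_sum_le_2 r_ge I0 by (intro mult_left_mono mult_mono) (auto simp: I_def intro!: sum_nonneg)
      also have "\<dots> = 2 * 16 ^ q * KW\<^sup>2 * eps_bd\<^sup>2 * r ^ (2 * q)"
        by (simp add: power_mult_distrib power_mult)
      also have "\<dots> \<le> CWA KW Cx * r ^ (2 * q)" unfolding C using nn by simp
      finally show "(\<Sum>i\<in>{1..N}. (4 * r) ^ (2 * q) * (c\<^sup>2 * I i)) \<le> CWA KW Cx * r ^ (2 * q)" .
    qed
  next
    case True
    define B1 where "B1 i = (8 * \<mu> / real N) ^ (2 * q) * (c\<^sup>2 * I i)" for i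
    define B2 where "B2 i = (4 * mesh_size) ^ 4 * (KW\<^sup>2 * ((exp (- \<rho>))\<^sup>2 * (X i - X (i - 1))))" for i
    have B1: "B1 i \<ge> 0" for i using I0 mu_bounds by (auto simp: B1_def)
    have B2: "i \<in> {1..N} \<Longrightarrow> B2 i \<ge> 0" for i using cell_in[of i] mesh_size by (auto simp: B2_def)
    show ?thesis
    proof (intro exI[of _ "\<lambda>i. B1 i + B2 i"] conjI ballI)
      fix i assume i: "i \<in> {1..N}"
      from interior_layer_cell[OF i] show "proj_err_le q (X (i - 1)) (X i) (g 0) (B1 i + B2 i)"
      proof (elim disjE)
        assume w: "X i - X (i - 1) \<le> 8 * \<mu> / real N"
        have "proj_err_le q (X (i - 1)) (X i) (g 0) (B1 i)"
          unfolding B1_def I_def by (rule weight_A[OF ch i order_refl _ w]) (use bd[OF order_refl] in \<open>simp add: c_def\<close>)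
        then show ?thesis by (rule proj_err_le_mono) (use B2[OF i] in simp)
      next
        have far: "proj_err_le q (X (i - 1)) (X i) (g 0) (B1 i + B2 i)" if f: "X i \<le> 1 - \<mu> \<or> 1 + \<mu> \<le> X (i - 1)"
        proof -
          have "proj_err_le q (X (i - 1)) (X i) (g 0) ((4 * mesh_size) ^ (2 * 2) * (KW\<^sup>2 * sqint (X (i - 1)) (X i) int_weight))"
          proof (rule weight_A[OF ch i])
            \<comment> \<open>Two derivatives use up exactly the factor \<epsilon>^2; the q - 2
              orders that are still missing come from the decay in \<open>cx\<close>.\<close>
            show "\<bar>g 2 x\<bar> \<le> KW * int_weight x" if "x \<in> {0<..<2} - {1}" for x
              using bd[of 2 x] that True \<epsilon> by (simp add: power2_eq_square)
            show "X i - X (i - 1) \<le> 4 * mesh_size" using width_le[OF i] by (simp add: mesh_size_def)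
          qed (use True in auto)
          then show ?thesis
          proof (rule proj_err_le_mono)
            have "(4 * mesh_size) ^ (2 * 2) * (KW\<^sup>2 * sqint (X (i - 1)) (X i) int_weight) \<le> (4 * mesh_size) ^ (2 * 2) * (KW\<^sup>2 * ((exp (- \<rho>))\<^sup>2 * (X i - X (i - 1))))"
              using far_int_weight[OF f i] mesh_size by (intro mult_left_mono) auto
            then show "(4 * mesh_size) ^ (2 * 2) * (KW\<^sup>2 * sqint (X (i - 1)) (X i) int_weight) \<le> B1 i + B2 i"
              using B1[of i] by (simp add: B2_def)
          qed
        qed
        { assume "X i \<le> 1 - \<mu>" then show ?thesis using far by blast
        next assume "1 + \<mu> \<le> X (i - 1)" then show ?thesis using far by blast }
      qed
    next
      have "(\<Sum>i\<in>{1..N}. B1 i) = (8 * \<mu> / real N) ^ (2 * q) * (c\<^sup>2 * (\<Sum>i\<in>{1..N}. I i))"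
        unfolding B1_def by (simp only: sum_distrib_left)
      also have "\<dots> \<le> (8 * \<mu> / real N) ^ (2 * q) * (c\<^sup>2 * (\<epsilon> / \<beta>))"
        using int_weight_sum mu_bounds by (intro mult_left_mono) (auto simp: I_def)
      also have "\<dots> = (8 / \<beta>) ^ (2 * q) * KW\<^sup>2 / \<beta> * (1 / real N) ^ (2 * q) * (\<rho> ^ (2 * q) * \<epsilon> ^ 5)"
      proof -
        have "\<epsilon> ^ (2 * q) * (((1 / \<epsilon>) ^ q)\<^sup>2 * ((\<epsilon>\<^sup>2)\<^sup>2 * \<epsilon>)) = \<epsilon> ^ 5"
        proof -
          have "\<epsilon> ^ (2 * q) * ((1 / \<epsilon>) ^ q)\<^sup>2 = 1"
            using \<epsilon> by (simp add: power_mult[symmetric] power_one_over mult.commute)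
          moreover have "(\<epsilon>\<^sup>2)\<^sup>2 * \<epsilon> = \<epsilon> ^ 5" by (simp add: eval_nat_numeral)
          ultimately show ?thesis by (simp only: mult.assoc[symmetric] mult_1_left)
        qed
        moreover have "(8 * \<mu> / real N) ^ (2 * q) * (c\<^sup>2 * (\<epsilon> / \<beta>)) = (8 / \<beta>) ^ (2 * q) * KW\<^sup>2 / \<beta> * (1 / real N) ^ (2 * q) * \<rho> ^ (2 * q) * (\<epsilon> ^ (2 * q) * (((1 / \<epsilon>) ^ q)\<^sup>2 * ((\<epsilon>\<^sup>2)\<^sup>2 * \<epsilon>)))"
          unfolding near_width c_def power_mult_distrib by (simp only: mult_ac times_divide_eq_left times_divide_eq_right)
        ultimately show ?thesis by (simp only: mult.assoc)
      qed
      \<comment> \<open>There are two powers of \<open>\<rho>\<close> fewer than in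
        \<open>\<rho>_power\<close>, because the projection error is not integrated here; the
        remaining 1/\<rho> is bounded.\<close>
      also have "\<rho> ^ (2 * q) * \<epsilon> ^ 5 = (1 / \<rho>)\<^sup>2"
        using \<rho>_power[OF True] \<rho>_pos by (simp add: power_add field_simps power2_eq_square)
      also have "(8 / \<beta>) ^ (2 * q) * KW\<^sup>2 / \<beta> * (1 / real N) ^ (2 * q) * (1 / \<rho>)\<^sup>2 \<le> (8 / \<beta>) ^ (2 * q) * KW\<^sup>2 / \<beta> * r ^ (2 * q) * eps_bd\<^sup>2"
        using r_ge \<rho>_inverse[OF True] \<rho>_pos \<beta> by (intro mult_mono mult_left_mono power_mono) auto
      finally have S1: "(\<Sum>i\<in>{1..N}. B1 i) \<le> (8 / \<beta>) ^ (2 * q) * KW\<^sup>2 * eps_bd\<^sup>2 / \<beta> * r ^ (2 * q)" by (simp add: mult_ac)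
      have "(\<Sum>i\<in>{1..N}. B2 i) = (4 * mesh_size) ^ 4 * (KW\<^sup>2 * ((exp (- \<rho>))\<^sup>2 * 2))"
        unfolding B2_def by (simp only: sum_distrib_left[symmetric] sum_widths)
      also have "\<dots> \<le> (4 * mesh_size) ^ 4 * (KW\<^sup>2 * ((Cx * \<epsilon> * mesh_size ^ (q - 2))\<^sup>2 * 2))"
        using cx[OF True] mesh_size by (intro mult_left_mono mult_right_mono power_mono) auto
      also have "\<dots> = 512 * KW\<^sup>2 * Cx\<^sup>2 * \<epsilon>\<^sup>2 * (mesh_size ^ 4 * (mesh_size ^ (q - 2))\<^sup>2)"
        by (simp add: power_mult_distrib)
      also have "mesh_size ^ 4 * (mesh_size ^ (q - 2))\<^sup>2 = mesh_size ^ (2 * q)"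
      proof -
        have "4 + (q - 2) * 2 = 2 * q" using True by simp
        then show ?thesis by (simp only: power_mult[symmetric] power_add[symmetric])
      qed
      also have "512 * KW\<^sup>2 * Cx\<^sup>2 * \<epsilon>\<^sup>2 * mesh_size ^ (2 * q) \<le> 512 * KW\<^sup>2 * Cx\<^sup>2 * eps_bd\<^sup>2 * r ^ (2 * q)"
        using mesh_size eps_bd \<epsilon> by (intro mult_mono[OF mult_left_mono[OF power_mono] power_mono]) auto
      finally have S2: "(\<Sum>i\<in>{1..N}. B2 i) \<le> 512 * KW\<^sup>2 * Cx\<^sup>2 * eps_bd\<^sup>2 * r ^ (2 * q)" .
      show "(\<Sum>i\<in>{1..N}. B1 i + B2 i) \<le> CWA KW Cx * r ^ (2 * q)"
        unfolding C sum.distrib using S1 S2 nn(1) by linarith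
    qed
  qed
qed

text \<open>The numbers are powers of the width factor 4: 512 = 2 * 4^4 for q = 1, 4352 = 4^6 + 4^4
  for the two subcases of q = 2, and 8192 = 2 * 4^6 for the far cells if q > 2.\<close>

definition CWT where
  "CWT KW Cx = 512 * KW\<^sup>2 * R + 4352 * KW\<^sup>2 / \<beta> + ((8 / \<beta>) ^ (2 * q + 2) * KW\<^sup>2 / \<beta> + 8192 * KW\<^sup>2 * Cx\<^sup>2) * R"

lemma W_T:
  assumes ch: "deriv_chain g" and KW: "KW \<ge> 0"
    and bd: "\<And>j x. j \<le> q \<Longrightarrow> x \<in> {0<..<2} - {1} \<Longrightarrow> \<bar>g j x\<bar> \<le> KW * \<epsilon> * (1 / \<epsilon>) ^ j * int_weight x"
    and cx: "q > 2 \<Longrightarrow> exp (- \<rho>) \<le> Cx * \<epsilon> * mesh_size ^ (q - 2)"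
  shows "\<exists>B. (\<forall>i\<in>{1..N}. prim_err_le q (X (i - 1)) (X i) (g 0) (B i)) \<and> (\<Sum>i\<in>{1..N}. B i) \<le> CWT KW Cx * r ^ (2 * q + 1)"
proof -
  define I where "I i = sqint (X (i - 1)) (X i) int_weight" for i
  have I0: "I i \<ge> 0" for i unfolding I_def by (rule int_weight_cell_nonneg)
  have Is: "(\<Sum>i\<in>{1..N}. I i) \<le> 2" "(\<Sum>i\<in>{1..N}. I i) \<le> \<epsilon> / \<beta>"
    using int_weight_sum_le_2 int_weight_sum by (auto simp: I_def)
  have nn: "0 \<le> 512 * KW\<^sup>2 * R" "0 \<le> 4352 * KW\<^sup>2 / \<beta>" "0 \<le> (8 / \<beta>) ^ (2 * q + 2) * KW\<^sup>2 / \<beta> * R"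
    "0 \<le> 8192 * KW\<^sup>2 * Cx\<^sup>2 * R" using \<beta> R_nonneg by auto
  have C: "CWT KW Cx = 512 * KW\<^sup>2 * R + 4352 * KW\<^sup>2 / \<beta> + ((8 / \<beta>) ^ (2 * q + 2) * KW\<^sup>2 / \<beta> * R + 8192 * KW\<^sup>2 * Cx\<^sup>2 * R)"
    unfolding CWT_def by (simp only: distrib_right)
  \<comment> \<open>For q \<le> 2 all cells are treated alike, with a number n' of derivatives that
    is still open.\<close>
  have low: ?thesis if n: "n' \<le> q" and t: "(4 * r) ^ (2 * n' + 2) * ((KW * \<epsilon> * (1 / \<epsilon>) ^ n')\<^sup>2 * (\<Sum>i\<in>{1..N}. I i)) \<le> Q * r ^ (2 * q + 1)"
    and Q: "Q \<le> CWT KW Cx" for n' Q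
  proof (intro exI[of _ "\<lambda>i. (4 * r) ^ (2 * n' + 2) * ((KW * \<epsilon> * (1 / \<epsilon>) ^ n')\<^sup>2 * I i)"] conjI ballI)
    fix i assume i: "i \<in> {1..N}"
    show "prim_err_le q (X (i - 1)) (X i) (g 0) ((4 * r) ^ (2 * n' + 2) * ((KW * \<epsilon> * (1 / \<epsilon>) ^ n')\<^sup>2 * I i))"
      unfolding I_def by (rule weight_T[OF ch i n bd[OF n] width_r[OF i]])
  next
    have "(\<Sum>i\<in>{1..N}. (4 * r) ^ (2 * n' + 2) * ((KW * \<epsilon> * (1 / \<epsilon>) ^ n')\<^sup>2 * I i)) = (4 * r) ^ (2 * n' + 2) * ((KW * \<epsilon> * (1 / \<epsilon>) ^ n')\<^sup>2 * (\<Sum>i\<in>{1..N}. I i))"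
      by (simp only: sum_distrib_left)
    also have "\<dots> \<le> CWT KW Cx * r ^ (2 * q + 1)"
      by (rule order_trans[OF t mult_right_mono[OF Q]]) (use r_ge in simp)
    finally show "(\<Sum>i\<in>{1..N}. (4 * r) ^ (2 * n' + 2) * ((KW * \<epsilon> * (1 / \<epsilon>) ^ n')\<^sup>2 * I i)) \<le> CWT KW Cx * r ^ (2 * q + 1)" .
  qed
  \<comment> \<open>for \<open>q = 2\<close> the order \<open>q + 1/2\<close> results from two derivatives if \<open>r \<le> \<epsilon>\<close>, from one otherwise\<close>
  consider "q = 1" | "q = 2" | "q > 2" using q by linarith
  then show ?thesis
  proof cases
    case 1
    show ?thesis
    proof (rule low[of 1])
      have "(4 * r) ^ (2 * 1 + 2) * ((KW * \<epsilon> * (1 / \<epsilon>) ^ 1)\<^sup>2 * (\<Sum>i\<in>{1..N}. I i)) \<le> (4 * r) ^ (2 * 1 + 2) * (KW\<^sup>2 * 2)"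
        using \<epsilon> Is r_ge I0 by (intro mult_left_mono mult_mono) (auto intro: sum_nonneg)
      also have "\<dots> = 512 * KW\<^sup>2 * (r * r ^ (2 * q + 1))" by (simp add: 1 power_mult_distrib eval_nat_numeral)
      also have "\<dots> \<le> 512 * KW\<^sup>2 * (R * r ^ (2 * q + 1))" using r_R r_ge by (intro mult_left_mono mult_right_mono) auto
      finally show "(4 * r) ^ (2 * 1 + 2) * ((KW * \<epsilon> * (1 / \<epsilon>) ^ 1)\<^sup>2 * (\<Sum>i\<in>{1..N}. I i)) \<le> 512 * KW\<^sup>2 * R * r ^ (2 * q + 1)"
        by (simp only: mult.assoc)
    qed (use 1 nn C in auto)
  next
    case 2
    show ?thesis
    proof (cases "r \<le> \<epsilon>")
      case True
      show ?thesis
      proof (rule low[of 2])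
        have "(4 * r) ^ (2 * 2 + 2) * ((KW * \<epsilon> * (1 / \<epsilon>) ^ 2)\<^sup>2 * (\<Sum>i\<in>{1..N}. I i)) \<le> (4 * r) ^ (2 * 2 + 2) * ((KW * \<epsilon> * (1 / \<epsilon>) ^ 2)\<^sup>2 * (\<epsilon> / \<beta>))"
          using Is r_ge by (intro mult_left_mono) auto
        also have "\<dots> = 4096 * KW\<^sup>2 / \<beta> * r ^ 5 * (r / \<epsilon>)"
          using \<epsilon> by (simp add: power_mult_distrib power_divide field_simps eval_nat_numeral)
        also have "\<dots> \<le> 4096 * KW\<^sup>2 / \<beta> * r ^ 5 * 1"
          using True \<epsilon> \<beta> r_ge by (intro mult_left_mono) auto
        finally show "(4 * r) ^ (2 * 2 + 2) * ((KW * \<epsilon> * (1 / \<epsilon>) ^ 2)\<^sup>2 * (\<Sum>i\<in>{1..N}. I i)) \<le> 4096 * KW\<^sup>2 / \<beta> * r ^ (2 * q + 1)"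
          by (simp add: 2)
        have "4096 * KW\<^sup>2 / \<beta> \<le> 4352 * KW\<^sup>2 / \<beta>" using \<beta> by (intro divide_right_mono) auto
        then show "4096 * KW\<^sup>2 / \<beta> \<le> CWT KW Cx" unfolding C using nn by linarith
      qed (use 2 in auto)
    next
      case False
      show ?thesis
      proof (rule low[of 1])
        have "(4 * r) ^ (2 * 1 + 2) * ((KW * \<epsilon> * (1 / \<epsilon>) ^ 1)\<^sup>2 * (\<Sum>i\<in>{1..N}. I i)) \<le> (4 * r) ^ (2 * 1 + 2) * ((KW * \<epsilon> * (1 / \<epsilon>) ^ 1)\<^sup>2 * (\<epsilon> / \<beta>))"
          using Is r_ge by (intro mult_left_mono) auto
        also have "\<dots> = 256 * KW\<^sup>2 / \<beta> * r ^ 4 * \<epsilon>"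
          using \<epsilon> by (simp add: power_mult_distrib power_divide field_simps eval_nat_numeral)
        also have "\<dots> \<le> 256 * KW\<^sup>2 / \<beta> * r ^ 4 * r"
          using False \<epsilon> \<beta> r_ge by (intro mult_left_mono) auto
        finally show "(4 * r) ^ (2 * 1 + 2) * ((KW * \<epsilon> * (1 / \<epsilon>) ^ 1)\<^sup>2 * (\<Sum>i\<in>{1..N}. I i)) \<le> 256 * KW\<^sup>2 / \<beta> * r ^ (2 * q + 1)"
          by (simp add: 2 eval_nat_numeral mult_ac)
        have "256 * KW\<^sup>2 / \<beta> \<le> 4352 * KW\<^sup>2 / \<beta>" using \<beta> by (intro divide_right_mono) auto
        then show "256 * KW\<^sup>2 / \<beta> \<le> CWT KW Cx" unfolding C using nn by linarith
      qed (use 2 in auto)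
    qed
  next
    case 3
    define c where "c = KW * \<epsilon> * (1 / \<epsilon>) ^ q"
    define B1 where "B1 i = (8 * \<mu> / real N) ^ (2 * q + 2) * (c\<^sup>2 * I i)" for i
    define B2 where "B2 i = (4 * mesh_size) ^ 6 * ((KW / \<epsilon>)\<^sup>2 * ((exp (- \<rho>))\<^sup>2 * (X i - X (i - 1))))" for i
    have B1: "B1 i \<ge> 0" for i using I0 mu_bounds by (auto simp: B1_def)
    have B2: "i \<in> {1..N} \<Longrightarrow> B2 i \<ge> 0" for i using cell_in[of i] mesh_size by (auto simp: B2_def)
    show ?thesis
    proof (intro exI[of _ "\<lambda>i. B1 i + B2 i"] conjI ballI)
      fix i assume i: "i \<in> {1..N}"
      from interior_layer_cell[OF i] show "prim_err_le q (X (i - 1)) (X i) (g 0) (B1 i + B2 i)"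
      proof (elim disjE)
        assume w: "X i - X (i - 1) \<le> 8 * \<mu> / real N"
        have "prim_err_le q (X (i - 1)) (X i) (g 0) (B1 i)"
          unfolding B1_def I_def by (rule weight_T[OF ch i order_refl _ w]) (use bd[OF order_refl] in \<open>simp add: c_def\<close>)
        then show ?thesis by (rule prim_err_le_mono) (use B2[OF i] in simp)
      next
        have far: "prim_err_le q (X (i - 1)) (X i) (g 0) (B1 i + B2 i)" if f: "X i \<le> 1 - \<mu> \<or> 1 + \<mu> \<le> X (i - 1)"
        proof -
          have "prim_err_le q (X (i - 1)) (X i) (g 0) ((4 * mesh_size) ^ (2 * 2 + 2) * ((KW / \<epsilon>)\<^sup>2 * sqint (X (i - 1)) (X i) int_weight))"
          proof (rule weight_T[OF ch i])
            \<comment> \<open>Two derivatives cost a factor 1/\<epsilon> here; the factor \<epsilon>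
              in \<open>cx\<close> compensates it.\<close>
            show "\<bar>g 2 x\<bar> \<le> KW / \<epsilon> * int_weight x" if "x \<in> {0<..<2} - {1}" for x
              using bd[of 2 x] that 3 \<epsilon> by (simp add: power2_eq_square)
            show "X i - X (i - 1) \<le> 4 * mesh_size" using width_le[OF i] by (simp add: mesh_size_def)
          qed (use 3 in auto)
          then show ?thesis
          proof (rule prim_err_le_mono)
            have "(4 * mesh_size) ^ (2 * 2 + 2) * ((KW / \<epsilon>)\<^sup>2 * sqint (X (i - 1)) (X i) int_weight) \<le> (4 * mesh_size) ^ (2 * 2 + 2) * ((KW / \<epsilon>)\<^sup>2 * ((exp (- \<rho>))\<^sup>2 * (X i - X (i - 1))))"
              using far_int_weight[OF f i] mesh_size by (intro mult_left_mono) auto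
            then show "(4 * mesh_size) ^ (2 * 2 + 2) * ((KW / \<epsilon>)\<^sup>2 * sqint (X (i - 1)) (X i) int_weight) \<le> B1 i + B2 i"
              using B1[of i] by (simp add: B2_def)
          qed
        qed
        { assume "X i \<le> 1 - \<mu>" then show ?thesis using far by blast
        next assume "1 + \<mu> \<le> X (i - 1)" then show ?thesis using far by blast }
      qed
    next
      have "(\<Sum>i\<in>{1..N}. B1 i) = (8 * \<mu> / real N) ^ (2 * q + 2) * (c\<^sup>2 * (\<Sum>i\<in>{1..N}. I i))"
        unfolding B1_def by (simp only: sum_distrib_left)
      also have "\<dots> \<le> (8 * \<mu> / real N) ^ (2 * q + 2) * (c\<^sup>2 * (\<epsilon> / \<beta>))"
        using Is mu_bounds by (intro mult_left_mono) auto
      also have "\<dots> = (8 / \<beta>) ^ (2 * q + 2) * KW\<^sup>2 / \<beta> * (1 / real N) ^ (2 * q + 2) * (\<rho> ^ (2 * q + 2) * \<epsilon> ^ 5)"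
      proof -
        have "\<epsilon> ^ (2 * q + 2) * (((1 / \<epsilon>) ^ q)\<^sup>2 * (\<epsilon>\<^sup>2 * \<epsilon>)) = \<epsilon> ^ 5"
        proof -
          have "\<epsilon> ^ (2 * q) * ((1 / \<epsilon>) ^ q)\<^sup>2 = 1"
            using \<epsilon> by (simp add: power_mult[symmetric] power_one_over mult.commute)
          moreover have "\<epsilon> ^ (2 * q + 2) * (((1 / \<epsilon>) ^ q)\<^sup>2 * (\<epsilon>\<^sup>2 * \<epsilon>)) = (\<epsilon> ^ (2 * q) * ((1 / \<epsilon>) ^ q)\<^sup>2) * (\<epsilon>\<^sup>2 * \<epsilon>\<^sup>2 * \<epsilon>)"
            by (simp only: power_add mult_ac)
          moreover have "\<epsilon>\<^sup>2 * \<epsilon>\<^sup>2 * \<epsilon> = \<epsilon> ^ 5" by (simp add: eval_nat_numeral)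
          ultimately show ?thesis by (simp only: mult_1_left)
        qed
        moreover have "(8 * \<mu> / real N) ^ (2 * q + 2) * (c\<^sup>2 * (\<epsilon> / \<beta>)) = (8 / \<beta>) ^ (2 * q + 2) * KW\<^sup>2 / \<beta> * (1 / real N) ^ (2 * q + 2) * \<rho> ^ (2 * q + 2) * (\<epsilon> ^ (2 * q + 2) * (((1 / \<epsilon>) ^ q)\<^sup>2 * (\<epsilon>\<^sup>2 * \<epsilon>)))"
          unfolding near_width c_def power_mult_distrib by (simp only: mult_ac times_divide_eq_left times_divide_eq_right)
        ultimately show ?thesis by (simp only: mult.assoc)
      qed
      also have "\<dots> = (8 / \<beta>) ^ (2 * q + 2) * KW\<^sup>2 / \<beta> * (1 / real N) ^ (2 * q + 2)"
        using \<rho>_power[OF 3] by simp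
      also have "\<dots> \<le> (8 / \<beta>) ^ (2 * q + 2) * KW\<^sup>2 / \<beta> * r ^ (2 * q + 2)"
        using r_ge \<beta> by (intro mult_left_mono power_mono) auto
      also have "\<dots> \<le> (8 / \<beta>) ^ (2 * q + 2) * KW\<^sup>2 / \<beta> * (R * r ^ (2 * q + 1))"
        using \<beta> by (intro mult_left_mono r_pow_Suc) auto
      finally have S1: "(\<Sum>i\<in>{1..N}. B1 i) \<le> (8 / \<beta>) ^ (2 * q + 2) * KW\<^sup>2 / \<beta> * R * r ^ (2 * q + 1)" by (simp only: mult.assoc)
      have "(\<Sum>i\<in>{1..N}. B2 i) = (4 * mesh_size) ^ 6 * ((KW / \<epsilon>)\<^sup>2 * ((exp (- \<rho>))\<^sup>2 * 2))"
        unfolding B2_def by (simp only: sum_distrib_left[symmetric] sum_widths)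
      also have "\<dots> \<le> (4 * mesh_size) ^ 6 * ((KW / \<epsilon>)\<^sup>2 * ((Cx * \<epsilon> * mesh_size ^ (q - 2))\<^sup>2 * 2))"
        using cx[OF 3] mesh_size by (intro mult_left_mono mult_right_mono power_mono) auto
      also have "\<dots> = 8192 * (KW / \<epsilon>)\<^sup>2 * \<epsilon>\<^sup>2 * Cx\<^sup>2 * (mesh_size ^ 6 * (mesh_size ^ (q - 2))\<^sup>2)"
        by (simp add: power_mult_distrib)
      also have "(mesh_size ^ 6 * (mesh_size ^ (q - 2))\<^sup>2) = mesh_size ^ (2 * q + 2)"
      proof -
        have "6 + (q - 2) * 2 = 2 * q + 2" using 3 by simp
        then show ?thesis by (simp only: power_mult[symmetric] power_add[symmetric])
      qed
      also have "8192 * (KW / \<epsilon>)\<^sup>2 * \<epsilon>\<^sup>2 * Cx\<^sup>2 * mesh_size ^ (2 * q + 2) = 8192 * KW\<^sup>2 * Cx\<^sup>2 * mesh_size ^ (2 * q + 2)"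
        using \<epsilon> by (simp add: power_divide)
      also have "\<dots> \<le> 8192 * KW\<^sup>2 * Cx\<^sup>2 * r ^ (2 * q + 2)" using mesh_size by (intro mult_left_mono power_mono) auto
      also have "\<dots> \<le> 8192 * KW\<^sup>2 * Cx\<^sup>2 * (R * r ^ (2 * q + 1))" by (intro mult_left_mono r_pow_Suc) auto
      finally have S2: "(\<Sum>i\<in>{1..N}. B2 i) \<le> 8192 * KW\<^sup>2 * Cx\<^sup>2 * R * r ^ (2 * q + 1)" by (simp only: mult.assoc)
      have "(\<Sum>i\<in>{1..N}. B1 i + B2 i) \<le> ((8 / \<beta>) ^ (2 * q + 2) * KW\<^sup>2 / \<beta> * R + 8192 * KW\<^sup>2 * Cx\<^sup>2 * R) * r ^ (2 * q + 1)"
        unfolding sum.distrib distrib_right by (rule add_mono[OF S1 S2])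
      also have "\<dots> \<le> CWT KW Cx * r ^ (2 * q + 1)"
        unfolding C using nn r_ge by (intro mult_right_mono) auto
      finally show "(\<Sum>i\<in>{1..N}. B1 i + B2 i) \<le> CWT KW Cx * r ^ (2 * q + 1)" .
    qed
  qed
qed

section \<open>Smooth part and sum of all contributions\<close>

lemma S_A:
  assumes ch: "deriv_chain g" and S: "(\<Sum>i\<in>{1..N}. sqint (X (i - 1)) (X i) (g q)) \<le> KS"
  shows "\<exists>B. (\<forall>i\<in>{1..N}. proj_err_le q (X (i - 1)) (X i) (g 0) (B i)) \<and> (\<Sum>i\<in>{1..N}. B i) \<le> 16 ^ q * KS * r ^ (2 * q)"
proof (intro exI[of _ "\<lambda>i. (4 * r) ^ (2 * q) * sqint (X (i - 1)) (X i) (g q)"] conjI ballI)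
  fix i assume i: "i \<in> {1..N}"
  show "proj_err_le q (X (i - 1)) (X i) (g 0) ((4 * r) ^ (2 * q) * sqint (X (i - 1)) (X i) (g q))"
  proof (rule proj_err_le_mono[OF proj_err_le_chain[where n = q and g = g]])
    show "(X i - X (i - 1)) ^ (2 * q) * sqint (X (i - 1)) (X i) (g q) \<le> (4 * r) ^ (2 * q) * sqint (X (i - 1)) (X i) (g q)"
      using width_r[OF i] cell_in[OF i]
      by (intro mult_right_mono power_mono integral_nonneg Ltwo_sq_int deriv_chain_Ltwo[OF ch i order_refl]) auto
  qed (use cell_in[OF i] deriv_chain_Ltwo[OF ch i, of 0] deriv_chain_wderiv_on[OF ch i] in auto)
next
  have "(\<Sum>i\<in>{1..N}. (4 * r) ^ (2 * q) * sqint (X (i - 1)) (X i) (g q)) \<le> (4 * r) ^ (2 * q) * KS"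
    unfolding sum_distrib_left[symmetric] using S r_ge by (intro mult_left_mono) auto
  also have "\<dots> = 16 ^ q * KS * r ^ (2 * q)" by (simp add: power_mult_distrib power_mult)
  finally show "(\<Sum>i\<in>{1..N}. (4 * r) ^ (2 * q) * sqint (X (i - 1)) (X i) (g q)) \<le> 16 ^ q * KS * r ^ (2 * q)" .
qed

lemma S_T:
  assumes ch: "deriv_chain g" and bd: "\<And>x. x \<in> {0<..<2} - {1} \<Longrightarrow> \<bar>g q x\<bar> \<le> KT"
  shows "\<exists>B. (\<forall>i\<in>{1..N}. prim_err_le q (X (i - 1)) (X i) (g 0) (B i)) \<and> (\<Sum>i\<in>{1..N}. B i) \<le> 2 * 16 ^ (q + 1) * KT\<^sup>2 * R * r ^ (2 * q + 1)"
proof (intro exI[of _ "\<lambda>i. (4 * r) ^ (2 * q + 2) * (KT\<^sup>2 * (X i - X (i - 1)))"] conjI ballI)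
  fix i assume i: "i \<in> {1..N}"
  have "sqint (X (i - 1)) (X i) (g q) \<le> KT\<^sup>2 * integral {X (i - 1)..X i} (\<lambda>x. 1\<^sup>2)"
    by (rule integral_sq_le_weight[OF deriv_chain_Ltwo[OF ch i order_refl]]) (use bd cell_interior[OF i] in auto)
  then have I: "sqint (X (i - 1)) (X i) (g q) \<le> KT\<^sup>2 * (X i - X (i - 1))"
    using cell_in[OF i] by simp
  show "prim_err_le q (X (i - 1)) (X i) (g 0) ((4 * r) ^ (2 * q + 2) * (KT\<^sup>2 * (X i - X (i - 1))))"
  proof (rule prim_err_le_mono[OF prim_err_le_chain[where n = q and g = g]])
    show "(X i - X (i - 1)) ^ (2 * q + 2) * sqint (X (i - 1)) (X i) (g q) \<le> (4 * r) ^ (2 * q + 2) * (KT\<^sup>2 * (X i - X (i - 1)))"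
    proof (rule mult_mono[OF _ I])
      show "(X i - X (i - 1)) ^ (2 * q + 2) \<le> (4 * r) ^ (2 * q + 2)"
        using width_r[OF i] cell_in[OF i] by (intro power_mono) auto
      show "0 \<le> (4 * r) ^ (2 * q + 2)" using r_ge by (intro zero_le_power) auto
    qed (intro integral_nonneg Ltwo_sq_int deriv_chain_Ltwo[OF ch i order_refl], simp)
  qed (use cell_in[OF i] deriv_chain_Ltwo[OF ch i, of 0] deriv_chain_wderiv_on[OF ch i] in auto)
next
  have "(\<Sum>i\<in>{1..N}. (4 * r) ^ (2 * q + 2) * (KT\<^sup>2 * (X i - X (i - 1)))) = (4 * r) ^ (2 * q + 2) * (KT\<^sup>2 * 2)"
    by (simp only: sum_distrib_left[symmetric] sum_widths)
  also have "\<dots> = 2 * 16 ^ (q + 1) * KT\<^sup>2 * r ^ (2 * q + 2)"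
  proof -
    have "2 * q + 2 = 2 * (q + 1)" by simp
    then show ?thesis by (simp only: power_mult_distrib power_mult) simp
  qed
  also have "\<dots> \<le> 2 * 16 ^ (q + 1) * KT\<^sup>2 * (R * r ^ (2 * q + 1))" by (intro mult_left_mono r_pow_Suc) auto
  finally show "(\<Sum>i\<in>{1..N}. (4 * r) ^ (2 * q + 2) * (KT\<^sup>2 * (X i - X (i - 1)))) \<le> 2 * 16 ^ (q + 1) * KT\<^sup>2 * R * r ^ (2 * q + 1)"
    by (simp only: mult.assoc)
qed

text \<open>The coefficients come from doubling at each of three additions: 8 for the smooth part, 8
  + 4 for the two boundary layers, multiplied by the length 2 of the domain, and 2 for the weak
  layers.\<close>

definition CA where "CA KS K1 KW Cx = 8 * (16 ^ q * KS) + 24 * (K1\<^sup>2 * (Cf ^ (2 * q) + R\<^sup>2)) + 2 * CWA KW Cx"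

definition CT where
  "CT KT K1 KW Cx CL = 8 * (2 * 16 ^ (q + 1) * KT\<^sup>2 * R) + 24 * (K1\<^sup>2 * (Cf ^ (2 * q + 2) + CL / \<beta>\<^sup>2) * R) + 2 * CWT KW Cx"

lemma total_A:
  assumes ae: "negligible {x\<in>{0..2}. g x \<noteq> gS 0 x + g1 0 x + g2 0 x + gW 0 x}"
    and ch: "deriv_chain gS" "deriv_chain g1" "deriv_chain g2" "deriv_chain gW"
    and S: "(\<Sum>i\<in>{1..N}. sqint (X (i - 1)) (X i) (gS q)) \<le> KS"
    and b1: "\<And>j x. j \<le> q \<Longrightarrow> x \<in> {0<..<2} - {1} \<Longrightarrow> \<bar>g1 j x\<bar> \<le> K1 * (1 / \<epsilon>) ^ j * exp (- \<beta> * x / \<epsilon>)"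
    and b2: "\<And>j x. j \<le> q \<Longrightarrow> x \<in> {0<..<2} - {1} \<Longrightarrow> \<bar>g2 j x\<bar> \<le> K1 * (1 / \<epsilon>) ^ j * exp (- \<beta> * (2 - x) / \<epsilon>)"
    and bW: "\<And>j x. j \<le> q \<Longrightarrow> x \<in> {0<..<2} - {1} \<Longrightarrow> \<bar>gW j x\<bar> \<le> KW * \<epsilon>\<^sup>2 * (1 / \<epsilon>) ^ j * int_weight x" "KW \<ge> 0"
    and cx: "q > 2 \<Longrightarrow> exp (- \<rho>) \<le> Cx * \<epsilon> * mesh_size ^ (q - 2)"
    and P: "\<And>i. i \<in> {1..N} \<Longrightarrow> is_proj q (X (i - 1)) (X i) g (P i)"
  shows "(\<Sum>i\<in>{1..N}. sqint (X (i - 1)) (X i) (\<lambda>x. g x - poly (P i) x)) \<le> CA KS K1 KW Cx * r ^ (2 * q)"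
proof -
  obtain BS where BS: "\<forall>i\<in>{1..N}. proj_err_le q (X (i - 1)) (X i) (gS 0) (BS i)" "(\<Sum>i\<in>{1..N}. BS i) \<le> 16 ^ q * KS * r ^ (2 * q)"
    using S_A[OF ch(1) S] by blast
  obtain BW where BW: "\<forall>i\<in>{1..N}. proj_err_le q (X (i - 1)) (X i) (gW 0) (BW i)" "(\<Sum>i\<in>{1..N}. BW i) \<le> CWA KW Cx * r ^ (2 * q)"
    using W_A[OF ch(4) bW(2,1) cx] by blast
  define BE where "BE i = K1\<^sup>2 * (Cf ^ (2 * q) + r\<^sup>2) * r ^ (2 * q) * (X i - X (i - 1))" for i
  have sE: "(\<Sum>i\<in>{1..N}. BE i) \<le> K1\<^sup>2 * (Cf ^ (2 * q) + R\<^sup>2) * r ^ (2 * q) * 2"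
    unfolding BE_def sum_distrib_left[symmetric] sum_widths using r_R r_ge
    by (intro mult_right_mono mult_left_mono add_left_mono power_mono) auto
  have "(\<Sum>i\<in>{1..N}. sqint (X (i - 1)) (X i) (\<lambda>x. g x - poly (P i) x)) \<le>
    (\<Sum>i\<in>{1..N}. 2 * (2 * (2 * BS i + 2 * BE i) + 2 * BE i) + 2 * BW i)"
  proof (rule sum_mono)
    fix i assume i: "i \<in> {1..N}"
    have ab: "X (i - 1) \<le> X i" using cell_in[OF i] by simp
    have "proj_err_le q (X (i - 1)) (X i) (\<lambda>x. gS 0 x + g1 0 x + g2 0 x + gW 0 x) (2 * (2 * (2 * BS i + 2 * BE i) + 2 * BE i) + 2 * BW i)"
      using BS(1) BW(1) i left_A[OF ch(2) b1 i] right_A[OF ch(3) b2 i] unfolding BE_def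
      by (intro proj_err_le_add ab) auto
    then have "proj_err_le q (X (i - 1)) (X i) g (2 * (2 * (2 * BS i + 2 * BE i) + 2 * BE i) + 2 * BW i)"
      by (rule proj_err_le_spike[OF _ ae]) (use cell_in[OF i] in auto)
    then show "sqint (X (i - 1)) (X i) (\<lambda>x. g x - poly (P i) x) \<le> 2 * (2 * (2 * BS i + 2 * BE i) + 2 * BE i) + 2 * BW i"
      using P[OF i] unfolding proj_err_le_def by blast
  qed
  also have "\<dots> = 8 * (\<Sum>i\<in>{1..N}. BS i) + 12 * (\<Sum>i\<in>{1..N}. BE i) + 2 * (\<Sum>i\<in>{1..N}. BW i)"
    by (simp add: sum.distrib sum_distrib_left algebra_simps)
  also have "\<dots> \<le> 8 * (16 ^ q * KS * r ^ (2 * q)) + 12 * (K1\<^sup>2 * (Cf ^ (2 * q) + R\<^sup>2) * r ^ (2 * q) * 2) + 2 * (CWA KW Cx * r ^ (2 * q))"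
    using BS(2) BW(2) sE by (intro add_mono mult_left_mono) auto
  also have "\<dots> = CA KS K1 KW Cx * r ^ (2 * q)" by (simp add: CA_def algebra_simps)
  finally show ?thesis .
qed

lemma total_T:
  assumes ae: "negligible {x\<in>{0..2}. g x \<noteq> gS 0 x + g1 0 x + g2 0 x + gW 0 x}"
    and ch: "deriv_chain gS" "deriv_chain g1" "deriv_chain g2" "deriv_chain gW"
    and S: "\<And>x. x \<in> {0<..<2} - {1} \<Longrightarrow> \<bar>gS q x\<bar> \<le> KT"
    and b1: "\<And>j x. j \<le> q \<Longrightarrow> x \<in> {0<..<2} - {1} \<Longrightarrow> \<bar>g1 j x\<bar> \<le> K1 / \<epsilon> * (1 / \<epsilon>) ^ j * exp (- \<beta> * x / \<epsilon>)"
    and b2: "\<And>j x. j \<le> q \<Longrightarrow> x \<in> {0<..<2} - {1} \<Longrightarrow> \<bar>g2 j x\<bar> \<le> K1 / \<epsilon> * (1 / \<epsilon>) ^ j * exp (- \<beta> * (2 - x) / \<epsilon>)"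
    and K1: "K1 \<ge> 0"
    and bW: "\<And>j x. j \<le> q \<Longrightarrow> x \<in> {0<..<2} - {1} \<Longrightarrow> \<bar>gW j x\<bar> \<le> KW * \<epsilon> * (1 / \<epsilon>) ^ j * int_weight x" "KW \<ge> 0"
    and cx: "q > 2 \<Longrightarrow> exp (- \<rho>) \<le> Cx * \<epsilon> * mesh_size ^ (q - 2)"
    and CL: "CL > 0" "\<And>a b g. a \<le> b \<Longrightarrow> Ltwo a b g \<Longrightarrow> prim_err_le q a b g ((b - a) * (CL * (integral {a..b} (\<lambda>x. \<bar>g x\<bar>))\<^sup>2))"
    and P: "\<And>i. i \<in> {1..N} \<Longrightarrow> is_proj q (X (i - 1)) (X i) g (P i)"
  shows "(\<Sum>i\<in>{1..N}. sqint (X (i - 1)) (X i) (\<lambda>x. integral {X (i - 1)..x} (\<lambda>x. g x - poly (P i) x))) \<le> CT KT K1 KW Cx CL * r ^ (2 * q + 1)"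
proof -
  obtain BS where BS: "\<forall>i\<in>{1..N}. prim_err_le q (X (i - 1)) (X i) (gS 0) (BS i)" "(\<Sum>i\<in>{1..N}. BS i) \<le> 2 * 16 ^ (q + 1) * KT\<^sup>2 * R * r ^ (2 * q + 1)"
    using S_T[OF ch(1) S] by blast
  obtain BW where BW: "\<forall>i\<in>{1..N}. prim_err_le q (X (i - 1)) (X i) (gW 0) (BW i)" "(\<Sum>i\<in>{1..N}. BW i) \<le> CWT KW Cx * r ^ (2 * q + 1)"
    using W_T[OF ch(4) bW(2,1) cx] by blast
  define BE where "BE i = K1\<^sup>2 * (Cf ^ (2 * q + 2) + CL / \<beta>\<^sup>2) * r ^ (2 * q + 2) * (X i - X (i - 1))" for i
  have Cf0: "Cf \<ge> 0" using \<sigma> \<beta> by (simp add: Cf_def)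
  have sE: "(\<Sum>i\<in>{1..N}. BE i) \<le> K1\<^sup>2 * (Cf ^ (2 * q + 2) + CL / \<beta>\<^sup>2) * (R * r ^ (2 * q + 1)) * 2"
  proof -
    have "0 \<le> K1\<^sup>2 * (Cf ^ (2 * q + 2) + CL / \<beta>\<^sup>2)"
      by (rule mult_nonneg_nonneg[OF zero_le_power2]) (use Cf0 CL(1) in auto)
    from mult_right_mono[OF mult_left_mono[OF r_pow_Suc this], of 2] show ?thesis
      unfolding BE_def sum_distrib_left[symmetric] sum_widths by simp
  qed
  have "(\<Sum>i\<in>{1..N}. sqint (X (i - 1)) (X i) (\<lambda>x. integral {X (i - 1)..x} (\<lambda>x. g x - poly (P i) x))) \<le>
    (\<Sum>i\<in>{1..N}. 2 * (2 * (2 * BS i + 2 * BE i) + 2 * BE i) + 2 * BW i)"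
  proof (rule sum_mono)
    fix i assume i: "i \<in> {1..N}"
    have ab: "X (i - 1) \<le> X i" using cell_in[OF i] by simp
    have "prim_err_le q (X (i - 1)) (X i) (\<lambda>x. gS 0 x + g1 0 x + g2 0 x + gW 0 x) (2 * (2 * (2 * BS i + 2 * BE i) + 2 * BE i) + 2 * BW i)"
      using BS(1) BW(1) i left_T[OF ch(2) b1 i K1 CL] right_T[OF ch(3) b2 i K1 CL] unfolding BE_def
      by (intro prim_err_le_add ab) auto
    then have "prim_err_le q (X (i - 1)) (X i) g (2 * (2 * (2 * BS i + 2 * BE i) + 2 * BE i) + 2 * BW i)"
      by (rule prim_err_le_spike[OF _ ae]) (use cell_in[OF i] in auto)
    then show "sqint (X (i - 1)) (X i) (\<lambda>x. integral {X (i - 1)..x} (\<lambda>x. g x - poly (P i) x)) \<le> 2 * (2 * (2 * BS i + 2 * BE i) + 2 * BE i) + 2 * BW i"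
      using P[OF i] unfolding prim_err_le_def by blast
  qed
  also have "\<dots> = 8 * (\<Sum>i\<in>{1..N}. BS i) + 12 * (\<Sum>i\<in>{1..N}. BE i) + 2 * (\<Sum>i\<in>{1..N}. BW i)"
    by (simp add: sum.distrib sum_distrib_left algebra_simps)
  also have "\<dots> \<le> 8 * (2 * 16 ^ (q + 1) * KT\<^sup>2 * R * r ^ (2 * q + 1)) + 12 * (K1\<^sup>2 * (Cf ^ (2 * q + 2) + CL / \<beta>\<^sup>2) * (R * r ^ (2 * q + 1)) * 2) + 2 * (CWT KW Cx * r ^ (2 * q + 1))"
    using BS(2) BW(2) sE by (intro add_mono mult_left_mono) auto
  also have "\<dots> = CT KT K1 KW Cx CL * r ^ (2 * q + 1)"
  proof -
    have "8 * (A * t) + 12 * (B * (R * t) * 2) + 2 * (W * t) = (8 * A + 24 * (B * R) + 2 * W) * t" for A B W t :: real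
      by (simp add: algebra_simps)
    then show ?thesis unfolding CT_def .
  qed
  finally show ?thesis .
qed

end

section \<open>Estimates from the solution decomposition\<close>

lemma AE_lebesgue_negligible:
  assumes "AE x in lebesgue. P x" shows "negligible {x. \<not> P x}"
proof -
  obtain S where "S \<in> null_sets lebesgue" "{x. \<not> P x} \<subseteq> S"
    using assms unfolding eventually_ae_filter by auto
  then show ?thesis using negligible_iff_null_sets negligible_subset by blast
qed

text \<open>The essential supremum ignores null sets and the end points; continuity extends the
  bound to every point of the closed interval.\<close>

lemma abs_le_Linf_nrm:
  assumes ab: "a < b" and f: "continuous_on {a..b} f" and x: "x \<in> {a..b}"
  shows "\<bar>f x\<bar> \<le> Linf_nrm a b f"
proof -
  define M where "M = restrict_space lebesgue {a<..<b}"
  define E where "E = esssup M (\<lambda>x. ereal \<bar>f x\<bar>)"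
  have "bounded (f ` {a..b})" by (intro compact_imp_bounded compact_continuous_image f) auto
  then obtain B where B: "\<And>x. x \<in> {a..b} \<Longrightarrow> \<bar>f x\<bar> \<le> B"
    unfolding bounded_iff by (metis image_eqI real_norm_def)
  have "f \<in> borel_measurable M"
    unfolding M_def by (rule continuous_imp_measurable_on_sets_lebesgue)
      (use f in \<open>auto intro: continuous_on_subset\<close>)
  then have m: "(\<lambda>x. ereal \<bar>f x\<bar>) \<in> borel_measurable M" by simp
  have "AE x in M. ereal \<bar>f x\<bar> \<le> ereal B"
    by (rule AE_I2) (use B in \<open>auto simp: M_def\<close>)
  \<comment> \<open>This excludes an infinite value, which \<open>real_of_ereal\<close> would turn
    into 0.\<close>
  then have EB: "E \<le> ereal B" unfolding E_def by (rule esssup_I[OF m])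
  have "AE x in M. ereal \<bar>f x\<bar> \<le> E" unfolding E_def by (rule esssup_AE)
  then have "AE x in M. \<bar>f x\<bar> \<le> real_of_ereal E"
  proof eventually_elim
    case (elim x)
    then show ?case using EB by (cases E) auto
  qed
  then have "AE x in lebesgue. x \<in> {a<..<b} \<longrightarrow> \<bar>f x\<bar> \<le> Linf_nrm a b f"
    unfolding M_def Linf_nrm_def E_def by (subst (asm) AE_restrict_space_iff) auto
  then have n: "negligible ({x. \<not> (x \<in> {a<..<b} \<longrightarrow> \<bar>f x\<bar> \<le> Linf_nrm a b f)} \<union> {a, b})"
    by (intro negligible_Un AE_lebesgue_negligible) auto
  \<comment> \<open>The positive part of the excess is continuous and vanishes almost everywhere,
    hence everywhere.\<close>
  have "max (\<bar>f x\<bar> - Linf_nrm a b f) 0 = 0"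
    by (rule continuous_ae_eq[OF _ _ ab n _ x]) (use f in \<open>auto intro!: continuous_intros\<close>)
  then show ?thesis by simp
qed

section \<open>Derivatives of the components as chains on cells\<close>

lemma dern_Suc: "dern A (Suc k) v x = vector_derivative (dern A k v) (at x within A)"
  by (simp add: dern_def)

lemma dern_has_derivative:
  assumes "times_differentiable_on n v A" "k < n" "x \<in> A"
  shows "(dern A k v has_real_derivative dern A (Suc k) v x) (at x within A)"
proof -
  have "dern A k v differentiable (at x within A)"
    using assms unfolding times_differentiable_on_def differentiable_on_def by auto
  then show ?thesis
    unfolding dern_Suc has_real_derivative_iff_has_vector_derivative by (simp add: vector_derivative_works)
qed

lemma dern_wderiv_on:
  assumes "open A" "times_differentiable_on n v A" "k < n" "{a<..<b} \<subseteq> A" "a \<le> b"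
    and "\<And>x. x \<in> A \<Longrightarrow> \<bar>dern A (Suc k) v x\<bar> \<le> M"
  shows "wderiv_on a b (dern A k v) (dern A (Suc k) v)"
proof (cases "a = b")
  case False
  show ?thesis
  proof (rule wderiv_on_of_deriv[where M = M])
    fix x assume "x \<in> {a<..<b}"
    then have x: "x \<in> A" using assms(4) by blast
    show "(dern A k v has_real_derivative dern A (Suc k) v x) (at x)"
      using dern_has_derivative[OF assms(2,3) x] unfolding at_within_open[OF x assms(1)] .
  next
    show "a < b" using False assms(5) by simp
  next
    fix x assume "x \<in> {a<..<b}"
    then show "\<bar>dern A (Suc k) v x\<bar> \<le> M" using assms(4,6) by blast
  qed
qed (simp add: wderiv_on_refl)

lemma smooth_dern_cont:
  assumes "smooth_fun_on v A" shows "continuous_on A (dern A k v)"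
proof -
  have "dern A k v differentiable_on A"
    using assms unfolding smooth_fun_on_def times_differentiable_on_def by blast
  then show ?thesis by (rule differentiable_imp_continuous_on)
qed

lemma smooth_dern_AC:
  assumes "smooth_fun_on v {a..b}" "a \<le> b"
  shows "AC a b (dern {a..b} k v) (dern {a..b} (Suc k) v)"
proof (rule AC_C1(1)[OF assms(2) _ smooth_dern_cont[OF assms(1)]])
  fix x assume "x \<in> {a..b}"
  then show "(dern {a..b} k v has_real_derivative dern {a..b} (Suc k) v x) (at x within {a..b})"
    using dern_has_derivative[of "Suc k" v "{a..b}" k x] assms unfolding smooth_fun_on_def by auto
qed

lemma wderiv_on_spike:
  assumes "wderiv_on a b v g" "negligible S" "\<And>x. x \<in> {a..b} - S \<Longrightarrow> v' x = v x" "\<And>x. x \<in> {a..b} - S \<Longrightarrow> g' x = g x"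
  shows "wderiv_on a b v' g'"
proof -
  have w: "wderiv_on a b v' g" by (rule wderiv_on_spike_fun[OF assms(1,2)]) (simp add: assms(3))
  obtain c where c: "negligible {x\<in>{a..b}. v' x \<noteq> c + integral {a..x} g}" using w by (auto simp: wderiv_on_def)
  have "integral {a..x} g' = integral {a..x} g" if "x \<in> {a..b}" for x
    by (rule integral_spike[OF assms(2)]) (use that assms(4) in auto)
  then have "{x\<in>{a..b}. v' x \<noteq> c + integral {a..x} g'} = {x\<in>{a..b}. v' x \<noteq> c + integral {a..x} g}" by auto
  moreover have "Ltwo a b g'" by (rule Ltwo_spike[OF wderiv_on_Ltwo[OF w] assms(2,4)])
  ultimately show ?thesis using c unfolding wderiv_on_def by (intro exI[of _ c] conjI) simp_all
qed

text \<open>Components that may jump at x = 1 have no weak derivative on the whole domain; their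
  derivatives on the two halves are joined afterwards, with an immaterial value at 1.\<close>

definition halves :: "(real \<Rightarrow> real) \<Rightarrow> (real \<Rightarrow> real) \<Rightarrow> real \<Rightarrow> real" where
  "halves gl gr x = (if x < 1 then gl x else gr x)"

text \<open>Although single components may jump at x = 1, their sum has a weak derivative on the
  whole domain. Uniqueness on each half identifies it with the sum of the piecewise
  derivatives.\<close>

lemma wderiv_ae_halves:
  assumes "sob u u1" "wderiv_on 0 1 u vl" "wderiv_on 1 2 u vr"
    and "\<And>x. 0 < x \<Longrightarrow> x < 1 \<Longrightarrow> g x = vl x" "\<And>x. 1 < x \<Longrightarrow> x < 2 \<Longrightarrow> g x = vr x"
  shows "negligible {x\<in>{0..2}. u1 x \<noteq> g x}"
proof -
  have w: "wderiv_on 0 2 u u1" using AC_imp_wderiv_on assms(1) by (auto simp: sob_def)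
  have "negligible {x\<in>{0..1}. u1 x \<noteq> vl x}" by (rule wderiv_on_unique[OF wderiv_on_sub[OF w] assms(2)]) auto
  moreover have "negligible {x\<in>{1..2}. u1 x \<noteq> vr x}" by (rule wderiv_on_unique[OF wderiv_on_sub[OF w] assms(3)]) auto
  ultimately have "negligible (({x\<in>{0..1}. u1 x \<noteq> vl x} \<union> {x\<in>{1..2}. u1 x \<noteq> vr x}) \<union> {0,1,2})"
    by (intro negligible_Un) auto
  then show ?thesis
  proof (rule negligible_subset, intro subsetI)
    fix x assume x: "x \<in> {x\<in>{0..2}. u1 x \<noteq> g x}"
    consider "x \<in> {0,1,2}" | "0 < x" "x < 1" | "1 < x" "x < 2" using x by force
    then show "x \<in> ({x\<in>{0..1}. u1 x \<noteq> vl x} \<union> {x\<in>{1..2}. u1 x \<noteq> vr x}) \<union> {0,1,2}"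
      using x assms(4,5)[of x] by cases auto
  qed
qed

context stype_mesh
begin

lemma deriv_chain_dern:
  assumes A: "open A" "{0<..<2} - {1} \<subseteq> A" and v: "times_differentiable_on (q + 1) v A"
    and M: "\<And>k. k \<le> q \<Longrightarrow> \<exists>M. \<forall>x\<in>A. \<bar>dern A (Suc k) v x\<bar> \<le> M"
  shows "deriv_chain (\<lambda>j. dern A (Suc j) v)"
  unfolding deriv_chain_def
proof (intro ballI conjI allI impI)
  fix i assume i: "i \<in> {1..N}"
  have s: "{X (i - 1)<..<X i} \<subseteq> A" 
  proof
    fix x assume "x \<in> {X (i - 1)<..<X i}"
    then have "x \<in> {0<..<2} - {1}" by (intro cell_interior[OF i]) simp_all
    then show "x \<in> A" by (rule subsetD[OF A(2)])
  qed
  have w: "wderiv_on (X (i - 1)) (X i) (dern A k v) (dern A (Suc k) v)" if k: "k \<le> q" for k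
  proof -
    obtain B where "\<forall>x\<in>A. \<bar>dern A (Suc k) v x\<bar> \<le> B" using M[OF k] by blast
    then show ?thesis using k cell_in[OF i] by (intro dern_wderiv_on[OF A(1) v _ s, of k B]) auto
  qed
  show "Ltwo (X (i - 1)) (X i) (dern A (Suc 0) v)" using wderiv_on_Ltwo[OF w[of 0]] by simp
  fix j assume "j < q"
  then show "wderiv_on (X (i - 1)) (X i) (dern A (Suc j) v) (dern A (Suc (Suc j)) v)" using w[of "Suc j"] by simp
qed

lemma deriv_chain_halves:
  assumes l: "Ltwo 0 1 (gl 0)" "\<And>j. j < q \<Longrightarrow> wderiv_on 0 1 (gl j) (gl (Suc j))"
    and r: "Ltwo 1 2 (gr 0)" "\<And>j. j < q \<Longrightarrow> wderiv_on 1 2 (gr j) (gr (Suc j))"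
  shows "deriv_chain (\<lambda>j. halves (gl j) (gr j))"
  unfolding deriv_chain_def
proof (intro ballI conjI allI impI)
  fix i assume i: "i \<in> {1..N}"
  have n: "negligible {1::real}" by simp
  show "Ltwo (X (i - 1)) (X i) (halves (gl 0) (gr 0))"
    using half_cells[OF i]
  proof (elim disjE)
    assume h: "X i \<le> 1 \<and> i \<le> 4 * n"
    have "Ltwo (X (i - 1)) (X i) (gl 0)" by (rule Ltwo_subinterval[OF l(1)]) (use h cell_in[OF i] in auto)
    then show ?thesis by (rule Ltwo_spike[OF _ n]) (use h in \<open>auto simp: halves_def\<close>)
  next
    assume h: "1 \<le> X (i - 1) \<and> i > 4 * n"
    have "Ltwo (X (i - 1)) (X i) (gr 0)" by (rule Ltwo_subinterval[OF r(1)]) (use h cell_in[OF i] in auto)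
    then show ?thesis by (rule Ltwo_spike[OF _ n]) (use h in \<open>auto simp: halves_def\<close>)
  qed
  fix j assume j: "j < q"
  show "wderiv_on (X (i - 1)) (X i) (halves (gl j) (gr j)) (halves (gl (Suc j)) (gr (Suc j)))"
    using half_cells[OF i]
  proof (elim disjE)
    assume h: "X i \<le> 1 \<and> i \<le> 4 * n"
    have "wderiv_on (X (i - 1)) (X i) (gl j) (gl (Suc j))" by (rule wderiv_on_sub[OF l(2)[OF j]]) (use h cell_in[OF i] in auto)
    then show ?thesis by (rule wderiv_on_spike[OF _ n]) (use h in \<open>auto simp: halves_def\<close>)
  next
    assume h: "1 \<le> X (i - 1) \<and> i > 4 * n"
    have "wderiv_on (X (i - 1)) (X i) (gr j) (gr (Suc j))" by (rule wderiv_on_sub[OF r(2)[OF j]]) (use h cell_in[OF i] in auto)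
    then show ?thesis by (rule wderiv_on_spike[OF _ n]) (use h in \<open>auto simp: halves_def\<close>)
  qed
qed

lemma powi_split: "\<epsilon> powi (int a - int b) = \<epsilon> ^ a * (1 / \<epsilon>) ^ b"
  using \<epsilon> by (simp add: power_int_diff power_one_over divide_inverse power_inverse)

lemma eps_pow_le: "p \<in> {1, 2::nat} \<Longrightarrow> \<epsilon> ^ (p - 1) \<le> eps_bd"
  using eps_bd by auto

text \<open>The integer power may be negative; it is split into a bounded power of \<epsilon> and a
  power of 1/\<epsilon>. The sign of \<open>K\<close> is left open, hence the absolute
  value.\<close>

lemma weaken_decay:
  assumes "y \<le> K * \<epsilon> powi (int a - int b) * z" "\<epsilon> ^ a \<le> B" "0 \<le> z"
  shows "y \<le> \<bar>K\<bar> * B * (1 / \<epsilon>) ^ b * z"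
proof -
  have "K * \<epsilon> powi (int a - int b) * z = K * (\<epsilon> ^ a * (1 / \<epsilon>) ^ b * z)" by (simp only: powi_split mult.assoc)
  also have "\<dots> \<le> \<bar>K\<bar> * (B * (1 / \<epsilon>) ^ b * z)"
    using assms(2,3) \<epsilon> by (intro mult_mono mult_right_mono) auto
  finally show ?thesis using assms(1) by (simp only: mult.assoc)
qed

lemma exp_decay_le_1: "t \<ge> 0 \<Longrightarrow> exp (- \<beta> * t / \<epsilon>) \<le> 1"
  using \<beta> \<epsilon> by simp

lemma halves_weight:
  assumes x: "x \<in> {0<..<2} - {1}"
    and l: "\<And>x. x \<in> {0<..<1} \<Longrightarrow> \<bar>gl x\<bar> \<le> c * exp (- \<beta> * (1 - x) / \<epsilon>)"
    and r: "\<And>x. x \<in> {1<..<2} \<Longrightarrow> \<bar>gr x\<bar> \<le> c * exp (- \<beta> * (x - 1) / \<epsilon>)"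
  shows "\<bar>halves gl gr x\<bar> \<le> c * int_weight x"
proof (cases "x < 1")
  case True then show ?thesis using l[of x] x by (simp add: halves_def int_weight_def)
next
  case False then show ?thesis using r[of x] x by (simp add: halves_def int_weight_def)
qed

lemma deriv_chain_halves_dern:
  assumes l: "times_differentiable_on (q + 1) v {0<..<1}"
      "\<And>j x. j \<le> q \<Longrightarrow> x \<in> {0<..<1} \<Longrightarrow> \<bar>dern {0<..<1} (Suc j) v x\<bar> \<le> c j"
    and r: "times_differentiable_on (q + 1) w {1<..<2}"
      "\<And>j x. j \<le> q \<Longrightarrow> x \<in> {1<..<2} \<Longrightarrow> \<bar>dern {1<..<2} (Suc j) w x\<bar> \<le> c j"
  shows "deriv_chain (\<lambda>j. halves (dern {0<..<1} (Suc j) v) (dern {1<..<2} (Suc j) w))"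
    "wderiv_on 0 1 v (dern {0<..<1} (Suc 0) v)" "wderiv_on 1 2 w (dern {1<..<2} (Suc 0) w)"
proof -
  have wl: "wderiv_on 0 1 (dern {0<..<1} k v) (dern {0<..<1} (Suc k) v)" if "k \<le> q" for k
    by (rule dern_wderiv_on[OF _ l(1) _ _ _ l(2)]) (use that in auto)
  have wr: "wderiv_on 1 2 (dern {1<..<2} k w) (dern {1<..<2} (Suc k) w)" if "k \<le> q" for k
    by (rule dern_wderiv_on[OF _ r(1) _ _ _ r(2)]) (use that in auto)
  have d0: "dern A 0 f = f" for A f by (simp add: dern_def)
  show "wderiv_on 0 1 v (dern {0<..<1} (Suc 0) v)" "wderiv_on 1 2 w (dern {1<..<2} (Suc 0) w)"
    using wl[of 0] wr[of 0] by (auto simp: d0)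
  show "deriv_chain (\<lambda>j. halves (dern {0<..<1} (Suc j) v) (dern {1<..<2} (Suc j) w))"
    by (rule deriv_chain_halves[OF wderiv_on_Ltwo[OF wl[OF le0]] wl[OF Suc_leI] wderiv_on_Ltwo[OF wr[OF le0]] wr[OF Suc_leI]])
qed

lemma dern_wderiv_on_halves:
  assumes "open A" "{0<..<2} - {1} \<subseteq> A" "times_differentiable_on (q + 1) v A"
    and "\<And>x. x \<in> A \<Longrightarrow> \<bar>dern A (Suc 0) v x\<bar> \<le> M"
  shows "wderiv_on 0 1 v (dern A (Suc 0) v)" "wderiv_on 1 2 v (dern A (Suc 0) v)"
proof -
  have d0: "dern A 0 v = v" by (simp add: dern_def)
  have s: "{0<..<1} \<subseteq> A" "{1<..<2} \<subseteq> A" using assms(2) by auto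
  show "wderiv_on 0 1 v (dern A (Suc 0) v)" "wderiv_on 1 2 v (dern A (Suc 0) v)"
    using dern_wderiv_on[OF assms(1,3) _ s(1) _ assms(4), unfolded d0] dern_wderiv_on[OF assms(1,3) _ s(2) _ assms(4), unfolded d0] by auto
qed

lemma layer_props:
  assumes b: "deriv_bounds (q + 1) {0<..<2} v G"
    and G: "\<And>j x. j \<le> q \<Longrightarrow> x \<in> {0<..<2} \<Longrightarrow> G (Suc j) x \<le> c * (1 / \<epsilon>) ^ j * e x" and e: "\<And>x. x \<in> {0<..<2} \<Longrightarrow> 0 \<le> e x \<and> e x \<le> 1" and c: "c \<ge> 0"
  shows "deriv_chain (\<lambda>j. dern {0<..<2} (Suc j) v)"
    "\<And>j x. j \<le> q \<Longrightarrow> x \<in> {0<..<2} - {1} \<Longrightarrow> \<bar>dern {0<..<2} (Suc j) v x\<bar> \<le> c * (1 / \<epsilon>) ^ j * e x"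
    "wderiv_on 0 1 v (dern {0<..<2} (Suc 0) v)" "wderiv_on 1 2 v (dern {0<..<2} (Suc 0) v)"
proof -
  have t: "times_differentiable_on (q + 1) v {0<..<2}" using b by (simp add: deriv_bounds_def)
  have B: "\<bar>dern {0<..<2} (Suc j) v x\<bar> \<le> c * (1 / \<epsilon>) ^ j * e x" if "j \<le> q" "x \<in> {0<..<2}" for j x
  proof -
    have "\<bar>dern {0<..<2} (Suc j) v x\<bar> \<le> G (Suc j) x" using b that by (auto simp: deriv_bounds_def)
    then show ?thesis using G[OF that] by linarith
  qed
  have B': "\<bar>dern {0<..<2} (Suc j) v x\<bar> \<le> c * (1 / \<epsilon>) ^ j" if "j \<le> q" "x \<in> {0<..<2}" for j x
  proof -
    have "c * (1 / \<epsilon>) ^ j * e x \<le> c * (1 / \<epsilon>) ^ j * 1" using e[OF that(2)] c \<epsilon> by (intro mult_left_mono) auto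
    then show ?thesis using B[OF that] by linarith
  qed
  show "deriv_chain (\<lambda>j. dern {0<..<2} (Suc j) v)" 
  proof (rule deriv_chain_dern[OF _ _ t])
    fix j assume "j \<le> q"
    then show "\<exists>M. \<forall>x\<in>{0<..<2}. \<bar>dern {0<..<2} (Suc j) v x\<bar> \<le> M"
      by (intro exI[of _ "c * (1 / \<epsilon>) ^ j"] ballI B')
  qed auto
  show "\<bar>dern {0<..<2} (Suc j) v x\<bar> \<le> c * (1 / \<epsilon>) ^ j * e x" if "j \<le> q" "x \<in> {0<..<2} - {1}" for j x
    using B that by auto
  show "wderiv_on 0 1 v (dern {0<..<2} (Suc 0) v)" "wderiv_on 1 2 v (dern {0<..<2} (Suc 0) v)"
    using dern_wderiv_on_halves[OF _ _ t B'[OF le0]] by auto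
qed

lemma interior_props:
  assumes b: "deriv_bounds (q + 1) {0<..<1} v G" "deriv_bounds (q + 1) {1<..<2} w G'"
    and G: "\<And>j x. j \<le> q \<Longrightarrow> x \<in> {0<..<1} \<Longrightarrow> G (Suc j) x \<le> c * (1 / \<epsilon>) ^ j * exp (- \<beta> * (1 - x) / \<epsilon>)"
      "\<And>j x. j \<le> q \<Longrightarrow> x \<in> {1<..<2} \<Longrightarrow> G' (Suc j) x \<le> c * (1 / \<epsilon>) ^ j * exp (- \<beta> * (x - 1) / \<epsilon>)"
    and c: "c \<ge> 0"
  shows "deriv_chain (\<lambda>j. halves (dern {0<..<1} (Suc j) v) (dern {1<..<2} (Suc j) w))"
    "\<And>j x. j \<le> q \<Longrightarrow> x \<in> {0<..<2} - {1} \<Longrightarrow> \<bar>halves (dern {0<..<1} (Suc j) v) (dern {1<..<2} (Suc j) w) x\<bar> \<le> c * (1 / \<epsilon>) ^ j * int_weight x"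
    "wderiv_on 0 1 v (dern {0<..<1} (Suc 0) v)" "wderiv_on 1 2 w (dern {1<..<2} (Suc 0) w)"
proof -
  have t: "times_differentiable_on (q + 1) v {0<..<1}" "times_differentiable_on (q + 1) w {1<..<2}"
    using b by (auto simp: deriv_bounds_def)
  have B1: "\<bar>dern {0<..<1} (Suc j) v x\<bar> \<le> c * (1 / \<epsilon>) ^ j * exp (- \<beta> * (1 - x) / \<epsilon>)" if "j \<le> q" "x \<in> {0<..<1}" for j x
  proof -
    have "\<bar>dern {0<..<1} (Suc j) v x\<bar> \<le> G (Suc j) x" using b that by (auto simp: deriv_bounds_def)
    then show ?thesis using G(1)[OF that] by linarith
  qed
  have B2: "\<bar>dern {1<..<2} (Suc j) w x\<bar> \<le> c * (1 / \<epsilon>) ^ j * exp (- \<beta> * (x - 1) / \<epsilon>)" if "j \<le> q" "x \<in> {1<..<2}" for j x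
  proof -
    have "\<bar>dern {1<..<2} (Suc j) w x\<bar> \<le> G' (Suc j) x" using b that by (auto simp: deriv_bounds_def)
    then show ?thesis using G(2)[OF that] by linarith
  qed
  have le: "c * (1 / \<epsilon>) ^ j * exp (- \<beta> * t / \<epsilon>) \<le> c * (1 / \<epsilon>) ^ j" if "t \<ge> 0" for j t
    using mult_left_mono[OF exp_decay_le_1[OF that], of "c * (1 / \<epsilon>) ^ j"] c \<epsilon> by simp
  have B1': "\<bar>dern {0<..<1} (Suc j) v x\<bar> \<le> c * (1 / \<epsilon>) ^ j" if "j \<le> q" "x \<in> {0<..<1}" for j x
    using order_trans[OF B1[OF that] le] that by auto
  have B2': "\<bar>dern {1<..<2} (Suc j) w x\<bar> \<le> c * (1 / \<epsilon>) ^ j" if "j \<le> q" "x \<in> {1<..<2}" for j x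
    using order_trans[OF B2[OF that] le] that by auto
  note H = deriv_chain_halves_dern[OF t(1) B1' t(2) B2']
  show "deriv_chain (\<lambda>j. halves (dern {0<..<1} (Suc j) v) (dern {1<..<2} (Suc j) w))" by (rule H(1))
  show "wderiv_on 0 1 v (dern {0<..<1} (Suc 0) v)" "wderiv_on 1 2 w (dern {1<..<2} (Suc 0) w)" using H(2,3) by auto
  show "\<bar>halves (dern {0<..<1} (Suc j) v) (dern {1<..<2} (Suc j) w) x\<bar> \<le> c * (1 / \<epsilon>) ^ j * int_weight x"
    if "j \<le> q" "x \<in> {0<..<2} - {1}" for j x
    by (rule halves_weight[OF that(2) B1 B2]) (use that in auto)
qed

lemma u_bound:
  assumes p: "p \<in> {1, 2}" and dec: "u_decomposition q p \<beta> K \<epsilon> u" and u: "sob u u1"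
    and cx: "q > 2 \<Longrightarrow> exp (- \<rho>) \<le> Cx * \<epsilon> * mesh_size ^ (q - 2)"
    and P: "\<And>i. i \<in> {1..N} \<Longrightarrow> is_proj q (X (i - 1)) (X i) u1 (P i)"
  shows "(\<Sum>i\<in>{1..N}. sqint (X (i - 1)) (X i) (\<lambda>x. u1 x - poly (P i) x)) \<le> CA (K\<^sup>2) (\<bar>K\<bar> * eps_bd) \<bar>K\<bar> Cx * r ^ (2 * q)"
proof -
  obtain S E1 E2 W1 W2 where
    ae: "AE x in lebesgue. x \<in> {0<..<2} \<longrightarrow>
        u x = S x + E1 x + E2 x + W1 x * indicator {0<..<1} x + W2 x * indicator {1<..<2} x" and
    S: "S \<in> sobolev (q + 1) 0 1" "S \<in> sobolev (q + 1) 1 2"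
     "\<forall>k\<le>q + 1. L2_nrm 0 1 ((wderiv 0 1 ^^ k) S) + L2_nrm 1 2 ((wderiv 1 2 ^^ k) S) \<le> K" and
    E1: "deriv_bounds (q + 1) {0<..<2} E1 (\<lambda>k x. K * \<epsilon> powi (int p - int k) * exp (- \<beta> * x / \<epsilon>))" and
    E2: "deriv_bounds (q + 1) {0<..<2} E2 (\<lambda>k x. K * \<epsilon> powi (int p - int k) * exp (- \<beta> * (2 - x) / \<epsilon>))" and
    W1: "deriv_bounds (q + 1) {0<..<1} W1 (\<lambda>k x. K * \<epsilon> powi (3 - int k) * exp (- \<beta> * (1 - x) / \<epsilon>))" and
    W2: "deriv_bounds (q + 1) {1<..<2} W2 (\<lambda>k x. K * \<epsilon> powi (3 - int k) * exp (- \<beta> * (x - 1) / \<epsilon>))"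
    using dec unfolding u_decomposition_def by blast
  have eps_bd_nonneg: "\<bar>K\<bar> * eps_bd \<ge> 0" using eps_bd by simp
  \<comment> \<open>The chains start with a first derivative, which takes one power of \<epsilon>.
    For the boundary layers \<epsilon>^(m-1) is bounded by \<open>eps_bd\<close>, and for the weak
    layers \<epsilon>^2 is left over.\<close>
  have ip: "int p - int (Suc j) = int (p - 1) - int j" "(3::int) - int (Suc j) = int 2 - int j" for j
    using p by auto
  have E1': "K * \<epsilon> powi (int p - int (Suc j)) * exp (- \<beta> * x / \<epsilon>) \<le> \<bar>K\<bar> * eps_bd * (1 / \<epsilon>) ^ j * exp (- \<beta> * x / \<epsilon>)" for j x
    unfolding ip by (rule weaken_decay[OF order_refl eps_pow_le[OF p]]) simp
  have E2': "K * \<epsilon> powi (int p - int (Suc j)) * exp (- \<beta> * (2 - x) / \<epsilon>) \<le> \<bar>K\<bar> * eps_bd * (1 / \<epsilon>) ^ j * exp (- \<beta> * (2 - x) / \<epsilon>)" for j x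
    unfolding ip by (rule weaken_decay[OF order_refl eps_pow_le[OF p]]) simp
  have W': "K * \<epsilon> powi (3 - int (Suc j)) * exp t \<le> \<bar>K\<bar> * \<epsilon>\<^sup>2 * (1 / \<epsilon>) ^ j * exp t" for j t
    unfolding ip by (rule weaken_decay[OF order_refl order_refl]) simp
  have x1: "0 \<le> exp (- \<beta> * x / \<epsilon>) \<and> exp (- \<beta> * x / \<epsilon>) \<le> 1" if "x \<in> {0<..<2}" for x
    using exp_decay_le_1[of x] that by auto
  have x2: "0 \<le> exp (- \<beta> * (2 - x) / \<epsilon>) \<and> exp (- \<beta> * (2 - x) / \<epsilon>) \<le> 1" if "x \<in> {0<..<2}" for x
    using exp_decay_le_1[of "2 - x"] that by auto
  note L1 = layer_props[where e = "\<lambda>x. exp (- \<beta> * x / \<epsilon>)", OF E1 E1' x1 eps_bd_nonneg]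
  note L2 = layer_props[where e = "\<lambda>x. exp (- \<beta> * (2 - x) / \<epsilon>)", OF E2 E2' x2 eps_bd_nonneg]
  have cW: "\<bar>K\<bar> * \<epsilon>\<^sup>2 \<ge> 0" by simp
  note IW = interior_props[OF W1 W2 W' W' cW]
  define gS where "gS j = halves ((wderiv 0 1 ^^ Suc j) S) ((wderiv 1 2 ^^ Suc j) S)" for j
  have wS: "wderiv_on 0 1 ((wderiv 0 1 ^^ k) S) ((wderiv 0 1 ^^ Suc k) S)" "wderiv_on 1 2 ((wderiv 1 2 ^^ k) S) ((wderiv 1 2 ^^ Suc k) S)"
    if "k \<le> q" for k using sobolev_wderiv_on[OF S(1), of k] sobolev_wderiv_on[OF S(2), of k] that by auto
  have chS: "deriv_chain gS" unfolding gS_def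
  proof (rule deriv_chain_halves)
    show "Ltwo 0 1 ((wderiv 0 1 ^^ Suc 0) S)" "Ltwo 1 2 ((wderiv 1 2 ^^ Suc 0) S)"
      using wS[of 0, THEN wderiv_on_Ltwo] by simp_all
    fix j assume "j < q"
    then show "wderiv_on 0 1 ((wderiv 0 1 ^^ Suc j) S) ((wderiv 0 1 ^^ Suc (Suc j)) S)" "wderiv_on 1 2 ((wderiv 1 2 ^^ Suc j) S) ((wderiv 1 2 ^^ Suc (Suc j)) S)"
      using wS[of "Suc j"] by (simp_all only: Suc_leI)
  qed
  have sumS: "(\<Sum>i\<in>{1..N}. sqint (X (i - 1)) (X i) (gS q)) \<le> K\<^sup>2"
  proof -
    define a where "a = (wderiv 0 1 ^^ Suc q) S"
    define c where "c = (wderiv 1 2 ^^ Suc q) S"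
    have L: "Ltwo 0 1 a" "Ltwo 1 2 c" unfolding a_def c_def using wS[OF order_refl, THEN wderiv_on_Ltwo] by auto
    have n: "negligible {1::real}" by simp
    have ha: "halves a c x = a x" if "x \<in> {0..1} - {1}" for x using that by (auto simp: halves_def)
    have hc: "halves a c x = c x" if "x \<in> {1..2} - {1}" for x using that by (auto simp: halves_def)
    have "Ltwo 0 1 (halves a c)" "Ltwo 1 2 (halves a c)"
      using Ltwo_spike[OF L(1) n ha] Ltwo_spike[OF L(2) n hc] by auto
    then have LL: "Ltwo 0 2 (halves a c)" by (rule Ltwo_glue) auto
    have "(\<Sum>i\<in>{1..N}. sqint (X (i - 1)) (X i) (halves a c)) = sqint 0 2 (halves a c)"
      by (rule sum_cells[OF Ltwo_sq_int[OF LL]])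
    also have "\<dots> = sqint 0 1 (halves a c) + sqint 1 2 (halves a c)"
      using Henstock_Kurzweil_Integration.integral_combine[of 0 1 2 "\<lambda>x. (halves a c x)\<^sup>2"] Ltwo_sq_int[OF LL] by simp
    also have "sqint 0 1 (halves a c) = sqint 0 1 a"
      by (rule integral_spike[OF n]) (simp add: ha)
    also have "sqint 1 2 (halves a c) = sqint 1 2 c"
      by (rule integral_spike[OF n]) (simp add: hc)
    finally have "(\<Sum>i\<in>{1..N}. sqint (X (i - 1)) (X i) (halves a c)) = (L2_nrm 0 1 a)\<^sup>2 + (L2_nrm 1 2 c)\<^sup>2"
      by (simp only: L2_nrm_sq[OF L(1)] L2_nrm_sq[OF L(2)])
    moreover have nn: "L2_nrm 0 1 a \<ge> 0" "L2_nrm 1 2 c \<ge> 0"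
      using integral_nonneg[OF Ltwo_mult_int[OF L(1) L(1)]] integral_nonneg[OF Ltwo_mult_int[OF L(2) L(2)]]
      by (auto simp: L2_nrm_def L2_inner_eq_integral L)
    \<comment> \<open>The decomposition bounds the sum of the norms on the halves, which dominates
      the square root of the sum of their squares.\<close>
    moreover have "(L2_nrm 0 1 a + L2_nrm 1 2 c)\<^sup>2 \<le> K\<^sup>2"
      using S(3) nn unfolding a_def c_def by (intro power_mono) (auto simp del: funpow.simps)
    moreover have "(L2_nrm 0 1 a)\<^sup>2 + (L2_nrm 1 2 c)\<^sup>2 \<le> (L2_nrm 0 1 a + L2_nrm 1 2 c)\<^sup>2"
      using nn by (simp add: power2_sum)
    ultimately show ?thesis unfolding gS_def a_def c_def by linarith
  qed
  \<comment> \<open>Besides the exceptional set of the splitting, the end points of both halves are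
    removed, where the indicators vanish.\<close>
  define N0 where "N0 = {x. \<not> (x \<in> {0<..<2} \<longrightarrow>
        u x = S x + E1 x + E2 x + W1 x * indicator {0<..<1} x + W2 x * indicator {1<..<2} x)} \<union> {0, 1, 2::real}"
  have N0: "negligible N0" unfolding N0_def by (intro negligible_Un AE_lebesgue_negligible[OF ae]) auto
  have d0: "(wderiv a b ^^ 0) S = S" for a b by simp
  have l: "wderiv_on 0 1 u (\<lambda>x. (wderiv 0 1 ^^ Suc 0) S x + dern {0<..<2} (Suc 0) E1 x + dern {0<..<2} (Suc 0) E2 x + dern {0<..<1} (Suc 0) W1 x)"
    by (rule wderiv_on_spike_fun[OF wderiv_on_add[OF wderiv_on_add[OF wderiv_on_add[OF wS(1)[OF le0, unfolded d0] L1(3)] L2(3)] IW(3)] N0])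
      (auto simp: N0_def)
  have rr: "wderiv_on 1 2 u (\<lambda>x. (wderiv 1 2 ^^ Suc 0) S x + dern {0<..<2} (Suc 0) E1 x + dern {0<..<2} (Suc 0) E2 x + dern {1<..<2} (Suc 0) W2 x)"
    by (rule wderiv_on_spike_fun[OF wderiv_on_add[OF wderiv_on_add[OF wderiv_on_add[OF wS(2)[OF le0, unfolded d0] L1(4)] L2(4)] IW(4)] N0])
      (auto simp: N0_def)
  have neg: "negligible {x\<in>{0..2}. u1 x \<noteq> gS 0 x + dern {0<..<2} (Suc 0) E1 x + dern {0<..<2} (Suc 0) E2 x
      + halves (dern {0<..<1} (Suc 0) W1) (dern {1<..<2} (Suc 0) W2) x}"
    by (rule wderiv_ae_halves[OF u l rr]) (auto simp: gS_def halves_def)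
  show ?thesis
    by (rule total_A[where gS = gS and ?g1.0 = "\<lambda>j. dern {0<..<2} (Suc j) E1" and ?g2.0 = "\<lambda>j. dern {0<..<2} (Suc j) E2"
          and gW = "\<lambda>j. halves (dern {0<..<1} (Suc j) W1) (dern {1<..<2} (Suc j) W2)", OF neg chS L1(1) L2(1) IW(1) sumS L1(2) L2(2) IW(2) _ cx P])
      auto
qed

lemma w_bound:
  assumes p: "p \<in> {1, 2}" and dec: "w_decomposition q p \<beta> K \<epsilon> w" and w: "sob w w1"
    and cx: "q > 2 \<Longrightarrow> exp (- \<rho>) \<le> Cx * \<epsilon> * mesh_size ^ (q - 2)"
    and CL: "CL > 0" "\<And>a b g. a \<le> b \<Longrightarrow> Ltwo a b g \<Longrightarrow> prim_err_le q a b g ((b - a) * (CL * (integral {a..b} (\<lambda>x. \<bar>g x\<bar>))\<^sup>2))"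
    and P: "\<And>i. i \<in> {1..N} \<Longrightarrow> is_proj q (X (i - 1)) (X i) w1 (P i)"
  shows "(\<Sum>i\<in>{1..N}. sqint (X (i - 1)) (X i) (\<lambda>x. integral {X (i - 1)..x} (\<lambda>x. w1 x - poly (P i) x))) \<le> CT (\<bar>K\<bar> * eps_bd) (\<bar>K\<bar> * eps_bd) \<bar>K\<bar> Cx CL * r ^ (2 * q + 1)"
proof -
  define A where "A = {0<..<2} - {1::real}"
  have A: "open A" "{0<..<2} - {1} \<subseteq> A" by (auto simp: A_def intro: open_Diff)
  obtain S E1 E2 W1 W2 where
    ae: "\<forall>x\<in>{0<..<2} - {1}. w x = S x + E1 x + E2 x + W1 x * indicator {0<..<1} x + W2 x * indicator {1<..<2} x" and
    S: "deriv_bounds (q + 1) A S (\<lambda>k x. K * \<epsilon>)" and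
    E1: "deriv_bounds (q + 1) {0<..<2} E1 (\<lambda>k x. K * \<epsilon> powi (int p - 1 - int k) * exp (- \<beta> * x / \<epsilon>))" and
    E2: "deriv_bounds (q + 1) {0<..<2} E2 (\<lambda>k x. K * \<epsilon> powi (int p - 1 - int k) * exp (- \<beta> * (2 - x) / \<epsilon>))" and
    W1: "deriv_bounds (q + 1) {0<..<1} W1 (\<lambda>k x. K * \<epsilon> powi (2 - int k) * exp (- \<beta> * (1 - x) / \<epsilon>))" and
    W2: "deriv_bounds (q + 1) {1<..<2} W2 (\<lambda>k x. K * \<epsilon> powi (2 - int k) * exp (- \<beta> * (x - 1) / \<epsilon>))"
    using dec unfolding w_decomposition_def A_def by blast
  have eps_bd_nonneg: "\<bar>K\<bar> * eps_bd / \<epsilon> \<ge> 0" "\<bar>K\<bar> * eps_bd \<ge> 0" using eps_bd \<epsilon> by auto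
  \<comment> \<open>For w the bounded power \<epsilon>^(m-1) is already spent on the function
    itself, so its first derivative in the boundary layers is of size 1/\<epsilon>.\<close>
  have ip: "int p - 1 - int (Suc j) = int (p - 1) - int (Suc j)" "(2::int) - int (Suc j) = int 1 - int j" for j
    using p by auto
  have sc: "\<bar>K\<bar> * eps_bd * (1 / \<epsilon>) ^ Suc j = \<bar>K\<bar> * eps_bd / \<epsilon> * (1 / \<epsilon>) ^ j" for j by simp
  have E1': "K * \<epsilon> powi (int p - 1 - int (Suc j)) * exp (- \<beta> * x / \<epsilon>) \<le> \<bar>K\<bar> * eps_bd / \<epsilon> * (1 / \<epsilon>) ^ j * exp (- \<beta> * x / \<epsilon>)" for j x
    unfolding ip sc[symmetric] by (rule weaken_decay[OF order_refl eps_pow_le[OF p]]) simp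
  have E2': "K * \<epsilon> powi (int p - 1 - int (Suc j)) * exp (- \<beta> * (2 - x) / \<epsilon>) \<le> \<bar>K\<bar> * eps_bd / \<epsilon> * (1 / \<epsilon>) ^ j * exp (- \<beta> * (2 - x) / \<epsilon>)" for j x
    unfolding ip sc[symmetric] by (rule weaken_decay[OF order_refl eps_pow_le[OF p]]) simp
  have W': "K * \<epsilon> powi (2 - int (Suc j)) * exp t \<le> \<bar>K\<bar> * \<epsilon> * (1 / \<epsilon>) ^ j * exp t" for j t
    unfolding ip by (rule weaken_decay[OF order_refl]) auto
  have x1: "0 \<le> exp (- \<beta> * x / \<epsilon>) \<and> exp (- \<beta> * x / \<epsilon>) \<le> 1" if "x \<in> {0<..<2}" for x
    using exp_decay_le_1[of x] that by auto
  have x2: "0 \<le> exp (- \<beta> * (2 - x) / \<epsilon>) \<and> exp (- \<beta> * (2 - x) / \<epsilon>) \<le> 1" if "x \<in> {0<..<2}" for x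
    using exp_decay_le_1[of "2 - x"] that by auto
  note L1 = layer_props[where e = "\<lambda>x. exp (- \<beta> * x / \<epsilon>)", OF E1 E1' x1 eps_bd_nonneg(1)]
  note L2 = layer_props[where e = "\<lambda>x. exp (- \<beta> * (2 - x) / \<epsilon>)", OF E2 E2' x2 eps_bd_nonneg(1)]
  have cW: "\<bar>K\<bar> * \<epsilon> \<ge> 0" using \<epsilon> by simp
  note IW = interior_props[OF W1 W2 W' W' cW]
  have tS: "times_differentiable_on (q + 1) S A" using S by (simp add: deriv_bounds_def)
  have BS: "\<bar>dern A (Suc j) S x\<bar> \<le> \<bar>K\<bar> * eps_bd" if "j \<le> q" "x \<in> A" for j x
  proof -
    have "\<bar>dern A (Suc j) S x\<bar> \<le> K * \<epsilon>" using S that by (auto simp: deriv_bounds_def)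
    also have "\<dots> \<le> \<bar>K\<bar> * eps_bd" using eps_bd \<epsilon> by (intro mult_mono) auto
    finally show ?thesis .
  qed
  have chS: "deriv_chain (\<lambda>j. dern A (Suc j) S)" by (rule deriv_chain_dern[OF A tS]) (use BS in blast)
  note wS = dern_wderiv_on_halves[OF A tS BS[OF le0]]
  have n: "negligible {0, 1, 2::real}" by simp
  have l: "wderiv_on 0 1 w (\<lambda>x. dern A (Suc 0) S x + dern {0<..<2} (Suc 0) E1 x + dern {0<..<2} (Suc 0) E2 x + dern {0<..<1} (Suc 0) W1 x)"
    by (rule wderiv_on_spike_fun[OF wderiv_on_add[OF wderiv_on_add[OF wderiv_on_add[OF wS(1) L1(3)] L2(3)] IW(3)] n]) (use ae in auto)
  have rr: "wderiv_on 1 2 w (\<lambda>x. dern A (Suc 0) S x + dern {0<..<2} (Suc 0) E1 x + dern {0<..<2} (Suc 0) E2 x + dern {1<..<2} (Suc 0) W2 x)"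
    by (rule wderiv_on_spike_fun[OF wderiv_on_add[OF wderiv_on_add[OF wderiv_on_add[OF wS(2) L1(4)] L2(4)] IW(4)] n]) (use ae in auto)
  have neg: "negligible {x\<in>{0..2}. w1 x \<noteq> dern A (Suc 0) S x + dern {0<..<2} (Suc 0) E1 x + dern {0<..<2} (Suc 0) E2 x
      + halves (dern {0<..<1} (Suc 0) W1) (dern {1<..<2} (Suc 0) W2) x}"
    by (rule wderiv_ae_halves[OF w l rr]) (auto simp: halves_def)
  have SK: "\<bar>dern A (Suc q) S x\<bar> \<le> \<bar>K\<bar> * eps_bd" if "x \<in> {0<..<2} - {1}" for x
    using BS[OF order_refl, of x] that by (simp add: A_def)
  show ?thesis
    by (rule total_T[where gS = "\<lambda>j. dern A (Suc j) S" and ?g1.0 = "\<lambda>j. dern {0<..<2} (Suc j) E1" and ?g2.0 = "\<lambda>j. dern {0<..<2} (Suc j) E2"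
          and gW = "\<lambda>j. halves (dern {0<..<1} (Suc j) W1) (dern {1<..<2} (Suc j) W2)", OF neg chS L1(1) L2(1) IW(1) SK L1(2) L2(2) eps_bd_nonneg(2) IW(2) _ cx CL P])
      auto
qed

end

section \<open>Uniform constants and the final estimates\<close>

lemma square_le_powr:
  assumes "0 \<le> E" "E\<^sup>2 \<le> V * r ^ (2 * q + 1)" "r > 0" "sqrt V \<le> C"
  shows "E \<le> C * r powr (real q + 1/2)"
proof -
  have "(r powr (real q + 1/2))\<^sup>2 = r powr (real (2 * q + 1))"
    by (simp add: power2_eq_square powr_add[symmetric] add.commute)
  then have "r ^ (2 * q + 1) = (r powr (real q + 1/2))\<^sup>2" using assms(3) by (simp only: powr_realpow)
  then have "E \<le> sqrt (V * (r powr (real q + 1/2))\<^sup>2)" using assms(2) by (simp add: real_le_rsqrt)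
  also have "\<dots> = sqrt V * r powr (real q + 1/2)" by (simp add: real_sqrt_mult)
  also have "\<dots> \<le> C * r powr (real q + 1/2)" using assms(4) by (intro mult_right_mono) auto
  finally show ?thesis .
qed

lemma square_le_power:
  assumes "E\<^sup>2 \<le> V * r ^ (2 * q)" "r \<ge> 0" "sqrt V \<le> C"
  shows "E \<le> C * r ^ q"
proof -
  have "E \<le> sqrt (V * (r ^ q)\<^sup>2)" using assms(1) by (simp add: real_le_rsqrt power_mult mult.commute[of 2])
  also have "\<dots> = sqrt V * r ^ q" using assms(2) by (simp add: real_sqrt_mult)
  also have "\<dots> \<le> C * r ^ q" using assms(2,3) by (intro mult_right_mono) auto
  finally show ?thesis .
qed

lemma smooth_coeffs:
  assumes pos: "\<beta> > 0" "\<delta> > 0"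
    and b: "smooth_fun_on b {0..2}" and c: "smooth_fun_on c {0..2}" and d: "smooth_fun_on d {0..2}"
    and "\<forall>x\<in>{0..2}. b x \<ge> \<beta>\<^sup>2"
    and "\<forall>x\<in>{0..2}. c x - 1/2 * Linf_nrm 1 2 d
           - 1 / (2 * \<beta>\<^sup>2) * (Linf_nrm 0 2 (dern {0..2} 1 b))\<^sup>2 \<ge> \<delta>"
  obtains M where "coeffs b (dern {0..2} 1 b) (dern {0..2} 2 b) c d \<beta> \<delta> (Linf_nrm 1 2 d)
    (Linf_nrm 0 2 (dern {0..2} 1 b)) M"
proof -
  have d0: "dern {0..2} 0 v = v" for v by (simp add: dern_def)
  have cont: "continuous_on {0..2} (dern {0..2} 1 b)" "continuous_on {0..2} (dern {0..2} 2 b)"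
    "continuous_on {0..2} c" "continuous_on {0..2} d"
    using smooth_dern_cont[OF b] smooth_dern_cont[OF c, of 0] smooth_dern_cont[OF d, of 0] by (auto simp: d0)
  have "\<exists>M. \<forall>x\<in>{0..2}. \<bar>g x\<bar> \<le> M" if "continuous_on {0..2} g" for g :: "real \<Rightarrow> real"
  proof -
    have "bounded (g ` {0..2})" using that by (intro compact_imp_bounded compact_continuous_image) auto
    then show ?thesis unfolding bounded_iff by auto
  qed
  then obtain M1 M2 M3 M4 where M: "\<forall>x\<in>{0..2}. \<bar>dern {0..2} 1 b x\<bar> \<le> M1" "\<forall>x\<in>{0..2}. \<bar>dern {0..2} 2 b x\<bar> \<le> M2"
    "\<forall>x\<in>{0..2}. \<bar>c x\<bar> \<le> M3" "\<forall>x\<in>{0..2}. \<bar>d x\<bar> \<le> M4"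
    using cont by metis
  define M where "M = max (max M1 M2) (max M3 M4)"
  have AC: "AC 0 2 b (dern {0..2} 1 b)" "AC 0 2 (dern {0..2} 1 b) (dern {0..2} 2 b)"
    using smooth_dern_AC[OF b, of 0] smooth_dern_AC[OF b, of 1] by (simp_all add: d0 numeral_2_eq_2)
  have "coeffs b (dern {0..2} 1 b) (dern {0..2} 2 b) c d \<beta> \<delta> (Linf_nrm 1 2 d)
    (Linf_nrm 0 2 (dern {0..2} 1 b)) M"
  proof unfold_locales
    fix x :: real assume x: "x \<in> {0..2}"
    show "\<bar>dern {0..2} 1 b x\<bar> \<le> M" "\<bar>dern {0..2} 2 b x\<bar> \<le> M" "\<bar>c x\<bar> \<le> M" "\<bar>d x\<bar> \<le> M"
      using M[THEN bspec, OF x] unfolding M_def by linarith+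
    show "\<bar>dern {0..2} 1 b x\<bar> \<le> Linf_nrm 0 2 (dern {0..2} 1 b)"
      by (rule abs_le_Linf_nrm[OF _ cont(1) x]) simp
  next
    fix x :: real assume x: "x \<in> {1..2}"
    show "\<bar>d x\<bar> \<le> Linf_nrm 1 2 d"
      by (rule abs_le_Linf_nrm[OF _ _ x]) (use cont(4) in \<open>auto intro: continuous_on_subset\<close>)
  qed (use AC cont pos assms(6,7) in blast)+
  then show thesis by (rule that)
qed

context stype_mesh
begin

text \<open>The point at which the hypothesis linking \<epsilon> to the mesh size enters: for q > 2
  the decay at distance \<mu> is dominated by \<epsilon> e^(-\<epsilon>^(-1/q)), hence by \<epsilon>
  times the power q - 2 of the mesh size.\<close>

lemma interior_decay:
  assumes C: "3 \<le> q \<Longrightarrow> C > 0 \<and> (\<forall>\<epsilon>>0. exp (- (\<epsilon> powr (- (5 / (2 * (real q + 1)))))) \<le> C * \<epsilon> * exp (- (\<epsilon> powr (- 1 / real q))))"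
    and h: "exp (- (\<epsilon> powr (- 1 / real q))) \<le> (h + 1 / real N) powi (int q - 2)" and q3: "q > 2"
  shows "exp (- \<rho>) \<le> C * \<epsilon> * mesh_size ^ (q - 2)"
proof -
  have e: "int q - 2 = int (q - 2)" using q3 by simp
  have "exp (- \<rho>) \<le> C * \<epsilon> * exp (- (\<epsilon> powr (- 1 / real q)))"
    unfolding \<rho>_eq[OF q3] using C q3 \<epsilon> by simp
  also have "\<dots> \<le> C * \<epsilon> * mesh_size ^ (q - 2)"
    using h C q3 \<epsilon> unfolding e power_int_of_nat mesh_size_def by (intro mult_left_mono) auto
  finally show ?thesis .
qed

text \<open>With H = 4r the error of u' contributes r^(2q+2) to the discrete error, which the term
  r^(2q+1) from w dominates; this gives the order q + 1/2. In the full error r^(2q) from u' appears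
  without a factor H and reduces the order to q.\<close>

lemma energy_bounds:
  assumes "0 \<le> A" "0 \<le> T" "0 \<le> C0" "0 \<le> \<delta>"
  shows "2 * C0 * ((4 * r)\<^sup>2 * (A * r ^ (2 * q)) + T * r ^ (2 * q + 1)) \<le> 2 * C0 * (16 * R * A + T) * r ^ (2 * q + 1)"
    "2 * (T * r ^ (2 * q + 1) + \<beta>\<^sup>2 / 2 * (A * r ^ (2 * q)) + \<delta> * ((4 * r)\<^sup>2 * (A * r ^ (2 * q))))
      + 2 * (2 * C0 * ((4 * r)\<^sup>2 * (A * r ^ (2 * q)) + T * r ^ (2 * q + 1)))
      \<le> (2 * (T * R + \<beta>\<^sup>2 / 2 * A + 16 * \<delta> * R\<^sup>2 * A) + 4 * C0 * (16 * R\<^sup>2 * A + T * R)) * r ^ (2 * q)"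
proof -
  have r: "0 \<le> r" "r \<le> R" using r_ge r_R by auto
  have "(4 * r)\<^sup>2 * (A * r ^ (2 * q)) + T * r ^ (2 * q + 1) = (16 * r * A + T) * r ^ (2 * q + 1)"
    by (simp add: power2_eq_square algebra_simps)
  also have "\<dots> \<le> (16 * R * A + T) * r ^ (2 * q + 1)"
    using r assms by (intro mult_right_mono add_right_mono mult_left_mono) auto
  finally show "2 * C0 * ((4 * r)\<^sup>2 * (A * r ^ (2 * q)) + T * r ^ (2 * q + 1)) \<le> 2 * C0 * (16 * R * A + T) * r ^ (2 * q + 1)"
    using mult_left_mono[of _ _ "2 * C0"] assms(3) by (simp add: mult.assoc)
  have "2 * (T * r ^ (2 * q + 1) + \<beta>\<^sup>2 / 2 * (A * r ^ (2 * q)) + \<delta> * ((4 * r)\<^sup>2 * (A * r ^ (2 * q))))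
      + 2 * (2 * C0 * ((4 * r)\<^sup>2 * (A * r ^ (2 * q)) + T * r ^ (2 * q + 1)))
    = (2 * (T * r + \<beta>\<^sup>2 / 2 * A + 16 * \<delta> * r\<^sup>2 * A) + 4 * C0 * (16 * r\<^sup>2 * A + T * r)) * r ^ (2 * q)"
    by (simp add: power2_eq_square algebra_simps)
  also have "\<dots> \<le> (2 * (T * R + \<beta>\<^sup>2 / 2 * A + 16 * \<delta> * R\<^sup>2 * A) + 4 * C0 * (16 * R\<^sup>2 * A + T * R)) * r ^ (2 * q)"
    using r assms by (intro mult_right_mono add_mono mult_left_mono power_mono order_refl) auto
  finally show "2 * (T * r ^ (2 * q + 1) + \<beta>\<^sup>2 / 2 * (A * r ^ (2 * q)) + \<delta> * ((4 * r)\<^sup>2 * (A * r ^ (2 * q))))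
      + 2 * (2 * C0 * ((4 * r)\<^sup>2 * (A * r ^ (2 * q)) + T * r ^ (2 * q + 1)))
      \<le> (2 * (T * R + \<beta>\<^sup>2 / 2 * A + 16 * \<delta> * R\<^sup>2 * A) + 4 * C0 * (16 * R\<^sup>2 * A + T * R)) * r ^ (2 * q)" .
qed

end

theorem theorem5p2:
  fixes m q :: nat and \<beta> \<delta> \<sigma> K :: real and b c d f \<Phi> :: "real \<Rightarrow> real"
  assumes "m \<in> {1, 2}" and "q \<ge> 1" and "\<beta> > 0" and "\<delta> > 0" and "\<sigma> > 0"
    and "\<sigma> \<ge> real q + 1"
    and "smooth_fun_on b {0..2}" and "smooth_fun_on c {0..2}" and "smooth_fun_on d {0..2}"
    and "\<forall>x\<in>{0..2}. b x \<ge> \<beta>\<^sup>2"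
    and "\<forall>x\<in>{0..2}. c x - 1/2 * Linf_nrm 1 2 d
           - 1 / (2 * \<beta>\<^sup>2) * (Linf_nrm 0 2 (dern {0..2} 1 b))\<^sup>2 \<ge> \<delta>"
    and "square_integrable 0 2 f"
    and "times_differentiable_on m \<Phi> {-1..0}" and "continuous_on {-1..0} (dern {-1..0} m \<Phi>)"
    and "\<Phi> 0 = 0" and "dern {-1..0} m \<Phi> 0 = 0"
  shows "\<exists>C. \<forall>\<epsilon> N \<phi> u w uh wh.
    (let X = mesh_node q \<sigma> \<beta> \<epsilon> N \<phi>;
         h = layer_width N X;
         r = h + max_abs_psi' \<phi> / real N
     in
       \<epsilon> > 0 \<and> N > 0 \<and> 8 dvd N \<and>
       mesh_lambda \<sigma> \<beta> \<epsilon> N < 1/4 \<and> (q > 2 \<longrightarrow> mesh_mu q \<beta> \<epsilon> < 1/4) \<and>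
       mesh_defining K N \<phi> \<and>
       exp (- (\<epsilon> powr (- 1 / real q))) \<le> (h + 1 / real N) powi (int q - 2) \<and>
       (u, w) \<in> U_space m \<and>
       (\<forall>(y, z) \<in> U_space m. B_form \<epsilon> b c d (u, w) (y, z) = F_form f d \<Phi> y) \<and>
       u_decomposition q m \<beta> K \<epsilon> u \<and> w_decomposition q m \<beta> K \<epsilon> w \<and>
       (uh, wh) \<in> Uh_space m q N X \<and>
       (\<forall>(y, z) \<in> Uh_space m q N X. B_form \<epsilon> b c d (uh, wh) (y, z) = F_form f d \<Phi> y)
     \<longrightarrow>
       energy_nrm \<beta> \<delta> (\<lambda>x. interp q N X u x - uh x, \<lambda>x. interp q N X w x - wh x)
         \<le> C * r powr (real q + 1/2) \<and>
       energy_nrm \<beta> \<delta> (\<lambda>x. u x - uh x, \<lambda>x. w x - wh x) \<le> C * r ^ q)"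
proof -
  define b1 where "b1 = dern {0..2} 1 b"
  obtain M where co: "coeffs b b1 (dern {0..2} 2 b) c d \<beta> \<delta> (Linf_nrm 1 2 d) (Linf_nrm 0 2 b1) M"
    unfolding b1_def by (rule smooth_coeffs[OF assms(3,4,7-11)])
  obtain Cx where Cx: "3 \<le> q \<Longrightarrow> Cx > 0 \<and> (\<forall>\<epsilon>>0. exp (- (\<epsilon> powr (- (5 / (2 * (real q + 1)))))) \<le> Cx * \<epsilon> * exp (- (\<epsilon> powr (- 1 / real q))))"
    using exp_decay_dominated[of q] by metis
  obtain CL where CL: "CL > 0" "\<And>a b g. a \<le> b \<Longrightarrow> Ltwo a b g \<Longrightarrow> prim_err_le q a b g ((b - a) * (CL * (integral {a..b} (\<lambda>x. \<bar>g x\<bar>))\<^sup>2))"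
    using prim_err_le_L1[of q] by metis
  define Cf where "Cf = 4 * \<sigma> / \<beta> * exp (4 * \<bar>K\<bar>)"
  \<comment> \<open>The constants exported from the locale take only q, \<sigma>, \<beta>, K and
    \<open>Cf\<close> as locale parameters, which is what allows \<open>C\<close> to be fixed before
    \<epsilon>, N and \<phi>. Absolute values below secure nonnegativity without inspecting the
    expressions.\<close>
  define k1 where "k1 = \<bar>K\<bar> * stype_mesh.eps_bd \<sigma> \<beta>"
  define A where "A = \<bar>stype_mesh.CA q \<sigma> \<beta> K Cf (K\<^sup>2) k1 \<bar>K\<bar> Cx\<bar>"
  define T where "T = \<bar>stype_mesh.CT q \<beta> K Cf k1 k1 \<bar>K\<bar> Cx CL\<bar>"
  define C0 where "C0 = coeffs.C0 \<beta> \<delta> M"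
  define R where "R = stype_mesh.R K"
  define V1 where "V1 = 2 * C0 * (16 * R * A + T)"
  define V2 where "V2 = 2 * (T * R + \<beta>\<^sup>2 / 2 * A + 16 * \<delta> * R\<^sup>2 * A) + 4 * C0 * (16 * R\<^sup>2 * A + T * R)"
  define C where "C = max (sqrt V1) (sqrt V2)"
  have C0: "C0 \<ge> 0" unfolding C0_def coeffs.C0_def[OF co] using assms(3,4) by simp
  have AT: "A \<ge> 0" "T \<ge> 0" by (simp_all add: A_def T_def)
  have main: "energy_nrm \<beta> \<delta> (\<lambda>x. interp q N X u x - uh x, \<lambda>x. interp q N X w x - wh x) \<le> C * r powr (real q + 1/2) \<and>
       energy_nrm \<beta> \<delta> (\<lambda>x. u x - uh x, \<lambda>x. w x - wh x) \<le> C * r ^ q"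
    if X: "X = mesh_node q \<sigma> \<beta> \<epsilon> N \<phi>" and h: "h = layer_width N X" and r: "r = h + max_abs_psi' \<phi> / real N"
      and N: "\<epsilon> > 0" "N > 0" "8 dvd N" "mesh_lambda \<sigma> \<beta> \<epsilon> N < 1/4" "q > 2 \<longrightarrow> mesh_mu q \<beta> \<epsilon> < 1/4" "mesh_defining K N \<phi>"
      and ex: "exp (- (\<epsilon> powr (- 1 / real q))) \<le> (h + 1 / real N) powi (int q - 2)"
      and U: "(u, w) \<in> U_space m"
      and eq: "\<forall>(y, z) \<in> U_space m. B_form \<epsilon> b c d (u, w) (y, z) = F_form f d \<Phi> y"
      and dec: "u_decomposition q m \<beta> K \<epsilon> u" "w_decomposition q m \<beta> K \<epsilon> w"
      and Uh: "(uh, wh) \<in> Uh_space m q N X"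
      and eqh: "\<forall>(y, z) \<in> Uh_space m q N X. B_form \<epsilon> b c d (uh, wh) (y, z) = F_form f d \<Phi> y"
    for \<epsilon> h r :: real and N :: nat and X \<phi> u w uh wh
  proof -
    have SM: "stype_mesh q N (N div 8) \<sigma> \<beta> \<epsilon> K \<phi> X h (max_abs_psi' \<phi>) r (mesh_mu q \<beta> \<epsilon>) (mesh_lambda \<sigma> \<beta> \<epsilon> N) (\<sigma> * \<epsilon> / \<beta>) Cf"
      unfolding stype_mesh_def using N X h r assms(2,3,5,6) by (simp add: Cf_def)
    note sm = stype_mesh.mesh[OF SM] stype_mesh.X_ends(1,2)[OF SM]
    have cx: "exp (- stype_mesh.\<rho> \<beta> \<epsilon> (mesh_mu q \<beta> \<epsilon>)) \<le> Cx * \<epsilon> * stype_mesh.mesh_size N h ^ (q - 2)" if "q > 2"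
      by (rule stype_mesh.interior_decay[OF SM Cx ex that])
    have sob: "sob u (wderiv 0 2 u)" "sob w (wderiv 0 2 w)"
      using U H1_sob unfolding U_space_def H10_def by (auto split: if_splits)
    have eq': "B_form \<epsilon> b c d (u, w) (y, z) = F_form f d \<Phi> y" if "(y, z) \<in> U_space m" for y z
      using eq that by blast
    have eqh': "B_form \<epsilon> b c d (uh, wh) (y, z) = F_form f d \<Phi> y" if "(y, z) \<in> Uh_space m q N X" for y z
      using eqh that by blast
    have r0: "r > 0" by (rule stype_mesh.r_ge(5)[OF SM])
    \<comment> \<open>Stability is applied with H = 4r, a bound for all cell widths.\<close>
    show ?thesis
    proof (rule coeffs.stability[where F = "F_form f d \<Phi>", OF co sm assms(2) stype_mesh.width_r[OF SM] U Uh eq' eqh' b1_def[symmetric], folded C0_def], assumption+, goal_cases)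
      case (1 P Q)
      note P = 1(1) note Q = 1(2) note E = 1(3)
      have A: "(\<Sum>i\<in>{1..N}. sqint (X (i - 1)) (X i) (\<lambda>x. wderiv 0 2 u x - poly (P i) x)) \<le> A * r ^ (2 * q)"
        by (rule order_trans[OF stype_mesh.u_bound[OF SM assms(1) dec(1) sob(1) cx P, folded k1_def]])
          (use r0 in \<open>auto simp: A_def intro!: mult_right_mono\<close>)
      have T: "(\<Sum>i\<in>{1..N}. sqint (X (i - 1)) (X i) (\<lambda>x. integral {X (i - 1)..x} (\<lambda>x. wderiv 0 2 w x - poly (Q i) x))) \<le> T * r ^ (2 * q + 1)"
        by (rule order_trans[OF stype_mesh.w_bound[OF SM assms(1) dec(2) sob(2) cx CL Q, folded k1_def]])
          (use r0 in \<open>auto simp: T_def simp del: power_Suc intro!: mult_right_mono\<close>)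
      note B = stype_mesh.energy_bounds[OF SM AT C0 less_imp_le[OF assms(4)], folded R_def, folded V1_def V2_def]
      have "(energy_nrm \<beta> \<delta> (\<lambda>x. interp q N X u x - uh x, \<lambda>x. interp q N X w x - wh x))\<^sup>2 \<le> V1 * r ^ (2 * q + 1)"
        using E[OF A T] B(1) by (meson order_trans)
      moreover have "(energy_nrm \<beta> \<delta> (\<lambda>x. u x - uh x, \<lambda>x. w x - wh x))\<^sup>2 \<le> V2 * r ^ (2 * q)"
        using E[OF A T] B(2) by (meson order_trans)
      ultimately show ?case
        using square_le_powr[OF energy_nrm_nonneg _ r0] square_le_power[OF _ less_imp_le[OF r0]] assms(4)
        by (auto simp: C_def)
    qed
  qed
  show ?thesis
    unfolding Let_def
    by (intro exI[of _ C] allI impI, elim conjE) (rule main[OF refl refl refl])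
qed

end
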